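(* For $\tau\in i\mathbb R_{>0}$ and $n\in\mathbb Z_{>0}$, the curvature equation $$\Delta u+e^u=8\pi n\,\delta_0+4\pi(\delta_p+\delta_{-p})\quad\text{on }E_\tau$$ has no non-even family of solutions for any $p\in E_\tau\setminus E_\tau[2]$.
   Context: $E_\tau=\mathbb C/(\mathbb Z+\mathbb Z\tau)$ with its flat metric; $\delta_a$ is the Dirac measure at $a$; $\wp,\zeta$ are the Weierstrass functions. For a solution $u$ put $q=-\frac12\bigl(u_{zz}-\frac12u_z^2\bigr)$. Then $q$ is an elliptic function of the form $$n(n+1)\wp(z)+\tfrac34(\wp(z+p)+\wp(z-p))+T_1(\zeta(z+p)-\zeta(z))+T_2(\zeta(z-p)-\zeta(z))+B$$ for which $y''=qy$ is log-free at $0,\pm p$ and has unitary monodromy. Solutions come in families with the same $q$ (obtained by replacing the developing map $f$ by $e^{\beta}f$, $\beta\in\mathbb R$). A family is called non-even if its parameter $(T_1,T_2)$ lies on the non-even component $V^{(1)}_{n,p}(\tau)$, i.e. $T_1-T_2+\frac{\wp''(p)}{2\wp'(p)}=0$, and even if it lies on $V^{(0)}_{n,p}(\tau)$, i.e. $T_1+T_2=0$. *)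

theory Defs
  imports "HOL-Analysis.Analysis"
begin

section \<open>The torus and the Weierstrass functions\<close>

definition lattice :: "complex \<Rightarrow> complex set" where
  "lattice \<tau> = {of_int a + of_int b * \<tau> | a b. True}"

definition fund_domain :: "complex \<Rightarrow> complex set" where
  "fund_domain \<tau> = {of_real s + of_real t * \<tau> | s t. 0 \<le> s \<and> s < 1 \<and> 0 \<le> t \<and> t < 1}"

text \<open>Functions on the torus are functions on the plane that are invariant under the lattice;
  points of the torus are given by representatives in the plane.\<close>

definition lattice_periodic :: "complex \<Rightarrow> (complex \<Rightarrow> 'a) \<Rightarrow> bool" where
  "lattice_periodic \<tau> f \<longleftrightarrow> (\<forall>z. \<forall>\<omega>\<in>lattice \<tau>. f (z + \<omega>) = f z)"

text \<open>The sums converge absolutely, so \<^const>\<open>infsum\<close> is the usual sum, for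
  non-real \<open>\<tau>\<close>. The values at lattice points, where the functions have poles, are
  arbitrary.\<close>

definition weierstrass_p :: "complex \<Rightarrow> complex \<Rightarrow> complex" where
  "weierstrass_p \<tau> z =
     1 / z\<^sup>2 + (\<Sum>\<^sub>\<infinity>\<omega>\<in>lattice \<tau> - {0}. 1 / (z - \<omega>)\<^sup>2 - 1 / \<omega>\<^sup>2)"

definition weierstrass_zeta :: "complex \<Rightarrow> complex \<Rightarrow> complex" where
  "weierstrass_zeta \<tau> z =
     1 / z + (\<Sum>\<^sub>\<infinity>\<omega>\<in>lattice \<tau> - {0}. 1 / (z - \<omega>) + 1 / \<omega> + z / \<omega>\<^sup>2)"

section \<open>Differential operators in the plane\<close>

text \<open>Derivatives are real derivatives of functions on the plane; \<open>1\<close> and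
  \<open>\<i>\<close> are the directions of the coordinates of \<open>z = x + \<i> y\<close>.\<close>

definition partial_x :: "(complex \<Rightarrow> 'a::real_normed_vector) \<Rightarrow> complex \<Rightarrow> 'a" where
  "partial_x f z = frechet_derivative f (at z) 1"

definition partial_y :: "(complex \<Rightarrow> 'a::real_normed_vector) \<Rightarrow> complex \<Rightarrow> 'a" where
  "partial_y f z = frechet_derivative f (at z) \<i>"

text \<open>Continuous differentiability of order \<open>k\<close>, meant for open sets \<open>S\<close>.\<close>

fun Ck_on :: "nat \<Rightarrow> (complex \<Rightarrow> 'a::real_normed_vector) \<Rightarrow> complex set \<Rightarrow> bool" where
  "Ck_on 0 f S \<longleftrightarrow> continuous_on S f"
| "Ck_on (Suc k) f S \<longleftrightarrow>
     (\<forall>z\<in>S. f differentiable (at z)) \<and> Ck_on k (partial_x f) S \<and> Ck_on k (partial_y f) S"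

definition laplacian :: "(complex \<Rightarrow> 'a::real_normed_vector) \<Rightarrow> complex \<Rightarrow> 'a" where
  "laplacian f z = partial_x (partial_x f) z + partial_y (partial_y f) z"

definition wirtinger :: "(complex \<Rightarrow> complex) \<Rightarrow> complex \<Rightarrow> complex" where
  "wirtinger f z = (partial_x f z - \<i> * partial_y f z) / 2"

section \<open>The curvature equation\<close>

definition sing_set :: "complex \<Rightarrow> complex \<Rightarrow> complex set" where
  "sing_set \<tau> p = {z. z \<in> lattice \<tau> \<or> z - p \<in> lattice \<tau> \<or> z + p \<in> lattice \<tau>}"

text \<open>Solutions of \<open>\<Delta>u + e\<^sup>u = 8\<pi>n \<delta>\<^sub>0 + 4\<pi>(\<delta>\<^sub>p + \<delta>\<^sub>-\<^sub>p)\<close> in the sense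
  of distributions on the torus: \<open>u\<close> and \<open>e\<^sup>u\<close> are integrable and the equation holds
  against every smooth test function on the torus. Among the functions representing such a
  distribution we take the one that is regular off the support of the Dirac measures; the
  values of \<open>u\<close> at the singular points play no role.\<close>

definition curvature_solution ::
    "nat \<Rightarrow> complex \<Rightarrow> complex \<Rightarrow> (complex \<Rightarrow> real) \<Rightarrow> bool" where
  "curvature_solution n \<tau> p u \<longleftrightarrow>
     lattice_periodic \<tau> u \<and>
     Ck_on 2 u (- sing_set \<tau> p) \<and>
     set_integrable lborel (fund_domain \<tau>) u \<and>
     set_integrable lborel (fund_domain \<tau>) (\<lambda>z. exp (u z)) \<and>
     (\<forall>\<phi> :: complex \<Rightarrow> real. lattice_periodic \<tau> \<phi> \<and> (\<forall>k. Ck_on k \<phi> UNIV) \<longrightarrow>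
        (LINT z:fund_domain \<tau>|lborel. u z * laplacian \<phi> z + exp (u z) * \<phi> z) =
          8 * pi * real n * \<phi> 0 + 4 * pi * (\<phi> p + \<phi> (- p)))"

definition q_of :: "(complex \<Rightarrow> real) \<Rightarrow> complex \<Rightarrow> complex" where
  "q_of u z = (let U = (\<lambda>w. complex_of_real (u w)) in
     - (1 / 2) * (wirtinger (wirtinger U) z - (1 / 2) * (wirtinger U z)\<^sup>2))"

definition q_form ::
    "nat \<Rightarrow> complex \<Rightarrow> complex \<Rightarrow> complex \<Rightarrow> complex \<Rightarrow> complex \<Rightarrow> complex \<Rightarrow> complex" where
  "q_form n \<tau> p T1 T2 B z =
     of_nat n * (of_nat n + 1) * weierstrass_p \<tau> z
     + 3 / 4 * (weierstrass_p \<tau> (z + p) + weierstrass_p \<tau> (z - p))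
     + T1 * (weierstrass_zeta \<tau> (z + p) - weierstrass_zeta \<tau> z)
     + T2 * (weierstrass_zeta \<tau> (z - p) - weierstrass_zeta \<tau> z) + B"

section \<open>Families of solutions\<close>

text \<open>A family consists of all solutions having the same \<open>q\<close> as a given one.\<close>

definition solution_family ::
    "nat \<Rightarrow> complex \<Rightarrow> complex \<Rightarrow> (complex \<Rightarrow> real) set \<Rightarrow> bool" where
  "solution_family n \<tau> p F \<longleftrightarrow>
     (\<exists>u. curvature_solution n \<tau> p u \<and>
        F = {v. curvature_solution n \<tau> p v \<and> (\<forall>z\<in>- sing_set \<tau> p. q_of v z = q_of u z)})"

definition noneven_component :: "complex \<Rightarrow> complex \<Rightarrow> (complex \<times> complex) set" where
  "noneven_component \<tau> p =
     {(T1, T2). T1 - T2 + deriv (deriv (weierstrass_p \<tau>)) p / (2 * deriv (weierstrass_p \<tau>) p) = 0}"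

text \<open>The residues of \<open>q\<close> at \<open>-p\<close> and \<open>p\<close> are \<open>T1\<close> and \<open>T2\<close>, so the parameters are
  determined by \<open>q\<close>. For the \<open>q\<close> of a solution, log-freeness and
  unitarity of the monodromy are automatic, so neither is imposed here.\<close>

definition noneven_family ::
    "nat \<Rightarrow> complex \<Rightarrow> complex \<Rightarrow> (complex \<Rightarrow> real) set \<Rightarrow> bool" where
  "noneven_family n \<tau> p F \<longleftrightarrow>
     solution_family n \<tau> p F \<and>
     (\<exists>T1 T2 B. (T1, T2) \<in> noneven_component \<tau> p \<and>
        (\<forall>u\<in>F. \<forall>z\<in>- sing_set \<tau> p. q_of u z = q_form n \<tau> p T1 T2 B z))"

end

theory Submission
  imports Defs "HOL-Complex_Analysis.Complex_Analysis"
begin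

text \<open>
  Let \<open>v = sqrt 8 * exp (- u / 2)\<close>. Locally \<open>v = |f|\<^sup>2 + |g|\<^sup>2\<close> for solutions \<open>f\<close>, \<open>g\<close> of \<open>y'' = q y\<close>
  with Wronskian 1. On the non-even component the absence of logarithms at \<open>p\<close> determines \<open>B\<close>,
  and \<open>q\<close> is then a Darboux transform of the Lame potential \<open>Q = n (n + 1) \<wp> + \<beta>\<close>. Undoing the
  transform turns \<open>v\<close> into a positive function \<open>V\<close> on the torus minus the origin that is
  locally \<open>|F|\<^sup>2 + |G|\<^sup>2\<close> for solutions \<open>F\<close>, \<open>G\<close> of \<open>y'' = Q y\<close>; the points \<open>\<plusminus>p\<close> are removable.

  For imaginary \<open>\<tau>\<close> no such \<open>V\<close> exists. Periodicity of \<open>\<partial>V/\<partial>z\<close> along the lines through the half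
  periods makes \<open>\<beta>\<close> real and yields \<open>Q > 0\<close> on \<open>(0, 1/2)\<close> and \<open>Q < 0\<close> on \<open>(0, \<tau>/2)\<close>. In
  terms of the even and the odd solution at \<open>(1 + \<tau>)/2\<close>, periodicity at \<open>1/2\<close> and at \<open>\<tau>/2\<close>
  gives two relations between the coefficients of \<open>V\<close>. They are incompatible with the solution
  that vanishes at \<open>0\<close>, which does not oscillate on either segment.
\<close>

section \<open>Regular singular points\<close>

text \<open>Solutions of \<open>y'' = q y\<close> are multivalued around the poles, and unitarity of
  the monodromy is a statement about continuation along paths. No continuation is carried out: two
  frames with Wronskian 1 and the same sum of squares differ by a constant matrix in SU(2), so
  single-valuedness of the sum of squares carries the unitarity. Conversely a solution
  \<open>y\<close> on a connected open set and the function \<open>V\<close> give back a whole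
  frame, because the conjugate of \<open>V y' - V_z y\<close> is again a holomorphic solution. This
  construction yields the solutions from the metric, the removability of points, the residue
  condition at \<open>p\<close> and the coordinates of \<open>V\<close> at the centre of the period
  rectangle.

  The Darboux transform is the one belonging to \<open>D = \<wp> - \<wp>(p)\<close>. The residues of
  its potential at \<open>p\<close> and \<open>-p\<close> differ by
  \<open>\<wp>''(p) / (2 \<wp>'(p))\<close>, which is exactly the equation of the non-even
  component; the remaining parameter \<kappa> is fitted to the residue at 0. The transform of a
  solution involves a square root of \<open>D\<close>, but the sum of squares of a transformed frame
  does not.\<close>

fun frobenius_coeff :: "(nat \<Rightarrow> complex) \<Rightarrow> nat \<Rightarrow> nat \<Rightarrow> complex" where
  "frobenius_coeff s b 0 = 1"
| "frobenius_coeff s b (Suc k) =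
     (\<Sum>i\<le>k. s i * frobenius_coeff s b (k - i)) / (of_nat (Suc k) * of_nat (k + b))"

text \<open>The weighted partial sums \<open>t k\<close> bound the convolution in the recursion, so
  each step multiplies them by at most \<open>1 + \<rho> * M / (k + 1)\<close>. From some index on
  this factor is below \<open>1 + \<epsilon>\<close>. The growth is thus geometric with a ratio as
  close to 1 as desired, and the radius of convergence is not smaller than that of the series with
  coefficients \<open>s\<close>.\<close>

lemma frobenius_coeff_growth:
  assumes M: "\<And>i. norm (s i) * \<rho> ^ i \<le> M" and \<rho>: "\<rho> > 0" and \<epsilon>: "\<epsilon> > 0"
  shows "\<exists>A. \<forall>k. norm (frobenius_coeff s b k) * \<rho> ^ k \<le> A * (1 + \<epsilon>) ^ k"
proof -
  let ?c = "frobenius_coeff s b"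
  define t where "t k = (\<Sum>i\<le>k. norm (?c i) * \<rho> ^ i)" for k
  have M0: "M \<ge> 0" using order_trans[OF norm_ge_zero, of "s 0" M] M[of 0] by simp
  have t0: "t k \<ge> 0" for k unfolding t_def using \<rho> by (intro sum_nonneg) auto
  \<comment> \<open>\<open>k \<ge> 1\<close> keeps the factor \<open>k + b\<close> of the
    denominator at least 1, also for \<open>b = 0\<close>.\<close>
  have step: "norm (?c (Suc k)) * \<rho> ^ Suc k \<le> \<rho> * M * t k / real (Suc k)" if "k \<ge> 1" for k
  proof -
    have "norm (\<Sum>i\<le>k. s i * ?c (k - i)) * \<rho> ^ k \<le> (\<Sum>i\<le>k. norm (s i * ?c (k - i))) * \<rho> ^ k"
      using \<rho> by (intro mult_right_mono norm_sum) auto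
    also have "\<dots> = (\<Sum>i\<le>k. (norm (s i) * \<rho> ^ i) * (norm (?c (k - i)) * \<rho> ^ (k - i)))"
      unfolding sum_distrib_right
      by (intro sum.cong refl) (auto simp: norm_mult mult_ac simp flip: power_add)
    also have "\<dots> \<le> (\<Sum>i\<le>k. M * (norm (?c (k - i)) * \<rho> ^ (k - i)))"
      using \<rho> by (intro sum_mono mult_right_mono M) auto
    also have "\<dots> = M * t k"
      unfolding t_def sum_distrib_left
      by (rule sum.reindex_bij_witness[of _ "\<lambda>i. k - i" "\<lambda>i. k - i"]) auto
    finally have 1: "norm (\<Sum>i\<le>k. s i * ?c (k - i)) * \<rho> ^ k \<le> M * t k" .
    have kb: "real (k + b) \<ge> 1" using that by simp
    have "norm (?c (Suc k)) * \<rho> ^ Suc k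
          = \<rho> * (norm (\<Sum>i\<le>k. s i * ?c (k - i)) * \<rho> ^ k) / (real (Suc k) * real (k + b))"
      by (simp add: norm_divide norm_mult del: of_nat_Suc of_nat_add)
    also have "\<dots> \<le> \<rho> * (M * t k) / (real (Suc k) * 1)"
      using 1 \<rho> kb M0 t0[of k] by (intro frac_le mult_left_mono) auto
    finally show ?thesis by (simp add: mult.assoc)
  qed
  \<comment> \<open>From this index on \<open>\<rho> * M / (k + 1) \<le> \<epsilon>\<close>.\<close>
  obtain K :: nat where K: "K \<ge> 1" "\<rho> * M \<le> \<epsilon> * real K"
  proof -
    obtain N :: nat where "\<rho> * M / \<epsilon> \<le> real N" using real_arch_simple by blast
    then have "\<rho> * M \<le> \<epsilon> * real (Suc N)" using \<epsilon> by (simp add: field_simps)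
    then show ?thesis by (intro that[of "Suc N"]) auto
  qed
  have tgrow: "t (K + j) \<le> t K * (1 + \<epsilon>) ^ j" for j
  proof (induction j)
    case (Suc j)
    have "t (K + Suc j) = t (K + j) + norm (?c (Suc (K + j))) * \<rho> ^ Suc (K + j)"
      by (simp add: t_def)
    also have "\<dots> \<le> t (K + j) + \<rho> * M * t (K + j) / real (Suc (K + j))"
      using step[of "K + j"] K by simp
    also have "\<rho> * M * t (K + j) / real (Suc (K + j)) \<le> \<epsilon> * t (K + j)"
    proof -
      have "\<rho> * M \<le> \<epsilon> * real (Suc (K + j))"
        using K \<epsilon> by (smt (verit) mult_left_mono of_nat_mono le_SucI le_add1)
      then have "\<rho> * M * t (K + j) \<le> \<epsilon> * real (Suc (K + j)) * t (K + j)"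
        using t0 by (intro mult_right_mono) auto
      then show ?thesis by (simp add: pos_divide_le_eq mult_ac del: of_nat_Suc)
    qed
    also have "t (K + j) + \<epsilon> * t (K + j) \<le> t K * (1 + \<epsilon>) ^ Suc j"
      using mult_right_mono[OF Suc.IH, of "1 + \<epsilon>"] \<epsilon> by (simp add: algebra_simps)
    finally show ?case by simp
  qed auto
  have tm: "t k \<le> t K * (1 + \<epsilon>) ^ k" for k
  proof (cases "k \<ge> K")
    case True
    then have "t k \<le> t K * (1 + \<epsilon>) ^ (k - K)" using tgrow[of "k - K"] by simp
    also have "\<dots> \<le> t K * (1 + \<epsilon>) ^ k"
      using t0 \<epsilon> by (intro mult_left_mono power_increasing) auto
    finally show ?thesis .
  next
    case False
    then have "t k \<le> t K" unfolding t_def using \<rho> by (intro sum_mono2) auto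
    also have "\<dots> = t K * 1" by simp
    also have "\<dots> \<le> t K * (1 + \<epsilon>) ^ k"
      using t0 \<epsilon> by (intro mult_left_mono one_le_power) auto
    finally show ?thesis .
  qed
  have "norm (?c k) * \<rho> ^ k \<le> t k" for k
    unfolding t_def using \<rho>
    by (intro member_le_sum[where f = "\<lambda>i. norm (?c i) * \<rho> ^ i"]) auto
  then show ?thesis using tm by (intro exI[of _ "t K"]) (meson order_trans)
qed

text \<open>Splitting off the leading power of a solution at a regular singular point leaves an
  equation \<open>z \<phi>'' + b \<phi>' = S \<phi>\<close>. Comparison of coefficients expresses
  \<open>(k + 1) (k + b)\<close> times the next coefficient of \<phi> as a convolution; this
  degenerates only for \<open>k = b = 0\<close>, where \<open>S 0 = 0\<close> is the condition for
  solvability. The values that occur are \<open>b = 0\<close> and \<open>b = 2\<close> at ordinary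
  points, \<open>b = 3\<close> for the exponent 3/2 and \<open>b = 2 n + 2\<close> for the exponent
  \<open>n + 1\<close>.\<close>

lemma frobenius_0:
  assumes S: "S holomorphic_on ball 0 r" and r: "r > 0" and b0: "b = 0 \<Longrightarrow> S 0 = 0"
  shows "\<exists>\<phi>. \<phi> holomorphic_on ball 0 r \<and> \<phi> 0 = 1 \<and> (b = 0 \<longrightarrow> deriv \<phi> 0 = 0) \<and>
    (\<forall>z\<in>ball 0 r. z * deriv (deriv \<phi>) z + of_nat b * deriv \<phi> z = S z * \<phi> z)"
proof -
  define s where "s = fps_nth (fps_expansion S 0)"
  define F where "F = Abs_fps (frobenius_coeff s b)"
  define G where "G = fps_expansion S 0"
  have Gr: "fps_conv_radius G \<ge> r" unfolding G_def
    by (rule conv_radius_fps_expansion) (simp add: S)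
  have Gev: "eval_fps G z = S z" if "z \<in> ball 0 r" for z
    unfolding G_def using eval_fps_expansion'[of S 0 "ereal r" z] that S by (simp add: eball_ereal)
  have Fr: "fps_conv_radius F \<ge> r"
    unfolding fps_conv_radius_def
  proof (rule conv_radius_geI_ex')
    fix r' :: real assume r': "0 < r'" "ereal r' < ereal r"
    \<comment> \<open>\<rho> lies strictly between \<open>r'\<close> and \<open>r\<close>, and
      \<epsilon> is so small that the geometric ratio
      \<open>x = (1 + \<epsilon>) r' / \<rho>\<close> stays below 1.\<close>
    define \<rho> where "\<rho> = (r' + r) / 2"
    have \<rho>: "r' < \<rho>" "\<rho> < r" "\<rho> > 0" using r' by (auto simp: \<rho>_def)
    define \<epsilon> where "\<epsilon> = (\<rho> / r' - 1) / 2"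
    have \<epsilon>: "\<epsilon> > 0" using \<rho> r' by (simp add: \<epsilon>_def field_simps)
    define x where "x = (1 + \<epsilon>) * (r' / \<rho>)"
    have x: "x < 1" "x > 0"
    proof -
      have "1 + \<epsilon> < \<rho> / r'" unfolding \<epsilon>_def using \<rho> r' by (simp add: field_simps)
      then show "x < 1" unfolding x_def using \<rho> r' by (simp add: field_simps)
      show "x > 0" unfolding x_def using \<rho> r' \<epsilon> by simp
    qed
    have "summable (\<lambda>n. fps_nth G n * of_real \<rho> ^ n)"
      using less_le_trans[OF _ Gr, of "ereal \<rho>"] \<rho> by (intro summable_fps) simp
    then have "(\<lambda>n. fps_nth G n * of_real \<rho> ^ n) \<longlonglongrightarrow> 0" by (rule summable_LIMSEQ_zero)
    then have "Bseq (\<lambda>n. fps_nth G n * of_real \<rho> ^ n)" by (rule convergent_imp_Bseq[OF convergentI])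
    then obtain M where M: "\<And>i. norm (fps_nth G i * of_real \<rho> ^ i) \<le> M"
      by (auto simp: Bseq_def)
    then have "norm (s i) * \<rho> ^ i \<le> M" for i
      using \<rho> M[of i] unfolding s_def G_def by (simp add: norm_mult norm_power)
    from frobenius_coeff_growth[of s \<rho> M \<epsilon> b, OF this \<rho>(3) \<epsilon>]
    obtain A where A: "\<And>k. norm (frobenius_coeff s b k) * \<rho> ^ k \<le> A * (1 + \<epsilon>) ^ k" by blast
    have "norm (fps_nth F n * of_real r' ^ n) \<le> A * x ^ n" for n
    proof -
      have "norm (fps_nth F n * of_real r' ^ n) = (norm (frobenius_coeff s b n) * \<rho> ^ n) * (r' / \<rho>) ^ n"
        using r' \<rho> by (simp add: F_def norm_mult norm_power power_divide)
      also have "\<dots> \<le> (A * (1 + \<epsilon>) ^ n) * (r' / \<rho>) ^ n"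
        using r' \<rho> by (intro mult_right_mono A) auto
      also have "\<dots> = A * x ^ n" unfolding x_def by (simp only: power_mult_distrib mult.assoc)
      finally show ?thesis .
    qed
    then have bnd: "\<And>n. 0 \<le> n \<Longrightarrow> norm (fps_nth F n * of_real r' ^ n) \<le> A * x ^ n" by blast
    have sm: "summable (\<lambda>n. A * x ^ n)" using x by (intro summable_mult summable_geometric) auto
    show "summable (\<lambda>n. fps_nth F n * of_real r' ^ n)"
      by (rule summable_comparison_test'[OF sm bnd])
  qed
  have eq: "fps_X * fps_deriv (fps_deriv F) + of_nat b * fps_deriv F = G * F"
  proof (rule fps_ext)
    fix k
    have Fk: "fps_nth F i = frobenius_coeff s b i" for i by (simp add: F_def)
    have "fps_nth (G * F) k = (\<Sum>i\<le>k. s i * frobenius_coeff s b (k - i))"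
      by (simp add: fps_mult_nth Fk s_def G_def atLeast0AtMost)
    also have "\<dots> = of_nat (Suc k) * of_nat (k + b) * frobenius_coeff s b (Suc k)"
    proof (cases "k + b = 0")
      case True
      have "s 0 = 0" using b0 True by (simp add: s_def fps_expansion_def)
      then show ?thesis using True by simp
    next
      case False
      then have "of_nat (Suc k) * of_nat (k + b) \<noteq> (0 :: complex)"
        by (simp del: of_nat_Suc of_nat_add)
      then show ?thesis unfolding frobenius_coeff.simps by (simp del: of_nat_Suc of_nat_add)
    qed
    also have "\<dots> = fps_nth (fps_X * fps_deriv (fps_deriv F) + of_nat b * fps_deriv F) k"
      by (cases k) (simp_all add: Fk fps_mult_of_nat_nth algebra_simps del: frobenius_coeff.simps)
    finally show "fps_nth (fps_X * fps_deriv (fps_deriv F) + of_nat b * fps_deriv F) k = fps_nth (G * F) k" ..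
  qed
  have in_r: "ereal (norm z) < fps_conv_radius F" "ereal (norm z) < fps_conv_radius G"
    "ereal (norm z) < fps_conv_radius (fps_deriv F)" "ereal (norm z) < fps_conv_radius (fps_deriv (fps_deriv F))"
    if "z \<in> ball 0 r" for z
  proof -
    have *: "ereal (norm z) < ereal r" using that by simp
    show "ereal (norm z) < fps_conv_radius F" "ereal (norm z) < fps_conv_radius G"
      using less_le_trans[OF * Fr] less_le_trans[OF * Gr] by auto
    show 1: "ereal (norm z) < fps_conv_radius (fps_deriv F)"
      by (rule less_le_trans[OF * order_trans[OF Fr fps_conv_radius_deriv]])
    show "ereal (norm z) < fps_conv_radius (fps_deriv (fps_deriv F))"
      by (rule less_le_trans[OF * order_trans[OF order_trans[OF Fr fps_conv_radius_deriv] fps_conv_radius_deriv]])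
  qed
  define \<phi> where "\<phi> = eval_fps F"
  have d1: "(\<phi> has_field_derivative eval_fps (fps_deriv F) z) (at z)" if "z \<in> ball 0 r" for z
    unfolding \<phi>_def using in_r[OF that] by (intro has_field_derivative_eval_fps) auto
  have d1': "deriv \<phi> z = eval_fps (fps_deriv F) z" if "z \<in> ball 0 r" for z
    using d1[OF that] by (rule DERIV_imp_deriv)
  have d2: "deriv (deriv \<phi>) z = eval_fps (fps_deriv (fps_deriv F)) z" if "z \<in> ball 0 r" for z
  proof -
    have "(eval_fps (fps_deriv F) has_field_derivative eval_fps (fps_deriv (fps_deriv F)) z) (at z)"
      using in_r[OF that] by (intro has_field_derivative_eval_fps) auto
    then have "(deriv \<phi> has_field_derivative eval_fps (fps_deriv (fps_deriv F)) z) (at z)"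
      by (rule has_field_derivative_transform_within_open[of _ _ _ "ball 0 r"]) (use that d1' in auto)
    then show ?thesis by (rule DERIV_imp_deriv)
  qed
  show ?thesis
  proof (intro exI[of _ \<phi>] conjI ballI impI)
    show "\<phi> holomorphic_on ball 0 r"
      unfolding holomorphic_on_open[OF open_ball] using d1 by blast
    show "\<phi> 0 = 1" by (simp add: \<phi>_def F_def eval_fps_at_0)
    have z0: "0 \<in> ball (0::complex) r" using r by simp
    \<comment> \<open>For \<open>b = 0\<close> the recursion divides by 0 at the first coefficient,
      which makes that coefficient 0.\<close>
    show "deriv \<phi> 0 = 0" if "b = 0"
      using that by (simp add: d1'[OF z0] eval_fps_at_0 F_def)
  next
    fix z :: complex assume z: "z \<in> ball 0 r"
    have "eval_fps (fps_X * fps_deriv (fps_deriv F) + of_nat b * fps_deriv F) z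
      = z * eval_fps (fps_deriv (fps_deriv F)) z + of_nat b * eval_fps (fps_deriv F) z"
    proof -
      have "ereal (norm z) < fps_conv_radius (fps_X * fps_deriv (fps_deriv F))"
        using in_r[OF z] by (intro less_le_trans[OF _ fps_conv_radius_mult]) simp
      moreover have "ereal (norm z) < fps_conv_radius (of_nat b * fps_deriv F)"
        using in_r[OF z] by (intro less_le_trans[OF _ fps_conv_radius_mult]) simp
      ultimately show ?thesis
        using in_r[OF z] by (simp add: eval_fps_add eval_fps_mult)
    qed
    moreover have "eval_fps (G * F) z = S z * \<phi> z"
      using in_r[OF z] Gev[OF z] by (simp add: eval_fps_mult \<phi>_def)
    ultimately show "z * deriv (deriv \<phi>) z + of_nat b * deriv \<phi> z = S z * \<phi> z"
      using eq d1'[OF z] d2[OF z] by simp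
  qed
qed

lemma deriv_shift: "deriv (\<lambda>z. f (z + a)) z = deriv f (z + a)" for f :: "complex \<Rightarrow> complex"
  unfolding deriv_def by (simp add: DERIV_shift)

lemma frobenius:
  assumes S: "S holomorphic_on ball a r" and r: "r > 0" and b0: "b = 0 \<Longrightarrow> S a = 0"
  obtains \<phi> where "\<phi> holomorphic_on ball a r" "\<phi> a = 1" "b = 0 \<Longrightarrow> deriv \<phi> a = 0"
    "\<And>z. z \<in> ball a r \<Longrightarrow> (z - a) * deriv (deriv \<phi>) z + of_nat b * deriv \<phi> z = S z * \<phi> z"
proof -
  have S': "(\<lambda>z. S (z + a)) holomorphic_on ball 0 r"
    by (rule holomorphic_on_compose_gen[of "\<lambda>z. z + a" _ S "ball a r", unfolded o_def])
       (use S in \<open>auto intro!: holomorphic_intros simp: dist_norm\<close>)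
  obtain \<psi> where \<psi>: "\<psi> holomorphic_on ball 0 r" "\<psi> 0 = 1" "b = 0 \<longrightarrow> deriv \<psi> 0 = 0"
    "\<forall>z\<in>ball 0 r. z * deriv (deriv \<psi>) z + of_nat b * deriv \<psi> z = S (z + a) * \<psi> z"
    using frobenius_0[OF S' r, of b] b0 by auto
  define \<phi> where "\<phi> z = \<psi> (z + - a)" for z
  have d1: "deriv \<phi> = (\<lambda>z. deriv \<psi> (z + - a))" unfolding \<phi>_def by (rule ext) (rule deriv_shift)
  have d2: "deriv (deriv \<phi>) = (\<lambda>z. deriv (deriv \<psi>) (z + - a))" unfolding d1 by (rule ext) (rule deriv_shift)
  show ?thesis
  proof (rule that[of \<phi>])
    show "\<phi> holomorphic_on ball a r" unfolding \<phi>_def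
      by (rule holomorphic_on_compose_gen[of "\<lambda>z. z + - a" _ \<psi> "ball 0 r", unfolded o_def])
         (use \<psi> in \<open>auto intro!: holomorphic_intros simp: dist_norm norm_minus_commute\<close>)
    show "\<phi> a = 1" using \<psi> by (simp add: \<phi>_def)
    show "deriv \<phi> a = 0" if "b = 0" using \<psi> that by (simp add: d1)
    show "(z - a) * deriv (deriv \<phi>) z + of_nat b * deriv \<phi> z = S z * \<phi> z" if "z \<in> ball a r" for z
      using \<psi>(4)[rule_format, of "z + - a"] that unfolding d2 unfolding d1
      by (simp add: \<phi>_def dist_norm norm_minus_commute)
  qed
qed

section \<open>Hermitian forms in solutions of linear equations\<close>

lemma mult_cnj_eq_norm_sq: "z * cnj z = (complex_of_real (cmod z))\<^sup>2"
  using complex_norm_square[of z] by simp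

definition ode_sol :: "(complex \<Rightarrow> complex) \<Rightarrow> complex set \<Rightarrow> (complex \<Rightarrow> complex) \<Rightarrow> bool" where
  "ode_sol Q S y \<longleftrightarrow> y holomorphic_on S \<and> (\<forall>z\<in>S. deriv (deriv y) z = Q z * y z)"

definition wronskian :: "(complex \<Rightarrow> complex) \<Rightarrow> (complex \<Rightarrow> complex) \<Rightarrow> complex \<Rightarrow> complex" where
  "wronskian f g z = f z * deriv g z - deriv f z * g z"

lemma ode_solD:
  assumes "ode_sol Q S y" "open S" "z \<in> S"
  shows "(y has_field_derivative deriv y z) (at z)"
    "(deriv y has_field_derivative Q z * y z) (at z)"
proof -
  have y: "y holomorphic_on S" "deriv (deriv y) z = Q z * y z" using assms by (auto simp: ode_sol_def)
  show "(y has_field_derivative deriv y z) (at z)" by (rule holomorphic_derivI[OF y(1) assms(2,3)])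
  have "deriv y holomorphic_on S" by (rule holomorphic_deriv[OF y(1) assms(2)])
  from holomorphic_derivI[OF this assms(2,3)] y(2)
  show "(deriv y has_field_derivative Q z * y z) (at z)" by simp
qed

lemma ode_solI:
  assumes "open S" "\<And>z. z \<in> S \<Longrightarrow> (y has_field_derivative y' z) (at z)"
    "\<And>z. z \<in> S \<Longrightarrow> (y' has_field_derivative Q z * y z) (at z)"
  shows "ode_sol Q S y" "\<And>z. z \<in> S \<Longrightarrow> deriv y z = y' z"
proof -
  show d: "deriv y z = y' z" if "z \<in> S" for z using assms(2)[OF that] by (rule DERIV_imp_deriv)
  have "deriv (deriv y) z = Q z * y z" if z: "z \<in> S" for z
  proof -
    have "(deriv y has_field_derivative Q z * y z) (at z)"
      by (rule has_field_derivative_transform_within_open[OF assms(3)[OF z] assms(1) z]) (simp add: d)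
    then show ?thesis by (rule DERIV_imp_deriv)
  qed
  moreover have "y holomorphic_on S"
    unfolding holomorphic_on_open[OF assms(1)] using assms(2) by blast
  ultimately show "ode_sol Q S y" by (simp add: ode_sol_def)
qed

lemma ode_sol_subset: "ode_sol Q S y \<Longrightarrow> T \<subseteq> S \<Longrightarrow> ode_sol Q T y"
  unfolding ode_sol_def using holomorphic_on_subset by blast

lemma ode_sol_lincomb:
  assumes "ode_sol Q S f" "ode_sol Q S g" "open S"
  shows "ode_sol Q S (\<lambda>z. a * f z + b * g z)"
    "z \<in> S \<Longrightarrow> deriv (\<lambda>z. a * f z + b * g z) z = a * deriv f z + b * deriv g z"
proof -
  have 1: "((\<lambda>z. a * f z + b * g z) has_field_derivative a * deriv f z + b * deriv g z) (at z)"
    if "z \<in> S" for z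
    using ode_solD[OF assms(1,3) that] ode_solD[OF assms(2,3) that]
    by (auto intro!: derivative_eq_intros)
  have 2: "((\<lambda>z. a * deriv f z + b * deriv g z) has_field_derivative Q z * (a * f z + b * g z)) (at z)"
    if "z \<in> S" for z
    using ode_solD[OF assms(1,3) that] ode_solD[OF assms(2,3) that]
    by (auto intro!: derivative_eq_intros simp: algebra_simps)
  show "ode_sol Q S (\<lambda>z. a * f z + b * g z)"
    "z \<in> S \<Longrightarrow> deriv (\<lambda>z. a * f z + b * g z) z = a * deriv f z + b * deriv g z"
    using ode_solI[OF assms(3) 1 2] by blast+
qed

lemma wronskian_deriv:
  assumes "ode_sol Q S f" "ode_sol Q S g" "open S" "z \<in> S"
  shows "(wronskian f g has_field_derivative 0) (at z)"
proof -
  have "((\<lambda>z. f z * deriv g z - deriv f z * g z) has_field_derivative 0) (at z)"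
    using ode_solD[OF assms(1,3,4)] ode_solD[OF assms(2,3,4)]
    by (auto intro!: derivative_eq_intros)
  then show ?thesis by (simp add: wronskian_def[abs_def])
qed

lemma wronskian_const:
  assumes "ode_sol Q S f" "ode_sol Q S g" "open S" "connected S" "z \<in> S" "w \<in> S"
  shows "wronskian f g z = wronskian f g w"
proof -
  have "wronskian f g constant_on S"
    by (rule has_field_derivative_0_imp_constant_on[OF _ assms(4,3)])
       (use wronskian_deriv[OF assms(1-3)] in blast)
  then show ?thesis using assms(5,6) by (auto simp: constant_on_def)
qed

lemma wronskian_decomp:
  assumes "wronskian e h z = 1"
  shows "y z = wronskian y h z * e z + wronskian e y z * h z"
    "deriv y z = wronskian y h z * deriv e z + wronskian e y z * deriv h z"
proof -
  have "wronskian y h z * e z + wronskian e y z * h z = wronskian e h z * y z"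
    "wronskian y h z * deriv e z + wronskian e y z * deriv h z = wronskian e h z * deriv y z"
    unfolding wronskian_def by algebra+
  then show "y z = wronskian y h z * e z + wronskian e y z * h z"
    "deriv y z = wronskian y h z * deriv e z + wronskian e y z * deriv h z" using assms by simp_all
qed

text \<open>By Cramer's rule the coordinates of \<open>y\<close> in the frame are Wronskians of two
  solutions, hence constant on the connected set \<open>T\<close>.\<close>

lemma ode_decomp:
  assumes "ode_sol Q S e" "ode_sol Q S h" "ode_sol Q T y" "open S" "open T" "T \<subseteq> S" "connected T"
    "\<And>z. z \<in> S \<Longrightarrow> wronskian e h z = 1"
  obtains a b where "\<And>z. z \<in> T \<Longrightarrow> y z = a * e z + b * h z"
    "\<And>z. z \<in> T \<Longrightarrow> deriv y z = a * deriv e z + b * deriv h z"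
    "\<And>z. z \<in> T \<Longrightarrow> wronskian y h z = a" "\<And>z. z \<in> T \<Longrightarrow> wronskian e y z = b"
proof (cases "T = {}")
  case True then show ?thesis using that by auto
next
  case False
  then obtain w where w: "w \<in> T" by blast
  have eh: "ode_sol Q T e" "ode_sol Q T h" using assms ode_sol_subset by blast+
  have *: "wronskian y h z = wronskian y h w" "wronskian e y z = wronskian e y w" if "z \<in> T" for z
    using wronskian_const[OF assms(3) eh(2) assms(5,7) that w]
      wronskian_const[OF eh(1) assms(3) assms(5,7) that w] by auto
  show ?thesis
  proof (rule that[of "wronskian y h w" "wronskian e y w"])
    fix z assume z: "z \<in> T"
    then have "wronskian e h z = 1" using assms(6,8) by blast
    from wronskian_decomp[OF this, of y] *[OF z]
    show "y z = wronskian y h w * e z + wronskian e y w * h z"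
      "deriv y z = wronskian y h w * deriv e z + wronskian e y w * deriv h z" by simp_all
  qed (fact *)+
qed

text \<open>Both solutions come from the Frobenius lemma at an ordinary point: \<open>e\<close> with
  \<open>b = 0\<close>, and \<open>h = (z - a) p\<close> with \<open>b = 2\<close>, since
  \<open>((z - a) p)'' = (z - a) p'' + 2 p'\<close>.\<close>

lemma ode_exists:
  assumes Q: "Q holomorphic_on ball a r" and r: "r > 0"
  obtains e h where "ode_sol Q (ball a r) e" "ode_sol Q (ball a r) h"
    "e a = 1" "deriv e a = 0" "h a = 0" "deriv h a = 1"
    "\<And>z. z \<in> ball a r \<Longrightarrow> wronskian e h z = 1"
proof -
  let ?B = "ball a r"
  have a: "a \<in> ?B" using r by simp
  have S: "(\<lambda>z. (z - a) * Q z) holomorphic_on ?B" using Q by (intro holomorphic_intros)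
  obtain e where e: "e holomorphic_on ?B" "e a = 1" "deriv e a = 0"
    "\<And>z. z \<in> ?B \<Longrightarrow> (z - a) * deriv (deriv e) z + of_nat 0 * deriv e z = (z - a) * Q z * e z"
    using frobenius[OF S r, of 0] by auto
  obtain p where p: "p holomorphic_on ?B" "p a = 1"
    "\<And>z. z \<in> ?B \<Longrightarrow> (z - a) * deriv (deriv p) z + of_nat 2 * deriv p z = (z - a) * Q z * p z"
    using frobenius[OF S r, of 2] by auto
  have e_sol: "ode_sol Q ?B e"
    unfolding ode_sol_def
  proof (intro conjI ballI)
    fix z assume z: "z \<in> ?B"
    \<comment> \<open>The Frobenius equation carries a factor \<open>z - a\<close>; the value at the
      centre follows by continuation from the punctured disc.\<close>
    show "deriv (deriv e) z = Q z * e z"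
    proof (rule analytic_continuation_open[of "?B - {a}" ?B "deriv (deriv e)" "\<lambda>z. Q z * e z"])
      show "?B - {a} \<noteq> {}"
      proof -
        have "a + of_real (r / 2) \<in> ?B - {a}" using r by (simp add: dist_norm)
        then show ?thesis by blast
      qed
      show "deriv (deriv e) holomorphic_on ?B" "(\<lambda>z. Q z * e z) holomorphic_on ?B"
        using e(1) Q by (auto intro!: holomorphic_intros holomorphic_deriv)
      show "deriv (deriv e) w = Q w * e w" if "w \<in> ?B - {a}" for w
        using e(4)[of w] that by auto
    qed (use z in auto)
  qed (fact e(1))
  define h where "h z = (z - a) * p z" for z
  have hd: "(h has_field_derivative p z + (z - a) * deriv p z) (at z)"
    "((\<lambda>z. p z + (z - a) * deriv p z) has_field_derivative Q z * h z) (at z)" if z: "z \<in> ?B" for z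
  proof -
    have 1: "(p has_field_derivative deriv p z) (at z)"
      by (rule holomorphic_derivI[OF p(1) open_ball z])
    have 2: "(deriv p has_field_derivative deriv (deriv p) z) (at z)"
      by (rule holomorphic_derivI[OF holomorphic_deriv[OF p(1) open_ball] open_ball z])
    show "(h has_field_derivative p z + (z - a) * deriv p z) (at z)"
      unfolding h_def by (auto intro!: derivative_eq_intros 1)
    have "((\<lambda>z. p z + (z - a) * deriv p z) has_field_derivative
      (z - a) * deriv (deriv p) z + of_nat 2 * deriv p z) (at z)"
      by (auto intro!: derivative_eq_intros 1 2)
    then show "((\<lambda>z. p z + (z - a) * deriv p z) has_field_derivative Q z * h z) (at z)"
      using p(3)[OF z] by (simp add: h_def mult_ac)
  qed
  have h_sol: "ode_sol Q ?B h" and h': "\<And>z. z \<in> ?B \<Longrightarrow> deriv h z = p z + (z - a) * deriv p z"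
    using ode_solI[OF open_ball hd] by blast+
  have h0: "h a = 0" "deriv h a = 1" using h'[OF a] p(2) by (auto simp: h_def)
  have "wronskian e h z = 1" if "z \<in> ?B" for z
  proof -
    have "wronskian e h z = wronskian e h a"
      by (rule wronskian_const[OF e_sol h_sol open_ball connected_ball that a])
    then show ?thesis using h0 e by (simp add: wronskian_def)
  qed
  then show ?thesis using that e_sol h_sol e(2,3) h0 by blast
qed

text \<open>Frames are required only on discs: on \<open>S\<close> itself solutions of the equation
  may be multivalued, while \<open>V\<close> is a function.\<close>

definition herm_sol :: "(complex \<Rightarrow> complex) \<Rightarrow> (complex \<Rightarrow> real) \<Rightarrow> complex set \<Rightarrow> bool" where
  "herm_sol Q V S \<longleftrightarrow> (\<forall>z\<in>S. \<exists>r>0. ball z r \<subseteq> S \<and> (\<exists>f g. ode_sol Q (ball z r) f \<and> ode_sol Q (ball z r) g \<and>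
     (\<forall>w\<in>ball z r. wronskian f g w = 1 \<and> V w = (cmod (f w))\<^sup>2 + (cmod (g w))\<^sup>2)))"

abbreviation dz :: "(complex \<Rightarrow> real) \<Rightarrow> complex \<Rightarrow> complex" where
  "dz V \<equiv> wirtinger (\<lambda>w. complex_of_real (V w))"

lemma wirtinger_eqI:
  assumes "(F has_derivative (\<lambda>h. A * h + B * cnj h)) (at z)"
  shows "partial_x F z = A + B" "partial_y F z = \<i> * (A - B)" "wirtinger F z = A"
proof -
  have *: "frechet_derivative F (at z) = (\<lambda>h. A * h + B * cnj h)"
    using frechet_derivative_at[OF assms] by simp
  show "partial_x F z = A + B" "partial_y F z = \<i> * (A - B)" "wirtinger F z = A"
    by (simp_all add: partial_x_def partial_y_def wirtinger_def * algebra_simps)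
qed

lemma has_derivative_sumsq:
  assumes V: "\<And>w. w \<in> S \<Longrightarrow> V w = (cmod (f w))\<^sup>2 + (cmod (g w))\<^sup>2" and S: "open S" "z \<in> S"
    and f: "(f has_field_derivative f') (at z)" and g: "(g has_field_derivative g') (at z)"
  shows "((\<lambda>w. complex_of_real (V w)) has_derivative
    (\<lambda>h. (f' * cnj (f z) + g' * cnj (g z)) * h + cnj (f' * cnj (f z) + g' * cnj (g z)) * cnj h)) (at z)"
proof -
  have 1: "(f has_derivative (*) f') (at z)" "(g has_derivative (*) g') (at z)"
    using f g by (simp_all add: has_field_derivative_def)
  have "((\<lambda>w. f w * cnj (f w) + g w * cnj (g w)) has_derivative
    (\<lambda>h. (f' * cnj (f z) + g' * cnj (g z)) * h + cnj (f' * cnj (f z) + g' * cnj (g z)) * cnj h)) (at z)"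
    by (rule derivative_eq_intros has_derivative_cnj 1 refl)+ (auto simp: fun_eq_iff algebra_simps)
  then show ?thesis
    by (rule has_derivative_transform_within_open[OF _ S])
       (simp add: V mult_cnj_eq_norm_sq)
qed

lemma dz_sumsq:
  assumes V: "\<And>w. w \<in> S \<Longrightarrow> V w = (cmod (f w))\<^sup>2 + (cmod (g w))\<^sup>2" and S: "open S" "z \<in> S"
    and f: "ode_sol Q S f" and g: "ode_sol Q S g"
  shows "dz V z = deriv f z * cnj (f z) + deriv g z * cnj (g z)"
  by (rule wirtinger_eqI(3)[OF has_derivative_sumsq[OF V S ode_solD(1)[OF f S] ode_solD(1)[OF g S]]])

lemma herm_solE:
  assumes "herm_sol Q V S" "z \<in> S"
  obtains r f g where "r > 0" "ball z r \<subseteq> S" "ode_sol Q (ball z r) f" "ode_sol Q (ball z r) g"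
    "\<And>w. w \<in> ball z r \<Longrightarrow> wronskian f g w = 1"
    "\<And>w. w \<in> ball z r \<Longrightarrow> V w = (cmod (f w))\<^sup>2 + (cmod (g w))\<^sup>2"
    "\<And>w. w \<in> ball z r \<Longrightarrow> dz V w = deriv f w * cnj (f w) + deriv g w * cnj (g w)"
proof -
  from assms obtain r f g where *: "r > 0" "ball z r \<subseteq> S" "ode_sol Q (ball z r) f" "ode_sol Q (ball z r) g"
    "\<And>w. w \<in> ball z r \<Longrightarrow> wronskian f g w = 1"
    "\<And>w. w \<in> ball z r \<Longrightarrow> V w = (cmod (f w))\<^sup>2 + (cmod (g w))\<^sup>2"
    unfolding herm_sol_def by meson
  show ?thesis by (rule that[OF * dz_sumsq[OF *(6) open_ball _ *(3,4)]])
qed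

lemma herm_sol_subset:
  assumes "herm_sol Q V S" "T \<subseteq> S" "open T"
  shows "herm_sol Q V T"
  unfolding herm_sol_def
proof
  fix z assume z: "z \<in> T"
  obtain r f g where *: "r > 0" "ball z r \<subseteq> S" "ode_sol Q (ball z r) f" "ode_sol Q (ball z r) g"
    "\<And>w. w \<in> ball z r \<Longrightarrow> wronskian f g w = 1"
    "\<And>w. w \<in> ball z r \<Longrightarrow> V w = (cmod (f w))\<^sup>2 + (cmod (g w))\<^sup>2"
    by (rule herm_solE[OF assms(1) subsetD[OF assms(2) z]]) blast
  obtain r' where r': "r' > 0" "ball z r' \<subseteq> T" using assms(3) z open_contains_ball by blast
  let ?B = "ball z (min r r')"
  have sub: "?B \<subseteq> ball z r" "?B \<subseteq> T" using r' by auto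
  have "ode_sol Q ?B f" "ode_sol Q ?B g" using *(3,4) sub(1) ode_sol_subset by blast+
  moreover have "\<forall>w\<in>?B. wronskian f g w = 1 \<and> V w = (cmod (f w))\<^sup>2 + (cmod (g w))\<^sup>2"
    using *(5,6) sub(1) by blast
  moreover have "min r r' > 0" using *(1) r'(1) by simp
  ultimately show "\<exists>r>0. ball z r \<subseteq> T \<and> (\<exists>f g. ode_sol Q (ball z r) f \<and> ode_sol Q (ball z r) g \<and>
     (\<forall>w\<in>ball z r. wronskian f g w = 1 \<and> V w = (cmod (f w))\<^sup>2 + (cmod (g w))\<^sup>2))"
    using sub(2) by blast
qed

lemma herm_sol_pos:
  assumes "herm_sol Q V S" "z \<in> S"
  shows "V z > 0"
proof -
  obtain r f g where r: "r > 0" and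
    W: "\<And>w. w \<in> ball z r \<Longrightarrow> wronskian f g w = 1" and
    V: "\<And>w. w \<in> ball z r \<Longrightarrow> V w = (cmod (f w))\<^sup>2 + (cmod (g w))\<^sup>2"
    by (rule herm_solE[OF assms]) blast
  have "f z \<noteq> 0 \<or> g z \<noteq> 0" using W[of z] r by (auto simp: wronskian_def)
  then show ?thesis using V[of z] r by (auto simp: add_pos_nonneg add_nonneg_pos)
qed

text \<open>\<open>w1\<close> and \<open>w2\<close> are the Wronskians of a frame \<open>f\<close>,
  \<open>g\<close> with a solution \<open>y\<close>, so that \<open>y = w1 g - w2 f\<close>. The
  last identity is Lagrange's for the pairs \<open>(w1, w2)\<close> and \<open>(f, g)\<close>; the
  middle one exhibits the Wronskian of the companion with \<open>y\<close> as a sum of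
  squares.\<close>

lemma frame_algebra:
  fixes f g f' g' y y' :: complex
  assumes W: "f * g' - f' * g = 1"
  defines "V \<equiv> f * cnj f + g * cnj g" and "P \<equiv> f' * cnj f + g' * cnj g"
  defines "w1 \<equiv> f * y' - f' * y" and "w2 \<equiv> g * y' - g' * y"
  shows "V * y' - P * y = w1 * cnj f + w2 * cnj g"
    "(cnj w1 * f + cnj w2 * g) * y' - (cnj w1 * f' + cnj w2 * g') * y = w1 * cnj w1 + w2 * cnj w2"
    "(w1 * cnj w1 + w2 * cnj w2) * V = (cnj w1 * f + cnj w2 * g) * cnj (cnj w1 * f + cnj w2 * g) + y * cnj y"
proof -
  show "V * y' - P * y = w1 * cnj f + w2 * cnj g" "(cnj w1 * f + cnj w2 * g) * y' - (cnj w1 * f' + cnj w2 * g') * y = w1 * cnj w1 + w2 * cnj w2"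
    unfolding V_def P_def w1_def w2_def by (auto simp: algebra_simps)
  have y: "y = w1 * g - w2 * f"
  proof -
    have "w1 * g - w2 * f = (f * g' - f' * g) * y" unfolding w1_def w2_def by algebra
    then show ?thesis using W by simp
  qed
  show "(w1 * cnj w1 + w2 * cnj w2) * V = (cnj w1 * f + cnj w2 * g) * cnj (cnj w1 * f + cnj w2 * g) + y * cnj y"
    unfolding V_def y by (simp add: algebra_simps)
qed

text \<open>In terms of a local frame \<open>f\<close>, \<open>g\<close> the companion \<eta> equals
  \<open>cnj w1 * f + cnj w2 * g\<close> with constant Wronskians \<open>w1\<close>,
  \<open>w2\<close>, so it is a solution; its definition by \<open>V\<close> and
  \<open>dz V\<close>, however, mentions no frame. One solution on a connected set is thus completed
  to a frame on all of it, with \<open>\<omega> = |w1|\<^sup>2 + |w2|\<^sup>2\<close> taking up the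
  normalisation.\<close>

lemma frame:
  assumes V: "herm_sol Q V S" and S: "open S" "connected S" and y: "ode_sol Q S y"
    and y0: "z0 \<in> S" "y z0 \<noteq> 0"
  defines "\<eta> \<equiv> \<lambda>z. cnj (of_real (V z) * deriv y z - dz V z * y z)"
  obtains \<omega> :: real where "\<omega> > 0" "ode_sol Q S \<eta>" "\<And>z. z \<in> S \<Longrightarrow> wronskian \<eta> y z = of_real \<omega>"
    "\<And>z. z \<in> S \<Longrightarrow> \<omega> * V z = (cmod (\<eta> z))\<^sup>2 + (cmod (y z))\<^sup>2"
proof -
  have loc: "\<exists>r>0. ball z r \<subseteq> S \<and> ode_sol Q (ball z r) \<eta> \<and> (\<exists>\<omega>::real. \<forall>w\<in>ball z r.
      wronskian \<eta> y w = of_real \<omega> \<and> \<omega> * V w = (cmod (\<eta> w))\<^sup>2 + (cmod (y w))\<^sup>2)" if z: "z \<in> S" for z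
  proof -
    obtain r f g where r: "r > 0" "ball z r \<subseteq> S" and fg: "ode_sol Q (ball z r) f" "ode_sol Q (ball z r) g"
      and W: "\<And>w. w \<in> ball z r \<Longrightarrow> wronskian f g w = 1"
      and Vw: "\<And>w. w \<in> ball z r \<Longrightarrow> V w = (cmod (f w))\<^sup>2 + (cmod (g w))\<^sup>2"
      and Pw: "\<And>w. w \<in> ball z r \<Longrightarrow> dz V w = deriv f w * cnj (f w) + deriv g w * cnj (g w)"
      by (rule herm_solE[OF V z]) blast
    have yb: "ode_sol Q (ball z r) y" using y r(2) ode_sol_subset by blast
    define w1 where "w1 = wronskian f y z"
    define w2 where "w2 = wronskian g y z"
    have w: "f w * deriv y w - deriv f w * y w = w1" "g w * deriv y w - deriv g w * y w = w2" if "w \<in> ball z r" for w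
      using wronskian_const[OF fg(1) yb open_ball connected_ball that, of z]
        wronskian_const[OF fg(2) yb open_ball connected_ball that, of z] r(1)
      by (auto simp: w1_def w2_def wronskian_def)
    have Vc: "complex_of_real (V w) = f w * cnj (f w) + g w * cnj (g w)" if "w \<in> ball z r" for w
      using Vw[OF that] by (simp add: mult_cnj_eq_norm_sq)
    have eta: "\<eta> w = cnj w1 * f w + cnj w2 * g w" if b: "w \<in> ball z r" for w
    proof -
      have "of_real (V w) * deriv y w - dz V w * y w = w1 * cnj (f w) + w2 * cnj (g w)"
        unfolding Vc[OF b] Pw[OF b]
        by (rule frame_algebra(1)[of "f w" "deriv g w" "deriv f w" "g w" "deriv y w" "y w",
            OF W[OF b, unfolded wronskian_def], unfolded w[OF b]])
      from arg_cong[OF this, of cnj] show ?thesis by (simp add: \<eta>_def)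
    qed
    have s: "ode_sol Q (ball z r) (\<lambda>w. cnj w1 * f w + cnj w2 * g w)"
      by (rule ode_sol_lincomb[OF fg open_ball])
    have "ode_sol Q (ball z r) \<eta>"
      "\<And>w. w \<in> ball z r \<Longrightarrow> deriv \<eta> w = cnj w1 * deriv f w + cnj w2 * deriv g w"
    proof -
      have d1: "(\<eta> has_field_derivative cnj w1 * deriv f w + cnj w2 * deriv g w) (at w)" if b: "w \<in> ball z r" for w
        by (rule has_field_derivative_transform_within_open[OF ode_solD(1)[OF s open_ball b, unfolded ode_sol_lincomb(2)[OF fg open_ball b]] open_ball b])
           (simp add: eta)
      have d2: "((\<lambda>w. cnj w1 * deriv f w + cnj w2 * deriv g w) has_field_derivative Q w * \<eta> w) (at w)" if b: "w \<in> ball z r" for w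
        using ode_solD(2)[OF fg(1) open_ball b] ode_solD(2)[OF fg(2) open_ball b]
        by (auto intro!: derivative_eq_intros simp: eta[OF b] algebra_simps)
      show "ode_sol Q (ball z r) \<eta>"
      "\<And>w. w \<in> ball z r \<Longrightarrow> deriv \<eta> w = cnj w1 * deriv f w + cnj w2 * deriv g w"
        using ode_solI[OF open_ball d1 d2] by blast+
    qed
    note eta_sol = this
    define \<omega> where "\<omega> = (cmod w1)\<^sup>2 + (cmod w2)\<^sup>2"
    have om: "complex_of_real \<omega> = w1 * cnj w1 + w2 * cnj w2" by (simp add: \<omega>_def mult_cnj_eq_norm_sq)
    have "wronskian \<eta> y w = of_real \<omega> \<and> \<omega> * V w = (cmod (\<eta> w))\<^sup>2 + (cmod (y w))\<^sup>2" if b: "w \<in> ball z r" for w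
    proof -
      note fa = frame_algebra[of "f w" "deriv g w" "deriv f w" "g w" "deriv y w" "y w",
          OF W[OF b, unfolded wronskian_def], unfolded w[OF b]]
      have "wronskian \<eta> y w = of_real \<omega>"
        using fa(2) by (simp add: wronskian_def eta[OF b] eta_sol(2)[OF b] om)
      moreover have "complex_of_real (\<omega> * V w) = complex_of_real ((cmod (\<eta> w))\<^sup>2 + (cmod (y w))\<^sup>2)"
        unfolding of_real_mult om Vc[OF b] of_real_add complex_norm_square eta[OF b] by (rule fa(3))
      ultimately show ?thesis by (simp only: of_real_eq_iff)
    qed
    then show ?thesis using r eta_sol(1) by blast
  qed
  have eta_sol: "ode_sol Q S \<eta>"
    unfolding ode_sol_def
  proof
    show "\<eta> holomorphic_on S"
    proof -
      have "\<exists>f'. (\<eta> has_field_derivative f') (at z)" if z: "z \<in> S" for z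
        using loc[OF z] ode_solD(1)[of Q "ball z _" \<eta> z] by (metis centre_in_ball open_ball)
      then show ?thesis unfolding holomorphic_on_open[OF S(1)] by blast
    qed
    show "\<forall>z\<in>S. deriv (deriv \<eta>) z = Q z * \<eta> z"
      using loc unfolding ode_sol_def by (metis centre_in_ball)
  qed
  obtain \<omega> where om0: "wronskian \<eta> y z0 = of_real \<omega>" "\<omega> * V z0 = (cmod (\<eta> z0))\<^sup>2 + (cmod (y z0))\<^sup>2"
    using loc[OF y0(1)] by (metis centre_in_ball)
  have wc: "wronskian \<eta> y z = of_real \<omega>" if "z \<in> S" for z
    using wronskian_const[OF eta_sol y S that y0(1)] om0 by simp
  have "\<omega> * V z = (cmod (\<eta> z))\<^sup>2 + (cmod (y z))\<^sup>2" if z: "z \<in> S" for z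
  proof -
    \<comment> \<open>The local constant is the value of the Wronskian, which is the same throughout
      the connected set.\<close>
    obtain \<omega>' :: real where "wronskian \<eta> y z = of_real \<omega>'" "\<omega>' * V z = (cmod (\<eta> z))\<^sup>2 + (cmod (y z))\<^sup>2"
      using loc[OF z] by (metis centre_in_ball)
    then show ?thesis using wc[OF z] by simp
  qed
  moreover have "\<omega> > 0"
  proof -
    have "\<omega> * V z0 > 0" using om0(2) y0(2) by (simp add: add_nonneg_pos)
    then show ?thesis using herm_sol_pos[OF V y0(1)] by (simp add: zero_less_mult_iff)
  qed
  ultimately show ?thesis using that eta_sol wc by blast
qed

section \<open>Weierstrass functions of a rectangular lattice\<close>

locale rect_lattice =
  fixes \<tau> :: complex
  assumes Re_tau [simp]: "Re \<tau> = 0" and Im_tau: "Im \<tau> > 0"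
begin

abbreviation \<Lambda> :: "complex set" where "\<Lambda> \<equiv> lattice \<tau>"

section \<open>The rectangular lattice: group laws, symmetry and discreteness\<close>

lemma lattice_iff: "z \<in> \<Lambda> \<longleftrightarrow> (\<exists>a b :: int. Re z = of_int a \<and> Im z = of_int b * Im \<tau>)"
  by (auto simp: lattice_def complex_eq_iff)

lemma lattice_0 [simp]: "0 \<in> \<Lambda>" and lattice_1 [simp]: "1 \<in> \<Lambda>" and lattice_tau [simp]: "\<tau> \<in> \<Lambda>"
  unfolding lattice_iff by (auto intro!: exI[of _ "0::int"] exI[of _ "1::int"])

lemma lattice_add: "z \<in> \<Lambda> \<Longrightarrow> w \<in> \<Lambda> \<Longrightarrow> z + w \<in> \<Lambda>"
  unfolding lattice_iff by (metis (no_types, opaque_lifting) distrib_right of_int_add plus_complex.sel)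

lemma lattice_minus_iff [simp]: "- z \<in> \<Lambda> \<longleftrightarrow> z \<in> \<Lambda>"
proof -
  have "- z \<in> \<Lambda>" if "z \<in> \<Lambda>" for z
    using that unfolding lattice_iff by (auto simp flip: of_int_minus mult_minus_left)
  from this[of z] this[of "- z"] show ?thesis by auto
qed

lemma lattice_diff: "z \<in> \<Lambda> \<Longrightarrow> w \<in> \<Lambda> \<Longrightarrow> z - w \<in> \<Lambda>"
  using lattice_add[of z "- w"] by simp

lemma lattice_add_cancel: "w \<in> \<Lambda> \<Longrightarrow> z + w \<in> \<Lambda> \<longleftrightarrow> z \<in> \<Lambda>"
  using lattice_add[of z w] lattice_diff[of "z + w" w] by auto

text \<open>Holds because \<tau> is purely imaginary; the reality of \<wp> on the symmetry lines
  rests on it.\<close>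

lemma lattice_cnj_iff [simp]: "cnj z \<in> \<Lambda> \<longleftrightarrow> z \<in> \<Lambda>"
proof -
  have "cnj z \<in> \<Lambda>" if "z \<in> \<Lambda>" for z
    using that unfolding lattice_iff by (auto simp flip: of_int_minus mult_minus_left)
  from this[of z] this[of "cnj z"] show ?thesis by auto
qed

definition lat_min :: real where "lat_min = min 1 (Im \<tau>)"

lemma lat_min_pos: "lat_min > 0" using Im_tau by (simp add: lat_min_def)

lemma lattice_norm_ge:
  assumes "z \<in> \<Lambda>" "z \<noteq> 0"
  shows "norm z \<ge> lat_min"
proof -
  obtain a b :: int where ab: "Re z = of_int a" "Im z = of_int b * Im \<tau>" using assms by (auto simp: lattice_iff)
  have "a \<noteq> 0 \<or> b \<noteq> 0" using ab assms(2) by (auto simp: complex_eq_iff)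
  then show ?thesis
  proof
    assume "a \<noteq> 0"
    then have "1 \<le> \<bar>Re z\<bar>" using ab(1) by simp
    then show ?thesis using abs_Re_le_cmod[of z] by (simp add: lat_min_def)
  next
    assume "b \<noteq> 0"
    then have "1 * Im \<tau> \<le> \<bar>of_int b\<bar> * Im \<tau>" using Im_tau by (intro mult_right_mono) auto
    then have "Im \<tau> \<le> \<bar>Im z\<bar>" using ab(2) Im_tau by (simp add: abs_mult)
    then show ?thesis using abs_Im_le_cmod[of z] by (simp add: lat_min_def)
  qed
qed

text \<open>Distinct lattice points have distance at least \<open>lat_min\<close>. Arbitrary subsets
  are covered so that the lattice may also be taken with a point removed.\<close>

lemma closed_lattice_subset: "A \<subseteq> \<Lambda> \<Longrightarrow> closed A"
proof (rule discrete_imp_closed[OF lat_min_pos], intro ballI impI)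
  fix x y assume "A \<subseteq> \<Lambda>" "x \<in> A" "y \<in> A" "dist y x < lat_min"
  then show "y = x" using lattice_norm_ge[of "y - x"] lattice_diff by (force simp: dist_norm)
qed

lemma countable_lattice: "countable \<Lambda>"
proof -
  have "\<Lambda> = (\<lambda>(a, b). of_int a + of_int b * \<tau>) ` (UNIV :: (int \<times> int) set)"
    by (auto simp: lattice_def)
  then show ?thesis by simp
qed

lemma connected_compl_lattice: "connected (- \<Lambda>)"
  unfolding Compl_eq_Diff_UNIV
  by (rule connected_open_diff_countable[OF _ open_UNIV connected_UNIV countable_lattice]) simp

lemma open_compl_lattice: "open (- \<Lambda>)"
  using closed_lattice_subset[of \<Lambda>] by (simp add: open_Compl)

section \<open>Convergence of lattice sums\<close>

lemma summable_int_powr: "(\<lambda>a::int. (1 + \<bar>of_int a\<bar>) powr (-3/2) :: real) summable_on UNIV"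
proof -
  let ?f = "\<lambda>a::int. (1 + \<bar>of_int a\<bar>) powr (-3/2) :: real"
  have "summable (\<lambda>n. of_nat n powr (-3/2) :: real)" by (subst summable_real_powr_iff) simp
  then have "summable (\<lambda>n. of_nat (Suc n) powr (-3/2) :: real)" by (subst summable_Suc_iff)
  then have n: "(\<lambda>n. of_nat (Suc n) powr (-3/2) :: real) summable_on UNIV"
    by (rule summable_nonneg_imp_summable_on) simp
  have "?f summable_on range int"
    by (subst summable_on_reindex) (use n in \<open>auto simp: o_def\<close>)
  moreover have "?f summable_on range (\<lambda>n. - int n)"
    by (subst summable_on_reindex) (use n in \<open>auto simp: o_def inj_on_def\<close>)
  ultimately have "?f summable_on (range int \<union> range (\<lambda>n. - int n))"
    by (rule summable_on_union)
  also have "range int \<union> range (\<lambda>n. - int n) = UNIV"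
  proof -
    have "x \<in> range int \<union> range (\<lambda>n. - int n)" for x
    proof (cases "x \<ge> 0")
      case True then have "x = int (nat x)" by simp then show ?thesis by blast
    next
      case False then have "x = - int (nat (- x))" by simp then show ?thesis by blast
    qed
    then show ?thesis by blast
  qed
  finally show ?thesis .
qed

lemma summable_int_prod:
  "(\<lambda>(a::int, b::int). (1 + \<bar>of_int a\<bar>) powr (-3/2) * (1 + \<bar>of_int b\<bar>) powr (-3/2) :: real)
     summable_on UNIV"
proof -
  let ?f = "\<lambda>a::int. (1 + \<bar>of_int a\<bar>) powr (-3/2) :: real"
  have "(\<lambda>(a, b). ?f a * ?f b) summable_on (Sigma UNIV (\<lambda>_. UNIV))"
  proof (rule summable_on_SigmaI)
    show "((\<lambda>y. case (x, y) of (a, b) \<Rightarrow> ?f a * ?f b) has_sum (?f x * infsum ?f UNIV)) UNIV" for x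
      using summable_int_powr by (auto intro!: has_sum_cmult_right has_sum_infsum)
    show "(\<lambda>x. ?f x * infsum ?f UNIV) summable_on UNIV"
      by (rule summable_on_cmult_left[OF summable_int_powr])
  qed auto
  then show ?thesis by simp
qed

text \<open>For \<open>(a, b) \<noteq> (0, 0)\<close> one has
  \<open>(1 + |a|) (1 + |b|) \<le> 3 (a\<^sup>2 + b\<^sup>2)\<close>, because integers satisfy
  \<open>|a| \<le> a\<^sup>2\<close>. Together with \<open>|\<omega>|\<^sup>2 \<ge> lat_min\<^sup>2
  (a\<^sup>2 + b\<^sup>2)\<close> this dominates the term by a product of two one-dimensional ones;
  the exponent 3 is shared equally, and 3/2 suffices for convergence of each.\<close>

lemma summable_lattice: "(\<lambda>\<omega>. 1 / norm \<omega> ^ 3) summable_on (\<Lambda> - {0})"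
proof -
  let ?h = "\<lambda>(a::int, b::int). of_int a + of_int b * \<tau>"
  let ?g = "\<lambda>(a::int, b::int). (1 + \<bar>of_int a\<bar>) powr (-3/2) * (1 + \<bar>of_int b\<bar>) powr (-3/2) :: real"
  have inj: "inj_on ?h (UNIV - {(0, 0)})"
    using Im_tau by (auto simp: inj_on_def complex_eq_iff)
  have img: "\<Lambda> - {0} = ?h ` (UNIV - {(0, 0)})"
  proof -
    have "?h (a, b) = 0 \<longleftrightarrow> (a, b) = (0, 0)" for a b using Im_tau by (auto simp: complex_eq_iff)
    then show ?thesis unfolding lattice_def by (auto simp: image_iff)
  qed
  define C where "C = 3 powr (3/2) / lat_min ^ 3"
  have bound: "1 / norm (?h (a, b)) ^ 3 \<le> C * ?g (a, b)" if "(a, b) \<noteq> (0, 0)" for a b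
  proof -
    define x y where "x = \<bar>real_of_int a\<bar>" and "y = \<bar>real_of_int b\<bar>"
    define s where "s = x\<^sup>2 + y\<^sup>2"
    have xy: "x \<le> x\<^sup>2" "y \<le> y\<^sup>2" "x \<ge> 0" "y \<ge> 0"
    proof -
      have *: "\<bar>real_of_int k\<bar> \<le> \<bar>real_of_int k\<bar>\<^sup>2" for k
      proof (cases "k = 0")
        case False
        then have "1 \<le> \<bar>real_of_int k\<bar>" by simp
        then show ?thesis by (rule self_le_power) simp
      qed simp
      show "x \<le> x\<^sup>2" "y \<le> y\<^sup>2" unfolding x_def y_def by (rule *)+
    qed (auto simp: x_def y_def)
    have s1: "s \<ge> 1"
    proof -
      have "a \<noteq> 0 \<or> b \<noteq> 0" using that by auto
      then have "x \<ge> 1 \<or> y \<ge> 1" by (auto simp: x_def y_def)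
      then show ?thesis using xy by (auto simp: s_def)
    qed
    have "2 * (x * y) \<le> s" using sum_squares_bound[of x y] by (simp add: s_def)
    then have prod: "(1 + x) * (1 + y) \<le> 3 * s" using xy s1 mult_nonneg_nonneg[OF xy(3,4)]
      by (simp add: algebra_simps s_def)
    have n2: "(norm (?h (a, b)))\<^sup>2 \<ge> lat_min\<^sup>2 * s"
    proof -
      have "(norm (?h (a, b)))\<^sup>2 = x\<^sup>2 + y\<^sup>2 * (Im \<tau>)\<^sup>2"
        by (simp add: cmod_power2 x_def y_def power_mult_distrib)
      moreover have "lat_min\<^sup>2 * x\<^sup>2 \<le> 1 * x\<^sup>2" "lat_min\<^sup>2 * y\<^sup>2 \<le> (Im \<tau>)\<^sup>2 * y\<^sup>2"
        using lat_min_pos Im_tau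
        by (intro mult_right_mono; auto simp: lat_min_def power_le_one intro!: power_mono)+
      ultimately show ?thesis by (simp add: s_def algebra_simps)
    qed
    have n: "norm (?h (a, b)) \<ge> lat_min * sqrt s"
      using n2 lat_min_pos s1 by (intro power2_le_imp_le[OF _ norm_ge_zero]) (auto simp: power_mult_distrib)
    have "lat_min ^ 3 * ((1 + x) * (1 + y) / 3) powr (3/2) \<le> lat_min ^ 3 * s powr (3/2)"
      using prod xy lat_min_pos by (intro mult_left_mono powr_mono2) auto
    also have "s powr (3/2) = sqrt s ^ 3"
    proof -
      have "sqrt s ^ 3 = (s powr (1/2)) powr 3" using s1 by (simp add: powr_half_sqrt powr_numeral)
      also have "\<dots> = s powr (3/2)" by (simp add: powr_powr)
      finally show ?thesis ..
    qed
    also have "lat_min ^ 3 * sqrt s ^ 3 = (lat_min * sqrt s) ^ 3" by (simp add: power_mult_distrib)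
    also have "\<dots> \<le> norm (?h (a, b)) ^ 3" using n lat_min_pos s1 by (intro power_mono) auto
    finally have *: "lat_min ^ 3 * ((1 + x) * (1 + y) / 3) powr (3/2) \<le> norm (?h (a, b)) ^ 3" .
    have pos: "lat_min ^ 3 * ((1 + x) * (1 + y) / 3) powr (3/2) > 0"
      using lat_min_pos xy by (auto intro!: mult_pos_pos)
    have "1 / norm (?h (a, b)) ^ 3 \<le> 1 / (lat_min ^ 3 * ((1 + x) * (1 + y) / 3) powr (3/2))"
      using * pos by (intro frac_le) auto
    also have "\<dots> = C * ((1 + x) powr (-3/2) * (1 + y) powr (-3/2))"
    proof -
      have "((1 + x) * (1 + y) / 3) powr (3/2) = (1 + x) powr (3/2) * (1 + y) powr (3/2) / 3 powr (3/2)"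
        using xy by (simp only: powr_divide powr_mult)
      then show ?thesis by (simp only: C_def powr_minus_divide) (simp add: powr_minus divide_simps)
    qed
    finally show ?thesis by (simp add: x_def y_def)
  qed
  have "(\<lambda>\<omega>. 1 / norm \<omega> ^ 3) \<circ> ?h summable_on (UNIV - {(0, 0)})"
  proof (rule summable_on_comparison_test)
    have "(\<lambda>p. C * ?g p) summable_on UNIV"
      by (rule summable_on_cmult_right[OF summable_int_prod])
    then show "(\<lambda>p. C * ?g p) summable_on (UNIV - {(0, 0)})"
      by (rule summable_on_subset_banach) simp
    show "((\<lambda>\<omega>. 1 / norm \<omega> ^ 3) \<circ> ?h) p \<le> C * ?g p" if "p \<in> UNIV - {(0, 0)}" for p
      using bound[of "fst p" "snd p"] that by (cases p) auto
  qed auto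
  then show ?thesis unfolding img by (subst summable_on_reindex[OF inj])
qed

end

section \<open>Differentiation of the Weierstrass series term by term\<close>

lemma has_field_derivative_inverse_square:
  fixes x a :: complex
  assumes "x \<noteq> a"
  shows "((\<lambda>z. 1 / (z - a)\<^sup>2) has_field_derivative - 2 / (x - a) ^ 3) (at x)"
proof -
  have "- (2 * u) / (u\<^sup>2 * u\<^sup>2) = - 2 / u ^ 3" if "u \<noteq> 0" for u :: complex
    using that by (simp add: divide_simps) (simp add: eval_nat_numeral)
  from this[of "x - a"] have "- (2 * (x - a)) / ((x - a)\<^sup>2 * (x - a)\<^sup>2) = - 2 / (x - a) ^ 3"
    using assms by simp
  moreover have "((\<lambda>z. 1 / (z - a)\<^sup>2) has_field_derivative - (2 * (x - a)) / ((x - a)\<^sup>2 * (x - a)\<^sup>2)) (at x)"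
    using assms by (auto intro!: derivative_eq_intros)
  ultimately show ?thesis by simp
qed

text \<open>The majorant concerns the terms and not their derivatives: the finite partial sums are
  holomorphic and converge uniformly on the disc, and such limits may be differentiated. Summability
  of the derivatives is part of the conclusion.\<close>

lemma infsum_has_field_derivative:
  fixes f f' :: "'a \<Rightarrow> complex \<Rightarrow> complex"
  assumes d: "\<And>\<omega> z. \<omega> \<in> X \<Longrightarrow> z \<in> cball c r \<Longrightarrow> (f \<omega> has_field_derivative f' \<omega> z) (at z)"
    and M: "\<And>\<omega> z. \<omega> \<in> X \<Longrightarrow> z \<in> cball c r \<Longrightarrow> norm (f \<omega> z) \<le> M \<omega>" "M summable_on X"
    and r: "r > 0" and z: "z \<in> ball c r"
  shows "((\<lambda>z. \<Sum>\<^sub>\<infinity>\<omega>\<in>X. f \<omega> z) has_field_derivative (\<Sum>\<^sub>\<infinity>\<omega>\<in>X. f' \<omega> z)) (at z)"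
    "(\<lambda>\<omega>. f' \<omega> z) summable_on X"
proof -
  have ul: "uniform_limit (cball c r) (\<lambda>X z. \<Sum>\<omega>\<in>X. f \<omega> z) (\<lambda>z. \<Sum>\<^sub>\<infinity>\<omega>\<in>X. f \<omega> z) (finite_subsets_at_top X)"
    by (rule Weierstrass_m_test_general[OF M])
  have ev: "eventually (\<lambda>Y. continuous_on (cball c r) (\<lambda>z. \<Sum>\<omega>\<in>Y. f \<omega> z) \<and>
     (\<forall>w\<in>ball c r. ((\<lambda>z. \<Sum>\<omega>\<in>Y. f \<omega> z) has_field_derivative (\<Sum>\<omega>\<in>Y. f' \<omega> w)) (at w))) (finite_subsets_at_top X)"
  proof (rule eventually_finite_subsets_at_top_weakI)
    fix Y assume Y: "finite Y" "Y \<subseteq> X"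
    have D: "((\<lambda>z. \<Sum>\<omega>\<in>Y. f \<omega> z) has_field_derivative (\<Sum>\<omega>\<in>Y. f' \<omega> w)) (at w)" if "w \<in> cball c r" for w
      by (rule DERIV_sum) (use d Y that in blast)
    have "continuous_on (cball c r) (\<lambda>z. \<Sum>\<omega>\<in>Y. f \<omega> z)"
      by (rule continuous_at_imp_continuous_on) (use D DERIV_isCont in blast)
    then show "continuous_on (cball c r) (\<lambda>z. \<Sum>\<omega>\<in>Y. f \<omega> z) \<and>
     (\<forall>w\<in>ball c r. ((\<lambda>z. \<Sum>\<omega>\<in>Y. f \<omega> z) has_field_derivative (\<Sum>\<omega>\<in>Y. f' \<omega> w)) (at w))"
      using D by (meson ball_subset_cball subsetD)
  qed
  obtain g' where g': "\<And>w. w \<in> ball c r \<Longrightarrow>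
      ((\<lambda>z. \<Sum>\<^sub>\<infinity>\<omega>\<in>X. f \<omega> z) has_field_derivative g' w) (at w) \<and>
      ((\<lambda>Y. \<Sum>\<omega>\<in>Y. f' \<omega> w) \<longlongrightarrow> g' w) (finite_subsets_at_top X)"
    by (rule has_complex_derivative_uniform_limit[OF ev ul _ r]) auto
  have hs: "((\<lambda>\<omega>. f' \<omega> z) has_sum g' z) X"
    using g'[OF z] by (simp add: has_sum_def)
  show "(\<lambda>\<omega>. f' \<omega> z) summable_on X" using hs by (rule has_sum_imp_summable)
  show "((\<lambda>z. \<Sum>\<^sub>\<infinity>\<omega>\<in>X. f \<omega> z) has_field_derivative (\<Sum>\<^sub>\<infinity>\<omega>\<in>X. f' \<omega> z)) (at z)"
    using g'[OF z] infsumI[OF hs] by simp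
qed

context rect_lattice begin

abbreviation \<Lambda>0 :: "complex set" where "\<Lambda>0 \<equiv> \<Lambda> - {0}"

text \<open>\<open>zeta0\<close> and \<open>wp0\<close> are the series without the pole at the
  origin. They are holomorphic near 0 as well, which provides the Laurent expansions there and, by
  translation, at \<open>p\<close> and \<open>-p\<close>.\<close>

definition zeta0 :: "complex \<Rightarrow> complex" where
  "zeta0 z = (\<Sum>\<^sub>\<infinity>\<omega>\<in>\<Lambda>0. 1 / (z - \<omega>) + 1 / \<omega> + z / \<omega>\<^sup>2)"
definition wp0 :: "complex \<Rightarrow> complex" where
  "wp0 z = (\<Sum>\<^sub>\<infinity>\<omega>\<in>\<Lambda>0. 1 / (z - \<omega>)\<^sup>2 - 1 / \<omega>\<^sup>2)"
definition wp0' :: "complex \<Rightarrow> complex" where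
  "wp0' z = (\<Sum>\<^sub>\<infinity>\<omega>\<in>\<Lambda>0. - 2 / (z - \<omega>) ^ 3)"

lemma weierstrass_p_eq: "weierstrass_p \<tau> z = 1 / z\<^sup>2 + wp0 z"
  and weierstrass_zeta_eq: "weierstrass_zeta \<tau> z = 1 / z + zeta0 z"
  by (simp_all add: weierstrass_p_def weierstrass_zeta_def wp0_def zeta0_def)

lemma open_compl_lattice0: "open (- \<Lambda>0)"
  by (rule open_Compl[OF closed_lattice_subset]) blast

text \<open>For \<open>|\<omega>| \<ge> 2 R\<close> the triangle inequality gives the factor 1/2;
  for the remaining \<omega> the disc keeps the distance \<open>r\<close> from
  \<open>\<Lambda>0\<close>, and \<open>r\<close> is at least \<open>r / (2 R)\<close> times
  \<open>|\<omega>|\<close>.\<close>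

lemma lattice0_sep:
  assumes "c \<notin> \<Lambda>0"
  obtains r \<kappa> where "r > 0" "\<kappa> > 0" "\<And>z \<omega>. z \<in> cball c r \<Longrightarrow> \<omega> \<in> \<Lambda>0 \<Longrightarrow> norm (z - \<omega>) \<ge> \<kappa> * norm \<omega>"
proof -
  obtain e where e: "e > 0" "ball c e \<subseteq> - \<Lambda>0"
    using open_compl_lattice0 assms open_contains_ball by blast
  define r where "r = e / 2"
  define R where "R = norm c + r"
  define \<kappa> where "\<kappa> = min (1/2) (r / (2 * R))"
  have pos: "r > 0" "R > 0" "\<kappa> > 0" using e by (auto simp: r_def R_def \<kappa>_def add_nonneg_pos)
  show ?thesis
  proof (rule that[OF pos(1,3)])
    fix z \<omega> assume z: "z \<in> cball c r" and \<omega>: "\<omega> \<in> \<Lambda>0"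
    have zR: "norm z \<le> R" using z norm_triangle_ineq2[of z c]
      by (simp add: R_def dist_norm norm_minus_commute)
    have "dist c \<omega> \<ge> e" using e \<omega> by (meson ComplD linorder_not_less mem_ball subsetD)
    then have zr: "norm (z - \<omega>) \<ge> r" using z dist_triangle[of c \<omega> z]
      by (simp add: dist_norm r_def)
    show "norm (z - \<omega>) \<ge> \<kappa> * norm \<omega>"
    proof (cases "norm \<omega> \<ge> 2 * R")
      case True
      have "\<kappa> * norm \<omega> \<le> 1 / 2 * norm \<omega>" unfolding \<kappa>_def by (intro mult_right_mono) auto
      also have "\<dots> \<le> norm \<omega> - R" using True by simp
      also have "\<dots> \<le> norm (z - \<omega>)" using zR norm_triangle_ineq3[of \<omega> z] by (simp add: norm_minus_commute)
      finally show ?thesis .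
    next
      case False
      have "\<kappa> * norm \<omega> \<le> r / (2 * R) * (2 * R)" using False pos unfolding \<kappa>_def by (intro mult_mono) auto
      also have "\<dots> = r" using pos by simp
      finally show ?thesis using zr by simp
    qed
  qed
qed

text \<open>A common denominator shows the cancellation in the terms: they equal
  \<open>z\<^sup>2 / (\<omega>\<^sup>2 (z - \<omega>))\<close> and \<open>z (2 \<omega> - z) /
  (\<omega>\<^sup>2 (z - \<omega>)\<^sup>2)\<close>, both of order \<open>|\<omega>| ^ (-3)\<close>
  locally uniformly in \<open>z\<close>.\<close>

lemma zeta0_deriv: "z \<notin> \<Lambda>0 \<Longrightarrow> (zeta0 has_field_derivative - wp0 z) (at z)" (is "_ \<Longrightarrow> ?A")
  and wp0_deriv: "z \<notin> \<Lambda>0 \<Longrightarrow> (wp0 has_field_derivative wp0' z) (at z)" (is "_ \<Longrightarrow> ?B")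
  and wp0'_summable: "z \<notin> \<Lambda>0 \<Longrightarrow> (\<lambda>\<omega>. - 2 / (z - \<omega>) ^ 3) summable_on \<Lambda>0" (is "_ \<Longrightarrow> ?C")
proof -
  assume c: "z \<notin> \<Lambda>0"
  obtain r \<kappa> where r: "r > 0" "\<kappa> > 0"
    "\<And>w \<omega>. w \<in> cball z r \<Longrightarrow> \<omega> \<in> \<Lambda>0 \<Longrightarrow> norm (w - \<omega>) \<ge> \<kappa> * norm \<omega>" using lattice0_sep[OF c] by blast
  define R where "R = norm z + r"
  have zb: "z \<in> ball z r" using r by simp
  have pos: "norm \<omega> > 0" "norm (w - \<omega>) > 0" "w \<noteq> \<omega>" "\<omega> \<noteq> 0" "norm (w - \<omega>) \<ge> \<kappa> * norm \<omega>" "norm w \<le> R" if "w \<in> cball z r" "\<omega> \<in> \<Lambda>0" for w \<omega>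
  proof -
    show 1: "norm \<omega> > 0" using that by auto
    show 3: "norm (w - \<omega>) \<ge> \<kappa> * norm \<omega>" using r(3) that by blast
    show 2: "norm (w - \<omega>) > 0" using 3 1 r(2) by (meson less_le_trans mult_pos_pos)
    then show "w \<noteq> \<omega>" by auto
    show "\<omega> \<noteq> 0" using 1 by auto
    show "norm w \<le> R" using that norm_triangle_ineq2[of w z] by (simp add: R_def dist_norm norm_minus_commute)
  qed
  have R0: "R \<ge> 0" using r by (simp add: R_def)
  show ?A
  proof -
    have "(zeta0 has_field_derivative (\<Sum>\<^sub>\<infinity>\<omega>\<in>\<Lambda>0. - 1 / (z - \<omega>)\<^sup>2 + 1 / \<omega>\<^sup>2)) (at z)"
      unfolding zeta0_def[abs_def]
    proof (rule infsum_has_field_derivative(1)[OF _ _ _ r(1) zb, where M = "\<lambda>\<omega>. (R\<^sup>2 / \<kappa>) * (1 / norm \<omega> ^ 3)"])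
      show "((\<lambda>z. 1 / (z - \<omega>) + 1 / \<omega> + z / \<omega>\<^sup>2) has_field_derivative - 1 / (w - \<omega>)\<^sup>2 + 1 / \<omega>\<^sup>2) (at w)"
        if "\<omega> \<in> \<Lambda>0" "w \<in> cball z r" for \<omega> w
        using pos[OF that(2,1)] by (auto intro!: derivative_eq_intros simp: power2_eq_square)
      show "norm (1 / (w - \<omega>) + 1 / \<omega> + w / \<omega>\<^sup>2) \<le> (R\<^sup>2 / \<kappa>) * (1 / norm \<omega> ^ 3)"
        if "\<omega> \<in> \<Lambda>0" "w \<in> cball z r" for \<omega> w
      proof -
        note p = pos[OF that(2,1)]
        have "1 / (w - \<omega>) + 1 / \<omega> + w / \<omega>\<^sup>2 = w\<^sup>2 / (\<omega>\<^sup>2 * (w - \<omega>))"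
          using p(3,4) by (simp add: field_simps power2_eq_square)
        also have "norm \<dots> = (norm w)\<^sup>2 / ((norm \<omega>)\<^sup>2 * norm (w - \<omega>))"
          by (simp add: norm_divide norm_mult norm_power)
        also have "\<dots> \<le> R\<^sup>2 / ((norm \<omega>)\<^sup>2 * (\<kappa> * norm \<omega>))"
          using p r(2) R0 by (intro frac_le mult_left_mono power_mono) auto
        also have "\<dots> = (R\<^sup>2 / \<kappa>) * (1 / norm \<omega> ^ 3)" by (simp add: power2_eq_square power3_eq_cube)
        finally show ?thesis .
      qed
      show "(\<lambda>\<omega>. (R\<^sup>2 / \<kappa>) * (1 / norm \<omega> ^ 3)) summable_on \<Lambda>0"
        by (rule summable_on_cmult_right[OF summable_lattice])
    qed
    also have "(\<Sum>\<^sub>\<infinity>\<omega>\<in>\<Lambda>0. - 1 / (z - \<omega>)\<^sup>2 + 1 / \<omega>\<^sup>2) = (\<Sum>\<^sub>\<infinity>\<omega>\<in>\<Lambda>0. - (1 / (z - \<omega>)\<^sup>2 - 1 / \<omega>\<^sup>2))"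
      by (rule infsum_cong) simp
    also have "\<dots> = - wp0 z" unfolding wp0_def by (rule infsum_uminus)
    finally show ?A .
  qed
  have d: "((\<lambda>z. 1 / (z - \<omega>)\<^sup>2 - 1 / \<omega>\<^sup>2) has_field_derivative - 2 / (w - \<omega>) ^ 3) (at w)"
    if "\<omega> \<in> \<Lambda>0" "w \<in> cball z r" for \<omega> w
    using DERIV_diff[OF has_field_derivative_inverse_square[OF pos(3)[OF that(2,1)]] DERIV_const] by simp
  \<comment> \<open>Collects \<open>|w| \<le> R\<close>,
    \<open>|2 \<omega> - w| \<le> (2 + R / lat_min) |\<omega>|\<close> and the separation constant
    \<kappa>.\<close>
  define K where "K = R * (2 + R / lat_min) / \<kappa>\<^sup>2"
  have m: "norm (1 / (w - \<omega>)\<^sup>2 - 1 / \<omega>\<^sup>2) \<le> K * (1 / norm \<omega> ^ 3)"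
    if "\<omega> \<in> \<Lambda>0" "w \<in> cball z r" for \<omega> w
  proof -
    note p = pos[OF that(2,1)]
    have l: "norm \<omega> \<ge> lat_min" using lattice_norm_ge that(1) by auto
    have "1 / (w - \<omega>)\<^sup>2 - 1 / \<omega>\<^sup>2 = w * (2 * \<omega> - w) / (\<omega>\<^sup>2 * (w - \<omega>)\<^sup>2)"
      using p(3,4) by (simp add: divide_simps) (simp add: power2_eq_square algebra_simps)
    also have "norm \<dots> = norm w * norm (2 * \<omega> - w) / ((norm \<omega>)\<^sup>2 * (norm (w - \<omega>))\<^sup>2)"
      by (simp add: norm_divide norm_mult norm_power)
    also have "\<dots> \<le> R * ((2 + R / lat_min) * norm \<omega>) / ((norm \<omega>)\<^sup>2 * (\<kappa> * norm \<omega>)\<^sup>2)"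
    proof (intro frac_le mult_mono power_mono)
      have "norm (2 * \<omega> - w) \<le> norm (2 * \<omega>) + norm w" by (rule norm_triangle_ineq4)
      also have "\<dots> \<le> 2 * norm \<omega> + R * 1" using p by simp
      also have "R * 1 \<le> R * (norm \<omega> / lat_min)"
        using l lat_min_pos R0 by (intro mult_left_mono) (auto simp: le_divide_eq_1)
      finally show "norm (2 * \<omega> - w) \<le> (2 + R / lat_min) * norm \<omega>" by (simp add: algebra_simps)
    qed (use p r(2) R0 lat_min_pos in auto)
    also have "\<dots> = K * (1 / norm \<omega> ^ 3)" using p(1) r(2)
      by (simp add: K_def divide_simps) (simp add: eval_nat_numeral)
    finally show ?thesis .
  qed
  have s: "(\<lambda>\<omega>. K * (1 / norm \<omega> ^ 3)) summable_on \<Lambda>0"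
    by (rule summable_on_cmult_right[OF summable_lattice])
  show ?B ?C unfolding wp0_def[abs_def] wp0'_def
    using infsum_has_field_derivative[OF d m s r(1) zb] by auto
qed

lemma zeta0_holo: "zeta0 holomorphic_on - \<Lambda>0" and wp0_holo: "wp0 holomorphic_on - \<Lambda>0"
  unfolding holomorphic_on_open[OF open_compl_lattice0] using zeta0_deriv wp0_deriv by blast+

lemma wp_deriv:
  assumes "z \<notin> \<Lambda>"
  shows "(weierstrass_p \<tau> has_field_derivative - 2 / z ^ 3 + wp0' z) (at z)"
proof -
  have z: "z \<noteq> 0" using assms by auto
  have "((\<lambda>z. 1 / z\<^sup>2) has_field_derivative - 2 / z ^ 3) (at z)"
    using has_field_derivative_inverse_square[of z 0] z by simp
  then show ?thesis unfolding weierstrass_p_eq[abs_def]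
    by (rule DERIV_add[OF _ wp0_deriv]) (use assms in auto)
qed

lemma wp_deriv': "z \<notin> \<Lambda> \<Longrightarrow> (weierstrass_p \<tau> has_field_derivative deriv (weierstrass_p \<tau>) z) (at z)"
  using wp_deriv[of z] DERIV_imp_deriv[OF wp_deriv[of z]] by simp

lemma zeta_deriv:
  assumes "z \<notin> \<Lambda>"
  shows "(weierstrass_zeta \<tau> has_field_derivative - weierstrass_p \<tau> z) (at z)"
proof -
  have z: "z \<noteq> 0" using assms by auto
  have 1: "((\<lambda>z. 1 / z) has_field_derivative - 1 / z\<^sup>2) (at z)"
    using z by (auto intro!: derivative_eq_intros simp: power2_eq_square)
  have "z \<notin> \<Lambda>0" using assms by blast
  from DERIV_add[OF 1 zeta0_deriv[OF this]] show ?thesis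
    unfolding weierstrass_zeta_eq[abs_def] weierstrass_p_eq by simp
qed

lemma wp_holo: "weierstrass_p \<tau> holomorphic_on - \<Lambda>"
  unfolding holomorphic_on_open[OF open_compl_lattice] using wp_deriv by blast

lemma zeta_holo: "weierstrass_zeta \<tau> holomorphic_on - \<Lambda>"
  unfolding holomorphic_on_open[OF open_compl_lattice] using zeta_deriv by blast

section \<open>Parity, conjugation symmetry and periodicity\<close>

lemma bij_uminus: "bij_betw uminus \<Lambda>0 \<Lambda>0"
  by (rule bij_betwI[of _ _ _ uminus]) auto

lemma bij_cnj: "bij_betw cnj \<Lambda>0 \<Lambda>0"
  by (rule bij_betwI[of _ _ _ cnj]) auto

lemma wp0_even: "wp0 (- z) = wp0 z"
proof -
  have "wp0 z = (\<Sum>\<^sub>\<infinity>\<omega>\<in>\<Lambda>0. 1 / (z - (- \<omega>))\<^sup>2 - 1 / (- \<omega>)\<^sup>2)"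
    unfolding wp0_def by (rule infsum_reindex_bij_betw[OF bij_uminus, symmetric])
  also have "\<dots> = wp0 (- z)" unfolding wp0_def
    by (rule infsum_cong) (simp add: power2_eq_square algebra_simps)
  finally show ?thesis ..
qed

lemma zeta0_odd: "zeta0 (- z) = - zeta0 z"
proof -
  have "zeta0 (- z) = (\<Sum>\<^sub>\<infinity>\<omega>\<in>\<Lambda>0. 1 / (- z - (- \<omega>)) + 1 / (- \<omega>) + (- z) / (- \<omega>)\<^sup>2)"
    unfolding zeta0_def by (rule infsum_reindex_bij_betw[OF bij_uminus, symmetric])
  also have "\<dots> = (\<Sum>\<^sub>\<infinity>\<omega>\<in>\<Lambda>0. - (1 / (z - \<omega>) + 1 / \<omega> + z / \<omega>\<^sup>2))"
  proof (rule infsum_cong)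
    fix \<omega> :: complex
    have "1 / (- z - (- \<omega>)) = - (1 / (z - \<omega>))" by (simp add: minus_divide_right)
    then show "1 / (- z - (- \<omega>)) + 1 / (- \<omega>) + (- z) / (- \<omega>)\<^sup>2 = - (1 / (z - \<omega>) + 1 / \<omega> + z / \<omega>\<^sup>2)" by simp
  qed
  also have "\<dots> = - zeta0 z" unfolding zeta0_def by (rule infsum_uminus)
  finally show ?thesis .
qed

lemma wp0_cnj: "wp0 (cnj z) = cnj (wp0 z)"
proof -
  have "wp0 (cnj z) = (\<Sum>\<^sub>\<infinity>\<omega>\<in>\<Lambda>0. 1 / (cnj z - cnj \<omega>)\<^sup>2 - 1 / (cnj \<omega>)\<^sup>2)"
    unfolding wp0_def by (rule infsum_reindex_bij_betw[OF bij_cnj, symmetric])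
  also have "\<dots> = (\<Sum>\<^sub>\<infinity>\<omega>\<in>\<Lambda>0. cnj (1 / (z - \<omega>)\<^sup>2 - 1 / \<omega>\<^sup>2))" by simp
  also have "\<dots> = cnj (wp0 z)" unfolding wp0_def by (rule infsum_cnj)
  finally show ?thesis .
qed

lemma wp_even: "weierstrass_p \<tau> (- z) = weierstrass_p \<tau> z"
  by (simp add: weierstrass_p_eq wp0_even)

lemma zeta_odd: "weierstrass_zeta \<tau> (- z) = - weierstrass_zeta \<tau> z"
  by (simp add: weierstrass_zeta_eq zeta0_odd)

lemma wp_cnj: "weierstrass_p \<tau> (cnj z) = cnj (weierstrass_p \<tau> z)"
  by (simp add: weierstrass_p_eq wp0_cnj)

text \<open>With the pole at 0 included the sum runs over the whole lattice and has no correction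
  terms, so that periodicity of the derivative is a reindexing.\<close>

lemma wp'_sum:
  assumes "z \<notin> \<Lambda>"
  shows "deriv (weierstrass_p \<tau>) z = (\<Sum>\<^sub>\<infinity>\<omega>\<in>\<Lambda>. - 2 / (z - \<omega>) ^ 3)"
proof -
  have "(\<Sum>\<^sub>\<infinity>\<omega>\<in>insert 0 \<Lambda>0. - 2 / (z - \<omega>) ^ 3) = - 2 / (z - 0) ^ 3 + wp0' z"
    unfolding wp0'_def using wp0'_summable[of z] assms by (subst infsum_insert) auto
  moreover have "insert 0 \<Lambda>0 = \<Lambda>" by auto
  ultimately show ?thesis using DERIV_imp_deriv[OF wp_deriv[OF assms]] by simp
qed

lemma wp'_periodic:
  assumes "z \<notin> \<Lambda>" "\<mu> \<in> \<Lambda>"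
  shows "deriv (weierstrass_p \<tau>) (z + \<mu>) = deriv (weierstrass_p \<tau>) z"
proof -
  have bij: "bij_betw (\<lambda>\<omega>. \<omega> + \<mu>) \<Lambda> \<Lambda>"
    by (rule bij_betwI[of _ _ _ "\<lambda>\<omega>. \<omega> - \<mu>"]) (use assms lattice_add lattice_diff in auto)
  have "(\<Sum>\<^sub>\<infinity>\<omega>\<in>\<Lambda>. - 2 / (z + \<mu> - \<omega>) ^ 3) = (\<Sum>\<^sub>\<infinity>\<omega>\<in>\<Lambda>. - 2 / (z + \<mu> - (\<omega> + \<mu>)) ^ 3)"
    by (rule infsum_reindex_bij_betw[OF bij, symmetric])
  then show ?thesis using assms by (simp add: wp'_sum lattice_add_cancel)
qed

text \<open>The derivative is periodic, so \<open>\<wp>(z + \<mu>) - \<wp>(z)\<close> is constant,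
  and evenness makes it vanish at \<open>z = - \<mu> / 2\<close>. This point has to avoid the poles,
  as it does for the generators 1 and \<tau>.\<close>

lemma wp_periodic_half:
  assumes \<mu>: "\<mu> \<in> \<Lambda>" "\<mu> / 2 \<notin> \<Lambda>" and z: "z \<notin> \<Lambda>"
  shows "weierstrass_p \<tau> (z + \<mu>) = weierstrass_p \<tau> z"
proof -
  have "((\<lambda>z. weierstrass_p \<tau> (z + \<mu>) - weierstrass_p \<tau> z) has_field_derivative 0) (at w)" if "w \<in> - \<Lambda>" for w
  proof -
    have w: "w \<notin> \<Lambda>" "w + \<mu> \<notin> \<Lambda>" using that \<mu> lattice_add_cancel by auto
    have "((\<lambda>z. weierstrass_p \<tau> (z + \<mu>)) has_field_derivative deriv (weierstrass_p \<tau>) (w + \<mu>)) (at w)"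
      by (rule iffD1[OF DERIV_shift wp_deriv'[OF w(2)]])
    moreover have "(weierstrass_p \<tau> has_field_derivative deriv (weierstrass_p \<tau>) w) (at w)"
      by (rule wp_deriv'[OF w(1)])
    ultimately show ?thesis using wp'_periodic[OF w(1) \<mu>(1)] by (auto intro!: derivative_eq_intros)
  qed
  then have "(\<lambda>z. weierstrass_p \<tau> (z + \<mu>) - weierstrass_p \<tau> z) constant_on - \<Lambda>"
    by (rule has_field_derivative_0_imp_constant_on[OF _ connected_compl_lattice open_compl_lattice])
  then obtain c where c: "\<And>z. z \<in> - \<Lambda> \<Longrightarrow> weierstrass_p \<tau> (z + \<mu>) - weierstrass_p \<tau> z = c"
    by (auto simp: constant_on_def)
  have "c = weierstrass_p \<tau> (- (\<mu> / 2) + \<mu>) - weierstrass_p \<tau> (- (\<mu> / 2))" using c[of "- (\<mu> / 2)"] \<mu> by auto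
  also have "- (\<mu> / 2) + \<mu> = \<mu> / 2" by simp
  finally have "c = 0" by (simp add: wp_even)
  then show ?thesis using c[of z] z by simp
qed

lemma half_notin: "1 / 2 \<notin> \<Lambda>" "\<tau> / 2 \<notin> \<Lambda>" "(1 + \<tau>) / 2 \<notin> \<Lambda>"
proof -
  have *: "real_of_int a \<noteq> 1 / 2" for a
  proof
    assume "real_of_int a = 1 / 2"
    then have "real_of_int (2 * a) = real_of_int 1" by simp
    then have "2 * a = 1" by (simp only: of_int_eq_iff)
    then show False by presburger
  qed
  show "1 / 2 \<notin> \<Lambda>" "(1 + \<tau>) / 2 \<notin> \<Lambda>" unfolding lattice_iff using * by auto
  show "\<tau> / 2 \<notin> \<Lambda>"
  proof
    assume "\<tau> / 2 \<in> \<Lambda>"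
    then obtain b :: int where "Im \<tau> / 2 = of_int b * Im \<tau>" by (auto simp: lattice_iff)
    then have "real_of_int b = 1 / 2" using Im_tau by (simp add: field_simps)
    then show False using * by blast
  qed
qed

text \<open>The exceptional set \<open>S\<close> is itself invariant, so no intermediate translate
  meets it. Negative multiples are reduced to positive ones by starting from the translated
  point.\<close>

lemma periodic_lattice_induct:
  assumes P1: "\<And>z. z \<notin> S \<Longrightarrow> f (z + 1) = f z" and Pt: "\<And>z. z \<notin> S \<Longrightarrow> f (z + \<tau>) = f z"
    and S: "\<And>z \<omega>. \<omega> \<in> \<Lambda> \<Longrightarrow> z + \<omega> \<in> S \<longleftrightarrow> z \<in> S" and z: "z \<notin> S" and \<omega>: "\<omega> \<in> \<Lambda>"
  shows "f (z + \<omega>) = f z"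
proof -
  have nat: "f (z + of_nat k * \<mu>) = f z"
    if "\<And>z. z \<notin> S \<Longrightarrow> f (z + \<mu>) = f z" "\<mu> \<in> \<Lambda>" "z \<notin> S" for k z \<mu>
  proof -
    have "z + of_nat k * \<mu> \<notin> S \<and> f (z + of_nat k * \<mu>) = f z"
    proof (induction k)
      case (Suc k)
      have e: "z + of_nat (Suc k) * \<mu> = (z + of_nat k * \<mu>) + \<mu>" by (simp add: algebra_simps)
      show ?case unfolding e using that Suc S by simp
    qed (use that in auto)
    then show ?thesis by blast
  qed
  have int: "f (z + of_int k * \<mu>) = f z \<and> z + of_int k * \<mu> \<notin> S"
    if p: "\<And>z. z \<notin> S \<Longrightarrow> f (z + \<mu>) = f z" and \<mu>: "\<mu> \<in> \<Lambda>" and "\<And>k::int. of_int k * \<mu> \<in> \<Lambda>" and z: "z \<notin> S" for k :: int and z \<mu>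
  proof -
    have kS: "z + of_int k * \<mu> \<notin> S" using S[OF that(3)] z by blast
    have "f (z + of_int k * \<mu>) = f z"
    proof (cases "k \<ge> 0")
      case True
      then show ?thesis using nat[OF p \<mu> z, of "nat k"] by simp
    next
      case False
      then have "f (z + of_int k * \<mu> + of_nat (nat (- k)) * \<mu>) = f (z + of_int k * \<mu>)"
        by (intro nat p \<mu> kS)
      then show ?thesis using False by simp
    qed
    then show ?thesis using kS by blast
  qed
  obtain a b :: int where ab: "\<omega> = of_int a * 1 + of_int b * \<tau>" using \<omega> by (auto simp: lattice_def)
  have "\<And>k::int. of_int k * 1 \<in> \<Lambda>" "\<And>k::int. of_int k * \<tau> \<in> \<Lambda>"
    by (auto simp: lattice_iff)
  then show ?thesis unfolding ab add.assoc[symmetric]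
    using int[of 1 z a] int[of \<tau> "z + of_int a * 1" b] P1 Pt z by (metis lattice_1 lattice_tau)
qed

lemma wp_periodic:
  assumes "z \<notin> \<Lambda>" "\<omega> \<in> \<Lambda>"
  shows "weierstrass_p \<tau> (z + \<omega>) = weierstrass_p \<tau> z"
  using wp_periodic_half[of 1] wp_periodic_half[of \<tau>] half_notin
  by (intro periodic_lattice_induct[OF _ _ _ assms]) (auto simp: lattice_add_cancel)

lemma zeta_quasi_periodic:
  assumes "\<omega> \<in> \<Lambda>"
  obtains c where "\<And>z. z \<notin> \<Lambda> \<Longrightarrow> weierstrass_zeta \<tau> (z + \<omega>) = weierstrass_zeta \<tau> z + c"
proof -
  have "((\<lambda>z. weierstrass_zeta \<tau> (z + \<omega>) - weierstrass_zeta \<tau> z) has_field_derivative 0) (at w)" if "w \<in> - \<Lambda>" for w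
  proof -
    have w: "w \<notin> \<Lambda>" "w + \<omega> \<notin> \<Lambda>" using that assms lattice_add_cancel by auto
    have "((\<lambda>z. weierstrass_zeta \<tau> (z + \<omega>)) has_field_derivative - weierstrass_p \<tau> (w + \<omega>)) (at w)"
      by (rule iffD1[OF DERIV_shift zeta_deriv[OF w(2)]])
    then show ?thesis using wp_periodic[OF w(1) assms] zeta_deriv[OF w(1)]
      by (auto intro!: derivative_eq_intros)
  qed
  then have "(\<lambda>z. weierstrass_zeta \<tau> (z + \<omega>) - weierstrass_zeta \<tau> z) constant_on - \<Lambda>"
    by (rule has_field_derivative_0_imp_constant_on[OF _ connected_compl_lattice open_compl_lattice])
  then obtain c where "\<And>z. z \<in> - \<Lambda> \<Longrightarrow> weierstrass_zeta \<tau> (z + \<omega>) - weierstrass_zeta \<tau> z = c"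
    by (auto simp: constant_on_def)
  then show ?thesis by (intro that[of c]) (simp add: algebra_simps)
qed

end

section \<open>Elliptic functions with singularities in the orbits of 0, p and -p\<close>

lemma holomorphic_shift:
  assumes "f holomorphic_on - X"
  shows "(\<lambda>z. f (z + a)) holomorphic_on {z. z + a \<notin> X}"
  by (rule holomorphic_on_compose_gen[OF _ assms, of "\<lambda>z. z + a", unfolded o_def])
     (intro holomorphic_intros, blast)

lemma holo_div_point:
  fixes f :: "complex \<Rightarrow> complex"
  assumes "f holomorphic_on S" "open S" "f s = 0"
  shows "\<exists>k. k holomorphic_on S \<and> (\<forall>z\<in>S. f z = (z - s) * k z) \<and> k s = deriv f s"
  by (rule exI[of _ "\<lambda>z. if z = s then deriv f s else (f z - f s) / (z - s)"])
     (use pole_lemma_open[OF assms(1,2), of s] assms(3) in auto)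

lemma holomorphic_ball_point_value:
  fixes g :: "complex \<Rightarrow> complex"
  assumes g: "g holomorphic_on ball s r" and r: "r > 0" and c: "\<And>z. z \<in> ball s r - {s} \<Longrightarrow> g z = c"
  shows "g s = c"
proof -
  have "(g \<longlongrightarrow> g s) (at s)"
    using holomorphic_on_imp_continuous_on[OF g] r continuous_on_eq_continuous_at[OF open_ball, of s r g]
    by (auto simp: isCont_def)
  moreover have "(g \<longlongrightarrow> c) (at s)"
    by (rule Lim_transform_within[OF tendsto_const r]) (use c in \<open>auto simp: dist_commute\<close>)
  ultimately show ?thesis by (rule LIM_unique)
qed

context rect_lattice begin

abbreviation sing :: "complex \<Rightarrow> complex set" where "sing p \<equiv> sing_set \<tau> p"

lemma sing_iff: "z \<in> sing p \<longleftrightarrow> (\<exists>s\<in>{0, p, - p}. z - s \<in> \<Lambda>)"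
  by (auto simp: sing_set_def)

lemma sing_periodic: "\<omega> \<in> \<Lambda> \<Longrightarrow> z + \<omega> \<in> sing p \<longleftrightarrow> z \<in> sing p"
proof -
  assume \<omega>: "\<omega> \<in> \<Lambda>"
  have "z + \<omega> - s \<in> \<Lambda> \<longleftrightarrow> z - s \<in> \<Lambda>" for s
    using lattice_add_cancel[OF \<omega>, of "z - s"] by (simp add: algebra_simps)
  then show ?thesis unfolding sing_iff by simp
qed

lemma closed_sing: "closed (sing p)"
proof -
  have "closed ((\<lambda>z. z - s) -` \<Lambda>)" for s
    by (intro closed_vimage closed_lattice_subset continuous_intros) auto
  then have "closed (\<Union>s\<in>{0, p, - p}. (\<lambda>z. z - s) -` \<Lambda>)" by blast
  also have "(\<Union>s\<in>{0, p, - p}. (\<lambda>z. z - s) -` \<Lambda>) = sing p" unfolding sing_iff[THEN eqTrueI, symmetric]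
    by (auto simp: sing_set_def)
  finally show ?thesis .
qed

lemma countable_sing: "countable (sing p)"
proof -
  have "sing p = (\<Union>s\<in>{0, p, - p}. (\<lambda>z. z + s) ` \<Lambda>)"
    by (auto simp: sing_set_def image_iff) (metis diff_add_cancel add_diff_cancel_right')+
  then show ?thesis using countable_lattice by simp
qed

lemma open_compl_sing: "open (- sing p)" using closed_sing by (simp add: open_Compl)

lemma isolated_sing:
  "\<exists>r>0. \<forall>z\<in>ball s r - {s}. z \<notin> sing p"
proof -
  have "\<exists>r>0. \<forall>z\<in>ball s r - {s}. z - a \<notin> \<Lambda>" for a
  proof -
    have "closed (\<Lambda> - {s - a})" by (rule closed_lattice_subset) blast
    then have "open (- (\<Lambda> - {s - a}))" by (rule open_Compl)
    then obtain r where r: "r > 0" "ball (s - a) r \<subseteq> - (\<Lambda> - {s - a})"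
      unfolding open_contains_ball by blast
    have "z - a \<notin> \<Lambda>" if "z \<in> ball s r - {s}" for z
    proof -
      have "z - a \<in> ball (s - a) r" "z - a \<noteq> s - a" using that by (auto simp: dist_norm)
      then show ?thesis using r(2) by blast
    qed
    then show ?thesis using r(1) by blast
  qed
  from this[of 0] this[of p] this[of "- p"] obtain r1 r2 r3 where
    r: "r1 > 0" "r2 > 0" "r3 > 0" "\<forall>z\<in>ball s r1 - {s}. z - 0 \<notin> \<Lambda>"
    "\<forall>z\<in>ball s r2 - {s}. z - p \<notin> \<Lambda>" "\<forall>z\<in>ball s r3 - {s}. z - (- p) \<notin> \<Lambda>" by blast
  show ?thesis
    by (rule exI[of _ "min r1 (min r2 r3)"]) (use r in \<open>auto simp: sing_set_def\<close>)
qed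

text \<open>Liouville's theorem on the torus: after removal of the singularities \<open>f\<close>
  becomes an entire function whose values are all taken on one compact period rectangle.\<close>

lemma elliptic_const:
  assumes f: "f holomorphic_on - sing p"
    and per: "\<And>z \<omega>. z \<notin> sing p \<Longrightarrow> \<omega> \<in> \<Lambda> \<Longrightarrow> f (z + \<omega>) = f z"
    and rem: "\<And>s. s \<in> {0, p, - p} \<Longrightarrow> \<exists>r>0. \<exists>g. g holomorphic_on ball s r \<and> (\<forall>z\<in>ball s r - {s}. g z = f z)"
  obtains c where "\<And>z. z \<notin> sing p \<Longrightarrow> f z = c"
proof -
  have loc: "\<exists>r>0. \<exists>g. g holomorphic_on ball s r \<and> (\<forall>z\<in>ball s r - {s}. z \<notin> sing p \<and> g z = f z)" for s
  proof (cases "s \<in> sing p")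
    case True
    then obtain s0 where s0: "s0 \<in> {0, p, - p}" "s - s0 \<in> \<Lambda>" unfolding sing_iff by blast
    obtain r g where rg: "r > 0" "g holomorphic_on ball s0 r" "\<And>z. z \<in> ball s0 r - {s0} \<Longrightarrow> g z = f z"
      using rem[OF s0(1)] by blast
    obtain r' where r': "r' > 0" "\<And>z. z \<in> ball s r' - {s} \<Longrightarrow> z \<notin> sing p" using isolated_sing[of s p] by blast
    define R where "R = min r r'"
    have R: "R > 0" using rg r' by (simp add: R_def)
    have tr: "z - (s - s0) \<in> ball s0 R" if "z \<in> ball s R" for z
      using that by (simp add: dist_norm algebra_simps)
    have "(\<lambda>z. g (z - (s - s0))) holomorphic_on ball s R"
      by (rule holomorphic_on_compose_gen[of "\<lambda>z. z - (s - s0)" _ g "ball s0 r", unfolded o_def])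
         (use rg tr in \<open>auto intro!: holomorphic_intros simp: R_def\<close>)
    moreover have "z \<notin> sing p \<and> g (z - (s - s0)) = f z" if z: "z \<in> ball s R - {s}" for z
    proof -
      have ns: "z \<notin> sing p" using r'(2)[of z] z by (auto simp: R_def)
      have "z - (s - s0) \<in> ball s0 r - {s0}" using tr[of z] z by (auto simp: R_def)
      from rg(3)[OF this] have "g (z - (s - s0)) = f (z + - (s - s0))" by (simp only: add_uminus_conv_diff)
      also have "\<dots> = f z" by (rule per[OF ns iffD2[OF lattice_minus_iff s0(2)]])
      finally show ?thesis using ns by blast
    qed
    ultimately show ?thesis using R by blast
  next
    case False
    then obtain r where "r > 0" "ball s r \<subseteq> - sing p" using open_compl_sing open_contains_ball by blast
    then show ?thesis using f holomorphic_on_subset[OF f] by (intro exI[of _ r] exI[of _ f] conjI) auto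
  qed
  \<comment> \<open>The limit does not depend on the chosen local extensions; \<open>Fg\<close>
    identifies it with each of them.\<close>
  define F where "F s = Lim (at s) f" for s
  have Fg: "F s = g s" if "r > 0" "g holomorphic_on ball s0 r" "\<And>z. z \<in> ball s0 r - {s0} \<Longrightarrow> z \<notin> sing p \<and> g z = f z"
    "s \<in> ball s0 r" for s s0 r g
  proof -
    have "(g \<longlongrightarrow> g s) (at s)"
      using holomorphic_on_imp_continuous_on[OF that(2)] that(4) continuous_on_eq_continuous_at[OF open_ball, of s0 r g]
      by (auto simp: isCont_def)
    moreover have "\<forall>\<^sub>F z in at s. g z = f z"
    proof -
      have "\<forall>\<^sub>F z in at s. z \<in> ball s0 r - {s0} \<or> z = s0 \<and> z \<noteq> s"
        using eventually_at_in_open'[OF open_ball that(4)] eventually_neq_at_within[of s s UNIV] by eventually_elim auto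
      moreover have "\<forall>\<^sub>F z in at s. z \<noteq> s0"
        by (rule eventually_neq_at_within)
      ultimately show ?thesis by eventually_elim (use that(3) in auto)
    qed
    ultimately have "(f \<longlongrightarrow> g s) (at s)" by (rule Lim_transform_eventually)
    then show ?thesis unfolding F_def by (simp add: tendsto_Lim)
  qed
  have Ff: "F z = f z" if z: "z \<notin> sing p" for z
  proof -
    obtain r where "r > 0" "ball z r \<subseteq> - sing p" using open_compl_sing open_contains_ball z by blast
    then show ?thesis by (intro Fg[of r f z]) (use holomorphic_on_subset[OF f] in auto)
  qed
  have FU: "F holomorphic_on UNIV"
    unfolding holomorphic_on_open[OF open_UNIV]
  proof
    fix s
    obtain r g where rg: "r > 0" "g holomorphic_on ball s r" "\<And>z. z \<in> ball s r - {s} \<Longrightarrow> z \<notin> sing p \<and> g z = f z"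
      using loc[of s] by blast
    have "(g has_field_derivative deriv g s) (at s)" using holomorphic_derivI[OF rg(2) open_ball] rg(1) by simp
    then have "(F has_field_derivative deriv g s) (at s)"
      by (rule has_field_derivative_transform_within_open[of _ _ _ "ball s r"]) (use Fg[OF rg] rg(1) in auto)
    then show "\<exists>f'. (F has_field_derivative f') (at s)" by blast
  qed
  have Fper: "F (z + \<omega>) = F z" if \<omega>: "\<omega> \<in> \<Lambda>" for z \<omega>
  proof (rule analytic_continuation_open[of "- sing p" UNIV "\<lambda>z. F (z + \<omega>)" F])
    show "- sing p \<noteq> {}" using countable_sing[of p] uncountable_UNIV_complex by (metis Compl_UNIV_eq double_compl)
    show "(\<lambda>z. F (z + \<omega>)) holomorphic_on UNIV"
      by (rule holomorphic_on_compose_gen[of "\<lambda>z. z + \<omega>" _ F UNIV, unfolded o_def])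
         (use FU in \<open>auto intro!: holomorphic_intros\<close>)
    show "F (z + \<omega>) = F z" if "z \<in> - sing p" for z
      using that Ff sing_periodic[OF \<omega>] per[OF _ \<omega>] by auto
  qed (use open_compl_sing FU in auto)
  have "bounded (range F)"
  proof -
    let ?K = "cbox 0 (1 + \<tau>)"
    have "compact (F ` ?K)"
      by (intro compact_continuous_image holomorphic_on_imp_continuous_on holomorphic_on_subset[OF FU]) auto
    moreover have "range F \<subseteq> F ` ?K"
    proof
      fix y assume "y \<in> range F"
      then obtain z where z: "y = F z" by blast
      define \<omega> where "\<omega> = of_int (- \<lfloor>Re z\<rfloor>) + of_int (- \<lfloor>Im z / Im \<tau>\<rfloor>) * \<tau>"
      have "\<omega> \<in> \<Lambda>" unfolding \<omega>_def lattice_def by blast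
      then have "y = F (z + \<omega>)" using Fper z by simp
      moreover have "z + \<omega> \<in> ?K"
      proof -
        have "of_int \<lfloor>Im z / Im \<tau>\<rfloor> * Im \<tau> \<le> Im z / Im \<tau> * Im \<tau>" "Im z / Im \<tau> * Im \<tau> \<le> (of_int \<lfloor>Im z / Im \<tau>\<rfloor> + 1) * Im \<tau>"
          using Im_tau by (intro mult_right_mono; linarith)+
        then have "of_int \<lfloor>Im z / Im \<tau>\<rfloor> * Im \<tau> \<le> Im z" "Im z \<le> of_int \<lfloor>Im z / Im \<tau>\<rfloor> * Im \<tau> + Im \<tau>"
          using Im_tau by (auto simp: algebra_simps)
        moreover have "of_int \<lfloor>Re z\<rfloor> \<le> Re z" "Re z \<le> of_int \<lfloor>Re z\<rfloor> + 1" by linarith+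
        ultimately show ?thesis by (auto simp: in_cbox_complex_iff \<omega>_def; linarith)
      qed
      ultimately show "y \<in> F ` ?K" by blast
    qed
    ultimately show ?thesis using compact_imp_bounded bounded_subset by blast
  qed
  then obtain c where "\<And>z. F z = c" using Liouville_theorem[OF FU] by (auto simp: constant_on_def)
  then show ?thesis using that Ff by metis
qed

text \<open>The partial fraction form of \<open>\<wp>'(p) / (\<wp>(z) - \<wp>(p))\<close>: the
  residues are 1 at \<open>p\<close> and -1 at \<open>-p\<close>, and the constant makes it vanish
  at 0.\<close>

definition wpN :: "complex \<Rightarrow> complex \<Rightarrow> complex" where
  "wpN p z = weierstrass_zeta \<tau> (z - p) - weierstrass_zeta \<tau> (z + p) + 2 * weierstrass_zeta \<tau> p"

lemma sing_notin: "z \<notin> sing p \<Longrightarrow> z \<notin> \<Lambda> \<and> z - p \<notin> \<Lambda> \<and> z + p \<notin> \<Lambda>"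
  by (auto simp: sing_set_def)

lemma wpN_periodic:
  assumes "z \<notin> sing p" "\<omega> \<in> \<Lambda>"
  shows "wpN p (z + \<omega>) = wpN p z"
proof -
  obtain c where c: "\<And>z. z \<notin> \<Lambda> \<Longrightarrow> weierstrass_zeta \<tau> (z + \<omega>) = weierstrass_zeta \<tau> z + c"
    using zeta_quasi_periodic[OF assms(2)] by blast
  show ?thesis using c[of "z - p"] c[of "z + p"] sing_notin[OF assms(1)]
    by (simp add: wpN_def algebra_simps)
qed

lemma p_notin: "2 * p \<notin> \<Lambda> \<Longrightarrow> p \<notin> \<Lambda>"
  using lattice_add[of p p] unfolding mult_2 by blast

lemma open_shift_compl: "open {z. z + a \<notin> \<Lambda>}" "open {z. z + a \<notin> \<Lambda>0}"
proof -
  have *: "open {z. z + a \<notin> A}" if "open (- A)" for A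
  proof -
    have "{z. z + a \<notin> A} = (\<lambda>z. z + a) -` (- A)" by auto
    moreover have "open ((\<lambda>z. z + a) -` (- A))"
      by (rule open_vimage[OF that]) (intro continuous_intros)
    ultimately show ?thesis by simp
  qed
  show "open {z. z + a \<notin> \<Lambda>}" by (rule *[OF open_compl_lattice])
  show "open {z. z + a \<notin> \<Lambda>0}" by (rule *[OF open_compl_lattice0])
qed

text \<open>All poles of the product cancel: the double pole of \<wp> at 0 against a double zero of
  \<open>wpN\<close>, and the simple poles of \<open>wpN\<close> at \<open>p\<close> and
  \<open>-p\<close> against zeros of \<open>\<wp> - \<wp>(p)\<close>. The product is therefore
  constant, and its value is read off at \<open>p\<close>.\<close>

lemma wpN_mult_const:
  assumes p: "2 * p \<notin> \<Lambda>" and z: "z \<notin> sing p"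
  shows "(weierstrass_p \<tau> z - weierstrass_p \<tau> p) * wpN p z = deriv (weierstrass_p \<tau>) p"
proof -
  let ?wp = "weierstrass_p \<tau>" let ?c = "weierstrass_p \<tau> p"
  let ?f = "\<lambda>z. (?wp z - ?c) * wpN p z"
  note pL = p_notin[OF p]
  have fh: "?f holomorphic_on - sing p"
    unfolding wpN_def
    by (intro holomorphic_intros holomorphic_on_subset[OF wp_holo]
        holomorphic_on_subset[OF holomorphic_shift[OF zeta_holo, of p]]
        holomorphic_on_subset[OF holomorphic_shift[OF zeta_holo, of "- p", unfolded add_uminus_conv_diff]])
       (auto simp: sing_set_def)
  have per: "?f (z + \<omega>) = ?f z" if "z \<notin> sing p" "\<omega> \<in> \<Lambda>" for z \<omega>
    using that wpN_periodic wp_periodic sing_notin by simp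
  have at0: "\<exists>r>0. \<exists>g. g holomorphic_on ball 0 r \<and> (\<forall>z\<in>ball 0 r - {0}. g z = ?f z)"
  proof -
    define S where "S = - \<Lambda>0 \<inter> ({z. z + (- p) \<notin> \<Lambda>} \<inter> {z. z + p \<notin> \<Lambda>})"
    have S: "open S" unfolding S_def by (intro open_Int open_compl_lattice0 open_shift_compl)
    have S0: "0 \<in> S" using pL by (auto simp: S_def)
    have N: "wpN p holomorphic_on S"
      unfolding wpN_def[abs_def] S_def
      by (intro holomorphic_intros holomorphic_on_subset[OF holomorphic_shift[OF zeta_holo, of p]]
        holomorphic_on_subset[OF holomorphic_shift[OF zeta_holo, of "- p", unfolded add_uminus_conv_diff]]) auto
    have N0: "wpN p 0 = 0" by (simp add: wpN_def zeta_odd)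
    \<comment> \<open>The derivative at 0 is \<open>\<wp>(p) - \<wp>(-p)\<close>, so evenness makes
      the zero a double one.\<close>
    have N'0: "deriv (wpN p) 0 = 0"
    proof -
      have "((\<lambda>z. weierstrass_zeta \<tau> (z + p)) has_field_derivative - ?wp (0 + p)) (at 0)"
        using pL by (intro iffD1[OF DERIV_shift zeta_deriv]) auto
      moreover have "((\<lambda>z. weierstrass_zeta \<tau> (z + (- p))) has_field_derivative - ?wp (0 + (- p))) (at 0)"
        using pL by (intro iffD1[OF DERIV_shift zeta_deriv]) auto
      ultimately have "(wpN p has_field_derivative 0) (at 0)"
        unfolding wpN_def[abs_def] by (auto intro!: derivative_eq_intros simp: wp_even)
      then show ?thesis by (rule DERIV_imp_deriv)
    qed
    obtain k where k: "k holomorphic_on S" "\<And>z. z \<in> S \<Longrightarrow> wpN p z = (z - 0) * k z" "k 0 = 0"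
      using holo_div_point[OF N S N0] N'0 by auto
    obtain l where l: "l holomorphic_on S" "\<And>z. z \<in> S \<Longrightarrow> k z = (z - 0) * l z"
      using holo_div_point[OF k(1) S k(3)] by auto
    define g where "g z = (1 + z\<^sup>2 * (wp0 z - ?c)) * l z" for z
    obtain r where r: "r > 0" "ball 0 r \<subseteq> S" using S S0 open_contains_ball by blast
    have "g holomorphic_on ball 0 r" unfolding g_def
      by (intro holomorphic_intros holomorphic_on_subset[OF wp0_holo] holomorphic_on_subset[OF l(1)])
         (use r(2) in \<open>auto simp: S_def\<close>)
    moreover have "g z = ?f z" if "z \<in> ball 0 r - {0}" for z
    proof -
      have "z \<in> S" "z \<noteq> 0" using that r(2) by auto
      then show ?thesis using k(2) l(2) by (simp add: g_def weierstrass_p_eq field_simps power2_eq_square)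
    qed
    ultimately show ?thesis using r(1) by blast
  qed
  have atp: "\<exists>r>0. \<exists>g. g holomorphic_on ball s r \<and> (\<forall>z\<in>ball s r - {s}. g z = ?f z) \<and> (s = p \<longrightarrow> g s = deriv ?wp p)"
    if s: "s = p \<or> s = - p" for s
  proof -
    define S where "S = - \<Lambda> \<inter> ({z. z + (- s) \<notin> \<Lambda>0} \<inter> {z. z + s \<notin> \<Lambda>})"
    have s2: "s + s \<notin> \<Lambda>" "s \<notin> \<Lambda>"
    proof -
      have "s + s = 2 * p \<or> s + s = - (2 * p)" using s by auto
      then show "s + s \<notin> \<Lambda>" using p lattice_minus_iff by metis
      show "s \<notin> \<Lambda>" using s pL by auto
    qed
    have S: "open S" unfolding S_def by (intro open_Int open_compl_lattice open_shift_compl)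
    have S0: "s \<in> S" using s2 by (auto simp: S_def)
    have ws: "?wp s = ?c" using s wp_even by auto
    obtain k where k: "k holomorphic_on S" "\<And>z. z \<in> S \<Longrightarrow> ?wp z - ?c = (z - s) * k z" "k s = deriv (\<lambda>z. ?wp z - ?c) s"
    proof -
      have "(\<lambda>z. ?wp z - ?c) holomorphic_on S"
        by (intro holomorphic_intros holomorphic_on_subset[OF wp_holo]) (auto simp: S_def)
      from holo_div_point[OF this S, of s] ws show ?thesis using that by auto
    qed
    have ks: "k s = deriv ?wp s"
      unfolding k(3) by (rule DERIV_imp_deriv) (use wp_deriv'[OF s2(2)] in \<open>auto intro!: derivative_eq_intros\<close>)
    \<comment> \<open>The residue of \<open>wpN p\<close> at \<open>s\<close>.\<close>
    define \<epsilon> :: complex where "\<epsilon> = (if s = p then 1 else - 1)"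
    define h where "h z = \<epsilon> * (zeta0 (z + (- s)) - weierstrass_zeta \<tau> (z + s)) + 2 * weierstrass_zeta \<tau> p" for z
    have hN: "wpN p z = \<epsilon> / (z - s) + h z" for z
      using s by (auto simp: wpN_def h_def \<epsilon>_def weierstrass_zeta_eq[of "z - p"] weierstrass_zeta_eq[of "z + p"])
    define g where "g z = k z * (\<epsilon> + (z - s) * h z)" for z
    obtain r where r: "r > 0" "ball s r \<subseteq> S" using S S0 open_contains_ball by blast
    have "g holomorphic_on ball s r" unfolding g_def h_def
      by (intro holomorphic_intros holomorphic_on_subset[OF holomorphic_shift[OF zeta0_holo]] holomorphic_on_subset[OF holomorphic_shift[OF zeta_holo]]
          holomorphic_on_subset[OF k(1)])
         (use r(2) in \<open>auto simp: S_def\<close>)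
    moreover have "g z = ?f z" if "z \<in> ball s r - {s}" for z
    proof -
      have "z \<in> S" "z \<noteq> s" using that r(2) by auto
      then have "?f z = ((z - s) * k z) * (\<epsilon> / (z - s) + h z)" using k(2)[of z] hN[of z] by simp
      also have "\<dots> = k z * (\<epsilon> + (z - s) * h z)" using \<open>z \<noteq> s\<close> by (simp add: distrib_left mult_ac)
      finally show ?thesis by (simp add: g_def)
    qed
    moreover have "s = p \<longrightarrow> g s = deriv ?wp p" using ks by (auto simp: g_def \<epsilon>_def)
    ultimately show ?thesis using r(1) by blast
  qed
  obtain c where c: "\<And>z. z \<notin> sing p \<Longrightarrow> ?f z = c"
    by (rule elliptic_const[OF fh per]) (use at0 atp in blast)+
  obtain r g where rg: "r > 0" "g holomorphic_on ball p r" "\<forall>z\<in>ball p r - {p}. g z = ?f z" "g p = deriv ?wp p"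
    using atp[of p] by auto
  obtain r' where r': "r' > 0" "\<And>z. z \<in> ball p r' - {p} \<Longrightarrow> z \<notin> sing p" using isolated_sing[of p p] by blast
  have "g p = c"
    by (rule holomorphic_ball_point_value[of g p "min r r'"])
       (use rg r' c in \<open>auto intro: holomorphic_on_subset[OF rg(2)]\<close>)
  then show ?thesis using c[OF z] rg(4) by simp
qed

lemma wp_not_const_near_0: "\<exists>r>0. \<forall>z\<in>ball 0 r - {0}. weierstrass_p \<tau> z \<noteq> c"
proof -
  have "isCont (\<lambda>z. 1 + z\<^sup>2 * (wp0 z - c)) 0"
    using wp0_deriv[of 0] by (intro continuous_intros DERIV_isCont) auto
  then have "((\<lambda>z. 1 + z\<^sup>2 * (wp0 z - c)) \<longlongrightarrow> 1) (at 0)" by (simp add: isCont_def)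
  then have "\<forall>\<^sub>F z in at 0. 1 + z\<^sup>2 * (wp0 z - c) \<noteq> 0" by (rule tendsto_imp_eventually_ne) simp
  then obtain d where d: "d > 0" "\<And>z. z \<noteq> 0 \<Longrightarrow> dist z 0 < d \<Longrightarrow> 1 + z\<^sup>2 * (wp0 z - c) \<noteq> 0"
    unfolding eventually_at by blast
  have "weierstrass_p \<tau> z \<noteq> c" if "z \<in> ball 0 d - {0}" for z
  proof
    assume "weierstrass_p \<tau> z = c"
    then have "1 + z\<^sup>2 * (wp0 z - c) = 0" using that by (simp add: weierstrass_p_eq divide_simps) (simp add: algebra_simps)
    then show False using d(2)[of z] that by auto
  qed
  then show ?thesis using d(1) by blast
qed

text \<open>If \<open>\<wp>'(p) = 0\<close>, the product of \<open>\<wp> - \<wp>(p)\<close> with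
  \<open>wpN p\<close> vanishes identically. Since \<open>wpN p\<close> has a pole at
  \<open>p\<close>, it has no zeros nearby; so \<wp> is constant near \<open>p\<close> and then
  everywhere off the lattice, against its pole at 0.\<close>

lemma wp'_nonzero:
  assumes p: "2 * p \<notin> \<Lambda>"
  shows "deriv (weierstrass_p \<tau>) p \<noteq> 0"
proof
  assume 0: "deriv (weierstrass_p \<tau>) p = 0"
  note pL = p_notin[OF p]
  obtain r1 where r1: "r1 > 0" "\<And>z. z \<in> ball p r1 - {p} \<Longrightarrow> z \<notin> sing p" using isolated_sing[of p p] by blast
  have "open ({z. z + (- p) \<notin> \<Lambda>0} \<inter> {z. z + p \<notin> \<Lambda>})" (is "open ?S") using open_shift_compl by blast
  have pS: "p \<in> ?S" using p unfolding mult_2 by simp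
  define h where "h z = 1 + (z - p) * (zeta0 (z + (- p)) - weierstrass_zeta \<tau> (z + p) + 2 * weierstrass_zeta \<tau> p)" for z
  have hh: "h holomorphic_on ?S" unfolding h_def
    by (intro holomorphic_intros holomorphic_on_subset[OF holomorphic_shift[OF zeta0_holo]] holomorphic_on_subset[OF holomorphic_shift[OF zeta_holo]]) auto
  have "isCont h p" using holomorphic_on_imp_continuous_on[OF hh] continuous_on_eq_continuous_at[OF \<open>open ?S\<close>] pS by blast
  then have "(h \<longlongrightarrow> 1) (at p)" by (simp add: isCont_def h_def)
  then have "\<forall>\<^sub>F z in at p. h z \<noteq> 0" by (rule tendsto_imp_eventually_ne) simp
  then obtain d where d: "d > 0" "\<And>z. z \<noteq> p \<Longrightarrow> dist z p < d \<Longrightarrow> h z \<noteq> 0"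
    unfolding eventually_at by blast
  define r where "r = min r1 d"
  have r: "r > 0" using r1 d by (simp add: r_def)
  have eq: "weierstrass_p \<tau> z = weierstrass_p \<tau> p" if z: "z \<in> ball p r - {p}" for z
  proof -
    have zs: "z \<notin> sing p" using r1(2)[of z] z by (auto simp: r_def)
    have "h z = (z - p) * wpN p z" using z by (simp add: h_def wpN_def weierstrass_zeta_eq[of "z - p"] field_simps)
    moreover have "h z \<noteq> 0" using d(2)[of z] z by (auto simp: r_def dist_commute)
    ultimately have "wpN p z \<noteq> 0" by auto
    then show ?thesis using wpN_mult_const[OF p zs] 0 by simp
  qed
  obtain r0 where r0: "r0 > 0" "\<And>z. z \<in> ball 0 r0 - {0} \<Longrightarrow> weierstrass_p \<tau> z \<noteq> weierstrass_p \<tau> p"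
    using wp_not_const_near_0 by blast
  have all: "weierstrass_p \<tau> z = weierstrass_p \<tau> p" if "z \<in> - \<Lambda>" for z
  proof (rule analytic_continuation_open[of "ball p r - {p}" "- \<Lambda>" "weierstrass_p \<tau>" "\<lambda>_. weierstrass_p \<tau> p"])
    have "p + of_real (r / 2) \<in> ball p r - {p}" using r by (simp add: dist_norm)
    then show "ball p r - {p} \<noteq> {}" by blast
    show "ball p r - {p} \<subseteq> - \<Lambda>"
    proof
      fix z assume "z \<in> ball p r - {p}"
      then have "z \<in> ball p r1 - {p}" by (auto simp: r_def)
      from sing_notin[OF r1(2)[OF this]] show "z \<in> - \<Lambda>" by blast
    qed
  qed (use that eq connected_compl_lattice open_compl_lattice wp_holo in auto)
  \<comment> \<open>A real point so close to 0 that it lies off the lattice and \<wp> avoids the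
    value \<open>\<wp>(p)\<close> there.\<close>
  define e where "e = min r0 lat_min / 2"
  have e: "e > 0" "e < r0" "e < lat_min" using r0 lat_min_pos by (auto simp: e_def)
  have "complex_of_real e \<notin> \<Lambda>" using lattice_norm_ge[of "of_real e"] e by auto
  then show False using all[of "of_real e"] r0(2)[of "of_real e"] e by auto
qed

text \<open>Off the orbits of 0, \<open>p\<close> and \<open>-p\<close> the difference
  \<open>\<wp>(z) - \<wp>(p)\<close> is a factor of the nonzero constant
  \<open>\<wp>'(p)\<close>.\<close>

lemma wp_inj:
  assumes p: "2 * p \<notin> \<Lambda>" and z: "z \<notin> \<Lambda>" and eq: "weierstrass_p \<tau> z = weierstrass_p \<tau> p"
  shows "z - p \<in> \<Lambda> \<or> z + p \<in> \<Lambda>"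
proof (rule ccontr)
  assume "\<not> ?thesis"
  then have "z \<notin> sing p" using z by (auto simp: sing_set_def)
  from wpN_mult_const[OF p this] eq wp'_nonzero[OF p] show False by simp
qed

section \<open>Values of \<wp> on the symmetry lines of the lattice\<close>

lemma wp_real:
  assumes "z \<notin> \<Lambda>" "Im z = 0 \<or> Re z = 0 \<or> Im z = Im \<tau> / 2 \<or> Re z = 1 / 2"
  shows "Im (weierstrass_p \<tau> z) = 0"
proof -
  have "weierstrass_p \<tau> (cnj z) = weierstrass_p \<tau> z"
  proof -
    \<comment> \<open>Each of the four lines is fixed pointwise by conjugation followed by a change
      of sign or not and a lattice translation.\<close>
    consider "Im z = 0" | "Re z = 0" | "Im z = Im \<tau> / 2" | "Re z = 1 / 2" using assms(2) by blast
    then show ?thesis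
    proof cases
      case 1 then have "cnj z = z" by (simp add: complex_eq_iff) then show ?thesis by simp
    next
      case 2 then have "cnj z = - z" by (simp add: complex_eq_iff) then show ?thesis by (simp add: wp_even)
    next
      case 3 then have "cnj z = z + (- \<tau>)" by (simp add: complex_eq_iff)
      then show ?thesis using wp_periodic[OF assms(1), of "- \<tau>"] by simp
    next
      case 4 then have "cnj z = - (z + (- 1))" by (simp add: complex_eq_iff)
      then show ?thesis using wp_periodic[OF assms(1), of "- 1"] by (simp only: wp_even) simp
    qed
  qed
  then have "cnj (weierstrass_p \<tau> z) = weierstrass_p \<tau> z" by (simp add: wp_cnj)
  then show ?thesis by (metis Reals_cnj_iff complex_is_Real_iff)
qed

text \<open>Near the pole \<open>\<wp>(s d) = \<epsilon> / s\<^sup>2 + O(1)\<close>, since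
  \<open>1 / d\<^sup>2 = 1 / \<epsilon> = \<epsilon>\<close>. The directions covered are the real
  axis with \<open>\<epsilon> = 1\<close> and the imaginary axis with
  \<open>\<epsilon> = -1\<close>.\<close>

lemma wp_large_near_0:
  assumes "d\<^sup>2 = of_real \<epsilon>" "\<epsilon>\<^sup>2 = 1" "x > 0"
  shows "\<exists>s\<in>{0<..x}. \<epsilon> * Re (weierstrass_p \<tau> (of_real s * d)) \<ge> c"
proof -
  have sq: "LIM s at_right (0::real). s\<^sup>2 :> at_right 0"
    unfolding filterlim_at
    by (auto intro!: tendsto_eq_intros eventually_at_right_less[THEN eventually_mono])
  have top: "LIM s at_right (0::real). inverse (s\<^sup>2) :> at_top"
    by (rule filterlim_compose[OF filterlim_inverse_at_top_right sq])
  have "((\<lambda>s. \<epsilon> * Re (wp0 (of_real s * d))) \<longlongrightarrow> \<epsilon> * Re (wp0 (of_real 0 * d))) (at_right 0)"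
  proof (intro tendsto_intros)
    have "isCont wp0 0" using wp0_deriv[of 0] by (intro DERIV_isCont) auto
    then show "((\<lambda>s. wp0 (of_real s * d)) \<longlongrightarrow> wp0 (of_real 0 * d)) (at_right 0)"
      by (intro isCont_tendsto_compose[of _ wp0] tendsto_intros) auto
  qed
  then have "LIM s at_right (0::real). \<epsilon> * Re (wp0 (of_real s * d)) + inverse (s\<^sup>2) :> at_top"
    by (rule filterlim_tendsto_add_at_top[OF _ top])
  then have "\<forall>\<^sub>F s in at_right 0. \<epsilon> * Re (wp0 (of_real s * d)) + inverse (s\<^sup>2) \<ge> c"
    by (simp add: filterlim_at_top)
  moreover have "\<forall>\<^sub>F s in at_right 0. s \<in> {0<..x}"
    using eventually_at_right_less[of "0::real"] eventually_at_right_real[OF assms(3)]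
    by eventually_elim auto
  ultimately have "\<forall>\<^sub>F s in at_right 0. s \<in> {0<..x} \<and> \<epsilon> * Re (weierstrass_p \<tau> (of_real s * d)) \<ge> c"
  proof eventually_elim
    case (elim s)
    have "1 / (of_real s * d)\<^sup>2 = of_real (\<epsilon> * inverse (s\<^sup>2))"
    proof -
      have "inverse \<epsilon> = \<epsilon>" using assms(2) by (intro inverse_unique) (simp add: power2_eq_square)
      moreover have "1 / (of_real s * d)\<^sup>2 = of_real (inverse \<epsilon> * inverse (s\<^sup>2))"
        unfolding power_mult_distrib assms(1) by (simp add: divide_inverse mult.commute)
      ultimately show ?thesis by simp
    qed
    then have "Re (weierstrass_p \<tau> (of_real s * d)) = \<epsilon> * inverse (s\<^sup>2) + Re (wp0 (of_real s * d))"
      by (simp only: weierstrass_p_eq plus_complex.sel Re_complex_of_real)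
    then have "\<epsilon> * Re (weierstrass_p \<tau> (of_real s * d)) = \<epsilon>\<^sup>2 * inverse (s\<^sup>2) + \<epsilon> * Re (wp0 (of_real s * d))"
      by (simp only: power2_eq_square distrib_left mult.assoc)
    then show ?case using elim assms(2) by simp
  qed
  from eventually_happens'[OF _ this] show ?thesis by force
qed

text \<open>Both comparisons of values of \<open>\<wp>\<close> follow from its injectivity modulo \<open>\<plusminus>\<close> and
  the intermediate value theorem, since \<open>\<wp>\<close> is unbounded on the segment ending at the pole.\<close>

lemma wp_gt_on_segment:
  assumes d: "d\<^sup>2 = of_real \<epsilon>" "\<epsilon>\<^sup>2 = 1" and x: "x > 0"
    and L: "\<And>s. 0 < s \<Longrightarrow> s \<le> x \<Longrightarrow> 2 * (of_real s * d) \<notin> \<Lambda>"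
    and re: "\<And>s. 0 < s \<Longrightarrow> s \<le> x \<Longrightarrow> Im (weierstrass_p \<tau> (of_real s * d)) = 0"
    and w: "w \<notin> \<Lambda>" "Im (weierstrass_p \<tau> w) = 0"
    and nw: "\<And>s. 0 < s \<Longrightarrow> s \<le> x \<Longrightarrow> w - of_real s * d \<notin> \<Lambda> \<and> w + of_real s * d \<notin> \<Lambda>"
  shows "\<epsilon> * Re (weierstrass_p \<tau> w) < \<epsilon> * Re (weierstrass_p \<tau> (of_real x * d))"
proof (rule ccontr)
  assume neg: "\<not> ?thesis"
  let ?F = "\<lambda>s. \<epsilon> * Re (weierstrass_p \<tau> (of_real s * d))"
  obtain s0 where s0: "0 < s0" "s0 \<le> x" "\<epsilon> * Re (weierstrass_p \<tau> w) \<le> ?F s0"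
    using wp_large_near_0[OF d x, of "\<epsilon> * Re (weierstrass_p \<tau> w)"] greaterThanAtMost_iff by blast
  have "\<exists>s. s0 \<le> s \<and> s \<le> x \<and> ?F s = \<epsilon> * Re (weierstrass_p \<tau> w)"
  proof (rule IVT2)
    show "\<forall>s. s0 \<le> s \<and> s \<le> x \<longrightarrow> isCont ?F s"
    proof (intro allI impI)
      fix s assume s: "s0 \<le> s \<and> s \<le> x"
      then have "of_real s * d \<notin> \<Lambda>" using p_notin L[of s] s0 by simp
      then have c: "isCont (weierstrass_p \<tau>) (of_real s * d)" by (rule DERIV_isCont[OF wp_deriv])
      have "isCont (\<lambda>s. of_real s * d) s" by (intro continuous_intros)
      from isCont_o2[OF this c] have "isCont (\<lambda>s. weierstrass_p \<tau> (of_real s * d)) s" .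
      then show "isCont ?F s" unfolding isCont_def by (intro tendsto_intros)
    qed
  qed (use s0 neg in auto)
  then obtain s where s: "s0 \<le> s" "s \<le> x" "?F s = \<epsilon> * Re (weierstrass_p \<tau> w)" by blast
  have "\<epsilon> \<noteq> 0" using d(2) by auto
  then have "weierstrass_p \<tau> w = weierstrass_p \<tau> (of_real s * d)"
    using s re[of s] s0 w(2) by (simp add: complex_eq_iff)
  from wp_inj[OF L w(1) this] s s0 nw[of s] show False by simp
qed

text \<open>Points of the segment from 0 to \<open>x\<close> have real part strictly between 0 and
  1/2, so none of them is congruent to \<open>w\<close> or \<open>- w\<close>.\<close>

lemma wp_compare_real:
  assumes "0 < x" "x < 1 / 2" "Re w = 1 / 2"
  shows "w \<notin> \<Lambda>" "Re (weierstrass_p \<tau> w) < Re (weierstrass_p \<tau> (of_real x))"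
proof -
  have nint: "r \<notin> \<int>" if "0 < r" "r < 1" for r :: real
    using that by (auto elim!: Ints_cases)
  have L: "z \<notin> \<Lambda>" if "0 < Re z" "Re z < 1" for z
    using nint[OF that] by (auto simp: lattice_iff)
  show w: "w \<notin> \<Lambda>" using L[of w] assms by simp
  have "1 * Re (weierstrass_p \<tau> w) < 1 * Re (weierstrass_p \<tau> (of_real x * 1))"
    by (rule wp_gt_on_segment) (use assms w L wp_real p_notin in auto)
  then show "Re (weierstrass_p \<tau> w) < Re (weierstrass_p \<tau> (of_real x))" by simp
qed

text \<open>On the imaginary axis \<open>\<epsilon> = -1\<close>: there \<wp> tends to minus
  infinity at the pole, which reverses the inequality.\<close>

lemma wp_compare_imag:
  assumes "0 < y" "y < Im \<tau> / 2" "Im w = Im \<tau> / 2"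
  shows "w \<notin> \<Lambda>" "Re (weierstrass_p \<tau> (\<i> * of_real y)) < Re (weierstrass_p \<tau> w)"
proof -
  have L: "z \<notin> \<Lambda>" if "0 < Im z" "Im z < Im \<tau>" for z
  proof
    assume "z \<in> \<Lambda>"
    then obtain b :: int where "Im z = of_int b * Im \<tau>" by (auto simp: lattice_iff)
    then have "0 < of_int b * Im \<tau>" "of_int b * Im \<tau> < 1 * Im \<tau>" using that by auto
    then have "0 < real_of_int b" "real_of_int b < 1" using Im_tau
      by (auto simp: zero_less_mult_iff)
    then show False by simp
  qed
  show w: "w \<notin> \<Lambda>" using L[of w] assms by simp
  have "(- 1) * Re (weierstrass_p \<tau> w) < (- 1) * Re (weierstrass_p \<tau> (of_real y * \<i>))"
    by (rule wp_gt_on_segment) (use assms w L wp_real p_notin in auto)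
  then show "Re (weierstrass_p \<tau> (\<i> * of_real y)) < Re (weierstrass_p \<tau> w)" by (simp add: mult.commute)
qed

end

section \<open>The Lame equation\<close>

lemma i_power_cases: "\<i> ^ n = 1 \<or> \<i> ^ n = -1 \<or> \<i> ^ n = \<i> \<or> \<i> ^ n = - \<i>"
  by (induction n) auto

text \<open>Lower case letters hold data at 1/2, upper case ones data at \<tau>/2, of the even and
  the odd solution, with factors \<i> removed; \<open>r\<close>, \<open>r'\<close> and
  \<open>s\<close>, \<open>s'\<close> belong to the solution that vanishes at the pole.
  \<open>c1\<close> and \<open>c2\<close> say that the two coordinates of this solution agree when
  computed at either point, and \<open>per\<close> is the periodicity of \<open>dz V\<close>. The
  two sets of relations force \<open>E * E'\<close> and \<open>H * H'\<close> to vanish, which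
  contradicts the Wronskians.\<close>

lemma frame_contradiction:
  fixes e e' h h' E E' H H' r r' s s' a b :: real
  assumes pos: "a > 0" "b > 0" "r * r' > 0" "s * s' > 0"
    and W: "e * h' + e' * h = 1" "E * H' - E' * H = 1"
    and per: "a * (e * e') = b * (h * h')" "a * (E * E') = - (b * (H * H'))"
    and c1: "complex_of_real r * h' - \<i> * r' * h = \<i> ^ n * (\<i> * s * H' - s' * H)"
    and c2: "complex_of_real e * r' - \<i> * e' * r = \<i> ^ n * (E * s' - \<i> * E' * s)"
  shows False
proof -
  have nz: "r \<noteq> 0" "r' \<noteq> 0" "s \<noteq> 0" "s' \<noteq> 0" using pos by auto
  \<comment> \<open>Real and imaginary parts of \<open>c1\<close> and \<open>c2\<close> are
    compared: \<open>\<i> ^ n\<close> equals \<epsilon> in the first alternative and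
    \<open>\<epsilon> * \<i>\<close> in the second.\<close>
  have "\<exists>\<epsilon>::real. \<epsilon>\<^sup>2 = 1 \<and> ((r * h' = - \<epsilon> * s' * H \<and> r' * h = - \<epsilon> * s * H' \<and> e * r' = \<epsilon> * E * s' \<and> e' * r = \<epsilon> * E' * s)
      \<or> (r * h' = - \<epsilon> * s * H' \<and> r' * h = \<epsilon> * s' * H \<and> e * r' = \<epsilon> * E' * s \<and> e' * r = - \<epsilon> * E * s'))"
  proof -
    consider "\<i> ^ n = 1" | "\<i> ^ n = -1" | "\<i> ^ n = \<i>" | "\<i> ^ n = - \<i>" using i_power_cases by blast
    then show ?thesis
    proof cases
      case 1
      note c = arg_cong[OF c1[unfolded 1], of Re] arg_cong[OF c1[unfolded 1], of Im]
        arg_cong[OF c2[unfolded 1], of Re] arg_cong[OF c2[unfolded 1], of Im]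
      show ?thesis by (rule exI[of _ "1"]) (use c in \<open>simp add: mult.commute\<close>)
    next
      case 2
      note c = arg_cong[OF c1[unfolded 2], of Re] arg_cong[OF c1[unfolded 2], of Im]
        arg_cong[OF c2[unfolded 2], of Re] arg_cong[OF c2[unfolded 2], of Im]
      show ?thesis by (rule exI[of _ "- 1"]) (use c in \<open>simp add: mult.commute\<close>)
    next
      case 3
      note c = arg_cong[OF c1[unfolded 3], of Re] arg_cong[OF c1[unfolded 3], of Im]
        arg_cong[OF c2[unfolded 3], of Re] arg_cong[OF c2[unfolded 3], of Im]
      show ?thesis by (rule exI[of _ "1"]) (use c in \<open>simp add: mult.commute\<close>)
    next
      case 4
      note c = arg_cong[OF c1[unfolded 4], of Re] arg_cong[OF c1[unfolded 4], of Im]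
        arg_cong[OF c2[unfolded 4], of Re] arg_cong[OF c2[unfolded 4], of Im]
      show ?thesis by (rule exI[of _ "- 1"]) (use c in \<open>simp add: mult.commute\<close>)
    qed
  qed
  then obtain \<epsilon> :: real where \<epsilon>: "\<epsilon>\<^sup>2 = 1" and
    alt: "(r * h' = - \<epsilon> * s' * H \<and> r' * h = - \<epsilon> * s * H' \<and> e * r' = \<epsilon> * E * s' \<and> e' * r = \<epsilon> * E' * s)
      \<or> (r * h' = - \<epsilon> * s * H' \<and> r' * h = \<epsilon> * s' * H \<and> e * r' = \<epsilon> * E' * s \<and> e' * r = - \<epsilon> * E * s')" by blast
  have \<epsilon>0: "\<epsilon> \<noteq> 0" using \<epsilon> by auto
  \<comment> \<open>In either alternative the pair of products at 1/2 is a nonzero multiple of the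
    pair at \<tau>/2. The opposite signs in \<open>per\<close> then leave only zero.\<close>
  have key: "E * E' = 0 \<and> H * H' = 0"
  proof -
    have 1: "\<exists>k. k \<noteq> 0 \<and> (r * r') * (e * e') = k * (E * E') \<and> (r * r') * (h * h') = k * (H * H')"
      using alt
    proof
      assume A: "r * h' = - \<epsilon> * s' * H \<and> r' * h = - \<epsilon> * s * H' \<and> e * r' = \<epsilon> * E * s' \<and> e' * r = \<epsilon> * E' * s"
      have "(r * r') * (e * e') = (e * r') * (e' * r)" "(r * r') * (h * h') = (r * h') * (r' * h)" by simp_all
      then have "(r * r') * (e * e') = \<epsilon>\<^sup>2 * (s * s') * (E * E')" "(r * r') * (h * h') = \<epsilon>\<^sup>2 * (s * s') * (H * H')"
        using A by (simp_all add: power2_eq_square)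
      then show ?thesis using \<epsilon> nz by (intro exI[of _ "s * s'"]) auto
    next
      assume A: "r * h' = - \<epsilon> * s * H' \<and> r' * h = \<epsilon> * s' * H \<and> e * r' = \<epsilon> * E' * s \<and> e' * r = - \<epsilon> * E * s'"
      have "(r * r') * (e * e') = (e * r') * (e' * r)" "(r * r') * (h * h') = (r * h') * (r' * h)" by simp_all
      then have "(r * r') * (e * e') = - (\<epsilon>\<^sup>2) * (s * s') * (E * E')" "(r * r') * (h * h') = - (\<epsilon>\<^sup>2) * (s * s') * (H * H')"
        using A by (simp_all add: power2_eq_square)
      then show ?thesis using \<epsilon> nz by (intro exI[of _ "- (s * s')"]) auto
    qed
    then obtain k where k: "k \<noteq> 0" "(r * r') * (e * e') = k * (E * E')" "(r * r') * (h * h') = k * (H * H')" by blast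
    have "k * (a * (E * E')) = (r * r') * (a * (e * e'))" using k(2) by (simp add: mult_ac)
    also have "\<dots> = (r * r') * (b * (h * h'))" using per(1) by simp
    also have "\<dots> = k * (b * (H * H'))" using k(3) by (simp add: mult_ac)
    finally have "a * (E * E') = b * (H * H')" using k(1) by simp
    then have "a * (E * E') = 0" "b * (H * H') = 0" using per(2) by linarith+
    then show ?thesis using pos by simp
  qed
  \<comment> \<open>\<open>E * H' - E' * H = 1\<close> excludes the last two cases; in the others
    the alternatives annihilate both terms of the first Wronskian relation.\<close>
  then consider "E' = 0" "H = 0" | "E = 0" "H' = 0" | "E = 0" "H = 0" | "E' = 0" "H' = 0" by auto
  then have "e * h' = 0 \<and> e' * h = 0"
    using alt W(2) nz \<epsilon>0 by cases auto
  then show False using W(1) by auto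
qed

lemma herm_V_deriv:
  assumes "herm_sol Q V S" "z \<in> S"
  shows "((\<lambda>w. complex_of_real (V w)) has_derivative (\<lambda>h. dz V z * h + cnj (dz V z) * cnj h)) (at z)"
proof -
  obtain r f g where r: "r > 0" and fg: "ode_sol Q (ball z r) f" "ode_sol Q (ball z r) g"
    and V: "\<And>w. w \<in> ball z r \<Longrightarrow> V w = (cmod (f w))\<^sup>2 + (cmod (g w))\<^sup>2"
    and P: "\<And>w. w \<in> ball z r \<Longrightarrow> dz V w = deriv f w * cnj (f w) + deriv g w * cnj (g w)"
    by (rule herm_solE[OF assms]) blast
  have z: "z \<in> ball z r" using r by simp
  show ?thesis unfolding P[OF z]
    by (rule has_derivative_sumsq[OF V open_ball z ode_solD(1)[OF fg(1) open_ball z] ode_solD(1)[OF fg(2) open_ball z]])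
qed

text \<open>The second derivatives of \<open>V\<close>: \<open>V_zz = Q V\<close> as for each
  solution, while the mixed derivative is \<open>N = |f'|\<^sup>2 + |g'|\<^sup>2\<close>, positive
  because the Wronskian is not zero. The sign of \<open>N\<close> is the source of the sign
  conditions on the Lame potential.\<close>

lemma herm_dz_deriv:
  assumes "herm_sol Q V S" "z \<in> S"
  obtains N :: real where "N > 0" "(dz V has_derivative (\<lambda>h. Q z * of_real (V z) * h + of_real N * cnj h)) (at z)"
proof -
  obtain r f g where r: "r > 0" and fg: "ode_sol Q (ball z r) f" "ode_sol Q (ball z r) g"
    and W: "\<And>w. w \<in> ball z r \<Longrightarrow> wronskian f g w = 1"
    and V: "\<And>w. w \<in> ball z r \<Longrightarrow> V w = (cmod (f w))\<^sup>2 + (cmod (g w))\<^sup>2"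
    and P: "\<And>w. w \<in> ball z r \<Longrightarrow> dz V w = deriv f w * cnj (f w) + deriv g w * cnj (g w)"
    by (rule herm_solE[OF assms]) blast
  have z: "z \<in> ball z r" using r by simp
  define N where "N = (cmod (deriv f z))\<^sup>2 + (cmod (deriv g z))\<^sup>2"
  have N: "N > 0"
  proof -
    have "deriv f z \<noteq> 0 \<or> deriv g z \<noteq> 0" using W[OF z] by (auto simp: wronskian_def)
    then show ?thesis by (auto simp: N_def add_pos_nonneg add_nonneg_pos)
  qed
  have d: "(f has_derivative (*) (deriv f z)) (at z)" "(g has_derivative (*) (deriv g z)) (at z)"
    "(deriv f has_derivative (*) (Q z * f z)) (at z)" "(deriv g has_derivative (*) (Q z * g z)) (at z)"
    using ode_solD[OF fg(1) open_ball z] ode_solD[OF fg(2) open_ball z] by (simp_all add: has_field_derivative_def)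
  have Nc: "of_real N = deriv f z * cnj (deriv f z) + deriv g z * cnj (deriv g z)"
    by (simp add: N_def mult_cnj_eq_norm_sq)
  have Vc: "of_real (V z) = f z * cnj (f z) + g z * cnj (g z)"
    by (simp add: V[OF z] mult_cnj_eq_norm_sq)
  have "((\<lambda>w. deriv f w * cnj (f w) + deriv g w * cnj (g w)) has_derivative
      (\<lambda>h. Q z * of_real (V z) * h + of_real N * cnj h)) (at z)"
    unfolding Nc Vc
    by (rule derivative_eq_intros has_derivative_cnj d refl)+ (auto simp: fun_eq_iff algebra_simps)
  then have "(dz V has_derivative (\<lambda>h. Q z * of_real (V z) * h + of_real N * cnj h)) (at z)"
    by (rule has_derivative_transform_within_open[OF _ open_ball z]) (simp add: P)
  then show ?thesis using that N by blast
qed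

lemma herm_line_deriv:
  assumes V: "herm_sol Q V S" and z: "a + of_real s * d \<in> S"
  defines "z \<equiv> a + of_real s * d"
  obtains N :: real where "N > 0"
    "((\<lambda>s. dz V (a + of_real s * d)) has_vector_derivative (Q z * of_real (V z) * d + of_real N * cnj d)) (at s)"
proof -
  obtain N :: real where N: "N > 0" "(dz V has_derivative (\<lambda>h. Q z * of_real (V z) * h + of_real N * cnj h)) (at z)"
    using herm_dz_deriv[OF V z] unfolding z_def by blast
  have l: "((\<lambda>s. a + of_real s * d) has_derivative (\<lambda>x. x *\<^sub>R d)) (at s)"
    by (auto intro!: derivative_eq_intros simp: scaleR_conv_of_real)
  have "(dz V \<circ> (\<lambda>s. a + of_real s * d) has_derivative
      (\<lambda>h. Q z * of_real (V z) * h + of_real N * cnj h) \<circ> (\<lambda>x. x *\<^sub>R d)) (at s)"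
    by (rule diff_chain_at[OF l]) (use N(2) in \<open>simp add: z_def\<close>)
  then have "((\<lambda>s. dz V (a + of_real s * d)) has_vector_derivative (Q z * of_real (V z) * d + of_real N * cnj d)) (at s)"
    unfolding has_vector_derivative_def o_def
    by (simp add: scaleR_conv_of_real algebra_simps)
  then show ?thesis using that N(1) by blast
qed

lemma ode_sol_uminus:
  assumes y: "ode_sol Q S y" and S: "open S" and Q: "\<And>z. z \<in> T \<Longrightarrow> Q (c - z) = Q z"
    and T: "open T" "\<And>z. z \<in> T \<Longrightarrow> c - z \<in> S"
  shows "ode_sol Q T (\<lambda>z. y (c - z))" "z \<in> T \<Longrightarrow> deriv (\<lambda>z. y (c - z)) z = - deriv y (c - z)"
proof -
  have m: "((\<lambda>z. c - z) has_field_derivative -1) (at z)" for z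
    by (auto intro!: derivative_eq_intros)
  have 1: "((\<lambda>z. y (c - z)) has_field_derivative - deriv y (c - z)) (at z)" if "z \<in> T" for z
    using DERIV_chain2[OF ode_solD(1)[OF y S T(2)[OF that]] m] by simp
  have "((\<lambda>z. deriv y (c - z)) has_field_derivative Q (c - z) * y (c - z) * (- 1)) (at z)" if "z \<in> T" for z
    by (rule DERIV_chain2[OF ode_solD(2)[OF y S T(2)[OF that]] m])
  note m2 = this
  have 2: "((\<lambda>z. - deriv y (c - z)) has_field_derivative Q z * y (c - z)) (at z)" if "z \<in> T" for z
    using DERIV_minus[OF m2[OF that]] unfolding Q[OF that] by simp
  show "ode_sol Q T (\<lambda>z. y (c - z))" "z \<in> T \<Longrightarrow> deriv (\<lambda>z. y (c - z)) z = - deriv y (c - z)"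
    using ode_solI[OF T(1) 1 2] by blast+
qed

lemma has_field_derivative_cnj_shift:
  assumes "(f has_field_derivative f') (at (cnj z + c))"
  shows "((\<lambda>z. cnj (f (cnj z + c))) has_field_derivative cnj f') (at z)"
proof -
  have "((\<lambda>w. f (w + c)) has_field_derivative f') (at (cnj z))" by (rule iffD1[OF DERIV_shift assms])
  from has_field_derivative_cnj_cnj[of "\<lambda>w. f (w + c)" "f'" z] this
  show ?thesis by (simp add: o_def)
qed

lemma ode_sol_cnj:
  assumes y: "ode_sol Q S y" and S: "open S" and Q: "\<And>z. z \<in> T \<Longrightarrow> cnj (Q (cnj z + c)) = Q z"
    and T: "open T" "\<And>z. z \<in> T \<Longrightarrow> cnj z + c \<in> S"
  shows "ode_sol Q T (\<lambda>z. cnj (y (cnj z + c)))"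
    "z \<in> T \<Longrightarrow> deriv (\<lambda>z. cnj (y (cnj z + c))) z = cnj (deriv y (cnj z + c))"
proof -
  have 1: "((\<lambda>z. cnj (y (cnj z + c))) has_field_derivative cnj (deriv y (cnj z + c))) (at z)" if "z \<in> T" for z
    by (rule has_field_derivative_cnj_shift[OF ode_solD(1)[OF y S T(2)[OF that]]])
  have 2: "((\<lambda>z. cnj (deriv y (cnj z + c))) has_field_derivative Q z * cnj (y (cnj z + c))) (at z)" if "z \<in> T" for z
    using has_field_derivative_cnj_shift[OF ode_solD(2)[OF y S T(2)[OF that]]] Q[OF that] by simp
  show "ode_sol Q T (\<lambda>z. cnj (y (cnj z + c)))"
    "z \<in> T \<Longrightarrow> deriv (\<lambda>z. cnj (y (cnj z + c))) z = cnj (deriv y (cnj z + c))"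
    using ode_solI[OF T(1) 1 2] by blast+
qed

text \<open>The derivative of \<open>Re (d y' cnj y)\<close> along the ray is
  \<open>\<epsilon> Re Q |y|\<^sup>2 + |y'|\<^sup>2\<close>, which is positive inside the segment.
  Starting from the limit 0 the function ends up positive, so neither \<open>y\<close> nor
  \<open>y'\<close> vanishes at the end point.\<close>

lemma nonoscillating_ray:
  assumes y: "ode_sol Q S y" "open S" and d: "d\<^sup>2 = of_real \<epsilon>" "norm d = 1"
    and S: "\<And>s. 0 < s \<Longrightarrow> s \<le> x \<Longrightarrow> of_real s * d \<in> S" and x: "x > 0"
    and Q: "\<And>s. 0 < s \<Longrightarrow> s < x \<Longrightarrow> \<epsilon> * Re (Q (of_real s * d)) > 0"
    and nz: "\<And>z. z \<in> S \<Longrightarrow> y z \<noteq> 0 \<or> deriv y z \<noteq> 0"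
    and lim: "((\<lambda>s. deriv y (of_real s * d) * cnj (y (of_real s * d))) \<longlongrightarrow> 0) (at_right 0)"
  shows "Re (d * deriv y (of_real x * d) * cnj (y (of_real x * d))) > 0"
proof -
  define G where "G s = Re (d * (deriv y (of_real s * d) * cnj (y (of_real s * d))))" for s
  have dG: "\<exists>D. (G has_real_derivative D) (at s) \<and> (s < x \<longrightarrow> D > 0)" if s: "0 < s" "s \<le> x" for s
  proof -
    let ?z = "of_real s * d"
    have l: "((\<lambda>s. of_real s * d) has_vector_derivative d) (at s)"
      by (auto intro!: derivative_eq_intros)
    have v1: "((\<lambda>s. y (of_real s * d)) has_vector_derivative d * deriv y ?z) (at s)"
      using field_vector_diff_chain_at[OF l ode_solD(1)[OF y S[OF s]]] by (simp add: o_def)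
    have v2: "((\<lambda>s. deriv y (of_real s * d)) has_vector_derivative d * (Q ?z * y ?z)) (at s)"
      using field_vector_diff_chain_at[OF l ode_solD(2)[OF y S[OF s]]] by (simp add: o_def)
    have v3: "((\<lambda>s. cnj (y (of_real s * d))) has_vector_derivative cnj (d * deriv y ?z)) (at s)"
      by (rule bounded_linear.has_vector_derivative[OF bounded_linear_cnj v1])
    have v4: "((\<lambda>s. d * (deriv y (of_real s * d) * cnj (y (of_real s * d)))) has_vector_derivative
        d * (deriv y ?z * cnj (d * deriv y ?z) + d * (Q ?z * y ?z) * cnj (y ?z))) (at s)"
      by (intro has_vector_derivative_mult_right has_vector_derivative_mult v2 v3)
    have e: "d * (deriv y ?z * cnj (d * deriv y ?z) + d * (Q ?z * y ?z) * cnj (y ?z))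
      = of_real \<epsilon> * Q ?z * of_real ((cmod (y ?z))\<^sup>2) + of_real ((cmod (deriv y ?z))\<^sup>2)"
    proof -
      have "d * cnj d = 1" using mult_cnj_eq_norm_sq[of d] d(2) by simp
      moreover have "d * (deriv y ?z * cnj (d * deriv y ?z) + d * (Q ?z * y ?z) * cnj (y ?z))
        = d\<^sup>2 * Q ?z * (y ?z * cnj (y ?z)) + (d * cnj d) * (deriv y ?z * cnj (deriv y ?z))"
        by (simp add: power2_eq_square algebra_simps)
      ultimately show ?thesis by (simp add: d(1) mult_cnj_eq_norm_sq)
    qed
    let ?D = "\<epsilon> * Re (Q ?z) * (cmod (y ?z))\<^sup>2 + (cmod (deriv y ?z))\<^sup>2"
    have Re_eq: "Re (of_real \<epsilon> * Q ?z * of_real ((cmod (y ?z))\<^sup>2) + of_real ((cmod (deriv y ?z))\<^sup>2)) = ?D" by simp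
    have "(G has_vector_derivative ?D) (at s)"
      unfolding G_def Re_eq[symmetric] by (rule bounded_linear.has_vector_derivative[OF bounded_linear_Re v4[unfolded e]])
    then have "(G has_real_derivative ?D) (at s)"
      by (simp add: has_real_derivative_iff_has_vector_derivative)
    moreover have "?D > 0" if "s < x"
    proof (cases "y ?z = 0")
      case True then show ?thesis using nz[OF S[OF s]] by simp
    next
      case False
      then have "\<epsilon> * Re (Q ?z) * (cmod (y ?z))\<^sup>2 > 0" using Q[of s] that s by simp
      then show ?thesis by (simp add: add_pos_nonneg)
    qed
    ultimately show ?thesis by blast
  qed
  have inc: "G s1 < G s2" if "0 < s1" "s1 < s2" "s2 \<le> x" for s1 s2
  proof (rule DERIV_pos_imp_increasing_open[OF that(2)])
    show "\<exists>D. (G has_real_derivative D) (at s) \<and> D > 0" if "s1 < s" "s < s2" for s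
      using dG[of s] that \<open>0 < s1\<close> \<open>s2 \<le> x\<close> by force
    show "continuous_on {s1..s2} G"
    proof (rule continuous_at_imp_continuous_on, intro ballI)
      fix s assume "s \<in> {s1..s2}"
      then have "0 < s" "s \<le> x" using that by auto
      then show "isCont G s" using dG DERIV_isCont by blast
    qed
  qed
  have "(G \<longlongrightarrow> Re (d * 0)) (at_right 0)"
    unfolding G_def by (intro tendsto_intros lim)
  then have "(G \<longlongrightarrow> 0) (at_right 0)" by simp
  moreover have "\<forall>\<^sub>F s in at_right 0. G s \<le> G (x / 2)"
    using eventually_at_right_real[of 0 "x / 2"] x by (auto elim!: eventually_mono intro!: less_imp_le inc)
  \<comment> \<open>The limit yields only a weak inequality, hence the detour over
    \<open>x / 2\<close>.\<close>
  ultimately have "0 \<le> G (x / 2)" by (rule tendsto_upperbound) simp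
  also have "\<dots> < G x" using inc[of "x / 2" x] x by simp
  finally show ?thesis by (simp add: G_def mult.assoc)
qed

section \<open>The Lame potential on the lines through the half periods\<close>

context rect_lattice begin

definition lame :: "nat \<Rightarrow> complex \<Rightarrow> complex \<Rightarrow> complex" where
  "lame n \<beta> z = of_nat n * (of_nat n + 1) * weierstrass_p \<tau> z + \<beta>"

lemma lame_holo: "lame n \<beta> holomorphic_on - \<Lambda>"
  unfolding lame_def[abs_def] by (intro holomorphic_intros wp_holo)

lemma lame_symmetries:
  assumes "z \<notin> \<Lambda>"
  shows "\<omega> \<in> \<Lambda> \<Longrightarrow> lame n \<beta> (z + \<omega>) = lame n \<beta> z" "\<omega> \<in> \<Lambda> \<Longrightarrow> lame n \<beta> (\<omega> - z) = lame n \<beta> z"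
    "Im \<beta> = 0 \<Longrightarrow> \<omega> \<in> \<Lambda> \<Longrightarrow> cnj (lame n \<beta> (cnj z + \<omega>)) = lame n \<beta> z"
proof -
  have 1: "lame n \<beta> (z + \<omega>) = lame n \<beta> z" if "z \<notin> \<Lambda>" "\<omega> \<in> \<Lambda>" for z \<omega>
    using that by (simp add: lame_def wp_periodic)
  show "\<omega> \<in> \<Lambda> \<Longrightarrow> lame n \<beta> (z + \<omega>) = lame n \<beta> z" using 1 assms .
  show "\<omega> \<in> \<Lambda> \<Longrightarrow> lame n \<beta> (\<omega> - z) = lame n \<beta> z"
    using 1[of "- z" \<omega>] assms by (simp add: lame_def wp_even)
  show "Im \<beta> = 0 \<Longrightarrow> \<omega> \<in> \<Lambda> \<Longrightarrow> cnj (lame n \<beta> (cnj z + \<omega>)) = lame n \<beta> z"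
  proof -
    assume "Im \<beta> = 0" "\<omega> \<in> \<Lambda>"
    then have "cnj \<beta> = \<beta>" by (simp add: complex_eq_iff)
    have "cnj (lame n \<beta> (cnj z + \<omega>)) = cnj (lame n \<beta> (cnj z))"
      using 1[of "cnj z" \<omega>] assms \<open>\<omega> \<in> \<Lambda>\<close> by simp
    also have "\<dots> = lame n \<beta> z" by (simp add: lame_def wp_cnj \<open>cnj \<beta> = \<beta>\<close>)
    finally show ?thesis .
  qed
qed

lemma Re_lame: "Re (lame n \<beta> z) = real n * (real n + 1) * Re (weierstrass_p \<tau> z) + Re \<beta>"
  and Im_lame: "Im (lame n \<beta> z) = real n * (real n + 1) * Im (weierstrass_p \<tau> z) + Im \<beta>"
proof -
  have "of_nat n * (of_nat n + 1) = complex_of_real (real n * (real n + 1))" by simp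
  then show "Re (lame n \<beta> z) = real n * (real n + 1) * Re (weierstrass_p \<tau> z) + Re \<beta>"
    "Im (lame n \<beta> z) = real n * (real n + 1) * Im (weierstrass_p \<tau> z) + Im \<beta>"
    unfolding lame_def by (simp_all only: plus_complex.sel Re_complex_of_real Im_complex_of_real times_complex.sel)
qed

lemma strip_notin: "0 < Re z \<Longrightarrow> Re z < 1 \<Longrightarrow> z \<notin> \<Lambda>" "0 < Im z \<Longrightarrow> Im z < Im \<tau> \<Longrightarrow> z \<notin> \<Lambda>"
proof -
  assume *: "0 < Re z" "Re z < 1"
  show "z \<notin> \<Lambda>"
  proof
    assume "z \<in> \<Lambda>"
    then obtain a :: int where "Re z = of_int a" by (auto simp: lattice_iff)
    then show False using * by simp
  qed
next
  assume *: "0 < Im z" "Im z < Im \<tau>"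
  show "z \<notin> \<Lambda>"
  proof
    assume "z \<in> \<Lambda>"
    then obtain b :: int where "Im z = of_int b * Im \<tau>" by (auto simp: lattice_iff)
    then have "0 < of_int b * Im \<tau>" "of_int b * Im \<tau> < 1 * Im \<tau>" using * by auto
    then have "0 < real_of_int b" "real_of_int b < 1" using Im_tau
      by (auto simp: zero_less_mult_iff)
    then show False by simp
  qed
qed

lemma dz_periodic:
  assumes V: "herm_sol Q V (- \<Lambda>)" and per: "\<And>z. z \<notin> \<Lambda> \<Longrightarrow> V (z + \<omega>) = V z" and \<omega>: "\<omega> \<in> \<Lambda>" and z: "z \<notin> \<Lambda>"
  shows "dz V (z + \<omega>) = dz V z"
proof -
  have z': "z + \<omega> \<in> - \<Lambda>" using z \<omega> lattice_add_cancel by simp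
  have l: "((\<lambda>z. z + \<omega>) has_derivative (\<lambda>h. h)) (at z)" by (auto intro!: derivative_eq_intros)
  have "((\<lambda>w. complex_of_real (V w)) \<circ> (\<lambda>z. z + \<omega>) has_derivative
      (\<lambda>h. dz V (z + \<omega>) * h + cnj (dz V (z + \<omega>)) * cnj h) \<circ> (\<lambda>h. h)) (at z)"
    by (rule diff_chain_at[OF l herm_V_deriv[OF V z']])
  then have "((\<lambda>w. complex_of_real (V w)) has_derivative
      (\<lambda>h. dz V (z + \<omega>) * h + cnj (dz V (z + \<omega>)) * cnj h)) (at z)"
    unfolding o_def
    by (rule has_derivative_transform_within_open[OF _ open_compl_lattice]) (use z per in auto)
  from wirtinger_eqI(3)[OF this] show ?thesis by simp
qed

text \<open>Along a line through a half period \<open>dz V\<close> returns to its value after one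
  period, so none of its components can be strictly monotone. On the horizontal line the derivative
  is \<open>Q V + N\<close> and \<wp> is real: the imaginary part is \<open>Im \<beta> V\<close>,
  and the real part is positive unless \<open>Re Q < 0\<close> somewhere. On the vertical line the
  derivative is \<open>\<i> (Q V - N)\<close>, which forces \<open>Re Q > 0\<close>
  somewhere.\<close>

lemma lame_accessory:
  assumes V: "herm_sol (lame n \<beta>) V (- \<Lambda>)" and per: "\<And>z \<omega>. z \<notin> \<Lambda> \<Longrightarrow> \<omega> \<in> \<Lambda> \<Longrightarrow> V (z + \<omega>) = V z"
  shows "Im \<beta> = 0" "\<exists>w. Im w = Im \<tau> / 2 \<and> Re (lame n \<beta> w) < 0" "\<exists>w. Re w = 1 / 2 \<and> Re (lame n \<beta> w) > 0"
proof -
  let ?Q = "lame n \<beta>"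
  have dzp: "dz V (z + \<omega>) = dz V z" if "z \<notin> \<Lambda>" "\<omega> \<in> \<Lambda>" for z \<omega>
    by (rule dz_periodic[OF V per]) (use that in auto)
  have h: "\<tau> / 2 + of_real s * 1 \<notin> \<Lambda>" for s :: real using Im_tau by (intro strip_notin(2)) auto
  have v: "1 / 2 + of_real s * \<i> \<notin> \<Lambda>" for s :: real by (intro strip_notin(1)) auto
  define H where "H s = dz V (\<tau> / 2 + of_real s * 1)" for s
  define U where "U s = dz V (1 / 2 + of_real s * \<i>)" for s
  have H1: "H 1 = H 0" using dzp[OF h[of 0] lattice_1] by (simp add: H_def)
  have tau_i: "of_real (Im \<tau>) * \<i> = \<tau>" by (simp add: complex_eq_iff)
  have U1: "U (Im \<tau>) = U 0" using dzp[OF v[of 0] lattice_tau] by (simp add: U_def tau_i)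
  have Hd: "\<exists>N>0. (H has_vector_derivative ?Q (\<tau> / 2 + of_real s * 1) * of_real (V (\<tau> / 2 + of_real s * 1)) * 1 + of_real N * cnj 1) (at s)" for s
    unfolding H_def by (rule herm_line_deriv[OF V, of "\<tau> / 2" s 1]) (use h[of s] in auto)
  have Ud: "\<exists>N>0. (U has_vector_derivative ?Q (1 / 2 + of_real s * \<i>) * of_real (V (1 / 2 + of_real s * \<i>)) * \<i> + of_real N * cnj \<i>) (at s)" for s
    unfolding U_def by (rule herm_line_deriv[OF V, of "1 / 2" s \<i>]) (use v[of s] in auto)
  have Vp: "V z > 0" if "z \<notin> \<Lambda>" for z using herm_sol_pos[OF V] that by simp
  show "Im \<beta> = 0"
  proof -
    have "((\<lambda>s. Im (H s)) has_real_derivative Im \<beta> * V (\<tau> / 2 + of_real s * 1)) (at s)" for s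
    proof -
      obtain N where N: "(H has_vector_derivative ?Q (\<tau> / 2 + of_real s * 1) * of_real (V (\<tau> / 2 + of_real s * 1)) * 1 + of_real N * cnj 1) (at s)"
        using Hd[of s] by blast
      have "Im (weierstrass_p \<tau> (\<tau> / 2 + of_real s * 1)) = 0" using h[of s] by (intro wp_real) auto
      then show ?thesis
        using bounded_linear.has_vector_derivative[OF bounded_linear_Im N]
        by (simp add: has_real_derivative_iff_has_vector_derivative Im_lame)
    qed
    from MVT2[of 0 1 "\<lambda>s. Im (H s)", OF _ this] obtain s where
      "Im (H 1) - Im (H 0) = (1 - 0) * (Im \<beta> * V (\<tau> / 2 + of_real s * 1))" by auto
    then show ?thesis using H1 Vp[OF h[of s]] by auto
  qed
  show "\<exists>w. Im w = Im \<tau> / 2 \<and> Re (?Q w) < 0"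
  proof (rule ccontr)
    assume "\<not> ?thesis"
    then have Q: "Re (?Q (\<tau> / 2 + of_real s * 1)) \<ge> 0" for s by (auto simp: not_less)
    have "Re (H 0) < Re (H 1)"
    proof (rule DERIV_pos_imp_increasing[where f = "\<lambda>s. Re (H s)"])
      fix s :: real
      obtain N where N: "N > 0" "(H has_vector_derivative ?Q (\<tau> / 2 + of_real s * 1) * of_real (V (\<tau> / 2 + of_real s * 1)) * 1 + of_real N * cnj 1) (at s)"
        using Hd[of s] by blast
      have "((\<lambda>s. Re (H s)) has_real_derivative Re (?Q (\<tau> / 2 + of_real s * 1)) * V (\<tau> / 2 + of_real s * 1) + N) (at s)"
        using bounded_linear.has_vector_derivative[OF bounded_linear_Re N(2)]
        by (simp add: has_real_derivative_iff_has_vector_derivative)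
      moreover have "Re (?Q (\<tau> / 2 + of_real s * 1)) * V (\<tau> / 2 + of_real s * 1) + N > 0"
        using Q[of s] Vp[OF h[of s]] N(1) by (intro add_nonneg_pos mult_nonneg_nonneg) auto
      ultimately show "\<exists>y. ((\<lambda>s. Re (H s)) has_real_derivative y) (at s) \<and> 0 < y" by blast
    qed auto
    then show False using H1 by simp
  qed
  show "\<exists>w. Re w = 1 / 2 \<and> Re (?Q w) > 0"
  proof (rule ccontr)
    assume "\<not> ?thesis"
    then have Q: "Re (?Q (1 / 2 + of_real s * \<i>)) \<le> 0" for s by (auto simp: not_less)
    have "Im (U 0) > Im (U (Im \<tau>))"
    proof (rule DERIV_neg_imp_decreasing[where f = "\<lambda>s. Im (U s)"])
      fix s :: real
      obtain N where N: "N > 0" "(U has_vector_derivative ?Q (1 / 2 + of_real s * \<i>) * of_real (V (1 / 2 + of_real s * \<i>)) * \<i> + of_real N * cnj \<i>) (at s)"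
        using Ud[of s] by blast
      have "((\<lambda>s. Im (U s)) has_real_derivative Re (?Q (1 / 2 + of_real s * \<i>)) * V (1 / 2 + of_real s * \<i>) - N) (at s)"
        using bounded_linear.has_vector_derivative[OF bounded_linear_Im N(2)]
        by (simp add: has_real_derivative_iff_has_vector_derivative)
      moreover have "Re (?Q (1 / 2 + of_real s * \<i>)) * V (1 / 2 + of_real s * \<i>) - N < 0"
        using Q[of s] Vp[OF v[of s]] N(1) mult_nonpos_nonneg[of "Re (?Q (1 / 2 + of_real s * \<i>))" "V (1 / 2 + of_real s * \<i>)"] by linarith
      ultimately show "\<exists>y. ((\<lambda>s. Im (U s)) has_real_derivative y) (at s) \<and> y < 0" by blast
    qed (use Im_tau in auto)
    then show False using U1 by simp
  qed
qed

text \<open>One point on each line is enough: on \<open>(0, 1/2)\<close> the function \<wp> exceeds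
  all its values on \<open>Re z = 1/2\<close>, and on \<open>(0, \<tau>/2)\<close> it lies below all
  its values on \<open>Im z = Im \<tau> / 2\<close>.\<close>

lemma lame_signs:
  assumes "\<exists>w. Im w = Im \<tau> / 2 \<and> Re (lame n \<beta> w) < 0" "\<exists>w. Re w = 1 / 2 \<and> Re (lame n \<beta> w) > 0"
  shows "0 < s \<Longrightarrow> s < 1 / 2 \<Longrightarrow> Re (lame n \<beta> (of_real s)) > 0"
    "0 < s \<Longrightarrow> s < Im \<tau> / 2 \<Longrightarrow> Re (lame n \<beta> (\<i> * of_real s)) < 0"
proof -
  have n: "real n * (real n + 1) \<ge> 0" by simp
  show "Re (lame n \<beta> (of_real s)) > 0" if "0 < s" "s < 1 / 2"
  proof -
    obtain w where w: "Re w = 1 / 2" "Re (lame n \<beta> w) > 0" using assms by blast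
    have "real n * (real n + 1) * Re (weierstrass_p \<tau> w) \<le> real n * (real n + 1) * Re (weierstrass_p \<tau> (of_real s))"
      using wp_compare_real(2)[OF that w(1)] n by (intro mult_left_mono) auto
    then show ?thesis using w(2) by (simp add: Re_lame)
  qed
  show "Re (lame n \<beta> (\<i> * of_real s)) < 0" if "0 < s" "s < Im \<tau> / 2"
  proof -
    obtain w where w: "Im w = Im \<tau> / 2" "Re (lame n \<beta> w) < 0" using assms by blast
    have "real n * (real n + 1) * Re (weierstrass_p \<tau> (\<i> * of_real s)) \<le> real n * (real n + 1) * Re (weierstrass_p \<tau> w)"
      using wp_compare_imag(2)[OF that w(1)] n by (intro mult_left_mono) auto
    then show ?thesis using w(2) by (simp add: Re_lame)
  qed
qed

section \<open>Solutions on the circumscribed disc and near the pole\<close>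

abbreviation ctr :: complex where "ctr \<equiv> (1 + \<tau>) / 2"

text \<open>The disc circumscribed about the fundamental rectangle contains no lattice point.\<close>

definition circ :: "complex set" where "circ = ball ctr (norm ctr)"

lemma circ_iff: "z \<in> circ \<longleftrightarrow> (Re z)\<^sup>2 + (Im z)\<^sup>2 < Re z + Im z * Im \<tau>"
proof -
  have "z \<in> circ \<longleftrightarrow> norm (ctr - z) < norm ctr" by (simp add: circ_def dist_norm)
  also have "\<dots> \<longleftrightarrow> (norm (ctr - z))\<^sup>2 < (norm ctr)\<^sup>2"
    using abs_le_square_iff[of "norm ctr" "norm (ctr - z)"] by (simp add: not_le[symmetric] del: norm_divide)
  also have "\<dots> \<longleftrightarrow> (Re z)\<^sup>2 + (Im z)\<^sup>2 < Re z + Im z * Im \<tau>"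
    unfolding cmod_power2 by (simp add: power2_eq_square algebra_simps)
  finally show ?thesis .
qed

text \<open>The inequality that describes the disc fails at lattice points because
  \<open>k \<le> k\<^sup>2\<close> for every integer \<open>k\<close>.\<close>

lemma circ_lattice: "circ \<subseteq> - \<Lambda>"
proof
  fix z assume z: "z \<in> circ"
  show "z \<in> - \<Lambda>"
  proof
    assume "z \<in> \<Lambda>"
    then obtain a b :: int where ab: "Re z = of_int a" "Im z = of_int b * Im \<tau>" by (auto simp: lattice_iff)
    have sq: "real_of_int k \<le> (real_of_int k)\<^sup>2" for k
    proof (cases "k \<ge> 1")
      case True then show ?thesis by (intro self_le_power) auto
    next
      case False then have "real_of_int k \<le> 0" by simp then show ?thesis by (meson order_trans zero_le_power2)
    qed
    have "of_int b * Im \<tau> * Im \<tau> \<le> (of_int b)\<^sup>2 * Im \<tau> * Im \<tau>"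
      using sq[of b] Im_tau by (intro mult_right_mono) auto
    moreover have "(Im z)\<^sup>2 = (of_int b)\<^sup>2 * Im \<tau> * Im \<tau>" using ab by (simp add: power2_eq_square mult_ac)
    ultimately show False using z sq[of a] unfolding circ_iff ab by linarith
  qed
qed

text \<open>The point reflection in the centre and the reflection in the horizontal midline of the
  rectangle.\<close>

lemma circ_symm:
  "z \<in> circ \<Longrightarrow> (1 + \<tau>) - z \<in> circ" "z \<in> circ \<Longrightarrow> cnj z + \<tau> \<in> circ"
  unfolding circ_iff by (simp_all add: power2_eq_square algebra_simps)

lemma circ_real: "0 < s \<Longrightarrow> s \<le> 1 / 2 \<Longrightarrow> of_real s \<in> circ"
  and circ_imag: "0 < s \<Longrightarrow> s \<le> Im \<tau> / 2 \<Longrightarrow> \<i> * of_real s \<in> circ"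
proof -
  show "of_real s \<in> circ" if "0 < s" "s \<le> 1 / 2"
    using that mult_strict_left_mono[of s 1 s] by (simp add: circ_iff power2_eq_square)
  show "\<i> * of_real s \<in> circ" if "0 < s" "s \<le> Im \<tau> / 2"
    using that mult_strict_left_mono[of s "Im \<tau>" s] by (simp add: circ_iff power2_eq_square)
qed

lemma open_circ: "open circ" and connected_circ: "connected circ" and convex_circ: "convex circ"
  by (auto simp: circ_def)

text \<open>The initial values at the centre are preserved, up to sign, by both symmetries of the
  disc and of the potential; uniqueness for the initial value problem passes this on to the
  solutions. The symmetry with conjugation uses that \<beta> is real.\<close>

lemma circ_frame:
  assumes \<beta>: "Im \<beta> = 0"
  obtains e h where "ode_sol (lame n \<beta>) circ e" "ode_sol (lame n \<beta>) circ h"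
    "\<And>z. z \<in> circ \<Longrightarrow> wronskian e h z = 1" "e ctr = 1" "deriv e ctr = 0" "h ctr = 0" "deriv h ctr = 1"
    "\<And>z. z \<in> circ \<Longrightarrow> e (1 + \<tau> - z) = e z" "\<And>z. z \<in> circ \<Longrightarrow> deriv e (1 + \<tau> - z) = - deriv e z"
    "\<And>z. z \<in> circ \<Longrightarrow> h (1 + \<tau> - z) = - h z" "\<And>z. z \<in> circ \<Longrightarrow> deriv h (1 + \<tau> - z) = deriv h z"
    "\<And>z. z \<in> circ \<Longrightarrow> cnj (e (cnj z + \<tau>)) = e z" "\<And>z. z \<in> circ \<Longrightarrow> cnj (deriv e (cnj z + \<tau>)) = deriv e z"
    "\<And>z. z \<in> circ \<Longrightarrow> cnj (h (cnj z + \<tau>)) = h z" "\<And>z. z \<in> circ \<Longrightarrow> cnj (deriv h (cnj z + \<tau>)) = deriv h z"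
proof -
  let ?Q = "lame n \<beta>"
  have cpos: "norm ctr > 0" by (auto simp: complex_eq_iff)
  have c: "ctr \<in> circ" using cpos by (simp add: circ_def)
  have cnjc: "cnj ctr + \<tau> = ctr" "1 + \<tau> - ctr = ctr" by (simp_all add: complex_eq_iff)
  obtain e h where eh: "ode_sol ?Q circ e" "ode_sol ?Q circ h"
    and init: "e ctr = 1" "deriv e ctr = 0" "h ctr = 0" "deriv h ctr = 1"
    and W: "\<And>z. z \<in> circ \<Longrightarrow> wronskian e h z = 1"
    using ode_exists[OF holomorphic_on_subset[OF lame_holo circ_lattice, unfolded circ_def] cpos] unfolding circ_def by metis
  have uniq: "y z = y ctr * e z + deriv y ctr * h z \<and> deriv y z = y ctr * deriv e z + deriv y ctr * deriv h z"
    if y: "ode_sol ?Q circ y" and z: "z \<in> circ" for y z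
  proof -
    obtain a b where ab: "\<And>z. z \<in> circ \<Longrightarrow> y z = a * e z + b * h z"
      "\<And>z. z \<in> circ \<Longrightarrow> deriv y z = a * deriv e z + b * deriv h z"
      using ode_decomp[OF eh y open_circ open_circ subset_refl connected_circ W] by metis
    have "y ctr = a" "deriv y ctr = b" using ab[OF c] init by auto
    then show ?thesis using ab[OF z] by simp
  qed
  have Qs: "?Q (1 + \<tau> - z) = ?Q z" "cnj (?Q (cnj z + \<tau>)) = ?Q z" if "z \<in> circ" for z
    using that circ_lattice lame_symmetries[of z] lattice_add[OF lattice_1 lattice_tau] \<beta> by auto
  have u: "ode_sol ?Q circ (\<lambda>z. y (1 + \<tau> - z))" if "ode_sol ?Q circ y" for y
    by (rule ode_sol_uminus(1)[OF that open_circ _ open_circ]) (use Qs(1) circ_symm(1) in auto)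
  have u': "deriv (\<lambda>z. y (1 + \<tau> - z)) z = - deriv y (1 + \<tau> - z)" if "ode_sol ?Q circ y" "z \<in> circ" for y z
    by (rule ode_sol_uminus(2)[OF that(1) open_circ _ open_circ _ that(2)]) (use Qs(1) circ_symm(1) in auto)
  have k: "ode_sol ?Q circ (\<lambda>z. cnj (y (cnj z + \<tau>)))" if "ode_sol ?Q circ y" for y
    by (rule ode_sol_cnj(1)[OF that open_circ _ open_circ]) (use Qs(2) circ_symm(2) in auto)
  have k': "deriv (\<lambda>z. cnj (y (cnj z + \<tau>))) z = cnj (deriv y (cnj z + \<tau>))" if "ode_sol ?Q circ y" "z \<in> circ" for y z
    by (rule ode_sol_cnj(2)[OF that(1) open_circ _ open_circ _ that(2)]) (use Qs(2) circ_symm(2) in auto)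
  show ?thesis
  proof (rule that[OF eh W init])
    fix z assume z: "z \<in> circ"
    have "e (1 + \<tau> - z) = e z" "- deriv e (1 + \<tau> - z) = deriv e z"
      using uniq[OF u[OF eh(1)] z] u'[OF eh(1) z] u'[OF eh(1) c] by (simp_all add: cnjc init)
    then show "e (1 + \<tau> - z) = e z" "deriv e (1 + \<tau> - z) = - deriv e z"
      by (simp_all add: minus_equation_iff)
    show "h (1 + \<tau> - z) = - h z" "deriv h (1 + \<tau> - z) = deriv h z"
      using uniq[OF u[OF eh(2)] z] u'[OF eh(2) z] u'[OF eh(2) c] by (simp_all add: cnjc init)
    show "cnj (e (cnj z + \<tau>)) = e z" "cnj (deriv e (cnj z + \<tau>)) = deriv e z"
      using uniq[OF k[OF eh(1)] z] unfolding k'[OF eh(1) z] k'[OF eh(1) c] cnjc init by simp_all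
    show "cnj (h (cnj z + \<tau>)) = h z" "cnj (deriv h (cnj z + \<tau>)) = deriv h z"
      using uniq[OF k[OF eh(2)] z] unfolding k'[OF eh(2) z] k'[OF eh(2) c] cnjc init by simp_all
  qed
qed

text \<open>The exponents at 0 are \<open>-n\<close> and \<open>n + 1\<close>, and
  \<open>f = z ^ (n + 1) * p\<close> belongs to the larger one. Summation over
  \<open>z \<mapsto> - z\<close>, weighted by the expected parity, and over conjugation enforces
  both symmetries; the leading coefficient becomes 4, so the result is not zero.\<close>

lemma recessive_solution:
  assumes \<beta>: "Im \<beta> = 0"
  obtains y where "ode_sol (lame n \<beta>) (ball 0 lat_min - {0}) y" "y holomorphic_on ball 0 lat_min" "y 0 = 0"
    "\<And>z. z \<in> ball 0 lat_min \<Longrightarrow> y (cnj z) = cnj (y z)"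
    "\<And>z. z \<in> ball 0 lat_min \<Longrightarrow> y (- z) = (- 1) ^ Suc n * y z"
    "\<And>U. open U \<Longrightarrow> U \<noteq> {} \<Longrightarrow> U \<subseteq> ball 0 lat_min \<Longrightarrow> \<exists>z\<in>U. y z \<noteq> 0"
proof -
  let ?B = "ball (0::complex) lat_min" and ?Q = "lame n \<beta>"
  have r: "lat_min > 0" by (rule lat_min_pos)
  have B0: "?B \<subseteq> - \<Lambda>0" and B1: "?B - {0} \<subseteq> - \<Lambda>"
  proof -
    have "z \<notin> \<Lambda>" if "z \<in> ?B" "z \<noteq> 0" for z using lattice_norm_ge[of z] that by auto
    then show "?B \<subseteq> - \<Lambda>0" "?B - {0} \<subseteq> - \<Lambda>" by auto
  qed
  \<comment> \<open>Away from 0 this is \<open>z * (Q z - n (n + 1) / z\<^sup>2)\<close>: the double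
    pole is absorbed by the exponent \<open>n + 1\<close>.\<close>
  define R where "R z = z * (of_nat n * (of_nat n + 1) * wp0 z + \<beta>)" for z
  have R: "R holomorphic_on ?B" unfolding R_def
    by (intro holomorphic_intros holomorphic_on_subset[OF wp0_holo B0])
  obtain p where p: "p holomorphic_on ?B" "p 0 = 1"
    "\<And>z. z \<in> ?B \<Longrightarrow> (z - 0) * deriv (deriv p) z + of_nat (2 * n + 2) * deriv p z = R z * p z"
    using frobenius[OF R r, of "2 * n + 2"] by auto
  define f where "f z = z ^ Suc n * p z" for z
  have fh: "f holomorphic_on ?B" unfolding f_def by (intro holomorphic_intros p(1))
  have f_sol: "ode_sol ?Q (?B - {0}) f"
  proof (rule ode_solI(1))
    show "open (?B - {0})" by (simp add: open_delete)
    fix z assume z: "z \<in> ?B - {0}"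
    have zB: "z \<in> ?B" and z0: "z \<noteq> 0" using z by auto
    have d1: "(p has_field_derivative deriv p z) (at z)" by (rule holomorphic_derivI[OF p(1) open_ball zB])
    have d2: "(deriv p has_field_derivative deriv (deriv p) z) (at z)"
      by (rule holomorphic_derivI[OF holomorphic_deriv[OF p(1) open_ball] open_ball zB])
    show "(f has_field_derivative of_nat (Suc n) * z ^ n * p z + z ^ Suc n * deriv p z) (at z)"
      unfolding f_def by (auto intro!: derivative_eq_intros d1 simp del: of_nat_Suc power_Suc)
    define D where "D = of_nat (Suc n) * (of_nat n * z ^ (n - 1)) * p z + 2 * (of_nat (Suc n) * z ^ n * deriv p z) + z ^ Suc n * deriv (deriv p) z"
    have "((\<lambda>z. of_nat (Suc n) * z ^ n * p z + z ^ Suc n * deriv p z) has_field_derivative D) (at z)"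
      unfolding D_def by (auto intro!: derivative_eq_intros d1 d2 simp del: of_nat_Suc power_Suc)
    moreover have "D = ?Q z * f z"
    proof -
      have "z\<^sup>2 * D = z ^ Suc n * (of_nat (Suc n) * of_nat n * p z + z * (of_nat (2 * n + 2) * deriv p z + z * deriv (deriv p) z))"
        unfolding D_def by (cases n) (simp_all add: power2_eq_square algebra_simps)
      also have "of_nat (2 * n + 2) * deriv p z + z * deriv (deriv p) z = R z * p z"
        using p(3)[OF zB] by (simp add: add.commute)
      also have "z ^ Suc n * (of_nat (Suc n) * of_nat n * p z + z * (R z * p z)) = z\<^sup>2 * (?Q z * f z)"
        using z0 by (simp add: R_def f_def lame_def weierstrass_p_eq power2_eq_square field_simps)
      finally show ?thesis using z0 by simp
    qed
    ultimately show "((\<lambda>z. of_nat (Suc n) * z ^ n * p z + z ^ Suc n * deriv p z) has_field_derivative ?Q z * f z) (at z)"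
      by simp
  qed
  define \<epsilon> :: complex where "\<epsilon> = (- 1) ^ Suc n"
  have \<epsilon>: "\<epsilon> * \<epsilon> = 1" "cnj \<epsilon> = \<epsilon>" by (simp_all add: \<epsilon>_def flip: power_mult_distrib)
  define g where "g z = 1 * f z + \<epsilon> * f (0 - z)" for z
  define y where "y z = 1 * g z + 1 * cnj (g (cnj z + 0))" for z
  have op: "open (?B - {0})" by (simp add: open_delete)
  have Qs: "?Q (0 - z) = ?Q z" "cnj (?Q (cnj z + 0)) = ?Q z" if "z \<in> ?B - {0}" for z
    using that B1 lame_symmetries(2)[OF _ lattice_0, of z] lame_symmetries(3)[OF _ \<beta> lattice_0, of z] by auto
  have g_sol: "ode_sol ?Q (?B - {0}) g" unfolding g_def[abs_def]
    by (rule ode_sol_lincomb(1)[OF f_sol ode_sol_uminus(1)[OF f_sol op Qs(1) op] op]) auto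
  have y_sol: "ode_sol ?Q (?B - {0}) y" unfolding y_def[abs_def]
    by (rule ode_sol_lincomb(1)[OF g_sol ode_sol_cnj(1)[OF g_sol op Qs(2) op] op]) auto
  have gh: "g holomorphic_on ?B" unfolding g_def
    by (intro holomorphic_intros fh holomorphic_on_compose_gen[of "\<lambda>z. 0 - z" _ f ?B, unfolded o_def]) auto
  have yh: "y holomorphic_on ?B"
  proof -
    have "(cnj \<circ> g \<circ> cnj) holomorphic_on ?B"
    proof (rule holomorphic_on_compose_cnj_cnj)
      have "cnj ` ?B \<subseteq> ?B" by auto
      then show "g holomorphic_on cnj ` ?B" by (rule holomorphic_on_subset[OF gh])
    qed simp
    then show ?thesis unfolding y_def using gh by (auto intro!: holomorphic_intros simp: o_def)
  qed
  have fp: "f z + \<epsilon> * f (- z) = z ^ Suc n * (p z + p (- z))" for z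
  proof -
    have "(- z) ^ Suc n = \<epsilon> * z ^ Suc n" unfolding \<epsilon>_def by (rule power_minus)
    then have "\<epsilon> * f (- z) = (\<epsilon> * \<epsilon>) * (z ^ Suc n * p (- z))" unfolding f_def by (simp only: mult_ac)
    then show ?thesis unfolding \<epsilon>(1) f_def by (simp only: distrib_left mult_1)
  qed
  have yp: "y z = z ^ Suc n * (p z + p (- z) + cnj (p (cnj z)) + cnj (p (- cnj z)))" for z
    using fp[of z] fp[of "cnj z"] unfolding y_def g_def by (simp add: algebra_simps)
  show ?thesis
  proof (rule that[OF y_sol yh])
    show "y 0 = 0" by (simp add: yp)
    show "y (cnj z) = cnj (y z)" for z by (simp add: yp add_ac)
    show "y (- z) = (- 1) ^ Suc n * y z" for z
      unfolding yp power_minus[of z] by (simp add: algebra_simps)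
    show "\<exists>z\<in>U. y z \<noteq> 0" if U: "open U" "U \<noteq> {}" "U \<subseteq> ?B" for U
    proof (rule ccontr)
      assume "\<not> ?thesis"
      then have z0: "y z = 0" if "z \<in> U" for z using that by blast
      have all: "y z = 0" if "z \<in> ?B" for z
        by (rule analytic_continuation_open[of U ?B y "\<lambda>_. 0"]) (use U yh that z0 in auto)
      have pc: "isCont p 0"
        using holomorphic_on_imp_continuous_on[OF p(1)] r continuous_on_eq_continuous_at[OF open_ball, of 0 lat_min p] by auto
      \<comment> \<open>Along the positive axis the cofactor of \<open>z ^ (n + 1)\<close> in
        \<open>y\<close> tends to \<open>4 * p 0 = 4\<close>.\<close>
      have l1: "((\<lambda>s::real. p (of_real s) + p (- of_real s) + cnj (p (cnj (of_real s))) + cnj (p (- cnj (of_real s))))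
          \<longlongrightarrow> p 0 + p 0 + cnj (p 0) + cnj (p 0)) (at_right 0)"
        by (intro tendsto_intros isCont_tendsto_compose[OF pc] tendsto_eq_intros) auto
      have l2: "\<forall>\<^sub>F s::real in at_right 0. p (of_real s) + p (- of_real s) + cnj (p (cnj (of_real s))) + cnj (p (- cnj (of_real s))) = 0"
        using eventually_at_right_real[OF r]
      proof eventually_elim
        case (elim s)
        then show ?case using all[of "of_real s"] by (simp add: yp)
      qed
      have "p 0 + p 0 + cnj (p 0) + cnj (p 0) = 0"
        by (rule tendsto_unique[OF trivial_limit_at_right_real l1 tendsto_eventually[OF l2]])
      then show False using p(2) by simp
    qed
  qed
qed

end

lemma holomorphic_on_isCont: "f holomorphic_on S \<Longrightarrow> open S \<Longrightarrow> z \<in> S \<Longrightarrow> isCont f z"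
  using continuous_on_eq_continuous_at holomorphic_on_imp_continuous_on by blast

lemma ode_sol_nonzero:
  assumes "ode_sol Q S h" "open S" "w \<in> S" "wronskian e h w \<noteq> 0"
  shows "\<exists>z\<in>S. h z \<noteq> 0"
proof (rule ccontr)
  assume "\<not> ?thesis"
  then have 0: "h z = 0" if "z \<in> S" for z using that by blast
  have "(h has_field_derivative 0) (at w)"
    by (rule has_field_derivative_transform_within_open[OF DERIV_const assms(2,3), of 0]) (simp add: 0)
  then have "deriv h w = 0" by (rule DERIV_imp_deriv)
  then show False using assms(4) 0[OF assms(3)] by (simp add: wronskian_def)
qed

text \<open>\<open>\<i> ^ k\<close> spans the line of fixed points of
  \<open>z \<mapsto> (- 1) ^ k * cnj z\<close>.\<close>

lemma reflected_real:
  assumes "z = (- 1) ^ k * cnj z"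
  shows "\<exists>s::real. z = \<i> ^ k * of_real s"
proof -
  have "cnj (\<i> ^ k) = (- 1) ^ k * \<i> ^ k" by (simp flip: power_mult_distrib)
  then have "cnj (z / \<i> ^ k) = cnj z / ((- 1) ^ k * \<i> ^ k)" by (simp only: complex_cnj_divide)
  also have "\<dots> = (- 1) ^ k * cnj z / \<i> ^ k" by (simp add: divide_simps flip: power_mult_distrib)
  also have "\<dots> = z / \<i> ^ k" using assms by simp
  finally have "z / \<i> ^ k = of_real (Re (z / \<i> ^ k))" by (metis Reals_cnj_iff of_real_Re)
  then have "z = \<i> ^ k * of_real (Re (z / \<i> ^ k))" by (metis complex_i_not_zero nonzero_mult_div_cancel_left power_not_zero times_divide_eq_right)
  then show ?thesis by blast
qed

section \<open>Reflections, periodicity and the contradiction\<close>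

context rect_lattice begin

text \<open>The companion of \<open>h\<close> has the form \<open>\<omega> e + \<gamma> h\<close>,
  since its Wronskian with \<open>h\<close> is \<omega>. Hence
  \<open>\<omega> V = |\<omega> e + \<gamma> h|\<^sup>2 + |h|\<^sup>2\<close>, and two constants
  describe \<open>V\<close> on the disc.\<close>

lemma circ_dz:
  assumes V: "herm_sol Q V circ" and e: "ode_sol Q circ e" and h: "ode_sol Q circ h"
    and W: "\<And>z. z \<in> circ \<Longrightarrow> wronskian e h z = 1"
  obtains \<omega> :: real and \<gamma> where "\<omega> > 0" "\<And>z. z \<in> circ \<Longrightarrow> of_real \<omega> * dz V z =
     (of_real \<omega> * deriv e z + \<gamma> * deriv h z) * cnj (of_real \<omega> * e z + \<gamma> * h z) + deriv h z * cnj (h z)"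
proof -
  have c: "ctr \<in> circ" by (auto simp: circ_def complex_eq_iff)
  obtain z0 where z0: "z0 \<in> circ" "h z0 \<noteq> 0"
    using ode_sol_nonzero[OF h open_circ c, of e] W[OF c] by auto
  define \<eta> where "\<eta> z = cnj (of_real (V z) * deriv h z - dz V z * h z)" for z
  obtain \<omega> :: real where w: "\<omega> > 0" "ode_sol Q circ \<eta>" "\<And>z. z \<in> circ \<Longrightarrow> wronskian \<eta> h z = of_real \<omega>"
    "\<And>z. z \<in> circ \<Longrightarrow> \<omega> * V z = (cmod (\<eta> z))\<^sup>2 + (cmod (h z))\<^sup>2"
    using frame[OF V open_circ connected_circ h z0] unfolding \<eta>_def by blast
  obtain a \<gamma> where ab: "\<And>z. z \<in> circ \<Longrightarrow> \<eta> z = a * e z + \<gamma> * h z"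
    "\<And>z. z \<in> circ \<Longrightarrow> deriv \<eta> z = a * deriv e z + \<gamma> * deriv h z" "\<And>z. z \<in> circ \<Longrightarrow> wronskian \<eta> h z = a"
    by (rule ode_decomp[OF e h w(2) open_circ open_circ subset_refl connected_circ], erule W) (rule that)
  have a: "a = of_real \<omega>" using ab(3)[OF c] w(3)[OF c] by simp
  define k where "k = complex_of_real (1 / sqrt \<omega>)"
  have kk: "(cmod k)\<^sup>2 = 1 / \<omega>" "of_real \<omega> * (k * cnj k) = 1"
    using w(1) by (simp_all add: k_def norm_divide power_divide flip: of_real_mult)
  \<comment> \<open>The vanishing terms \<open>0 * h z\<close> make the rescaling by
    \<open>1 / sqrt \<omega>\<close> an instance of \<open>ode_sol_lincomb\<close>.\<close>
  have s1: "ode_sol Q circ (\<lambda>z. k * \<eta> z + 0 * h z)" "ode_sol Q circ (\<lambda>z. k * h z + 0 * h z)"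
    by (rule ode_sol_lincomb(1)[OF w(2) h open_circ] ode_sol_lincomb(1)[OF h h open_circ])+
  have "dz V z = deriv (\<lambda>z. k * \<eta> z + 0 * h z) z * cnj (k * \<eta> z + 0 * h z) + deriv (\<lambda>z. k * h z + 0 * h z) z * cnj (k * h z + 0 * h z)"
    if z: "z \<in> circ" for z
  proof (rule dz_sumsq[OF _ open_circ z s1])
    fix w assume "w \<in> circ"
    then have "V w = ((cmod (\<eta> w))\<^sup>2 + (cmod (h w))\<^sup>2) / \<omega>" using w(1,4) by (simp add: field_simps)
    then show "V w = (cmod (k * \<eta> w + 0 * h w))\<^sup>2 + (cmod (k * h w + 0 * h w))\<^sup>2"
      using kk(1) by (simp add: norm_mult power_mult_distrib add_divide_distrib)
  qed
  then have dzV: "of_real \<omega> * dz V z = deriv \<eta> z * cnj (\<eta> z) + deriv h z * cnj (h z)" if z: "z \<in> circ" for z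
  proof -
    have "dz V z = (k * deriv \<eta> z) * cnj (k * \<eta> z) + (k * deriv h z) * cnj (k * h z)"
      using \<open>\<And>z. z \<in> circ \<Longrightarrow> dz V z = _ z\<close>[OF z]
      unfolding ode_sol_lincomb(2)[OF w(2) h open_circ z] ode_sol_lincomb(2)[OF h h open_circ z] by simp
    then have "of_real \<omega> * dz V z = (of_real \<omega> * (k * cnj k)) * (deriv \<eta> z * cnj (\<eta> z) + deriv h z * cnj (h z))"
      by (simp add: algebra_simps)
    then show ?thesis using kk(2) by simp
  qed
  show ?thesis
    by (rule that[OF w(1), of \<gamma>]) (use dzV ab(1,2) a in simp)
qed

text \<open>Schwarz reflection in the real axis (\<open>\<sigma> = 1\<close>) or the imaginary axis
  (\<open>\<sigma> = -1\<close>). Neither is an axis of symmetry of the disc \<open>circ\<close>;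
  hence the set \<open>U\<close> of those points of the disc whose mirror image stays in it.
  \<open>U\<close> is convex, and \<open>w\<close> shows that it meets the neighbourhood of 0 where
  the symmetry is known.\<close>

lemma circ_reflect:
  assumes Y: "Y holomorphic_on circ" and y: "\<And>z. z \<in> ball 0 lat_min \<inter> circ \<Longrightarrow> Y z = y z"
    and \<sigma>: "\<sigma> = 1 \<or> \<sigma> = - 1"
    and refl: "\<And>z. z \<in> ball 0 lat_min \<Longrightarrow> y (of_real \<sigma> * cnj z) = \<kappa> * cnj (y z)" and \<kappa>: "\<kappa> * cnj \<kappa> = 1"
    and w: "w \<in> ball 0 lat_min" "w \<in> circ" "of_real \<sigma> * cnj w = w"
    and z: "z \<in> circ" "of_real \<sigma> * cnj z = z"
  shows "Y z = \<kappa> * cnj (Y z)" "deriv Y z = of_real \<sigma> * \<kappa> * cnj (deriv Y z)"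
proof -
  let ?s = "complex_of_real \<sigma>"
  define U where "U = circ \<inter> ball (?s * cnj ctr) (norm ctr)"
  have ss: "?s * ?s = 1" "norm ?s = 1" "cnj ?s = ?s" using \<sigma> by auto
  have U_iff: "x \<in> U \<longleftrightarrow> x \<in> circ \<and> ?s * cnj x \<in> circ" for x
  proof -
    have "?s * cnj ctr - x = ?s * cnj (ctr - ?s * cnj x)"
      using ss by (simp add: right_diff_distrib mult.assoc[symmetric])
    then have "norm (?s * cnj ctr - x) = norm (ctr - ?s * cnj x)" using ss by (simp only: norm_mult complex_mod_cnj)
    then show ?thesis by (simp add: U_def circ_def dist_norm)
  qed
  have U: "open U" "connected U" by (auto simp: U_def open_circ convex_circ intro!: convex_connected convex_Int)
  have zU: "z \<in> U" using z by (simp add: U_iff)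
  define F where "F x = \<kappa> * cnj (Y (?s * cnj x))" for x
  have Fd: "(F has_field_derivative \<kappa> * (cnj (deriv Y (?s * cnj x)) * ?s)) (at x)" if "x \<in> U" for x
  proof -
    have sx: "cnj (?s * x) + 0 \<in> circ" using that ss by (simp add: U_iff)
    have "((\<lambda>w. cnj (Y (cnj w + 0))) has_field_derivative cnj (deriv Y (cnj (?s * x) + 0))) (at (?s * x))"
      by (rule has_field_derivative_cnj_shift[OF holomorphic_derivI[OF Y open_circ sx]])
    moreover have "((\<lambda>x. ?s * x) has_field_derivative ?s) (at x)" by (auto intro!: derivative_eq_intros)
    ultimately have "((\<lambda>x. cnj (Y (cnj (?s * x) + 0))) has_field_derivative cnj (deriv Y (cnj (?s * x) + 0)) * ?s) (at x)"
      by (rule DERIV_chain2)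
    from DERIV_cmult[OF this, of \<kappa>] show ?thesis unfolding F_def using ss by simp
  qed
  have Fh: "F holomorphic_on U" unfolding holomorphic_on_open[OF U(1)] using Fd by blast
  have eq: "F x = Y x" if x: "x \<in> U" for x
  proof (rule analytic_continuation_open[of "U \<inter> ball 0 lat_min" U F Y])
    have "w \<in> U \<inter> ball 0 lat_min" using w U_iff by simp
    then show "U \<inter> ball 0 lat_min \<noteq> {}" by blast
    show "F v = Y v" if "v \<in> U \<inter> ball 0 lat_min" for v
    proof -
      have v: "v \<in> circ" "?s * cnj v \<in> circ" "v \<in> ball 0 lat_min" using that U_iff by auto
      have v2: "?s * cnj v \<in> ball 0 lat_min" using v(3) ss by (simp add: norm_mult)
      have "F v = \<kappa> * cnj (\<kappa> * cnj (y v))" unfolding F_def using y[of "?s * cnj v"] refl[OF v(3)] v v2 by simp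
      also have "\<dots> = (\<kappa> * cnj \<kappa>) * y v" by simp
      finally show ?thesis using \<kappa> y[of v] v by simp
    qed
    show "Y holomorphic_on U" by (rule holomorphic_on_subset[OF Y]) (simp add: U_def)
  qed (use U Fh x in auto)
  show "Y z = \<kappa> * cnj (Y z)" using eq[OF zU] z(2) by (simp add: F_def)
  have "(Y has_field_derivative \<kappa> * (cnj (deriv Y (?s * cnj z)) * ?s)) (at z)"
    by (rule has_field_derivative_transform_within_open[OF Fd[OF zU] U(1) zU eq])
  from DERIV_imp_deriv[OF this] show "deriv Y z = ?s * \<kappa> * cnj (deriv Y z)"
    unfolding z(2) by (simp add: mult_ac)
qed

theorem lame_no_herm_sol:
  assumes V: "herm_sol (lame n \<beta>) V (- \<Lambda>)" and per: "\<And>z \<omega>. z \<notin> \<Lambda> \<Longrightarrow> \<omega> \<in> \<Lambda> \<Longrightarrow> V (z + \<omega>) = V z"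
  shows False
proof -
  let ?Q = "lame n \<beta>" and ?B = "ball (0::complex) lat_min"
  define t where "t = Im \<tau>"
  have t: "t > 0" using Im_tau by (simp add: t_def)
  have tau: "\<tau> = of_real t * \<i>" by (simp add: complex_eq_iff t_def)
  have acc: "Im \<beta> = 0" "\<exists>w. Im w = Im \<tau> / 2 \<and> Re (?Q w) < 0" "\<exists>w. Re w = 1 / 2 \<and> Re (?Q w) > 0"
    by (rule lame_accessory[OF V]; erule (1) per)+
  note sgn = lame_signs[OF acc(2,3)]
  obtain e h where e: "ode_sol ?Q circ e" and h: "ode_sol ?Q circ h"
    and W: "\<And>z. z \<in> circ \<Longrightarrow> wronskian e h z = 1"
    and "e ctr = 1" "deriv e ctr = 0" "h ctr = 0" "deriv h ctr = 1"
    and es: "\<And>z. z \<in> circ \<Longrightarrow> e (1 + \<tau> - z) = e z" "\<And>z. z \<in> circ \<Longrightarrow> deriv e (1 + \<tau> - z) = - deriv e z"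
    and hs: "\<And>z. z \<in> circ \<Longrightarrow> h (1 + \<tau> - z) = - h z" "\<And>z. z \<in> circ \<Longrightarrow> deriv h (1 + \<tau> - z) = deriv h z"
    and ec: "\<And>z. z \<in> circ \<Longrightarrow> cnj (e (cnj z + \<tau>)) = e z" "\<And>z. z \<in> circ \<Longrightarrow> cnj (deriv e (cnj z + \<tau>)) = deriv e z"
    and hc: "\<And>z. z \<in> circ \<Longrightarrow> cnj (h (cnj z + \<tau>)) = h z" "\<And>z. z \<in> circ \<Longrightarrow> cnj (deriv h (cnj z + \<tau>)) = deriv h z"
    by (rule circ_frame[OF acc(1), of n]) (rule that)
  obtain y where y: "ode_sol ?Q (?B - {0}) y" "y holomorphic_on ?B" "y 0 = 0"
    "\<And>z. z \<in> ?B \<Longrightarrow> y (cnj z) = cnj (y z)" "\<And>z. z \<in> ?B \<Longrightarrow> y (- z) = (- 1) ^ Suc n * y z"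
    "\<And>U. open U \<Longrightarrow> U \<noteq> {} \<Longrightarrow> U \<subseteq> ?B \<Longrightarrow> \<exists>z\<in>U. y z \<noteq> 0"
    by (rule recessive_solution[OF acc(1), of n]) (rule that)
  \<comment> \<open>The lens in which the disc around 0 and the circumscribed disc overlap. There
    \<open>y\<close> is a combination of the frame, and the same combination \<open>Y\<close>
    continues it to all of \<open>circ\<close>.\<close>
  define T where "T = ?B \<inter> circ"
  have T: "open T" "connected T" "T \<subseteq> circ" "T \<subseteq> ?B - {0}"
    by (auto simp: T_def open_circ convex_circ circ_iff intro!: convex_connected convex_Int)
  define s0 where "s0 = min lat_min (min 1 t) / 2"
  have s0: "0 < s0" "s0 < lat_min" "s0 \<le> 1 / 2" "s0 \<le> t / 2" using lat_min_pos t by (auto simp: s0_def)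
  have wr: "of_real s \<in> T" and wi: "of_real s * \<i> \<in> T" if "0 < s" "s \<le> s0" for s
    using that s0 circ_real[of s] circ_imag[of s] by (auto simp: T_def t_def norm_mult mult.commute)
  obtain a b where ab: "\<And>z. z \<in> T \<Longrightarrow> y z = a * e z + b * h z"
    "\<And>z. z \<in> T \<Longrightarrow> deriv y z = a * deriv e z + b * deriv h z"
    by (rule ode_decomp[OF e h ode_sol_subset[OF y(1) T(4)] open_circ T(1,3,2)], erule W) (rule that)
  define Y where "Y z = a * e z + b * h z" for z
  have Y: "ode_sol ?Q circ Y" unfolding Y_def[abs_def] by (rule ode_sol_lincomb(1)[OF e h open_circ])
  have Y': "deriv Y z = a * deriv e z + b * deriv h z" if "z \<in> circ" for z
    unfolding Y_def[abs_def] by (rule ode_sol_lincomb(2)[OF e h open_circ that])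
  have Yh: "Y holomorphic_on circ" using Y by (simp add: ode_sol_def)
  have a_eq: "Y z * deriv h z - deriv Y z * h z = a" and b_eq: "e z * deriv Y z - deriv e z * Y z = b" if "z \<in> circ" for z
  proof -
    have "Y z * deriv h z - deriv Y z * h z = a * wronskian e h z" "e z * deriv Y z - deriv e z * Y z = b * wronskian e h z"
      unfolding Y'[OF that] Y_def wronskian_def by (simp_all add: algebra_simps)
    then show "Y z * deriv h z - deriv Y z * h z = a" "e z * deriv Y z - deriv e z * Y z = b" using W[OF that] by auto
  qed
  have nz: "Y z \<noteq> 0 \<or> deriv Y z \<noteq> 0" if "z \<in> circ" for z
  proof (rule ccontr)
    assume "\<not> ?thesis"
    then have "a = 0" "b = 0" using a_eq[OF that] b_eq[OF that] by auto
    then have "y z = 0" if "z \<in> T" for z using ab(1)[OF that] by simp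
    moreover have "T \<noteq> {}" using wr[of s0] s0 by auto
    ultimately show False using y(6)[OF T(1)] by (auto simp: T_def)
  qed
  \<comment> \<open>\<open>y\<close> is holomorphic at the pole and vanishes there, so
    \<open>y' cnj y\<close> tends to 0, and \<open>Y\<close> agrees with \<open>y\<close> near the
    pole.\<close>
  have lim: "((\<lambda>s. deriv Y (of_real s * d) * cnj (Y (of_real s * d))) \<longlongrightarrow> 0) (at_right 0)"
    if d: "\<And>s. 0 < s \<Longrightarrow> s \<le> s0 \<Longrightarrow> of_real s * d \<in> T" for d
  proof -
    have c: "isCont y 0" "isCont (deriv y) 0"
      using lat_min_pos by (auto intro!: holomorphic_on_isCont[OF y(2) open_ball]
        holomorphic_on_isCont[OF holomorphic_deriv[OF y(2) open_ball] open_ball])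
    have "((\<lambda>s. of_real s * d) \<longlongrightarrow> of_real 0 * d) (at_right 0)" by (intro tendsto_intros)
    then have l: "((\<lambda>s. of_real s * d) \<longlongrightarrow> 0) (at_right 0)" by simp
    have "((\<lambda>s. deriv y (of_real s * d) * cnj (y (of_real s * d))) \<longlongrightarrow> deriv y 0 * cnj (y 0)) (at_right 0)"
      by (intro tendsto_mult tendsto_cnj isCont_tendsto_compose[OF c(1) l] isCont_tendsto_compose[OF c(2) l])
    then have l2: "((\<lambda>s. deriv y (of_real s * d) * cnj (y (of_real s * d))) \<longlongrightarrow> 0) (at_right 0)" by (simp add: y(3))
    have ev: "\<forall>\<^sub>F s in at_right 0. deriv y (of_real s * d) * cnj (y (of_real s * d)) = deriv Y (of_real s * d) * cnj (Y (of_real s * d))"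
      using eventually_at_right_real[OF s0(1)]
    proof eventually_elim
      case (elim s)
      then have sT: "of_real s * d \<in> T" using d[of s] by simp
      then have "of_real s * d \<in> circ" using T(3) by blast
      then show ?case using ab[OF sT] Y' by (simp add: Y_def)
    qed
    show ?thesis by (rule Lim_transform_eventually[OF l2 ev])
  qed
  have half: "1 / 2 \<in> circ" "\<tau> / 2 \<in> circ"
  proof -
    have "of_real (1 / 2) \<in> circ" by (rule circ_real) auto
    then show "1 / 2 \<in> circ" by simp
    have "\<i> * of_real (Im \<tau> / 2) \<in> circ" by (rule circ_imag) (use Im_tau in auto)
    moreover have "\<i> * of_real (Im \<tau> / 2) = \<tau> / 2" by (simp add: complex_eq_iff)
    ultimately show "\<tau> / 2 \<in> circ" by simp
  qed
  have p1: "Re (1 * deriv Y (of_real (1 / 2) * 1) * cnj (Y (of_real (1 / 2) * 1))) > 0"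
    by (rule nonoscillating_ray[OF Y open_circ, where \<epsilon> = 1])
       (use circ_real sgn(1) nz lim[of 1] wr in auto)
  have p2: "Re (\<i> * deriv Y (of_real (t / 2) * \<i>) * cnj (Y (of_real (t / 2) * \<i>))) > 0"
    by (rule nonoscillating_ray[OF Y open_circ, where \<epsilon> = "- 1"])
       (use circ_imag sgn(2) nz lim[of \<i>] wi t in \<open>auto simp: t_def mult.commute\<close>)
  have Yy: "Y z = y z" if "z \<in> ?B \<inter> circ" for z using ab(1)[of z] that by (simp add: Y_def T_def)
  obtain r r' :: real where r: "Y (1 / 2) = of_real r" "deriv Y (1 / 2) = of_real r'"
  proof -
    have "Y (1 / 2) = 1 * cnj (Y (1 / 2))" "deriv Y (1 / 2) = of_real 1 * 1 * cnj (deriv Y (1 / 2))"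
      by (rule circ_reflect[OF Yh Yy, of 1 1 "of_real s0"]; use y(4) wr[of s0] s0 half T_def in \<open>auto\<close>)+
    then have "cnj (Y (1 / 2)) = Y (1 / 2)" "cnj (deriv Y (1 / 2)) = deriv Y (1 / 2)" by simp_all
    then show ?thesis using that by (metis Reals_cnj_iff of_real_Re)
  qed
  \<comment> \<open>On the imaginary axis parity and reality of \<open>y\<close> combine to the
    reflection factor \<open>(- 1) ^ (n + 1)\<close>. So \<open>Y (\<tau> / 2)\<close> is a real
    multiple of \<open>\<i> ^ (n + 1)\<close>, and the derivative, which picks up another sign, one
    of \<open>\<i> ^ n\<close>.\<close>
  obtain s s' :: real where s: "Y (\<tau> / 2) = \<i> ^ Suc n * of_real s" "deriv Y (\<tau> / 2) = \<i> ^ n * of_real s'"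
  proof -
    have k: "(- 1) ^ Suc n * cnj ((- 1) ^ Suc n) = (1 :: complex)" by (simp flip: power_mult_distrib)
    have yr: "y (of_real (- 1) * cnj z) = (- 1) ^ Suc n * cnj (y z)" if "z \<in> ?B" for z
      using y(5)[of "cnj z"] y(4)[OF that] that by simp
    have w: "of_real s0 * \<i> \<in> ?B" "of_real s0 * \<i> \<in> circ" "of_real (- 1) * cnj (of_real s0 * \<i>) = of_real s0 * \<i>"
      using wi[of s0] s0 by (auto simp: T_def)
    have z: "of_real (- 1) * cnj (\<tau> / 2) = \<tau> / 2" by (simp add: tau)
    note R = circ_reflect[OF Yh Yy _ yr k w half(2) z]
    have "Y (\<tau> / 2) = (- 1) ^ Suc n * cnj (Y (\<tau> / 2))" by (rule R(1)) auto
    moreover have "deriv Y (\<tau> / 2) = of_real (- 1) * (- 1) ^ Suc n * cnj (deriv Y (\<tau> / 2))" by (rule R(2)) auto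
    ultimately show ?thesis using that reflected_real[of "Y (\<tau> / 2)" "Suc n"] reflected_real[of "deriv Y (\<tau> / 2)" n]
      by auto
  qed
  have rr: "r * r' > 0" using p1 by (simp add: r mult.commute)
  have ss: "s * s' > 0"
  proof -
    have "of_real (t / 2) * \<i> = \<tau> / 2" by (simp add: tau)
    then have "0 < Re (\<i> * deriv Y (\<tau> / 2) * cnj (Y (\<tau> / 2)))" using p2 by simp
    also have "\<i> * deriv Y (\<tau> / 2) * cnj (Y (\<tau> / 2)) = (\<i> ^ Suc n * cnj (\<i> ^ Suc n)) * of_real (s * s')"
      unfolding s by (simp add: mult_ac)
    also have "\<i> ^ Suc n * cnj (\<i> ^ Suc n) = 1" unfolding mult_cnj_eq_norm_sq norm_power by simp
    finally show ?thesis by simp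
  qed
  \<comment> \<open>The map \<open>z \<mapsto> cnj z + \<tau>\<close> fixes \<tau>/2 but sends 1/2
    to its image under the point reflection. Therefore all four values are real at \<tau>/2, while
    \<open>deriv e\<close> and \<open>h\<close> are imaginary at 1/2.\<close>
  have p12: "cnj (1 / 2) + \<tau> = 1 + \<tau> - 1 / 2" and pt2: "cnj (\<tau> / 2) + \<tau> = \<tau> / 2" by (simp_all add: complex_eq_iff)
  obtain e0 e1 h0 h1 :: real where A: "e (1 / 2) = of_real e0" "deriv e (1 / 2) = \<i> * of_real e1"
    "h (1 / 2) = \<i> * of_real h0" "deriv h (1 / 2) = of_real h1"
  proof -
    have "cnj (e (1 / 2)) = e (1 / 2)" "cnj (- deriv e (1 / 2)) = deriv e (1 / 2)"
      "cnj (- h (1 / 2)) = h (1 / 2)" "cnj (deriv h (1 / 2)) = deriv h (1 / 2)"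
      using ec[OF half(1)] hc[OF half(1)] unfolding p12 es[OF half(1)] hs[OF half(1)] by auto
    then show ?thesis
      by (intro that[of "Re (e (1 / 2))" "Im (deriv e (1 / 2))" "Im (h (1 / 2))" "Re (deriv h (1 / 2))"])
         (auto simp: complex_eq_iff)
  qed
  obtain E0 E1 H0 H1 :: real where B: "e (\<tau> / 2) = of_real E0" "deriv e (\<tau> / 2) = of_real E1"
    "h (\<tau> / 2) = of_real H0" "deriv h (\<tau> / 2) = of_real H1"
  proof -
    have "cnj (e (\<tau> / 2)) = e (\<tau> / 2)" "cnj (deriv e (\<tau> / 2)) = deriv e (\<tau> / 2)"
      "cnj (h (\<tau> / 2)) = h (\<tau> / 2)" "cnj (deriv h (\<tau> / 2)) = deriv h (\<tau> / 2)"
      using ec[OF half(2)] hc[OF half(2)] unfolding pt2 by auto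
    then show ?thesis
      by (intro that[of "Re (e (\<tau> / 2))" "Re (deriv e (\<tau> / 2))" "Re (h (\<tau> / 2))" "Re (deriv h (\<tau> / 2))"])
         (auto simp: complex_eq_iff)
  qed
  have W1: "e0 * h1 + e1 * h0 = 1" and W2: "E0 * H1 - E1 * H0 = 1"
  proof -
    have "complex_of_real (e0 * h1 + e1 * h0) = 1" using W[OF half(1)] by (simp add: wronskian_def A algebra_simps)
    then show "e0 * h1 + e1 * h0 = 1" by (simp only: of_real_eq_1_iff)
    have "complex_of_real (E0 * H1 - E1 * H0) = 1" using W[OF half(2)] by (simp add: wronskian_def B)
    then show "E0 * H1 - E1 * H0 = 1" by (simp only: of_real_eq_1_iff)
  qed
  obtain \<omega> :: real and \<gamma> where \<omega>: "\<omega> > 0" and dzV: "\<And>z. z \<in> circ \<Longrightarrow> of_real \<omega> * dz V z =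
     (of_real \<omega> * deriv e z + \<gamma> * deriv h z) * cnj (of_real \<omega> * e z + \<gamma> * h z) + deriv h z * cnj (h z)"
    by (rule circ_dz[OF herm_sol_subset[OF V circ_lattice open_circ] e h], erule W) (rule that)
  \<comment> \<open>The point reflection moves each of these half periods by a period, so
    periodicity compares \<open>dz V\<close> at reflected points.\<close>
  have dzp: "dz V (1 + \<tau> - 1 / 2) = dz V (1 / 2)" "dz V (1 + \<tau> - \<tau> / 2) = dz V (\<tau> / 2)"
  proof -
    have "dz V (1 / 2 + \<tau>) = dz V (1 / 2)" "dz V (\<tau> / 2 + 1) = dz V (\<tau> / 2)"
      using dz_periodic[OF V] per half_notin by auto
    moreover have "1 / 2 + \<tau> = 1 + \<tau> - 1 / 2" "\<tau> / 2 + 1 = 1 + \<tau> - \<tau> / 2" by simp_all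
    ultimately show "dz V (1 + \<tau> - 1 / 2) = dz V (1 / 2)" "dz V (1 + \<tau> - \<tau> / 2) = dz V (\<tau> / 2)" by (simp_all only:)
  qed
  have gam: "of_real ((cmod \<gamma>)\<^sup>2 + 1) = \<gamma> * cnj \<gamma> + 1" by (simp add: mult_cnj_eq_norm_sq)
  \<comment> \<open>Point reflection changes the signs of \<open>deriv e\<close> and
    \<open>h\<close>. The mixed terms of \<open>dz V\<close> are invariant, and equality of the two
    values leaves \<open>\<omega>\<^sup>2 e' cnj e + (|\<gamma>|\<^sup>2 + 1) h' cnj h =
    0\<close>.\<close>
  have per1: "\<omega>\<^sup>2 * (e0 * e1) = ((cmod \<gamma>)\<^sup>2 + 1) * (h0 * h1)"
  proof -
    have "(of_real \<omega> * deriv e (1/2) + \<gamma> * deriv h (1/2)) * cnj (of_real \<omega> * e (1/2) + \<gamma> * h (1/2)) + deriv h (1/2) * cnj (h (1/2))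
      = (of_real \<omega> * - deriv e (1/2) + \<gamma> * deriv h (1/2)) * cnj (of_real \<omega> * e (1/2) + \<gamma> * - h (1/2)) + deriv h (1/2) * cnj (- h (1/2))"
      using dzV[OF half(1)] dzV[OF circ_symm(1)[OF half(1)]] unfolding dzp es[OF half(1)] hs[OF half(1)] by simp
    then have "2 * \<i> * (of_real \<omega> ^ 2 * (of_real e0 * of_real e1) - (\<gamma> * cnj \<gamma> + 1) * (of_real h0 * of_real h1)) = 0"
      unfolding A by (simp add: power2_eq_square algebra_simps)
    then have "complex_of_real (\<omega>\<^sup>2 * (e0 * e1)) = of_real (((cmod \<gamma>)\<^sup>2 + 1) * (h0 * h1))"
      unfolding of_real_mult gam of_real_power by simp
    then show ?thesis by (simp only: of_real_eq_iff)
  qed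
  \<comment> \<open>The same relation at \<tau>/2; as all values are real there, the sign is the
    opposite one.\<close>
  have per2: "\<omega>\<^sup>2 * (E0 * E1) = - (((cmod \<gamma>)\<^sup>2 + 1) * (H0 * H1))"
  proof -
    have "(of_real \<omega> * deriv e (\<tau>/2) + \<gamma> * deriv h (\<tau>/2)) * cnj (of_real \<omega> * e (\<tau>/2) + \<gamma> * h (\<tau>/2)) + deriv h (\<tau>/2) * cnj (h (\<tau>/2))
      = (of_real \<omega> * - deriv e (\<tau>/2) + \<gamma> * deriv h (\<tau>/2)) * cnj (of_real \<omega> * e (\<tau>/2) + \<gamma> * - h (\<tau>/2)) + deriv h (\<tau>/2) * cnj (- h (\<tau>/2))"
      using dzV[OF half(2)] dzV[OF circ_symm(1)[OF half(2)]] unfolding dzp es[OF half(2)] hs[OF half(2)] by simp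
    then have "2 * (of_real \<omega> ^ 2 * (of_real E0 * of_real E1) + (\<gamma> * cnj \<gamma> + 1) * (of_real H0 * of_real H1)) = 0"
      unfolding B by (simp add: power2_eq_square algebra_simps)
    then have "of_real \<omega> ^ 2 * (of_real E0 * of_real E1) + (\<gamma> * cnj \<gamma> + 1) * (of_real H0 * of_real H1) = 0"
      by (metis mult_eq_0_iff zero_neq_numeral)
    then have "complex_of_real (\<omega>\<^sup>2 * (E0 * E1) + ((cmod \<gamma>)\<^sup>2 + 1) * (H0 * H1)) = 0"
      unfolding of_real_add[of "\<omega>\<^sup>2 * (E0 * E1)"] of_real_mult gam of_real_power by simp
    then have "\<omega>\<^sup>2 * (E0 * E1) + ((cmod \<gamma>)\<^sup>2 + 1) * (H0 * H1) = 0" by (simp only: of_real_eq_0_iff)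
    then show ?thesis by linarith
  qed
  \<comment> \<open>The coordinates \<open>a\<close> and \<open>b\<close> of \<open>Y\<close> are
    Wronskians and may be evaluated at either half period.\<close>
  have c1: "complex_of_real r * h1 - \<i> * r' * h0 = \<i> ^ n * (\<i> * s * H1 - s' * H0)"
  proof -
    have "complex_of_real r * h1 - \<i> * r' * h0 = a" using a_eq[OF half(1)] by (simp add: r A mult_ac)
    also have "a = \<i> ^ n * (\<i> * s * H1 - s' * H0)" using a_eq[OF half(2)] by (simp add: s B algebra_simps)
    finally show ?thesis .
  qed
  have c2: "complex_of_real e0 * r' - \<i> * e1 * r = \<i> ^ n * (E0 * s' - \<i> * E1 * s)"
  proof -
    have "complex_of_real e0 * r' - \<i> * e1 * r = b" using b_eq[OF half(1)] by (simp add: r A mult_ac)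
    also have "b = \<i> ^ n * (E0 * s' - \<i> * E1 * s)" using b_eq[OF half(2)] by (simp add: s B algebra_simps)
    finally show ?thesis .
  qed
  show False
    by (rule frame_contradiction[OF _ _ rr ss W1 W2 per1 per2 c1 c2]) (use \<omega> in \<open>auto simp: add_nonneg_pos\<close>)
qed

end

section \<open>From distributions to pointwise equations\<close>

lemma has_derivative_partials:
  fixes f :: "complex \<Rightarrow> real"
  assumes "f differentiable (at z)"
  shows "(f has_derivative (\<lambda>h. partial_x f z * Re h + partial_y f z * Im h)) (at z)"
proof -
  have d: "(f has_derivative frechet_derivative f (at z)) (at z)"
    using assms by (simp add: frechet_derivative_works)
  interpret D: linear "frechet_derivative f (at z)" by (rule linear_frechet_derivative[OF assms])
  have "frechet_derivative f (at z) h = partial_x f z * Re h + partial_y f z * Im h" for h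
  proof -
    have "h = Re h *\<^sub>R 1 + Im h *\<^sub>R \<i>" by (simp add: complex_eq_iff)
    then have "frechet_derivative f (at z) h = frechet_derivative f (at z) (Re h *\<^sub>R 1 + Im h *\<^sub>R \<i>)" by simp
    also have "\<dots> = partial_x f z * Re h + partial_y f z * Im h"
      unfolding D.add D.scale by (simp add: partial_x_def partial_y_def mult.commute)
    finally show ?thesis .
  qed
  with d show ?thesis by (metis (no_types, lifting) ext)
qed

lemma partials_eqI:
  fixes f :: "complex \<Rightarrow> real"
  assumes "(f has_derivative (\<lambda>h. a * Re h + b * Im h)) (at z)"
  shows "partial_x f z = a" "partial_y f z = b"
  using frechet_derivative_at[OF assms] by (simp_all add: partial_x_def partial_y_def flip: fun_eq_iff) (metis complex.sel(1,2) mult_zero_right add_0 add_0_right mult_1_right one_complex.sel imaginary_unit.sel)+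

lemma line_derivative:
  fixes f :: "complex \<Rightarrow> real"
  assumes "(f has_derivative (\<lambda>h. a * Re h + b * Im h)) (at (z + of_real s * d))"
  shows "((\<lambda>s. f (z + of_real s * d)) has_real_derivative a * Re d + b * Im d) (at s)"
proof -
  have l: "((\<lambda>s. z + of_real s * d) has_derivative (\<lambda>x. x *\<^sub>R d)) (at s)"
    by (auto intro!: derivative_eq_intros simp: scaleR_conv_of_real)
  have "(f \<circ> (\<lambda>s. z + of_real s * d) has_derivative (\<lambda>h. a * Re h + b * Im h) \<circ> (\<lambda>x. x *\<^sub>R d)) (at s)"
    by (rule diff_chain_at[OF l assms])
  then show ?thesis unfolding has_field_derivative_def o_def
    by (rule back_subst[of "\<lambda>D. (_ has_derivative D) (at s)"]) (auto simp: fun_eq_iff algebra_simps)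
qed

text \<open>The second difference of \<open>u\<close> over a small square equals the square of the
  side times either mixed derivative at some intermediate point, by the mean value theorem in the
  two orders. The sides then shrink to 0.\<close>

lemma mixed_partials:
  fixes u :: "complex \<Rightarrow> real"
  assumes S: "open S" "z \<in> S" and d: "\<And>z. z \<in> S \<Longrightarrow> u differentiable (at z)"
    "\<And>z. z \<in> S \<Longrightarrow> partial_x u differentiable (at z)" "\<And>z. z \<in> S \<Longrightarrow> partial_y u differentiable (at z)"
    and c: "continuous_on S (partial_y (partial_x u))" "continuous_on S (partial_x (partial_y u))"
  shows "partial_x (partial_y u) z = partial_y (partial_x u) z"
proof -
  obtain r where r: "r > 0" "ball z r \<subseteq> S" using S open_contains_ball by blast
  have inS: "z + of_real s + of_real t * \<i> \<in> S" if "\<bar>s\<bar> < r / 2" "\<bar>t\<bar> < r / 2" for s t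
  proof -
    have "norm (of_real s + of_real t * \<i>) \<le> \<bar>s\<bar> + \<bar>t\<bar>"
      using norm_triangle_ineq[of "of_real s" "of_real t * \<i>"] by (simp add: norm_mult)
    also have "\<dots> < r" using that by simp
    finally have "norm (of_real s + of_real t * \<i>) < r" .
    moreover have "dist z (z + w) = norm w" for w by (simp add: dist_norm)
    ultimately have "z + (of_real s + of_real t * \<i>) \<in> ball z r" by (simp only: mem_ball)
    then show ?thesis using r(2) by (auto simp: add.assoc)
  qed
  have dx: "((\<lambda>s. f (z + of_real s + of_real t * \<i>)) has_real_derivative partial_x f (z + of_real s + of_real t * \<i>)) (at s)"
    if "f differentiable (at (z + of_real s + of_real t * \<i>))" for f :: "complex \<Rightarrow> real" and s t
    using line_derivative[of f _ _ "z + of_real t * \<i>" s 1] has_derivative_partials[OF that]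
    by (simp add: add_ac)
  have dy: "((\<lambda>t. f (z + of_real s + of_real t * \<i>)) has_real_derivative partial_y f (z + of_real s + of_real t * \<i>)) (at t)"
    if "f differentiable (at (z + of_real s + of_real t * \<i>))" for f :: "complex \<Rightarrow> real" and s t
    using line_derivative[of f _ _ "z + of_real s" t \<i>] has_derivative_partials[OF that]
    by simp
  have ex: "\<exists>s t s' t'. 0 < s \<and> s < h \<and> 0 < t \<and> t < h \<and> 0 < s' \<and> s' < h \<and> 0 < t' \<and> t' < h \<and>
     partial_y (partial_x u) (z + of_real s + of_real t * \<i>) = partial_x (partial_y u) (z + of_real s' + of_real t' * \<i>)"
    if h: "0 < h" "h < r / 2" for h
  proof -
    define U where "U s t = u (z + of_real s + of_real t * \<i>)" for s t
    have "\<exists>s. 0 < s \<and> s < h \<and> (U h h - U h 0) - (U 0 h - U 0 0) =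
       (h - 0) * (partial_x u (z + of_real s + of_real h * \<i>) - partial_x u (z + of_real s + of_real 0 * \<i>))"
      unfolding U_def
      by (rule MVT2[OF h(1)]) (intro DERIV_diff dx d inS; use h in simp)
    then obtain s where s: "0 < s" "s < h" "(U h h - U h 0) - (U 0 h - U 0 0) =
       h * (partial_x u (z + of_real s + of_real h * \<i>) - partial_x u (z + of_real s + of_real 0 * \<i>))" by auto
    have "\<exists>t. 0 < t \<and> t < h \<and> partial_x u (z + of_real s + of_real h * \<i>) - partial_x u (z + of_real s + of_real 0 * \<i>)
       = (h - 0) * partial_y (partial_x u) (z + of_real s + of_real t * \<i>)"
      by (rule MVT2[OF h(1)]) (intro dy d inS; use h s in simp)
    then obtain t where t: "0 < t" "t < h" "partial_x u (z + of_real s + of_real h * \<i>) - partial_x u (z + of_real s + of_real 0 * \<i>)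
       = h * partial_y (partial_x u) (z + of_real s + of_real t * \<i>)" by auto
    have "\<exists>t'. 0 < t' \<and> t' < h \<and> (U h h - U 0 h) - (U h 0 - U 0 0) =
       (h - 0) * (partial_y u (z + of_real h + of_real t' * \<i>) - partial_y u (z + of_real 0 + of_real t' * \<i>))"
      unfolding U_def
      by (rule MVT2[OF h(1)]) (intro DERIV_diff dy d inS; use h in simp)
    then obtain t' where t': "0 < t'" "t' < h" "(U h h - U 0 h) - (U h 0 - U 0 0) =
       h * (partial_y u (z + of_real h + of_real t' * \<i>) - partial_y u (z + of_real 0 + of_real t' * \<i>))" by auto
    have "\<exists>s'. 0 < s' \<and> s' < h \<and> partial_y u (z + of_real h + of_real t' * \<i>) - partial_y u (z + of_real 0 + of_real t' * \<i>)
       = (h - 0) * partial_x (partial_y u) (z + of_real s' + of_real t' * \<i>)"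
      by (rule MVT2[OF h(1)]) (intro dx d inS; use h t' in simp)
    then obtain s' where s': "0 < s'" "s' < h" "partial_y u (z + of_real h + of_real t' * \<i>) - partial_y u (z + of_real 0 + of_real t' * \<i>)
       = h * partial_x (partial_y u) (z + of_real s' + of_real t' * \<i>)" by auto
    have "h * (h * partial_y (partial_x u) (z + of_real s + of_real t * \<i>)) =
      h * (h * partial_x (partial_y u) (z + of_real s' + of_real t' * \<i>))"
      using s(3)[unfolded t(3)] t'(3)[unfolded s'(3)] by linarith
    then have "partial_y (partial_x u) (z + of_real s + of_real t * \<i>) = partial_x (partial_y u) (z + of_real s' + of_real t' * \<i>)"
      using h(1) by simp
    then show ?thesis using s t s' t' by blast
  qed
  define H where "H k = r / 4 / real (Suc k)" for k
  have H: "0 < H k" "H k < r / 2" for k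
  proof -
    show "0 < H k" using r by (simp add: H_def)
    have "H k \<le> r / 4 / 1" unfolding H_def using r by (intro divide_left_mono) auto
    then show "H k < r / 2" using r by simp
  qed
  have H0: "H \<longlonglongrightarrow> 0"
  proof -
    have "(\<lambda>k. (r / 4) * (1 / real (Suc k))) \<longlonglongrightarrow> (r / 4) * 0"
      by (intro tendsto_mult tendsto_const LIMSEQ_Suc[OF lim_1_over_n])
    then show ?thesis unfolding H_def[abs_def] by simp
  qed
  from ex[OF H] obtain s t s' t' where st: "\<And>k. 0 < s k \<and> s k < H k \<and> 0 < t k \<and> t k < H k \<and> 0 < s' k \<and> s' k < H k \<and> 0 < t' k \<and> t' k < H k \<and>
     partial_y (partial_x u) (z + of_real (s k) + of_real (t k) * \<i>) = partial_x (partial_y u) (z + of_real (s' k) + of_real (t' k) * \<i>)"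
    by metis
  have sq: "f \<longlonglongrightarrow> 0" if "\<And>k. 0 < f k \<and> f k < H k" for f :: "nat \<Rightarrow> real"
    by (rule tendsto_sandwich[OF _ _ tendsto_const H0]) (use that in \<open>auto intro!: always_eventually less_imp_le\<close>)
  have lim: "(\<lambda>k. F (z + of_real (f k) + of_real (g k) * \<i>)) \<longlonglongrightarrow> F z"
    if F: "continuous_on S F" and f: "f \<longlonglongrightarrow> 0" and g: "g \<longlonglongrightarrow> 0" for F :: "complex \<Rightarrow> real" and f g :: "nat \<Rightarrow> real"
  proof (rule isCont_tendsto_compose[of _ F])
    show "isCont F z" using F S continuous_on_eq_continuous_at by blast
    have "(\<lambda>k. z + of_real (f k) + of_real (g k) * \<i>) \<longlonglongrightarrow> z + of_real 0 + of_real 0 * \<i>"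
      by (intro tendsto_intros f g)
    then show "(\<lambda>k. z + of_real (f k) + of_real (g k) * \<i>) \<longlonglongrightarrow> z" by simp
  qed
  have "(\<lambda>k. partial_y (partial_x u) (z + of_real (s k) + of_real (t k) * \<i>)) \<longlonglongrightarrow> partial_y (partial_x u) z"
    by (rule lim[OF c(1)]) (rule sq, use st in blast)+
  moreover have "(\<lambda>k. partial_x (partial_y u) (z + of_real (s' k) + of_real (t' k) * \<i>)) \<longlonglongrightarrow> partial_x (partial_y u) z"
    by (rule lim[OF c(2)]) (rule sq, use st in blast)+
  moreover have "(\<lambda>k. partial_y (partial_x u) (z + of_real (s k) + of_real (t k) * \<i>)) = (\<lambda>k. partial_x (partial_y u) (z + of_real (s' k) + of_real (t' k) * \<i>))"
    using st by blast
  ultimately show ?thesis using LIMSEQ_unique by metis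
qed

section \<open>Smooth periodic test functions\<close>

definition bump :: "nat \<Rightarrow> real \<Rightarrow> real" where
  "bump j s = (if s > 0 then exp (- 1 / s) / s ^ j else 0)"

lemma bump_zero [simp]: "s \<le> 0 \<Longrightarrow> bump j s = 0" by (simp add: bump_def)
lemma bump_pos: "s > 0 \<Longrightarrow> bump j s > 0" by (simp add: bump_def)
lemma bump_nonneg: "bump j s \<ge> 0" by (simp add: bump_def)

text \<open>Dividing \<open>exp (- 1 / s)\<close> by the powers of \<open>s\<close> gives a family
  whose linear span is closed under differentiation. At 0 the exponential beats every power.\<close>

lemma bump_deriv: "(bump j has_real_derivative - real j * bump (Suc j) s + bump (j + 2) s) (at s)"
proof -
  consider "s > 0" | "s < 0" | "s = 0" by linarith
  then show ?thesis
  proof cases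
    case 1
    have eq: "- real j * bump (Suc j) s + bump (j + 2) s = exp (- 1 / s) * (1 / s\<^sup>2) / s ^ j - exp (- 1 / s) * (real j * s ^ (j - 1)) / (s ^ j * s ^ j)"
      using 1 by (cases j) (simp_all add: bump_def field_simps power2_eq_square)
    have "((\<lambda>s. exp (- 1 / s) / s ^ j) has_real_derivative - real j * bump (Suc j) s + bump (j + 2) s) (at s)"
      unfolding eq using 1
      by (auto intro!: derivative_eq_intros simp: field_simps power2_eq_square)
    then show ?thesis
      by (rule has_field_derivative_transform_within_open[of _ _ _ "{0<..}"]) (use 1 in \<open>auto simp: bump_def\<close>)
  next
    case 2
    have "((\<lambda>s. 0) has_real_derivative 0) (at s)" by simp
    then have "(bump j has_real_derivative 0) (at s)"
      by (rule has_field_derivative_transform_within_open[of _ _ _ "{..<0}"]) (use 2 in auto)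
    then show ?thesis using 2 by simp
  next
    case 3
    have "((\<lambda>h. bump j h / h) \<longlongrightarrow> 0) (at 0)"
    proof (rule filterlim_split_at)
      show "((\<lambda>h. bump j h / h) \<longlongrightarrow> 0) (at_left 0)"
        by (rule tendsto_eventually) (auto simp: eventually_at_left_field intro!: exI[of _ "- 1"])
      have "((\<lambda>h::real. inverse h ^ Suc j / exp (inverse h)) \<longlongrightarrow> 0) (at_right 0)"
        by (rule filterlim_compose[OF tendsto_power_div_exp_0 filterlim_inverse_at_top_right])
      then show "((\<lambda>h. bump j h / h) \<longlongrightarrow> 0) (at_right 0)"
      proof (rule Lim_transform_eventually)
        show "\<forall>\<^sub>F h in at_right 0. inverse h ^ Suc j / exp (inverse h) = bump j h / h"
          using eventually_at_right_less[of "0::real"]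
        proof eventually_elim
          case (elim h)
          then show ?case by (simp add: bump_def exp_minus divide_inverse power_inverse)
        qed
      qed
    qed
    then show ?thesis using 3 by (simp add: DERIV_def)
  qed
qed

text \<open>An algebra of functions of one variable that contains the periodic bumps and, with each
  member, its derivative. Smoothness of every order is then a single induction.\<close>

inductive_set smooth_alg :: "(real \<Rightarrow> real) set" where
  const: "(\<lambda>_. c) \<in> smooth_alg"
| sin: "(\<lambda>x. sin (a * x + b)) \<in> smooth_alg"
| cos: "(\<lambda>x. cos (a * x + b)) \<in> smooth_alg"
| bump: "(\<lambda>x. bump j (cos (a * x + b) - c)) \<in> smooth_alg"
| add: "f \<in> smooth_alg \<Longrightarrow> g \<in> smooth_alg \<Longrightarrow> (\<lambda>x. f x + g x) \<in> smooth_alg"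
| mult: "f \<in> smooth_alg \<Longrightarrow> g \<in> smooth_alg \<Longrightarrow> (\<lambda>x. f x * g x) \<in> smooth_alg"

lemma bump_cos_deriv:
  "((\<lambda>x. bump j (cos (a * x + b) - c)) has_real_derivative
     (- real j * bump (Suc j) (cos (a * x + b) - c) + bump (j + 2) (cos (a * x + b) - c)) * (- a * sin (a * x + b))) (at x)"
  by (rule DERIV_chain2[OF bump_deriv]) (auto intro!: derivative_eq_intros)

lemma smooth_alg_deriv: "f \<in> smooth_alg \<Longrightarrow> \<exists>g\<in>smooth_alg. \<forall>x. (f has_real_derivative g x) (at x)"
proof (induction rule: smooth_alg.induct)
  case (const c) show ?case by (intro bexI[of _ "\<lambda>_. 0"] smooth_alg.const) auto
next
  case (sin a b)
  show ?case by (rule bexI[of _ "\<lambda>x. a * cos (a * x + b)"])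
     (auto intro!: derivative_eq_intros smooth_alg.mult smooth_alg.const smooth_alg.cos)
next
  case (cos a b)
  show ?case
  proof (rule bexI)
    show "(\<lambda>x. (- a) * sin (a * x + b)) \<in> smooth_alg"
      by (rule smooth_alg.mult[OF smooth_alg.const smooth_alg.sin])
  qed (auto intro!: derivative_eq_intros)
next
  case (bump j a b c)
  show ?case
    by (rule bexI[where x = "\<lambda>x. (- real j * bump (Suc j) (cos (a * x + b) - c) + bump (j + 2) (cos (a * x + b) - c)) * (- a * sin (a * x + b))"])
       (intro allI bump_cos_deriv, intro smooth_alg.mult smooth_alg.add smooth_alg.bump smooth_alg.const smooth_alg.sin)
next
  case (add f g)
  then obtain f' g' where "f' \<in> smooth_alg" "\<forall>x. (f has_real_derivative f' x) (at x)" "g' \<in> smooth_alg" "\<forall>x. (g has_real_derivative g' x) (at x)" by blast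
  then show ?case by (intro bexI[of _ "\<lambda>x. f' x + g' x"] smooth_alg.add) (auto intro!: derivative_eq_intros)
next
  case (mult f g)
  then obtain f' g' where "f' \<in> smooth_alg" "\<forall>x. (f has_real_derivative f' x) (at x)" "g' \<in> smooth_alg" "\<forall>x. (g has_real_derivative g' x) (at x)" by blast
  with mult show ?case by (intro bexI[of _ "\<lambda>x. f' x * g x + g' x * f x"] smooth_alg.add smooth_alg.mult) (auto intro!: derivative_eq_intros)
qed

lemma has_derivative_prod_Re_Im:
  assumes "(f has_real_derivative f') (at (Re z))" "(g has_real_derivative g') (at (Im z))"
  shows "((\<lambda>z. f (Re z) * g (Im z)) has_derivative (\<lambda>h. (f' * g (Im z)) * Re h + (f (Re z) * g') * Im h)) (at z)"
proof -
  have 1: "((\<lambda>z. f (Re z)) has_derivative (\<lambda>h. f' * Re h)) (at z)"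
    using has_derivative_compose[OF bounded_linear_imp_has_derivative[OF bounded_linear_Re] assms(1)[unfolded has_field_derivative_def]] by simp
  have 2: "((\<lambda>z. g (Im z)) has_derivative (\<lambda>h. g' * Im h)) (at z)"
    using has_derivative_compose[OF bounded_linear_imp_has_derivative[OF bounded_linear_Im] assms(2)[unfolded has_field_derivative_def]] by simp
  show ?thesis using has_derivative_mult[OF 1 2]
    by (rule back_subst[of "\<lambda>D. (_ has_derivative D) (at z)"]) (auto simp: fun_eq_iff algebra_simps)
qed

text \<open>Both partial derivatives of such a product are products of the same form, which keeps
  the induction going.\<close>

lemma Ck_smooth_prod:
  "f \<in> smooth_alg \<Longrightarrow> g \<in> smooth_alg \<Longrightarrow> Ck_on k (\<lambda>z. f (Re z) * g (Im z)) UNIV"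
proof (induction k arbitrary: f g)
  case 0
  obtain f' where f': "\<forall>x. (f has_real_derivative f' x) (at x)" using smooth_alg_deriv[OF 0(1)] by blast
  obtain g' where g': "\<forall>x. (g has_real_derivative g' x) (at x)" using smooth_alg_deriv[OF 0(2)] by blast
  have "isCont (\<lambda>z. f (Re z) * g (Im z)) z" for z
    by (rule has_derivative_continuous[OF has_derivative_prod_Re_Im[OF f'[rule_format] g'[rule_format]]])
  then show ?case by (simp add: continuous_at_imp_continuous_on)
next
  case (Suc k)
  obtain f' where f': "f' \<in> smooth_alg" "\<forall>x. (f has_real_derivative f' x) (at x)"
    using smooth_alg_deriv[OF Suc.prems(1)] by blast
  obtain g' where g': "g' \<in> smooth_alg" "\<forall>x. (g has_real_derivative g' x) (at x)"
    using smooth_alg_deriv[OF Suc.prems(2)] by blast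
  have d: "((\<lambda>z. f (Re z) * g (Im z)) has_derivative (\<lambda>h. (f' (Re z) * g (Im z)) * Re h + (f (Re z) * g' (Im z)) * Im h)) (at z)" for z
    using has_derivative_prod_Re_Im[OF f'(2)[rule_format] g'(2)[rule_format]] .
  have "partial_x (\<lambda>z. f (Re z) * g (Im z)) = (\<lambda>z. f' (Re z) * g (Im z))"
    "partial_y (\<lambda>z. f (Re z) * g (Im z)) = (\<lambda>z. f (Re z) * g' (Im z))"
    using partials_eqI[OF d] by auto
  moreover have "(\<lambda>z. f (Re z) * g (Im z)) differentiable (at z)" for z using d differentiableI by blast
  ultimately show ?case using Suc.IH[OF f'(1) Suc.prems(2)] Suc.IH[OF Suc.prems(1) g'(1)] by simp
qed

text \<open>By translation invariance the difference quotients of \<open>G\<close> have integral 0.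
  The mean value theorem bounds them by \<open>C\<close>, and they vanish outside a fixed ball, so
  dominated convergence applies.\<close>

lemma integral_directional_derivative:
  fixes G g :: "complex \<Rightarrow> real"
  assumes G: "integrable lborel G" and g: "integrable lborel g"
    and D: "\<And>z. ((\<lambda>s. G (z + of_real s * d)) has_real_derivative g z) (at 0)"
    and C: "\<And>z. \<bar>g z\<bar> \<le> C" and R: "\<And>z. norm z > R \<Longrightarrow> G z = 0"
  shows "(LINT z|lborel. g z) = 0"
proof -
  define h where "h k = 1 / real (Suc k)" for k
  have h: "h k > 0" "h k \<le> 1" for k by (auto simp: h_def)
  have h0: "h \<longlonglongrightarrow> 0" unfolding h_def[abs_def] by (rule LIMSEQ_Suc[OF lim_1_over_n])
  define q where "q k z = (G (z + of_real (h k) * d) - G z) / h k" for k z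
  have tr: "integrable lborel (\<lambda>z. G (z + c))" "(LINT z|lborel. G (z + c)) = (LINT z|lborel. G z)" for c
  proof -
    have m: "(\<lambda>z. c + z) \<in> measurable lborel borel" by simp
    have "integrable (distr lborel borel ((+) c)) G" by (simp add: lborel_distr_plus G)
    then show "integrable lborel (\<lambda>z. G (z + c))"
      by (subst (asm) integrable_distr_eq) (use G in \<open>auto simp: add.commute\<close>)
    have "(LINT z|lborel. G z) = (LINT z|distr lborel borel ((+) c). G z)" by (simp add: lborel_distr_plus)
    also have "\<dots> = (LINT z|lborel. G (c + z))"
      by (rule integral_distr) (use G in auto)
    finally show "(LINT z|lborel. G (z + c)) = (LINT z|lborel. G z)" by (simp add: add.commute)
  qed
  have q0: "(LINT z|lborel. q k z) = 0" for k
    unfolding q_def using tr G by simp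
  have Ds: "((\<lambda>s. G (z + of_real s * d)) has_real_derivative g (z + of_real s * d)) (at s)" for z s
  proof -
    have "((\<lambda>r. G ((z + of_real s * d) + of_real r * d)) has_real_derivative g (z + of_real s * d)) (at 0)" by (rule D)
    then have "((\<lambda>r. G (z + of_real (r + s) * d)) has_real_derivative g (z + of_real s * d)) (at 0)"
      by (simp add: algebra_simps)
    then show ?thesis using DERIV_shift[of "\<lambda>s. G (z + of_real s * d)" "g (z + of_real s * d)" 0 s] by simp
  qed
  have C0: "C \<ge> 0" using C[of 0] by linarith
  have bound: "\<bar>q k z\<bar> \<le> indicator (cball 0 (\<bar>R\<bar> + norm d)) z * C" for k z
  proof (cases "norm z \<le> \<bar>R\<bar> + norm d")
    case True
    obtain s where "G (z + of_real (h k) * d) - G (z + of_real 0 * d) = (h k - 0) * g (z + of_real s * d)"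
      using MVT2[OF h(1)[of k], of "\<lambda>s. G (z + of_real s * d)" "\<lambda>s. g (z + of_real s * d)"] Ds by blast
    then have "q k z = g (z + of_real s * d)" using h(1)[of k] by (simp add: q_def)
    then show ?thesis using True C by simp
  next
    case False
    have "norm (z + of_real (h k) * d) \<ge> norm z - norm (of_real (h k) * d)"
      using norm_triangle_ineq2[of z "- (of_real (h k) * d)"] by simp
    moreover have "norm (of_real (h k) * d) \<le> norm d"
      using h[of k] mult_right_mono[of "h k" 1 "norm d"] by (simp add: norm_mult)
    ultimately have "norm (z + of_real (h k) * d) > R" using False by linarith
    moreover have "norm z > R" using False norm_ge_zero[of d] by linarith
    ultimately show ?thesis using R C0 by (simp add: q_def)
  qed
  have "(\<lambda>k. LINT z|lborel. q k z) \<longlonglongrightarrow> (LINT z|lborel. g z)"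
  proof (rule integral_dominated_convergence[where w = "\<lambda>z. indicator (cball 0 (\<bar>R\<bar> + norm d)) z * C"])
    show "integrable lborel (\<lambda>z::complex. indicator (cball 0 (\<bar>R\<bar> + norm d)) z * C)"
      by (intro integrable_mult_left integrable_real_indicator) (use emeasure_bounded_finite[OF bounded_cball] in auto)
    show "AE z in lborel. (\<lambda>k. q k z) \<longlonglongrightarrow> g z"
    proof (rule AE_I2)
      fix z
      have "((\<lambda>s. (G (z + of_real (0 + s) * d) - G (z + of_real 0 * d)) / s) \<longlongrightarrow> g z) (at 0)"
        using D[of z] unfolding DERIV_def by simp
      moreover have "filterlim h (at 0) sequentially"
        unfolding filterlim_at using h0 h(1) by (auto intro!: always_eventually less_imp_neq[symmetric])
      ultimately have "(\<lambda>k. (G (z + of_real (0 + h k) * d) - G (z + of_real 0 * d)) / h k) \<longlonglongrightarrow> g z"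
        by (rule filterlim_compose)
      then show "(\<lambda>k. q k z) \<longlonglongrightarrow> g z" by (simp add: q_def)
    qed
    show "AE z in lborel. norm (q k z) \<le> indicator (cball 0 (\<bar>R\<bar> + norm d)) z * C" for k
      using bound by simp
  qed (use G g tr in \<open>auto simp: q_def\<close>)
  then show ?thesis using q0 by (simp add: LIMSEQ_const_iff)
qed

text \<open>The form in which integration by parts is used: \<open>G\<close> has its derivative only
  on the neighbourhood \<open>K'\<close>, and cutting off with the indicator of \<open>K\<close>
  keeps it differentiable because \<open>G\<close> and \<open>g\<close> vanish on
  \<open>K' - K\<close>.\<close>

lemma integral_compact_support_derivative:
  fixes G g :: "complex \<Rightarrow> real"
  assumes K: "compact K" "open K'" "K \<subseteq> K'"
    and D: "\<And>z. z \<in> K' \<Longrightarrow> ((\<lambda>s. G (z + of_real s * d)) has_real_derivative g z) (at 0)"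
    and c: "continuous_on K G" "continuous_on K g"
    and z: "\<And>z. z \<in> K' \<Longrightarrow> z \<notin> K \<Longrightarrow> G z = 0 \<and> g z = 0"
  shows "(LINT z|lborel. indicator K z *\<^sub>R g z) = 0"
proof -
  obtain R where R: "\<And>z. z \<in> K \<Longrightarrow> norm z \<le> R" using compact_imp_bounded[OF K(1)] by (auto simp: bounded_iff)
  have "bounded (g ` K)" by (rule compact_imp_bounded[OF compact_continuous_image[OF c(2) K(1)]])
  then obtain C where C: "\<And>z. z \<in> K \<Longrightarrow> \<bar>g z\<bar> \<le> C" by (auto simp: bounded_iff)
  show ?thesis
  proof (rule integral_directional_derivative[where G = "\<lambda>z. indicator K z *\<^sub>R G z" and d = d and C = "\<bar>C\<bar>" and R = R])
    show "integrable lborel (\<lambda>z. indicator K z *\<^sub>R G z)" "integrable lborel (\<lambda>z. indicator K z *\<^sub>R g z)"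
      by (rule borel_integrable_compact[OF K(1)], rule c)+
    show "((\<lambda>s. indicator K (z + of_real s * d) *\<^sub>R G (z + of_real s * d)) has_real_derivative indicator K z *\<^sub>R g z) (at 0)" for z
    proof (cases "z \<in> K'")
      case True
      have "open ((\<lambda>s. z + of_real s * d) -` K')" by (intro open_vimage K(2) continuous_intros)
      then have "((\<lambda>s. indicator K (z + of_real s * d) *\<^sub>R G (z + of_real s * d)) has_real_derivative g z) (at 0)"
        by (rule has_field_derivative_transform_within_open[OF D[OF True]])
           (use True z in \<open>auto simp: indicator_def\<close>)
      then show ?thesis using z[OF True] by (cases "z \<in> K") auto
    next
      case False
      have "open ((\<lambda>s. z + of_real s * d) -` (- K))"
        by (intro open_vimage open_Compl compact_imp_closed K(1) continuous_intros)
      then have "((\<lambda>s. indicator K (z + of_real s * d) *\<^sub>R G (z + of_real s * d)) has_real_derivative 0) (at 0)"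
        by (rule has_field_derivative_transform_within_open[OF DERIV_const])
           (use False K(3) in auto)
      then show ?thesis using False K(3) by (auto simp: indicator_def)
    qed
    show "\<bar>indicator K z *\<^sub>R g z\<bar> \<le> \<bar>C\<bar>" for z using C[of z] by (auto simp: indicator_def)
    show "indicator K z *\<^sub>R G z = 0" if "norm z > R" for z using R[of z] that by (auto simp: indicator_def)
  qed
qed

text \<open>The derivatives are exhibited so that their vanishing where the cosine is at most
  \<open>c\<close> can be read off as well.\<close>

lemma bump_cos_twice:
  fixes a b c :: real
  assumes f_def: "f = (\<lambda>x. bump 0 (cos (a * x + b) - c))"
  obtains f1 f2 where "f \<in> smooth_alg" "f1 \<in> smooth_alg" "f2 \<in> smooth_alg"
    "\<And>x. (f has_real_derivative f1 x) (at x)" "\<And>x. (f1 has_real_derivative f2 x) (at x)"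
    "\<And>x. cos (a * x + b) \<le> c \<Longrightarrow> f x = 0 \<and> f1 x = 0 \<and> f2 x = 0"
proof
  define f1 where "f1 x = bump 2 (cos (a * x + b) - c) * ((- a) * sin (a * x + b))" for x
  define f2 where "f2 x = ((- 2) * bump 3 (cos (a * x + b) - c) + bump 4 (cos (a * x + b) - c)) * ((- a) * sin (a * x + b)) * ((- a) * sin (a * x + b))
     + bump 2 (cos (a * x + b) - c) * ((- a * a) * cos (a * x + b))" for x
  show "f \<in> smooth_alg" unfolding f_def by (rule smooth_alg.bump)
  show "f1 \<in> smooth_alg" unfolding f1_def[abs_def]
    by (intro smooth_alg.mult smooth_alg.bump smooth_alg.const smooth_alg.sin)
  show "f2 \<in> smooth_alg" unfolding f2_def[abs_def]
    by (intro smooth_alg.add smooth_alg.mult smooth_alg.bump smooth_alg.const smooth_alg.sin smooth_alg.cos)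
  show "(f has_real_derivative f1 x) (at x)" for x
    using bump_cos_deriv[of 0 a b c x] unfolding f_def f1_def by (simp add: numeral_2_eq_2)
  have b2: "((\<lambda>x. bump 2 (cos (a * x + b) - c)) has_real_derivative
      ((- 2) * bump 3 (cos (a * x + b) - c) + bump 4 (cos (a * x + b) - c)) * ((- a) * sin (a * x + b))) (at x)" for x
    using bump_cos_deriv[of 2 a b c x] by (simp add: eval_nat_numeral)
  show "(f1 has_real_derivative f2 x) (at x)" for x
  proof -
    have "((\<lambda>x. (- a) * sin (a * x + b)) has_real_derivative (- a * a) * cos (a * x + b)) (at x)"
      by (auto intro!: derivative_eq_intros)
    from DERIV_mult[OF b2 this] show ?thesis
      unfolding f1_def[abs_def] f2_def by (simp add: mult_ac)
  qed
  show "f x = 0 \<and> f1 x = 0 \<and> f2 x = 0" if "cos (a * x + b) \<le> c" for x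
    using that by (simp add: f_def f1_def f2_def)
qed

text \<open>The threshold \<open>cos (2 \<pi> \<rho>)\<close> singles out the points within \<rho>
  of an integer, and for \<open>|d| \<le> 1 - \<rho>\<close> only the integer 0 counts.\<close>

lemma cos_gt_iff:
  assumes "0 < \<rho>" "\<rho> < 1 / 2" "\<bar>d\<bar> \<le> 1 - \<rho>"
  shows "cos (2 * pi * d) > cos (2 * pi * \<rho>) \<longleftrightarrow> \<bar>d\<bar> < \<rho>"
proof -
  have e: "cos (2 * pi * d) = cos (2 * pi * \<bar>d\<bar>)" by (cases "d \<ge> 0") (simp_all add: abs_if)
  show ?thesis
  proof (cases "\<bar>d\<bar> \<le> 1 / 2")
    case True
    have "cos (2 * pi * \<rho>) < cos (2 * pi * \<bar>d\<bar>) \<longleftrightarrow> 2 * pi * \<bar>d\<bar> < 2 * pi * \<rho>"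
      by (rule cos_mono_less_eq) (use True assms in auto)
    then show ?thesis using e by simp
  next
    case False
    have "cos (2 * pi * \<bar>d\<bar>) = cos (2 * pi * (1 - \<bar>d\<bar>))"
      by (simp add: right_diff_distrib cos_diff)
    moreover have "cos (2 * pi * (1 - \<bar>d\<bar>)) \<le> cos (2 * pi * \<rho>)"
      by (rule cos_monotone_0_pi_le) (use False assms in auto)
    ultimately show ?thesis using e False assms by auto
  qed
qed

lemma Ck_on_2D:
  fixes u :: "complex \<Rightarrow> real"
  assumes "Ck_on 2 u S"
  shows "\<And>z. z \<in> S \<Longrightarrow> u differentiable (at z)" "\<And>z. z \<in> S \<Longrightarrow> partial_x u differentiable (at z)"
    "\<And>z. z \<in> S \<Longrightarrow> partial_y u differentiable (at z)"
    "continuous_on S (partial_x (partial_x u))" "continuous_on S (partial_y (partial_x u))"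
    "continuous_on S (partial_x (partial_y u))" "continuous_on S (partial_y (partial_y u))"
  using assms by (auto simp: numeral_2_eq_2)

lemma laplacian_continuous: "Ck_on 2 u S \<Longrightarrow> continuous_on S (laplacian u)" for u :: "complex \<Rightarrow> real"
  unfolding laplacian_def[abs_def] by (intro continuous_intros Ck_on_2D)

text \<open>The same linear maps are derivatives at \<open>z\<close> and at
  \<open>z + \<omega>\<close>, so the choice made by \<open>frechet_derivative\<close> agrees, also
  at points without a derivative.\<close>

lemma partials_shift:
  fixes u :: "complex \<Rightarrow> 'a::real_normed_vector"
  assumes "\<And>z. u (z + \<omega>) = u z"
  shows "partial_x u (z + \<omega>) = partial_x u z" "partial_y u (z + \<omega>) = partial_y u z"
proof -
  have "(u has_derivative D) (at (z + \<omega>)) \<longleftrightarrow> (u has_derivative D) (at z)" for D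
  proof
    assume "(u has_derivative D) (at (z + \<omega>))"
    moreover have "((\<lambda>z. z + \<omega>) has_derivative (\<lambda>h. h)) (at z)" by (auto intro!: derivative_eq_intros)
    ultimately have "(u \<circ> (\<lambda>z. z + \<omega>) has_derivative D \<circ> (\<lambda>h. h)) (at z)" by (intro diff_chain_at)
    then show "(u has_derivative D) (at z)" by (simp add: o_def assms)
  next
    assume "(u has_derivative D) (at z)"
    then have "(u has_derivative D) (at (z + \<omega> + (- \<omega>)))" by simp
    moreover have "((\<lambda>z. z + (- \<omega>)) has_derivative (\<lambda>h. h)) (at (z + \<omega>))" by (auto intro!: derivative_eq_intros)
    ultimately have "(u \<circ> (\<lambda>z. z + (- \<omega>)) has_derivative D \<circ> (\<lambda>h. h)) (at (z + \<omega>))" by (intro diff_chain_at)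
    moreover have "u (z + - \<omega>) = u z" for z using assms[of "z - \<omega>"] by simp
    ultimately show "(u has_derivative D) (at (z + \<omega>))" by (simp add: o_def)
  qed
  then have "frechet_derivative u (at (z + \<omega>)) = frechet_derivative u (at z)"
    by (simp add: frechet_derivative_def)
  then show "partial_x u (z + \<omega>) = partial_x u z" "partial_y u (z + \<omega>) = partial_y u z"
    by (simp_all add: partial_x_def partial_y_def)
qed

section \<open>From the weak to the pointwise curvature equation\<close>

context rect_lattice begin

lemma fund_domain_iff: "z \<in> fund_domain \<tau> \<longleftrightarrow> 0 \<le> Re z \<and> Re z < 1 \<and> 0 \<le> Im z \<and> Im z < Im \<tau>"
proof
  assume "z \<in> fund_domain \<tau>"
  then obtain s t where "z = of_real s + of_real t * \<tau>" "0 \<le> s" "s < 1" "0 \<le> t" "t < 1"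
    by (auto simp: fund_domain_def)
  then show "0 \<le> Re z \<and> Re z < 1 \<and> 0 \<le> Im z \<and> Im z < Im \<tau>" using Im_tau by simp
next
  assume "0 \<le> Re z \<and> Re z < 1 \<and> 0 \<le> Im z \<and> Im z < Im \<tau>"
  then show "z \<in> fund_domain \<tau>" unfolding fund_domain_def using Im_tau
    by (intro CollectI exI[of _ "Re z"] exI[of _ "Im z / Im \<tau>"]) (simp add: complex_eq_iff)
qed

lemma floor_reduce:
  obtains \<omega> where "\<omega> \<in> \<Lambda>" "\<omega> = of_int \<lfloor>Re z\<rfloor> + of_int \<lfloor>Im z / Im \<tau>\<rfloor> * \<tau>" "z - \<omega> \<in> fund_domain \<tau>"
proof -
  let ?\<omega> = "of_int \<lfloor>Re z\<rfloor> + of_int \<lfloor>Im z / Im \<tau>\<rfloor> * \<tau>"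
  have "of_int \<lfloor>Im z / Im \<tau>\<rfloor> * Im \<tau> \<le> Im z / Im \<tau> * Im \<tau>" "Im z / Im \<tau> * Im \<tau> < (of_int \<lfloor>Im z / Im \<tau>\<rfloor> + 1) * Im \<tau>"
    using Im_tau by (intro mult_right_mono mult_strict_right_mono; linarith)+
  then have "of_int \<lfloor>Im z / Im \<tau>\<rfloor> * Im \<tau> \<le> Im z" "Im z < of_int \<lfloor>Im z / Im \<tau>\<rfloor> * Im \<tau> + Im \<tau>"
    using Im_tau by (auto simp: algebra_simps)
  moreover have "of_int \<lfloor>Re z\<rfloor> \<le> Re z" "Re z < of_int \<lfloor>Re z\<rfloor> + 1" by linarith+
  ultimately have "z - ?\<omega> \<in> fund_domain \<tau>" unfolding fund_domain_iff by (simp; linarith)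
  moreover have "?\<omega> \<in> \<Lambda>" unfolding lattice_def by blast
  ultimately show ?thesis using that by blast
qed

text \<open>The fundamental lemma of the calculus of variations. If the left side were not 0 at
  \<open>z0\<close>, it would keep its sign near \<open>z0\<close>; a nonnegative test function
  concentrated there, after its Laplacian has been moved to \<open>u\<close>, would give a nonzero
  integral. Interior points come first because the support has to fit into the fundamental
  domain.\<close>

lemma liouville_interior:
  assumes sol: "curvature_solution n \<tau> p u"
    and z0: "0 < Re z0" "Re z0 < 1" "0 < Im z0" "Im z0 < Im \<tau>" "z0 \<notin> sing p"
  shows "laplacian u z0 + exp (u z0) = 0"
proof (rule ccontr)
  assume neq: "laplacian u z0 + exp (u z0) \<noteq> 0"
  define t where "t = Im \<tau>"
  have t: "t > 0" using Im_tau by (simp add: t_def)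
  define W where "W z = laplacian u z + exp (u z)" for z
  have C2: "Ck_on 2 u (- sing p)" using sol by (simp add: curvature_solution_def)
  note C = Ck_on_2D[OF C2]
  have ucont: "continuous_on (- sing p) u"
    by (rule continuous_at_imp_continuous_on) (use C(1) differentiable_imp_continuous_within in blast)
  have xcont: "continuous_on (- sing p) (partial_x u)" "continuous_on (- sing p) (partial_y u)"
    by (rule continuous_at_imp_continuous_on, use C(2,3) differentiable_imp_continuous_within in blast)+
  have Wcont: "continuous_on (- sing p) W" unfolding W_def
    by (intro continuous_intros laplacian_continuous C2 ucont)
  define \<epsilon> where "\<epsilon> = sgn (W z0)"
  define N where "N = (- sing p \<inter> (\<lambda>z. \<epsilon> * W z) -` {0<..}) \<inter> ({z. 0 < Re z} \<inter> {z. Re z < 1}) \<inter> ({z. 0 < Im z} \<inter> {z. Im z < t})"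
  have "open (- sing p \<inter> (\<lambda>z. \<epsilon> * W z) -` {0<..})"
    by (rule continuous_open_preimage[OF _ open_compl_sing]) (intro continuous_intros Wcont, simp)
  from open_Int[OF open_Int[OF this open_Int[OF open_halfspace_Re_gt open_halfspace_Re_lt]]
      open_Int[OF open_halfspace_Im_gt open_halfspace_Im_lt]]
  have N: "open N" unfolding N_def .
  have z0N: "z0 \<in> N" using z0 neq by (auto simp: N_def \<epsilon>_def W_def t_def sgn_mult_self_eq mult_sgn_abs zero_less_mult_iff sgn_if)
  obtain r where r: "r > 0" "ball z0 r \<subseteq> N" using N z0N open_contains_ball by blast
  \<comment> \<open>\<open>2 * \<rho> * (1 + t) < r\<close> keeps the rectangle around
    \<open>z0\<close> with half-sides \<open>2 * \<rho>\<close> and \<open>2 * \<rho> * t\<close>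
    inside the ball, and \<open>\<rho> \<le> 1 / 8\<close> leaves room between it and its
    translates.\<close>
  define \<rho> where "\<rho> = min (1 / 8) (r / (4 * (1 + t)))"
  have \<rho>: "\<rho> > 0" "\<rho> < 1 / 2" "2 * \<rho> * (1 + t) < r"
  proof -
    show "\<rho> > 0" "\<rho> < 1 / 2" using r t by (auto simp: \<rho>_def)
    have "2 * \<rho> * (1 + t) \<le> 2 * (r / (4 * (1 + t))) * (1 + t)" using t by (intro mult_right_mono mult_left_mono) (auto simp: \<rho>_def)
    also have "\<dots> = r / 2"
    proof -
      have "2 * (r / (4 * k)) * k = r / 2" if "k > 0" for k using that by simp
      from this[of "1 + t"] show ?thesis using t by (simp only: add_pos_pos zero_less_one)
    qed
    finally show "2 * \<rho> * (1 + t) < r" using r by simp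
  qed
  \<comment> \<open>The imaginary coordinate is divided by \<open>t\<close>, so that both
    coordinates have period 1.\<close>
  define x0 y0 where "x0 = Re z0" and "y0 = Im z0 / t"
  define K' where "K' = {z. \<bar>Re z - x0\<bar> < 2 * \<rho> \<and> \<bar>Im z / t - y0\<bar> < 2 * \<rho>}"
  define K where "K = cbox (Complex (x0 - \<rho>) ((y0 - \<rho>) * t)) (Complex (x0 + \<rho>) ((y0 + \<rho>) * t))"
  have K_iff: "z \<in> K \<longleftrightarrow> \<bar>Re z - x0\<bar> \<le> \<rho> \<and> \<bar>Im z / t - y0\<bar> \<le> \<rho>" for z
    using t by (auto simp: K_def in_cbox_complex_iff abs_le_iff field_simps)
  have "K' = (\<lambda>z. \<bar>Re z - x0\<bar>) -` {..<2 * \<rho>} \<inter> (\<lambda>z. \<bar>Im z / t - y0\<bar>) -` {..<2 * \<rho>}" by (auto simp: K'_def)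
  then have oK': "open K'" by (simp add: open_Int open_vimage continuous_intros t less_imp_neq[symmetric])
  have KK': "K \<subseteq> K'" using \<rho> by (auto simp: K_iff K'_def)
  have near: "z \<in> N" if "\<bar>Re z - x0\<bar> \<le> 2 * \<rho>" "\<bar>Im z / t - y0\<bar> \<le> 2 * \<rho>" for z
  proof -
    have "\<bar>Im z - Im z0\<bar> = \<bar>Im z / t - y0\<bar> * t" using t by (simp add: y0_def abs_mult flip: diff_divide_distrib)
    also have "\<dots> \<le> 2 * \<rho> * t" using that t by (intro mult_right_mono) auto
    finally have "norm (z0 - z) \<le> 2 * \<rho> + 2 * \<rho> * t"
      using cmod_le[of "z0 - z"] that by (simp add: x0_def abs_minus_commute)
    also have "\<dots> < r" using \<rho>(3) by (simp add: algebra_simps)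
    finally show ?thesis using r(2) by (auto simp: dist_norm)
  qed
  have K'N: "K' \<subseteq> N" using near by (auto simp: K'_def)
  have KN: "K \<subseteq> N" using KK' K'N by blast
  have NS: "N \<subseteq> - sing p" by (auto simp: N_def)
  have cK: "compact K" by (simp add: K_def)
  have x0b: "2 * \<rho> < x0" "x0 < 1 - 2 * \<rho>" "2 * \<rho> < y0" "y0 < 1 - 2 * \<rho>"
  proof -
    have "Complex (x0 - 2 * \<rho>) ((y0 - 2 * \<rho>) * t) \<in> N" "Complex (x0 + 2 * \<rho>) ((y0 + 2 * \<rho>) * t) \<in> N"
      using t \<rho> by (intro near; simp)+
    then show "2 * \<rho> < x0" "x0 < 1 - 2 * \<rho>" "2 * \<rho> < y0" "y0 < 1 - 2 * \<rho>"
      using t by (auto simp: N_def zero_less_mult_iff)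
  qed
  define c where "c = cos (2 * pi * \<rho>)"
  define f where "f = (\<lambda>x. bump 0 (cos (2 * pi * x + (- 2 * pi * x0)) - c))"
  define g where "g = (\<lambda>y. bump 0 (cos (2 * pi / t * y + (- 2 * pi * y0)) - c))"
  obtain f1 f2 where f': "\<And>x. (f has_real_derivative f1 x) (at x)" "\<And>x. (f1 has_real_derivative f2 x) (at x)"
    "f \<in> smooth_alg" "f1 \<in> smooth_alg" "f2 \<in> smooth_alg"
    "\<And>x. cos (2 * pi * x + (- 2 * pi * x0)) \<le> c \<Longrightarrow> f x = 0 \<and> f1 x = 0 \<and> f2 x = 0"
    by (rule bump_cos_twice[OF f_def]) (rule that)
  note f = f'(3,4,5,1,2,6)
  obtain g1 g2 where g': "\<And>x. (g has_real_derivative g1 x) (at x)" "\<And>x. (g1 has_real_derivative g2 x) (at x)"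
    "g \<in> smooth_alg" "g1 \<in> smooth_alg" "g2 \<in> smooth_alg"
    "\<And>x. cos (2 * pi / t * x + (- 2 * pi * y0)) \<le> c \<Longrightarrow> g x = 0 \<and> g1 x = 0 \<and> g2 x = 0"
    by (rule bump_cos_twice[OF g_def]) (rule that)
  note g = g'(3,4,5,1,2,6)
  define \<phi> where "\<phi> z = f (Re z) * g (Im z)" for z
  have dprod: "((\<lambda>z. F (Re z) * H (Im z)) has_derivative (\<lambda>h. (F' (Re z) * H (Im z)) * Re h + (F (Re z) * H' (Im z)) * Im h)) (at z)"
    if "\<And>x. (F has_real_derivative F' x) (at x)" "\<And>x. (H has_real_derivative H' x) (at x)" for F F' H H' z
    by (rule has_derivative_prod_Re_Im[OF that])
  have px: "partial_x \<phi> = (\<lambda>z. f1 (Re z) * g (Im z))" and py: "partial_y \<phi> = (\<lambda>z. f (Re z) * g1 (Im z))"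
    unfolding \<phi>_def[abs_def] using partials_eqI[OF dprod[OF f(4) g(4)]] by auto
  have pxx: "partial_x (partial_x \<phi>) = (\<lambda>z. f2 (Re z) * g (Im z))" and pyy: "partial_y (partial_y \<phi>) = (\<lambda>z. f (Re z) * g2 (Im z))"
    unfolding px py using partials_eqI[OF dprod[OF f(5) g(4)]] partials_eqI[OF dprod[OF f(4) g(5)]] by auto
  have lap: "laplacian \<phi> z = f2 (Re z) * g (Im z) + f (Re z) * g2 (Im z)" for z
    by (simp add: laplacian_def pxx pyy)
  have cont: "continuous_on A (\<lambda>z. F (Re z) * H (Im z))" if "\<And>x. (F has_real_derivative F' x) (at x)" "\<And>x. (H has_real_derivative H' x) (at x)" for A F F' H H'
    by (rule continuous_at_imp_continuous_on, intro ballI) (rule has_derivative_continuous[OF dprod[OF that]])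
  obtain f3 where f3: "\<And>x. (f2 has_real_derivative f3 x) (at x)" using smooth_alg_deriv[OF f(3)] by blast
  obtain g3 where g3: "\<And>x. (g2 has_real_derivative g3 x) (at x)" using smooth_alg_deriv[OF g(3)] by blast
  have cos_f: "cos (2 * pi * x + (- 2 * pi * x0)) > c \<longleftrightarrow> \<bar>x - x0\<bar> < \<rho>" if "\<bar>x - x0\<bar> \<le> 1 - \<rho>" for x
    using cos_gt_iff[OF \<rho>(1,2) that] by (simp add: c_def algebra_simps)
  have cos_g: "cos (2 * pi / t * y + (- 2 * pi * y0)) > c \<longleftrightarrow> \<bar>y / t - y0\<bar> < \<rho>" if "\<bar>y / t - y0\<bar> \<le> 1 - \<rho>" for y
    using cos_gt_iff[OF \<rho>(1,2) that] by (simp add: c_def algebra_simps)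
  \<comment> \<open>Within one period around \<open>z0\<close> the test function and the derivatives
    that occur vanish outside \<open>K\<close>, since one of the two factors does so together with
    its derivatives.\<close>
  have off: "(f (Re z) = 0 \<and> f1 (Re z) = 0 \<and> f2 (Re z) = 0) \<or> (g (Im z) = 0 \<and> g1 (Im z) = 0 \<and> g2 (Im z) = 0)"
    if "\<bar>Re z - x0\<bar> \<le> 1 - \<rho>" "\<bar>Im z / t - y0\<bar> \<le> 1 - \<rho>" "z \<notin> K" for z
  proof -
    have "\<not> \<bar>Re z - x0\<bar> < \<rho> \<or> \<not> \<bar>Im z / t - y0\<bar> < \<rho>" using that(3) by (auto simp: K_iff)
    then show ?thesis
    proof
      assume "\<not> \<bar>Re z - x0\<bar> < \<rho>"
      then have "\<not> c < cos (2 * pi * Re z + (- 2 * pi * x0))" using cos_f[OF that(1)] by blast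
      then have "cos (2 * pi * Re z + (- 2 * pi * x0)) \<le> c" by (rule leI)
      then show ?thesis by (intro disjI1 f(6))
    next
      assume "\<not> \<bar>Im z / t - y0\<bar> < \<rho>"
      then have "\<not> c < cos (2 * pi / t * Im z + (- 2 * pi * y0))" using cos_g[OF that(2)] by blast
      then have "cos (2 * pi / t * Im z + (- 2 * pi * y0)) \<le> c" by (rule leI)
      then show ?thesis by (intro disjI2 g(6))
    qed
  qed
  have in_F: "\<bar>Re z - x0\<bar> \<le> 1 - \<rho>" "\<bar>Im z / t - y0\<bar> \<le> 1 - \<rho>" if "z \<in> fund_domain \<tau>" for z
  proof -
    have "0 \<le> Re z" "Re z < 1" "0 \<le> Im z / t" "Im z / t < 1" using that t by (auto simp: fund_domain_iff t_def)
    then show "\<bar>Re z - x0\<bar> \<le> 1 - \<rho>" "\<bar>Im z / t - y0\<bar> \<le> 1 - \<rho>" using x0b \<rho> by (auto simp: abs_le_iff)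
  qed
  have in_K': "\<bar>Re z - x0\<bar> \<le> 1 - \<rho>" "\<bar>Im z / t - y0\<bar> \<le> 1 - \<rho>" if "z \<in> K'" for z
  proof -
    have "\<rho> \<le> 1 / 8" unfolding \<rho>_def by (rule min.cobounded1)
    then show "\<bar>Re z - x0\<bar> \<le> 1 - \<rho>" "\<bar>Im z / t - y0\<bar> \<le> 1 - \<rho>" using that by (auto simp: K'_def)
  qed
  have per1: "\<phi> (z + (of_int a + of_int b * \<tau>)) = \<phi> z" for z a b
  proof -
    have cp: "cos (v + 2 * pi * of_int m) = cos v" for v :: real and m :: int
      by (simp add: cos_add)
    have c1: "cos (2 * pi * (x + of_int a) + k) = cos (2 * pi * x + k)" for x k
      using cp[of "2 * pi * x + k" a] by (simp add: algebra_simps)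
    have c2: "cos (2 * pi / t * (x + of_int b * t) + k) = cos (2 * pi / t * x + k)" for x k
    proof -
      have "2 * pi / t * (x + of_int b * t) + k = (2 * pi / t * x + k) + 2 * pi * of_int b" using t by (simp add: field_simps)
      then show ?thesis by (simp only: cp)
    qed
    have "Re (z + (of_int a + of_int b * \<tau>)) = Re z + of_int a" "Im (z + (of_int a + of_int b * \<tau>)) = Im z + of_int b * t"
      by (simp_all add: t_def)
    then show ?thesis unfolding \<phi>_def f_def g_def by (simp only: c1 c2)
  qed
  have per: "lattice_periodic \<tau> \<phi>"
    unfolding lattice_periodic_def lattice_def using per1 by auto
  have smooth: "\<forall>k. Ck_on k \<phi> UNIV" unfolding \<phi>_def[abs_def] using Ck_smooth_prod[OF f(1) g(1)] by blast
  \<comment> \<open>\<open>K\<close> avoids the singular set, so the Dirac terms of the weak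
    equation drop out.\<close>
  have \<phi>0: "\<phi> s = 0" if s: "s \<in> sing p" for s
  proof -
    obtain \<omega> where \<omega>: "\<omega> \<in> \<Lambda>" "s - \<omega> \<in> fund_domain \<tau>" by (rule floor_reduce) (rule that)
    have "s - \<omega> \<in> sing p" using sing_periodic[of "- \<omega>" s p] \<omega> s by simp
    then have "s - \<omega> \<notin> K" using KN NS by blast
    then have "\<phi> (s - \<omega>) = 0" using off[OF in_F[OF \<omega>(2)]] by (auto simp: \<phi>_def)
    moreover have "\<phi> (s - \<omega> + \<omega>) = \<phi> (s - \<omega>)" using per \<omega>(1) unfolding lattice_periodic_def by blast
    ultimately show ?thesis by simp
  qed
  have weak: "(LINT z:fund_domain \<tau>|lborel. u z * laplacian \<phi> z + exp (u z) * \<phi> z) = 0"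
  proof -
    have "0 \<in> sing p" "p \<in> sing p" "- p \<in> sing p" by (auto simp: sing_set_def)
    then have z: "\<phi> 0 = 0" "\<phi> p = 0" "\<phi> (- p) = 0" using \<phi>0 by blast+
    have "(LINT z:fund_domain \<tau>|lborel. u z * laplacian \<phi> z + exp (u z) * \<phi> z) =
        8 * pi * real n * \<phi> 0 + 4 * pi * (\<phi> p + \<phi> (- p))"
      using sol per smooth unfolding curvature_solution_def by blast
    then show ?thesis unfolding z by simp
  qed
  have KF: "K \<subseteq> fund_domain \<tau>"
  proof
    fix z assume "z \<in> K"
    then have "z \<in> N" using KN by blast
    then show "z \<in> fund_domain \<tau>" by (simp add: N_def fund_domain_iff t_def)
  qed
  have weakK: "(LINT z|lborel. indicator K z *\<^sub>R (u z * laplacian \<phi> z + exp (u z) * \<phi> z)) = 0"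
  proof -
    have "indicator K z *\<^sub>R (u z * laplacian \<phi> z + exp (u z) * \<phi> z) = indicator (fund_domain \<tau>) z *\<^sub>R (u z * laplacian \<phi> z + exp (u z) * \<phi> z)" for z
    proof (cases "z \<in> fund_domain \<tau> \<and> z \<notin> K")
      case True
      then have F: "z \<in> fund_domain \<tau>" "z \<notin> K" by blast+
      show ?thesis using off[OF in_F[OF F(1)] F(2)] by (auto simp: lap \<phi>_def)
    next
      case False
      then have "z \<in> K \<longleftrightarrow> z \<in> fund_domain \<tau>" using KF by blast
      then show ?thesis by (simp add: indicator_def)
    qed
    then show ?thesis using weak unfolding set_lebesgue_integral_def by (simp only:)
  qed
  have KS: "K \<subseteq> - sing p" using KN NS by blast
  note ck = continuous_on_subset[OF _ KS]
  \<comment> \<open>Green's identity: \<open>gx + gy = u \<Delta>\<phi> - \<phi> \<Delta>u\<close>,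
    where \<open>gx\<close> is the x-derivative of \<open>u \<phi>_x - \<phi> u_x\<close> and
    \<open>gy\<close> the analogous y-derivative. Each of them has integral 0.\<close>
  define gx where "gx z = u z * (f2 (Re z) * g (Im z)) - \<phi> z * partial_x (partial_x u) z" for z
  define gy where "gy z = u z * (f (Re z) * g2 (Im z)) - \<phi> z * partial_y (partial_y u) z" for z
  have \<phi>c: "continuous_on A \<phi>" for A unfolding \<phi>_def[abs_def] by (rule cont[OF f(4) g(4)])
  have gxc: "continuous_on K gx" unfolding gx_def[abs_def]
    by (intro continuous_intros ck[OF ucont] ck[OF C(4)] \<phi>c cont[OF f3 g(4)])
  have gyc: "continuous_on K gy" unfolding gy_def[abs_def]
    by (intro continuous_intros ck[OF ucont] ck[OF C(7)] \<phi>c cont[OF f(4) g3])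
  have K'S: "K' \<subseteq> - sing p" using K'N NS by blast
  have Ix: "(LINT z|lborel. indicator K z *\<^sub>R gx z) = 0"
  proof (rule integral_compact_support_derivative[OF cK oK' KK', where d = 1 and G = "\<lambda>z. u z * (f1 (Re z) * g (Im z)) - \<phi> z * partial_x u z"])
    fix z assume z: "z \<in> K'"
    then have zS: "z \<in> - sing p" using K'S by blast
    have L: "((\<lambda>s. F (z + of_real s * 1)) has_real_derivative a) (at 0)"
      if "(F has_derivative (\<lambda>h. a * Re h + b * Im h)) (at z)" for F a b
      using line_derivative[of F a b z 0 1] that by simp
    show "((\<lambda>s. u (z + of_real s * 1) * (f1 (Re (z + of_real s * 1)) * g (Im (z + of_real s * 1))) - \<phi> (z + of_real s * 1) * partial_x u (z + of_real s * 1))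
       has_real_derivative gx z) (at 0)"
      using DERIV_diff[OF DERIV_mult[OF L[OF has_derivative_partials[OF C(1)[OF zS]]] L[OF dprod[OF f(5) g(4)]]]
          DERIV_mult[OF L[OF dprod[OF f(4) g(4), folded \<phi>_def]] L[OF has_derivative_partials[OF C(2)[OF zS]]]]]
      by (simp add: gx_def mult_ac)
  next
    show "continuous_on K (\<lambda>z. u z * (f1 (Re z) * g (Im z)) - \<phi> z * partial_x u z)"
      by (intro continuous_intros ck[OF ucont] ck[OF xcont(1)] \<phi>c cont[OF f(5) g(4)])
    show "u z * (f1 (Re z) * g (Im z)) - \<phi> z * partial_x u z = 0 \<and> gx z = 0" if "z \<in> K'" "z \<notin> K" for z
      using off[OF in_K'[OF that(1)] that(2)] by (auto simp: gx_def \<phi>_def)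
  qed (rule gxc)
  have Iy: "(LINT z|lborel. indicator K z *\<^sub>R gy z) = 0"
  proof (rule integral_compact_support_derivative[OF cK oK' KK', where d = \<i> and G = "\<lambda>z. u z * (f (Re z) * g1 (Im z)) - \<phi> z * partial_y u z"])
    fix z assume z: "z \<in> K'"
    then have zS: "z \<in> - sing p" using K'S by blast
    have L: "((\<lambda>s. F (z + of_real s * \<i>)) has_real_derivative b) (at 0)"
      if "(F has_derivative (\<lambda>h. a * Re h + b * Im h)) (at z)" for F a b
      using line_derivative[of F a b z 0 \<i>] that by simp
    show "((\<lambda>s. u (z + of_real s * \<i>) * (f (Re (z + of_real s * \<i>)) * g1 (Im (z + of_real s * \<i>))) - \<phi> (z + of_real s * \<i>) * partial_y u (z + of_real s * \<i>))
       has_real_derivative gy z) (at 0)"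
      using DERIV_diff[OF DERIV_mult[OF L[OF has_derivative_partials[OF C(1)[OF zS]]] L[OF dprod[OF f(4) g(5)]]]
          DERIV_mult[OF L[OF dprod[OF f(4) g(4), folded \<phi>_def]] L[OF has_derivative_partials[OF C(3)[OF zS]]]]]
      by (simp add: gy_def mult_ac)
  next
    show "continuous_on K (\<lambda>z. u z * (f (Re z) * g1 (Im z)) - \<phi> z * partial_y u z)"
      by (intro continuous_intros ck[OF ucont] ck[OF xcont(2)] \<phi>c cont[OF f(4) g(5)])
    show "u z * (f (Re z) * g1 (Im z)) - \<phi> z * partial_y u z = 0 \<and> gy z = 0" if "z \<in> K'" "z \<notin> K" for z
      using off[OF in_K'[OF that(1)] that(2)] by (auto simp: gy_def \<phi>_def)
  qed (rule gyc)
  have int: "integrable lborel (\<lambda>z. indicator K z *\<^sub>R F z)" if "continuous_on K F" for F :: "complex \<Rightarrow> real"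
    by (rule borel_integrable_compact[OF cK that])
  have lc: "continuous_on K (\<lambda>z. u z * laplacian \<phi> z + exp (u z) * \<phi> z)"
    unfolding lap by (intro continuous_intros ck[OF ucont] \<phi>c cont[OF f3 g(4)] cont[OF f(4) g3])
  have W_eq: "W z = partial_x (partial_x u) z + partial_y (partial_y u) z + exp (u z)" for z
    by (simp add: W_def laplacian_def)
  have "(LINT z|lborel. indicator K z *\<^sub>R (\<phi> z * W z)) =
    (LINT z|lborel. indicator K z *\<^sub>R (u z * laplacian \<phi> z + exp (u z) * \<phi> z) - (indicator K z *\<^sub>R gx z + indicator K z *\<^sub>R gy z))"
    by (rule Bochner_Integration.integral_cong[OF refl])
       (simp add: lap gx_def gy_def W_eq indicator_def algebra_simps)
  also have "\<dots> = 0"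
    using weakK Ix Iy int[OF lc] int[OF gxc] int[OF gyc] by simp
  finally have "(LINT z|lborel. \<epsilon> * (indicator K z *\<^sub>R (\<phi> z * W z))) = 0" by simp
  then have I0: "(LINT z|lborel. indicator K z *\<^sub>R (\<phi> z * (\<epsilon> * W z))) = 0" by (simp add: mult_ac)
  have \<phi>nn: "\<phi> z \<ge> 0" for z by (simp add: \<phi>_def f_def g_def bump_nonneg)
  have WK: "\<epsilon> * W z > 0" if "z \<in> K" for z
  proof -
    have "z \<in> N" using that KN by blast
    then show ?thesis by (simp add: N_def)
  qed
  have "AE z in lborel. indicator K z *\<^sub>R (\<phi> z * (\<epsilon> * W z)) = 0"
  proof (rule integral_nonneg_eq_0_iff_AE[THEN iffD1, OF _ _ I0])
    show "integrable lborel (\<lambda>z. indicator K z *\<^sub>R (\<phi> z * (\<epsilon> * W z)))"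
      by (intro int continuous_intros \<phi>c ck[OF Wcont])
    show "AE z in lborel. 0 \<le> indicator K z *\<^sub>R (\<phi> z * (\<epsilon> * W z))"
    proof (rule AE_I2)
      fix z
      show "0 \<le> indicator K z *\<^sub>R (\<phi> z * (\<epsilon> * W z))"
      proof (cases "z \<in> K")
        case True
        then show ?thesis using mult_nonneg_nonneg[OF \<phi>nn[of z] less_imp_le[OF WK[OF True]]] by simp
      qed simp
    qed
  qed
  moreover have "indicator K z *\<^sub>R (\<phi> z * (\<epsilon> * W z)) \<noteq> 0" if "\<bar>Re z - x0\<bar> < \<rho> \<and> \<bar>Im z / t - y0\<bar> < \<rho>" for z
  proof -
    have zK: "z \<in> K" using that by (auto simp: K_iff)
    have zK': "z \<in> K'" using zK KK' by blast
    have "f (Re z) > 0" "g (Im z) > 0"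
      using that cos_f[OF in_K'(1)[OF zK']] cos_g[OF in_K'(2)[OF zK']] by (auto simp: f_def g_def bump_pos)
    then have "\<phi> z > 0" by (simp add: \<phi>_def)
    then show ?thesis using zK WK[OF zK] by (auto simp: indicator_def)
  qed
  ultimately have "AE z in lborel. z \<notin> {z. \<bar>Re z - x0\<bar> < \<rho> \<and> \<bar>Im z / t - y0\<bar> < \<rho>}"
    by (auto elim!: eventually_mono)
  moreover have oU: "open {z. \<bar>Re z - x0\<bar> < \<rho> \<and> \<bar>Im z / t - y0\<bar> < \<rho>}" (is "open ?U")
  proof -
    have "?U = (\<lambda>z. \<bar>Re z - x0\<bar>) -` {..<\<rho>} \<inter> (\<lambda>z. \<bar>Im z / t - y0\<bar>) -` {..<\<rho>}" by auto
    then show ?thesis by (simp add: open_Int open_vimage continuous_intros t less_imp_neq[symmetric])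
  qed
  ultimately have "?U \<in> null_sets lborel"
    by (subst AE_iff_null_sets) auto
  then have "negligible ?U" using null_sets_completionI negligible_iff_null_sets by blast
  moreover have "z0 \<in> ?U" using \<rho> by (simp add: x0_def y0_def)
  ultimately show False using open_not_negligible[OF oU] by blast
qed

text \<open>Each point has a translate in the half-open fundamental domain, possibly on its
  boundary. A small step in the direction \<open>1 + \<tau>\<close> leads into the interior, and the
  residual of the equation is continuous and periodic.\<close>

lemma liouville_pointwise:
  assumes sol: "curvature_solution n \<tau> p u" and z: "z \<notin> sing p"
  shows "laplacian u z = - exp (u z)"
proof -
  have per: "u (z + \<omega>) = u z" if "\<omega> \<in> \<Lambda>" for z \<omega>
    using sol that by (auto simp: curvature_solution_def lattice_periodic_def)
  have C2: "Ck_on 2 u (- sing p)" using sol by (simp add: curvature_solution_def)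
  define W where "W z = laplacian u z + exp (u z)" for z
  have lper: "W (z + \<omega>) = W z" if "\<omega> \<in> \<Lambda>" for z \<omega>
  proof -
    have "partial_x (partial_x u) (z + \<omega>) = partial_x (partial_x u) z"
      "partial_y (partial_y u) (z + \<omega>) = partial_y (partial_y u) z"
      by (rule partials_shift, rule partials_shift, rule per[OF that])+
    then show ?thesis using per[OF that] by (simp add: W_def laplacian_def)
  qed
  have ucont: "continuous_on (- sing p) u"
    by (rule continuous_at_imp_continuous_on) (use Ck_on_2D[OF C2] differentiable_imp_continuous_within in blast)
  have "continuous_on (- sing p) W" unfolding W_def
    by (intro continuous_intros laplacian_continuous C2 ucont)
  then have Wc: "isCont W z" using z open_compl_sing continuous_on_eq_continuous_at by blast
  obtain \<omega> where \<omega>: "\<omega> \<in> \<Lambda>" "z - \<omega> \<in> fund_domain \<tau>" by (rule floor_reduce) (rule that)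
  have l: "((\<lambda>s::real. z + of_real s * (1 + \<tau>)) \<longlongrightarrow> z) (at_right 0)"
  proof -
    have "((\<lambda>s::real. z + of_real s * (1 + \<tau>)) \<longlongrightarrow> z + of_real 0 * (1 + \<tau>)) (at_right 0)" by (intro tendsto_intros)
    then show ?thesis by simp
  qed
  have lim1: "((\<lambda>s::real. W (z + of_real s * (1 + \<tau>))) \<longlongrightarrow> W z) (at_right 0)"
    by (rule isCont_tendsto_compose[OF Wc l])
  define b where "b = min (1 - Re (z - \<omega>)) ((Im \<tau> - Im (z - \<omega>)) / Im \<tau>)"
  have b: "b > 0" using \<omega>(2) Im_tau by (simp add: b_def fund_domain_iff)
  have "\<forall>\<^sub>F s in at_right 0. z + of_real s * (1 + \<tau>) \<in> - sing p"
    by (rule topological_tendstoD[OF l open_compl_sing]) (use z in simp)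
  moreover have "\<forall>\<^sub>F s in at_right 0. s \<in> {0<..<b}" by (rule eventually_at_right_real[OF b])
  ultimately have lim2: "\<forall>\<^sub>F s in at_right 0. W (z + of_real s * (1 + \<tau>)) = 0"
  proof eventually_elim
    case (elim s)
    let ?w = "z - \<omega> + of_real s * (1 + \<tau>)"
    have s: "0 < s" "s < 1 - Re (z - \<omega>)" "s * Im \<tau> < Im \<tau> - Im (z - \<omega>)"
      using elim Im_tau by (auto simp: b_def field_simps)
    have "?w \<notin> sing p" using sing_periodic[of "- \<omega>" "z + of_real s * (1 + \<tau>)" p] \<omega>(1) elim by (simp add: algebra_simps)
    moreover have "0 < Re ?w" "Re ?w < 1" "0 < Im ?w" "Im ?w < Im \<tau>"
      using s \<omega>(2) Im_tau by (auto simp: fund_domain_iff intro: add_nonneg_pos)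
    ultimately have "W ?w = 0" unfolding W_def by (intro liouville_interior[OF sol])
    then show ?case using lper[OF \<omega>(1), of ?w] by simp
  qed
  have "W z = 0"
    by (rule tendsto_unique[OF trivial_limit_at_right_real lim1 tendsto_eventually[OF lim2]])
  then show ?thesis by (simp add: W_def)
qed

end

section \<open>The metric as a Hermitian form in solutions\<close>

lemma real_holomorphic_deriv_0:
  fixes f :: "complex \<Rightarrow> complex"
  assumes D: "(f has_field_derivative D) (at z)" and S: "open S" "z \<in> S"
    and re: "\<And>w. w \<in> S \<Longrightarrow> f w \<in> \<real>"
  shows "D = 0"
proof -
  have "((\<lambda>w. Im (f w)) has_derivative (\<lambda>h. Im (D * h))) (at z)"
    by (rule has_derivative_Im) (use D in \<open>simp add: has_field_derivative_def\<close>)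
  moreover have "((\<lambda>w. Im (f w)) has_derivative (\<lambda>h. 0)) (at z)"
    by (rule has_derivative_transform_within_open[OF has_derivative_const[of 0] S])
       (use re in \<open>simp add: complex_is_Real_iff\<close>)
  ultimately have "(\<lambda>h. Im (D * h)) = (\<lambda>h. 0)" by (rule has_derivative_unique)
  then have "Im (D * 1) = 0" "Im (D * \<i>) = 0" by meson+
  then show ?thesis by (simp add: complex_eq_iff)
qed

text \<open>The conjugate derivative of \<open>u_z\<close> is a quarter of the Laplacian; equality
  of the mixed partials removes its imaginary part.\<close>

lemma wirtinger_real_derivs:
  fixes u :: "complex \<Rightarrow> real"
  assumes S: "open S" "z \<in> S" and C2: "Ck_on 2 u S"
  defines "a \<equiv> dz u"
  shows "((\<lambda>w. complex_of_real (u w)) has_derivative (\<lambda>h. a z * h + cnj (a z) * cnj h)) (at z)"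
    "(a has_derivative (\<lambda>h. wirtinger a z * h + of_real (laplacian u z / 4) * cnj h)) (at z)"
proof -
  note C = Ck_on_2D[OF C2]
  define b where "b z = 1 / 2 * (complex_of_real (partial_x u z) - \<i> * of_real (partial_y u z))" for z
  have 1: "((\<lambda>w. complex_of_real (u w)) has_derivative (\<lambda>h. b z * h + cnj (b z) * cnj h)) (at z)" if "z \<in> S" for z
  proof -
    have "((\<lambda>w. complex_of_real (u w)) has_derivative
        (\<lambda>h. complex_of_real (partial_x u z * Re h + partial_y u z * Im h))) (at z)"
      by (intro has_derivative_of_real has_derivative_partials C(1)[OF that])
    also have "(\<lambda>h. complex_of_real (partial_x u z * Re h + partial_y u z * Im h)) = (\<lambda>h. b z * h + cnj (b z) * cnj h)"
      by (simp add: fun_eq_iff b_def complex_eq_iff field_simps)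
    finally show ?thesis .
  qed
  have ab: "a z = b z" if "z \<in> S" for z unfolding a_def by (rule wirtinger_eqI(3)[OF 1[OF that]])
  show "((\<lambda>w. complex_of_real (u w)) has_derivative (\<lambda>h. a z * h + cnj (a z) * cnj h)) (at z)"
    using 1[OF S(2)] ab[OF S(2)] by simp
  have mix: "partial_x (partial_y u) z = partial_y (partial_x u) z"
    by (rule mixed_partials[OF S]) (use C in auto)
  define A where "A = (complex_of_real (partial_x (partial_x u) z) - of_real (partial_y (partial_y u) z)
     - 2 * \<i> * of_real (partial_y (partial_x u) z)) / 4"
  have "(b has_derivative (\<lambda>h. 1 / 2 * (of_real (partial_x (partial_x u) z * Re h + partial_y (partial_x u) z * Im h)
      - \<i> * of_real (partial_x (partial_y u) z * Re h + partial_y (partial_y u) z * Im h)))) (at z)"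
    unfolding b_def[abs_def] using has_derivative_partials[OF C(2)[OF S(2)]] has_derivative_partials[OF C(3)[OF S(2)]]
    by (intro has_derivative_diff has_derivative_mult_right has_derivative_of_real)
  also have "(\<lambda>h. 1 / 2 * (of_real (partial_x (partial_x u) z * Re h + partial_y (partial_x u) z * Im h)
      - \<i> * of_real (partial_x (partial_y u) z * Re h + partial_y (partial_y u) z * Im h)))
    = (\<lambda>h. A * h + of_real (laplacian u z / 4) * cnj h)"
    by (simp add: fun_eq_iff A_def mix laplacian_def complex_eq_iff field_simps)
  finally have "(b has_derivative (\<lambda>h. A * h + of_real (laplacian u z / 4) * cnj h)) (at z)" .
  then have d: "(a has_derivative (\<lambda>h. A * h + of_real (laplacian u z / 4) * cnj h)) (at z)"
    by (rule has_derivative_transform_within_open[OF _ S]) (simp add: ab)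
  then show "(a has_derivative (\<lambda>h. wirtinger a z * h + of_real (laplacian u z / 4) * cnj h)) (at z)"
    unfolding wirtinger_eqI(3)[OF d] .
qed

text \<open>For this \<open>v\<close> the definition of \<open>q\<close> becomes the linear equation
  \<open>v_zz = q v\<close>, and the curvature equation says that \<open>v\<close> times its mixed
  derivative \<open>N\<close> is \<open>|v_z|\<^sup>2 + 1\<close>. The factor \<open>sqrt 8\<close>
  makes the constant 1, through \<open>v\<^sup>2 exp u = 8\<close>.\<close>

lemma curvature_herm_derivs:
  fixes u :: "complex \<Rightarrow> real"
  assumes S: "open S" "z \<in> S" and C2: "Ck_on 2 u S"
    and lap: "\<And>z. z \<in> S \<Longrightarrow> laplacian u z = - exp (u z)" and q: "\<And>z. z \<in> S \<Longrightarrow> q_of u z = q z"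
  defines "v \<equiv> \<lambda>z. sqrt 8 * exp (- u z / 2)"
  obtains N where "((\<lambda>w. complex_of_real (v w)) has_derivative (\<lambda>h. dz v z * h + cnj (dz v z) * cnj h)) (at z)"
    "(dz v has_derivative (\<lambda>h. of_real (v z) * q z * h + of_real N * cnj h)) (at z)"
    "v z * N = (cmod (dz v z))\<^sup>2 + 1"
proof -
  define a where "a = dz u"
  note D = wirtinger_real_derivs[OF S(1) _ C2, folded a_def]
  have vd: "((\<lambda>w. complex_of_real (v w)) has_derivative (\<lambda>h. - of_real (v z) / 2 * a z * h + cnj (- of_real (v z) / 2 * a z) * cnj h)) (at z)"
    if z: "z \<in> S" for z
  proof -
    have "(exp has_derivative (*) (exp (- (1 / 2) * complex_of_real (u z)))) (at (- (1 / 2) * complex_of_real (u z)))"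
      using DERIV_exp by (simp only: has_field_derivative_def)
    from has_derivative_mult_right[OF has_derivative_compose[OF has_derivative_mult_right[OF D(1)[OF z]] this], of "of_real (sqrt 8)"]
    have "((\<lambda>w. of_real (sqrt 8) * exp (- (1 / 2) * complex_of_real (u w))) has_derivative
      (\<lambda>h. of_real (sqrt 8) * (exp (- (1 / 2) * complex_of_real (u z)) * (- (1 / 2) * (a z * h + cnj (a z) * cnj h))))) (at z)" .
    moreover have ex: "of_real (sqrt 8) * exp (- (1 / 2) * complex_of_real (u w)) = of_real (v w)" for w
      using exp_of_real[of "- u w / 2", where 'a=complex] by (simp add: v_def)
    ultimately show ?thesis by (simp only: ex mult.assoc[symmetric]) (simp add: algebra_simps)
  qed
  have P: "dz v z = - of_real (v z) / 2 * a z" if "z \<in> S" for z by (rule wirtinger_eqI(3)[OF vd[OF that]])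
  have 1: "((\<lambda>w. complex_of_real (v w)) has_derivative (\<lambda>h. dz v z * h + cnj (dz v z) * cnj h)) (at z)"
    using vd[OF S(2)] unfolding P[OF S(2)] .
  define N where "N = v z / 4 * (cmod (a z))\<^sup>2 + 1 / v z"
  have v0: "v z > 0" by (simp add: v_def)
  have "exp (- u z / 2) * exp (- u z / 2) * exp (u z) = exp (- u z / 2 + - u z / 2 + u z)"
    by (simp only: exp_add)
  then have v2: "(v z)\<^sup>2 * exp (u z) = 8" by (simp add: v_def power_mult_distrib) (simp add: power2_eq_square)
  then have vE: "v z * exp (u z) / 8 = 1 / v z" using v0 by (simp add: field_simps power2_eq_square)
  have A: "wirtinger a z = (a z)\<^sup>2 / 2 - 2 * q z"
    using q[OF S(2)] unfolding q_of_def Let_def a_def[symmetric] by (simp add: algebra_simps)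
  have E: "of_real (laplacian u z / 4) = - complex_of_real (exp (u z)) / 4" using lap[OF S(2)] by simp
  have "((\<lambda>w. - (1 / 2) * of_real (v w) * a w) has_derivative
     (\<lambda>h. - (1 / 2) * of_real (v z) * (wirtinger a z * h + of_real (laplacian u z / 4) * cnj h)
        + - (1 / 2) * (dz v z * h + cnj (dz v z) * cnj h) * a z)) (at z)"
    by (intro has_derivative_mult has_derivative_mult_right 1 D(2)[OF S(2)])
  also have "(\<lambda>h. - (1 / 2) * of_real (v z) * (wirtinger a z * h + of_real (laplacian u z / 4) * cnj h)
        + - (1 / 2) * (dz v z * h + cnj (dz v z) * cnj h) * a z) = (\<lambda>h. of_real (v z) * q z * h + of_real N * cnj h)"
  proof -
    have "complex_of_real N = of_real (v z) / 4 * (a z * cnj (a z)) + of_real (v z * exp (u z) / 8)"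
      unfolding N_def vE mult_cnj_eq_norm_sq by simp
    then show ?thesis unfolding P[OF S(2)] A E by (simp add: fun_eq_iff power2_eq_square algebra_simps)
  qed
  finally have 2: "(dz v has_derivative (\<lambda>h. of_real (v z) * q z * h + of_real N * cnj h)) (at z)"
    by (rule has_derivative_transform_within_open[OF _ S]) (simp add: P)
  have "v z * N = (cmod (dz v z))\<^sup>2 + 1"
    using v0 unfolding P[OF S(2)] N_def by (simp add: norm_mult norm_divide power2_eq_square field_simps)
  then show ?thesis using that 1 2 by blast
qed

lemma herm_solI_scaled:
  assumes S: "open S" and fg: "ode_sol Q S f" "ode_sol Q S g" and om: "\<omega> > 0"
    and W: "\<And>z. z \<in> S \<Longrightarrow> wronskian f g z = of_real \<omega>"
    and V: "\<And>z. z \<in> S \<Longrightarrow> \<omega> * V z = (cmod (f z))\<^sup>2 + (cmod (g z))\<^sup>2"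
  shows "herm_sol Q V S"
  unfolding herm_sol_def
proof
  fix z assume "z \<in> S"
  then obtain r where r: "r > 0" "ball z r \<subseteq> S" using S open_contains_ball by blast
  define k where "k = complex_of_real (1 / sqrt \<omega>)"
  have k2: "k * k * of_real \<omega> = 1" "(cmod k)\<^sup>2 = 1 / \<omega>" using om
    by (auto simp: k_def power2_eq_square norm_divide simp flip: of_real_mult)
  define F G where "F w = k * f w" and "G w = k * g w" for w
  have F: "ode_sol Q S F" and Fd: "\<And>w. w \<in> S \<Longrightarrow> deriv F w = k * deriv f w"
    using ode_sol_lincomb[OF fg(1) fg(1) S, where a = k and b = 0] by (auto simp: F_def[abs_def])
  have G: "ode_sol Q S G" and Gd: "\<And>w. w \<in> S \<Longrightarrow> deriv G w = k * deriv g w"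
    using ode_sol_lincomb[OF fg(2) fg(2) S, where a = k and b = 0] by (auto simp: G_def[abs_def])
  have "wronskian F G w = 1 \<and> V w = (cmod (F w))\<^sup>2 + (cmod (G w))\<^sup>2" if w: "w \<in> S" for w
  proof
    have "wronskian F G w = k * k * wronskian f g w"
      using Fd[OF w] Gd[OF w] by (simp add: wronskian_def F_def G_def algebra_simps)
    then show "wronskian F G w = 1" using W[OF w] k2 by simp
    have "(cmod (F w))\<^sup>2 + (cmod (G w))\<^sup>2 = (\<omega> * V w) / \<omega>"
      unfolding V[OF w] by (simp add: F_def G_def norm_mult power_mult_distrib k2(2) add_divide_distrib)
    then show "V w = (cmod (F w))\<^sup>2 + (cmod (G w))\<^sup>2" using om by simp
  qed
  then show "\<exists>r>0. ball z r \<subseteq> S \<and> (\<exists>f g. ode_sol Q (ball z r) f \<and> ode_sol Q (ball z r) g \<and>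
     (\<forall>w\<in>ball z r. wronskian f g w = 1 \<and> V w = (cmod (f w))\<^sup>2 + (cmod (g w))\<^sup>2))"
    using r ode_sol_subset[OF F r(2)] ode_sol_subset[OF G r(2)] subsetD[OF r(2)] by blast
qed

text \<open>Let \<open>y\<close> be a zero-free solution on a small disc and \<eta> its companion
  built from \<open>v\<close>. The equation \<open>v_zz = q v\<close> makes \<eta> holomorphic, and
  the curvature equation gives \<open>W v = |\<eta>|\<^sup>2 + |y|\<^sup>2\<close> for the Wronskian
  \<open>W\<close> of \<eta> and \<open>y\<close>. Being holomorphic and real, \<open>W\<close> is
  constant, and the vanishing of its derivative says that \<eta> is a solution too.\<close>

lemma curvature_herm_sol:
  fixes u :: "complex \<Rightarrow> real"
  assumes S: "open S" and C2: "Ck_on 2 u S" and qh: "q holomorphic_on S"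
    and lap: "\<And>z. z \<in> S \<Longrightarrow> laplacian u z = - exp (u z)" and q: "\<And>z. z \<in> S \<Longrightarrow> q_of u z = q z"
  shows "herm_sol q (\<lambda>z. sqrt 8 * exp (- u z / 2)) S"
  unfolding herm_sol_def
proof
  fix z0 assume z0: "z0 \<in> S"
  define v where "v = (\<lambda>z. sqrt 8 * exp (- u z / 2))"
  obtain r0 where r0: "r0 > 0" "ball z0 r0 \<subseteq> S" using S z0 open_contains_ball by blast
  obtain y h where y: "ode_sol q (ball z0 r0) y" and "y z0 = 1"
    by (rule ode_exists[OF holomorphic_on_subset[OF qh r0(2)] r0(1)])
  have "isCont y z0" by (rule DERIV_isCont[OF ode_solD(1)[OF y open_ball]]) (use r0 in simp)
  then have "\<exists>e>0. \<forall>w. dist z0 w < e \<longrightarrow> y w \<noteq> 0"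
    using continuous_at_avoid[of z0 y 0] \<open>y z0 = 1\<close> by auto
  then obtain e where e: "e > 0" "\<And>w. dist z0 w < e \<Longrightarrow> y w \<noteq> 0" by blast
  define r where "r = min r0 e"
  let ?B = "ball z0 r"
  have r: "r > 0" "?B \<subseteq> S" and y0: "\<And>w. w \<in> ?B \<Longrightarrow> y w \<noteq> 0"
    using r0 e by (auto simp: r_def)
  have yB: "ode_sol q ?B y" by (rule ode_sol_subset[OF y]) (auto simp: r_def)
  define \<eta> where "\<eta> w = cnj (of_real (v w) * deriv y w - dz v w * y w)" for w
  have main: "\<exists>\<eta>'. (\<eta> has_field_derivative \<eta>') (at w) \<and>
      (\<eta> w * deriv y w - \<eta>' * y w) * of_real (v w) = of_real ((cmod (\<eta> w))\<^sup>2 + (cmod (y w))\<^sup>2)" if w: "w \<in> ?B" for w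
  proof -
    have wS: "w \<in> S" using w r by blast
    obtain N where N: "((\<lambda>w. complex_of_real (v w)) has_derivative (\<lambda>h. dz v w * h + cnj (dz v w) * cnj h)) (at w)"
      "(dz v has_derivative (\<lambda>h. of_real (v w) * q w * h + of_real N * cnj h)) (at w)"
      "v w * N = (cmod (dz v w))\<^sup>2 + 1"
      unfolding v_def by (rule curvature_herm_derivs[OF S wS C2 lap q])
    note yd = ode_solD[OF yB open_ball w, unfolded has_field_derivative_def]
    \<comment> \<open>The coefficient of \<open>cnj h\<close> in the differential of
      \<open>v y' - v_z y\<close>; that of \<open>h\<close> cancels.\<close>
    define K where "K = cnj (dz v w) * deriv y w - of_real N * y w"
    have "((\<lambda>w. of_real (v w) * deriv y w - dz v w * y w) has_derivative
      (\<lambda>h. (of_real (v w) * (q w * y w * h) + (dz v w * h + cnj (dz v w) * cnj h) * deriv y w)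
        - (dz v w * (deriv y w * h) + (of_real (v w) * q w * h + of_real N * cnj h) * y w))) (at w)"
      by (intro has_derivative_diff has_derivative_mult N yd)
    also have "(\<lambda>h. (of_real (v w) * (q w * y w * h) + (dz v w * h + cnj (dz v w) * cnj h) * deriv y w)
        - (dz v w * (deriv y w * h) + (of_real (v w) * q w * h + of_real N * cnj h) * y w)) = (\<lambda>h. K * cnj h)"
      by (simp add: fun_eq_iff K_def algebra_simps)
    finally have "(\<eta> has_derivative (\<lambda>h. cnj (K * cnj h))) (at w)"
      unfolding \<eta>_def[abs_def] by (rule has_derivative_cnj)
    then have d: "(\<eta> has_field_derivative cnj K) (at w)" by (simp add: has_field_derivative_def)
    have "(\<eta> w * deriv y w - cnj K * y w) * of_real (v w)
      = of_real (v w) * of_real (v w) * (deriv y w * cnj (deriv y w)) - of_real (v w) * (dz v w * cnj (deriv y w) * y w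
        + cnj (dz v w) * deriv y w * cnj (y w)) + of_real (v w * N) * (y w * cnj (y w))"
      by (simp add: \<eta>_def K_def algebra_simps)
    also have "\<dots> = cnj (\<eta> w) * \<eta> w + y w * cnj (y w)"
      unfolding N(3) of_real_add of_real_power mult_cnj_eq_norm_sq[symmetric] by (simp add: \<eta>_def algebra_simps)
    also have "\<dots> = of_real ((cmod (\<eta> w))\<^sup>2 + (cmod (y w))\<^sup>2)"
      using mult_cnj_eq_norm_sq[of "\<eta> w"] mult_cnj_eq_norm_sq[of "y w"] by (simp add: mult.commute)
    finally show ?thesis using d by blast
  qed
  have v0: "v w > 0" for w by (simp add: v_def)
  have etad: "(\<eta> has_field_derivative deriv \<eta> w) (at w)" and
    W: "wronskian \<eta> y w * of_real (v w) = of_real ((cmod (\<eta> w))\<^sup>2 + (cmod (y w))\<^sup>2)" if "w \<in> ?B" for w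
    using main[OF that] by (metis DERIV_imp_deriv, metis DERIV_imp_deriv wronskian_def)
  have eta_h: "\<eta> holomorphic_on ?B" unfolding holomorphic_on_open[OF open_ball] using etad by blast
  note eta2 = holomorphic_derivI[OF holomorphic_deriv[OF eta_h open_ball] open_ball]
  have Wd: "(wronskian \<eta> y has_field_derivative \<eta> w * (q w * y w) - deriv (deriv \<eta>) w * y w) (at w)" if w: "w \<in> ?B" for w
  proof -
    have "((\<lambda>z. \<eta> z * deriv y z - deriv \<eta> z * y z) has_field_derivative \<eta> w * (q w * y w) - deriv (deriv \<eta>) w * y w) (at w)"
      using ode_solD[OF yB open_ball w] etad[OF w] eta2[OF w] by (auto intro!: derivative_eq_intros)
    then show ?thesis by (simp add: wronskian_def[abs_def])
  qed
  have Wr: "wronskian \<eta> y w = of_real (((cmod (\<eta> w))\<^sup>2 + (cmod (y w))\<^sup>2) / v w)" if "w \<in> ?B" for w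
    using W[OF that] v0[of w] by (simp add: field_simps)
  \<comment> \<open>Division by the zero-free \<open>y\<close> turns this into
    \<open>\<eta>'' = q \<eta>\<close>.\<close>
  have Wd0: "\<eta> w * (q w * y w) - deriv (deriv \<eta>) w * y w = 0" if w: "w \<in> ?B" for w
    by (rule real_holomorphic_deriv_0[OF Wd[OF w] open_ball w]) (subst Wr, auto)
  then have eta_sol: "ode_sol q ?B \<eta>" using eta_h y0 unfolding ode_sol_def by (auto simp: algebra_simps)
  define \<omega> where "\<omega> = ((cmod (\<eta> z0))\<^sup>2 + (cmod (y z0))\<^sup>2) / v z0"
  have om: "\<omega> > 0" using y0[of z0] r v0[of z0] by (auto simp: \<omega>_def intro!: divide_pos_pos add_nonneg_pos)
  have Wc: "wronskian \<eta> y w = of_real \<omega>" if w: "w \<in> ?B" for w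
    using wronskian_const[OF eta_sol yB open_ball connected_ball w, of z0] Wr[of z0] r by (simp add: \<omega>_def)
  have vw: "\<omega> * v w = (cmod (\<eta> w))\<^sup>2 + (cmod (y w))\<^sup>2" if w: "w \<in> ?B" for w
    using W[OF w] unfolding Wc[OF w] of_real_mult[symmetric] of_real_eq_iff .
  have hs: "herm_sol q v ?B" by (rule herm_solI_scaled[OF open_ball eta_sol yB om Wc vw])
  obtain r' where r': "r' > 0" "ball z0 r' \<subseteq> ?B" "\<exists>f g. ode_sol q (ball z0 r') f \<and> ode_sol q (ball z0 r') g \<and>
     (\<forall>w\<in>ball z0 r'. wronskian f g w = 1 \<and> v w = (cmod (f w))\<^sup>2 + (cmod (g w))\<^sup>2)"
    using bspec[OF hs[unfolded herm_sol_def], of z0] r(1) by auto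
  show "\<exists>r>0. ball z0 r \<subseteq> S \<and> (\<exists>f g. ode_sol q (ball z0 r) f \<and> ode_sol q (ball z0 r) g \<and>
     (\<forall>w\<in>ball z0 r. wronskian f g w = 1 \<and> sqrt 8 * exp (- u w / 2) = (cmod (f w))\<^sup>2 + (cmod (g w))\<^sup>2))"
    using r'(1,3) subset_trans[OF r'(2) r(2)] unfolding v_def by blast
qed

section \<open>Removable points and the absence of logarithms\<close>

lemma connected_punctured_ball: "connected (ball a r - {a :: complex})"
  by (rule connected_open_diff_countable) auto

text \<open>\<open>h\<close> lives on the whole disc, and its companion is a single-valued solution
  on the punctured one. The companion is therefore a combination of \<open>e\<close> and
  \<open>h\<close> with constant coefficients, and this combination extends across the
  centre.\<close>

lemma herm_extend:
  assumes Q: "Q holomorphic_on ball a r" and r: "r > 0" and V: "herm_sol Q V (ball a r - {a})"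
  obtains V' where "herm_sol Q V' (ball a r)" "\<And>z. z \<in> ball a r - {a} \<Longrightarrow> V' z = V z"
proof -
  let ?S = "ball a r - {a}"
  have S: "open ?S" "connected ?S" "?S \<subseteq> ball a r" using connected_punctured_ball by auto
  have "a + of_real (r / 2) \<in> ?S" using r by (simp add: dist_norm)
  then obtain w where w: "w \<in> ?S" by blast
  obtain e h where eh: "ode_sol Q (ball a r) e" "ode_sol Q (ball a r) h"
    and W: "\<And>z. z \<in> ball a r \<Longrightarrow> wronskian e h z = 1"
    by (rule ode_exists[OF Q r]) blast
  have hS: "ode_sol Q ?S h" by (rule ode_sol_subset[OF eh(2) S(3)])
  have "wronskian e h w \<noteq> 0" using W[of w] w by auto
  from ode_sol_nonzero[OF hS S(1) w this] obtain z0 where z0: "z0 \<in> ?S" "h z0 \<noteq> 0" by blast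
  obtain \<omega> :: real where om: "\<omega> > 0" and
    eta: "ode_sol Q ?S (\<lambda>z. cnj (of_real (V z) * deriv h z - dz V z * h z))"
    and We: "\<And>z. z \<in> ?S \<Longrightarrow> wronskian (\<lambda>z. cnj (of_real (V z) * deriv h z - dz V z * h z)) h z = of_real \<omega>"
    and Ve: "\<And>z. z \<in> ?S \<Longrightarrow> \<omega> * V z = (cmod (cnj (of_real (V z) * deriv h z - dz V z * h z)))\<^sup>2 + (cmod (h z))\<^sup>2"
    by (rule frame[OF V S(1,2) hS z0]) (rule that)
  obtain \<alpha> \<beta> where dec: "\<And>z. z \<in> ?S \<Longrightarrow> cnj (of_real (V z) * deriv h z - dz V z * h z) = \<alpha> * e z + \<beta> * h z"
    and "\<And>z. z \<in> ?S \<Longrightarrow> deriv (\<lambda>z. cnj (of_real (V z) * deriv h z - dz V z * h z)) z = \<alpha> * deriv e z + \<beta> * deriv h z"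
    and al: "\<And>z. z \<in> ?S \<Longrightarrow> wronskian (\<lambda>z. cnj (of_real (V z) * deriv h z - dz V z * h z)) h z = \<alpha>"
    and "\<And>z. z \<in> ?S \<Longrightarrow> wronskian e (\<lambda>z. cnj (of_real (V z) * deriv h z - dz V z * h z)) z = \<beta>"
    by (rule ode_decomp[OF eh eta open_ball S(1,3,2) W]) (assumption, rule that)
  have alo: "\<alpha> = of_real \<omega>" using We[OF w] al[OF w] by simp
  define f where "f z = \<alpha> * e z + \<beta> * h z" for z
  have f: "ode_sol Q (ball a r) f" and fd: "\<And>z. z \<in> ball a r \<Longrightarrow> deriv f z = \<alpha> * deriv e z + \<beta> * deriv h z"
    using ode_sol_lincomb[OF eh open_ball, where a = \<alpha> and b = \<beta>] by (auto simp: f_def[abs_def])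
  have Wf: "wronskian f h z = of_real \<omega>" if z: "z \<in> ball a r" for z
  proof -
    have "wronskian f h z = \<alpha> * wronskian e h z"
      using fd[OF z] by (simp add: wronskian_def f_def algebra_simps)
    then show ?thesis using W[OF z] alo by simp
  qed
  define V' where "V' z = ((cmod (f z))\<^sup>2 + (cmod (h z))\<^sup>2) / \<omega>" for z
  show ?thesis
  proof (rule that)
    show "herm_sol Q V' (ball a r)"
      by (rule herm_solI_scaled[OF open_ball f eh(2) om Wf]) (use om in \<open>auto simp: V'_def\<close>)
    show "V' z = V z" if "z \<in> ?S" for z
      using Ve[OF that] om unfolding dec[OF that] by (simp add: V'_def f_def field_simps)
  qed
qed

text \<open>Around \<open>p\<close>, with \<open>x = z - p\<close>, the solution \<open>y = x powr (3/2) * \<phi>\<close> has a companion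
  \<open>\<eta>\<close> for which \<open>\<eta> / y\<close> is single-valued. Since \<open>(\<eta> / y)' = - \<omega> / (x\<^sup>3 \<phi>\<^sup>2)\<close> with a nonzero
  constant \<open>\<omega>\<close>, the residue of \<open>1 / (x\<^sup>3 \<phi>\<^sup>2)\<close> vanishes.\<close>

lemma log_free:
  assumes v: "herm_sol q v (ball p r - {p})" and r: "r > 0" and H: "H holomorphic_on ball p r"
    and q: "\<And>z. z \<in> ball p r - {p} \<Longrightarrow> q z = 3 / 4 / (z - p)\<^sup>2 + T / (z - p) + H z"
  shows "H p = T\<^sup>2"
proof -
  \<comment> \<open>The equation for \<open>x powr (3/2) * \<phi>\<close>, with \<open>a\<close> in
    the role of the square root of \<open>x = z - p\<close>.\<close>
  have expand: "3 / (4 * a) * f + a * ((T + a\<^sup>2 * h) * f) = (3 / 4 / (a\<^sup>2)\<^sup>2 + T / a\<^sup>2 + h) * (a ^ 3 * f)"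
    if a: "a \<noteq> 0" for a f h :: complex
  proof -
    define i where "i = 1 / a"
    have i: "a * i = 1" "1 / a = i" "x / a = x * i" "x / a\<^sup>2 = x * (i * i)" "x / (a\<^sup>2)\<^sup>2 = x * (i * i * i * i)" "x / (y * a) = x / y * i" for x y
      using a by (auto simp: i_def power2_eq_square)
    show ?thesis unfolding i using i(1) by algebra
  qed
  \<comment> \<open>With the exponent 3/2 split off, the equation becomes
    \<open>x \<phi>'' + 3 \<phi>' = (T + x H) \<phi>\<close>.\<close>
  have Sh: "(\<lambda>z. T + (z - p) * H z) holomorphic_on ball p r" by (intro holomorphic_intros H)
  obtain \<phi> where ph: "\<phi> holomorphic_on ball p r" and ph1: "\<phi> p = 1"
    and phi: "\<And>z. z \<in> ball p r \<Longrightarrow> (z - p) * deriv (deriv \<phi>) z + of_nat 3 * deriv \<phi> z = (T + (z - p) * H z) * \<phi> z"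
    by (rule frobenius[OF Sh r, of 3]) auto
  have pb: "p \<in> ball p r" using r by simp
  have "isCont \<phi> p" by (rule holomorphic_on_isCont[OF ph open_ball pb])
  then have "\<exists>e>0. \<forall>w. dist p w < e \<longrightarrow> \<phi> w \<noteq> 0"
    using continuous_at_avoid[of p \<phi> 0] ph1 by auto
  then obtain e where e: "e > 0" "\<And>w. dist p w < e \<Longrightarrow> \<phi> w \<noteq> 0" by blast
  define R where "R = min r e"
  have R: "R > 0" "ball p R \<subseteq> ball p r" and nz: "\<And>w. w \<in> ball p R \<Longrightarrow> \<phi> w \<noteq> 0" using e r by (auto simp: R_def)
  let ?S = "ball p R - {p}"
  have S: "open ?S" "connected ?S" using connected_punctured_ball by auto
  note d1 = holomorphic_derivI[OF ph open_ball]
  have ph': "deriv \<phi> holomorphic_on ball p r" by (rule holomorphic_deriv[OF ph open_ball])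
  note d2 = holomorphic_derivI[OF ph' open_ball]
  have ph'': "deriv (deriv \<phi>) holomorphic_on ball p r" by (rule holomorphic_deriv[OF ph' open_ball])
  note d3 = holomorphic_derivI[OF ph'' open_ball]
  \<comment> \<open>This is \<open>\<eta> / y\<close> with the square root \<open>s\<close> of
    \<open>z - p\<close> eliminated: only \<open>s * cnj s = |z - p|\<close> and
    \<open>s\<^sup>2\<close> remain, so \<open>G\<close> is single-valued.\<close>
  define G where "G z = of_real (cmod (z - p)) * cnj (of_real (v z) * (3 / 2 * \<phi> z + (z - p) * deriv \<phi> z)
     - dz v z * ((z - p) * \<phi> z)) / ((z - p)\<^sup>2 * \<phi> z)" for z
  have loc: "\<exists>\<omega>::real. \<omega> > 0 \<and> (\<exists>\<rho>>0. ball z \<rho> \<subseteq> ?S \<and>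
      (\<forall>w\<in>ball z \<rho>. (G has_field_derivative - of_real \<omega> / ((w - p) ^ 3 * (\<phi> w)\<^sup>2)) (at w)))" if z: "z \<in> ?S" for z
  proof -
    obtain \<rho> where rho: "\<rho> > 0" "ball z \<rho> \<subseteq> ?S" using S(1) z open_contains_ball by blast
    let ?B = "ball z \<rho>"
    have hol: "(\<lambda>w. w - p) holomorphic_on ?B" by (intro holomorphic_intros)
    have xnz: "w - p \<noteq> 0" if "w \<in> ?B" for w using that rho(2) by auto
    obtain s where s: "s holomorphic_on ?B" "\<And>w. w \<in> ?B \<Longrightarrow> w - p = (s w)\<^sup>2"
      by (rule contractible_imp_holomorphic_sqrt[OF hol convex_imp_contractible[OF convex_ball]], erule xnz, rule that)
    have s0: "s w \<noteq> 0" if "w \<in> ?B" for w using s(2)[OF that] xnz[OF that] by auto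
    have sd: "(s has_field_derivative 1 / (2 * s w)) (at w)" if w: "w \<in> ?B" for w
    proof -
      note sd = holomorphic_derivI[OF s(1) open_ball w]
      have "((\<lambda>w. (s w)\<^sup>2) has_field_derivative 2 * s w * deriv s w) (at w)"
        by (auto intro!: derivative_eq_intros sd)
      moreover have "((\<lambda>w. (s w)\<^sup>2) has_field_derivative 1) (at w)"
        by (rule has_field_derivative_transform_within_open[of "\<lambda>w. w - p" _ _ ?B])
           (use w s(2) in \<open>auto intro!: derivative_eq_intros\<close>)
      ultimately have "2 * s w * deriv s w = 1" by (rule DERIV_unique)
      then have "deriv s w = 1 / (2 * s w)" using s0[OF w] by (simp add: field_simps)
      then show ?thesis using sd by simp
    qed
    have sub: "?B \<subseteq> ball p r - {p}" "?B \<subseteq> ball p R" "?B \<subseteq> ball p r" using rho(2) R(2) by auto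
    define y where "y w = s w ^ 3 * \<phi> w" for w
    define y1 where "y1 w = s w * (3 / 2 * \<phi> w + (w - p) * deriv \<phi> w)" for w
    have yd: "(y has_field_derivative y1 w) (at w)" if w: "w \<in> ?B" for w
    proof -
      have "(y has_field_derivative 3 * (s w)\<^sup>2 * (1 / (2 * s w)) * \<phi> w + s w ^ 3 * deriv \<phi> w) (at w)"
        unfolding y_def[abs_def] using sd[OF w] d1[OF subsetD[OF sub(3) w]]
        by (auto intro!: derivative_eq_intros simp: power2_eq_square)
      also have "3 * (s w)\<^sup>2 * (1 / (2 * s w)) * \<phi> w + s w ^ 3 * deriv \<phi> w = y1 w"
        unfolding y1_def s(2)[OF w] using s0[OF w] by (simp add: field_simps power2_eq_square power3_eq_cube)
      finally show ?thesis .
    qed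
    have yd2: "(y1 has_field_derivative q w * y w) (at w)" if w: "w \<in> ?B" for w
    proof -
      note wr = subsetD[OF sub(3) w]
      have "(y1 has_field_derivative 1 / (2 * s w) * (3 / 2 * \<phi> w + (w - p) * deriv \<phi> w)
         + s w * (3 / 2 * deriv \<phi> w + (deriv \<phi> w + (w - p) * deriv (deriv \<phi>) w))) (at w)"
        unfolding y1_def[abs_def] using sd[OF w] d1[OF wr] d2[OF wr]
        by (auto intro!: derivative_eq_intros)
      also have "1 / (2 * s w) * (3 / 2 * \<phi> w + (w - p) * deriv \<phi> w)
         + s w * (3 / 2 * deriv \<phi> w + (deriv \<phi> w + (w - p) * deriv (deriv \<phi>) w))
         = 3 / (4 * s w) * \<phi> w + s w * ((w - p) * deriv (deriv \<phi>) w + of_nat 3 * deriv \<phi> w)"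
        unfolding s(2)[OF w] using s0[OF w] by (simp add: field_simps power2_eq_square)
      also have "\<dots> = q w * y w"
        unfolding phi[OF wr] q[OF subsetD[OF sub(1) w]] y_def unfolding s(2)[OF w] by (rule expand[OF s0[OF w]])
      finally show ?thesis .
    qed
    have y: "ode_sol q ?B y" and yd': "\<And>w. w \<in> ?B \<Longrightarrow> deriv y w = y1 w"
      using ode_solI[OF open_ball yd yd2] by blast+
    have y0: "y w \<noteq> 0" if "w \<in> ?B" for w using s0[OF that] nz subsetD[OF sub(2) that] by (auto simp: y_def)
    have zB: "z \<in> ?B" using rho by simp
    define \<eta> where "\<eta> = (\<lambda>z. cnj (of_real (v z) * deriv y z - dz v z * y z))"
    obtain \<omega> :: real where om: "\<omega> > 0" "ode_sol q ?B \<eta>" "\<And>w. w \<in> ?B \<Longrightarrow> wronskian \<eta> y w = of_real \<omega>"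
      unfolding \<eta>_def by (rule frame[OF herm_sol_subset[OF v sub(1) open_ball] open_ball connected_ball y zB y0[OF zB]]) blast
    have G: "\<eta> w / y w = G w" if w: "w \<in> ?B" for w
    proof -
      define X where "X = cnj (of_real (v w) * (3 / 2 * \<phi> w + (w - p) * deriv \<phi> w) - dz v w * ((w - p) * \<phi> w))"
      have "\<eta> w = cnj (s w) * X"
        unfolding \<eta>_def X_def yd'[OF w] y1_def y_def s(2)[OF w] by (simp add: algebra_simps power2_eq_square power3_eq_cube)
      then have "s w * \<eta> w = s w * cnj (s w) * X" by simp
      then have sX: "s w * \<eta> w = of_real (cmod (w - p)) * X"
        unfolding mult_cnj_eq_norm_sq s(2)[OF w] by (simp add: norm_power)
      have "\<eta> w / y w = s w * \<eta> w / (s w * y w)" using s0[OF w] by simp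
      also note sX
      also have "s w * y w = (w - p)\<^sup>2 * \<phi> w" unfolding y_def s(2)[OF w] by algebra
      finally show ?thesis unfolding G_def X_def .
    qed
    have "(G has_field_derivative - of_real \<omega> / ((w - p) ^ 3 * (\<phi> w)\<^sup>2)) (at w)" if w: "w \<in> ?B" for w
    proof -
      have "((\<lambda>w. \<eta> w / y w) has_field_derivative (deriv \<eta> w * y w - \<eta> w * deriv y w) / (y w * y w)) (at w)"
        by (rule DERIV_divide[OF ode_solD(1)[OF om(2) open_ball w] ode_solD(1)[OF y open_ball w] y0[OF w]])
      also have "(deriv \<eta> w * y w - \<eta> w * deriv y w) / (y w * y w) = - of_real \<omega> / ((w - p) ^ 3 * (\<phi> w)\<^sup>2)"
      proof -
        have "deriv \<eta> w * y w - \<eta> w * deriv y w = - of_real \<omega>"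
          unfolding om(3)[OF w, symmetric] wronskian_def by simp
        moreover have "y w * y w = (w - p) ^ 3 * (\<phi> w)\<^sup>2" unfolding y_def s(2)[OF w] by algebra
        ultimately show ?thesis by simp
      qed
      finally show ?thesis by (rule has_field_derivative_transform_within_open[OF _ open_ball w]) (simp add: G)
    qed
    then show ?thesis using rho om(1) by blast
  qed
  \<comment> \<open>Recovers the local constant \<omega> from the derivative of \<open>G\<close>;
    being locally constant, it is constant on the punctured disc.\<close>
  define K where "K w = - deriv G w * ((w - p) ^ 3 * (\<phi> w)\<^sup>2)" for w
  have nz2: "(w - p) ^ 3 * (\<phi> w)\<^sup>2 \<noteq> 0" if "w \<in> ?S" for w using nz that by auto
  have Kw: "K w = of_real \<omega>" if "(G has_field_derivative - of_real \<omega> / ((w - p) ^ 3 * (\<phi> w)\<^sup>2)) (at w)" "w \<in> ?S" for w and \<omega> :: real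
    using DERIV_imp_deriv[OF that(1)] nz2[OF that(2)] by (simp add: K_def)
  have "K constant_on ?S"
  proof (rule has_field_derivative_0_imp_constant_on[OF _ S(2,1)])
    fix z assume "z \<in> ?S"
    from loc[OF this] obtain \<omega> :: real and \<rho> where o: "\<rho> > 0" "ball z \<rho> \<subseteq> ?S"
      "\<And>w. w \<in> ball z \<rho> \<Longrightarrow> (G has_field_derivative - of_real \<omega> / ((w - p) ^ 3 * (\<phi> w)\<^sup>2)) (at w)" by blast
    show "(K has_field_derivative 0) (at z)"
      by (rule has_field_derivative_transform_within_open[OF DERIV_const open_ball, of z z \<rho> "of_real \<omega>"])
         (use o(1) Kw[OF o(3) subsetD[OF o(2)]] in auto)
  qed
  then obtain \<kappa> where K: "K w = \<kappa>" if "w \<in> ?S" for w by (auto simp: constant_on_def)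
  have Gd: "(G has_field_derivative - \<kappa> / ((w - p) ^ 3 * (\<phi> w)\<^sup>2)) (at w)" and k0: "\<kappa> \<noteq> 0" if "w \<in> ?S" for w
  proof -
    from loc[OF that] obtain \<omega> :: real and \<rho> where o: "\<omega> > 0" "\<rho> > 0"
      "\<And>w'. w' \<in> ball w \<rho> \<Longrightarrow> (G has_field_derivative - of_real \<omega> / ((w' - p) ^ 3 * (\<phi> w')\<^sup>2)) (at w')" by blast
    have o3: "(G has_field_derivative - of_real \<omega> / ((w - p) ^ 3 * (\<phi> w)\<^sup>2)) (at w)" by (rule o(3)) (use o(2) in simp)
    have "\<kappa> = of_real \<omega>" using Kw[OF o3 that] K[OF that] by simp
    then show "(G has_field_derivative - \<kappa> / ((w - p) ^ 3 * (\<phi> w)\<^sup>2)) (at w)" "\<kappa> \<noteq> 0" using o3 o(1) by auto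
  qed
  have "p + of_real (R / 2) \<in> ?S" using R by (simp add: dist_norm)
  from k0[OF this] have k: "\<kappa> \<noteq> 0" .
  define \<psi> where "\<psi> w = - \<kappa> / (\<phi> w)\<^sup>2" for w
  define \<psi>' where "\<psi>' w = 2 * \<kappa> * deriv \<phi> w / (\<phi> w) ^ 3" for w
  have psid: "(\<psi> has_field_derivative \<psi>' w) (at w)" if w: "w \<in> ball p R" for w
    unfolding \<psi>_def[abs_def] \<psi>'_def using d1[OF subsetD[OF R(2) w]] nz[OF w]
    by (auto intro!: derivative_eq_intros simp: field_simps power2_eq_square power3_eq_cube)
  have psih: "\<psi> holomorphic_on ball p R" unfolding holomorphic_on_open[OF open_ball] using psid by blast
  have pR: "p \<in> ball p R" using R by simp
  have psid2: "deriv (deriv \<psi>) p = 2 * \<kappa> * (deriv (deriv \<phi>) p - 3 * (deriv \<phi> p)\<^sup>2)"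
  proof (rule DERIV_imp_deriv)
    have "(\<psi>' has_field_derivative 2 * \<kappa> * (deriv (deriv \<phi>) p - 3 * (deriv \<phi> p)\<^sup>2)) (at p)"
      unfolding \<psi>'_def[abs_def] using d1[OF pb] d2[OF pb]
      by (auto intro!: derivative_eq_intros simp: ph1 power2_eq_square algebra_simps)
    then show "(deriv \<psi> has_field_derivative 2 * \<kappa> * (deriv (deriv \<phi>) p - 3 * (deriv \<phi> p)\<^sup>2)) (at p)"
      by (rule has_field_derivative_transform_within_open[OF _ open_ball pR]) (simp add: DERIV_imp_deriv[OF psid])
  qed
  \<comment> \<open>Cauchy's formula gives the integral of the derivative of \<open>G\<close> over a
    circle as \<open>\<pi> \<i> \<psi>''(p)\<close>. As \<open>G\<close> is a primitive, the
    integral is 0.\<close>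
  have c1: "((\<lambda>u. \<psi> u / (u - p) ^ Suc 2) has_contour_integral (2 * pi * \<i>) / fact 2 * (deriv ^^ 2) \<psi> p) (circlepath p (R / 2))"
  proof (rule Cauchy_has_contour_integral_higher_derivative_circlepath)
    have "cball p (R / 2) \<subseteq> ball p R" "ball p (R / 2) \<subseteq> ball p R" using R(1) by auto
    then show "continuous_on (cball p (R / 2)) \<psi>" "\<psi> holomorphic_on ball p (R / 2)"
      using holomorphic_on_subset[OF psih] holomorphic_on_imp_continuous_on by metis+
  qed (use R(1) in simp)
  have c2: "((\<lambda>u. \<psi> u / (u - p) ^ Suc 2) has_contour_integral 0) (circlepath p (R / 2))"
  proof (rule Cauchy_theorem_primitive)
    show "(G has_field_derivative \<psi> w / (w - p) ^ Suc 2) (at w within ?S)" if w: "w \<in> ?S" for w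
    proof -
      have "- \<kappa> / ((w - p) ^ 3 * (\<phi> w)\<^sup>2) = \<psi> w / (w - p) ^ Suc 2"
        unfolding \<psi>_def eval_nat_numeral by (simp only: divide_divide_eq_left mult.commute)
      then show ?thesis using has_field_derivative_at_within[OF Gd[OF w], of ?S] by (simp only:)
    qed
    have "sphere p (R / 2) \<subseteq> ?S" using R(1) by (auto simp: dist_norm norm_minus_commute)
    then show "path_image (circlepath p (R / 2)) \<subseteq> ?S" using R(1) path_image_circlepath[of p "R / 2"] by simp
  qed (rule valid_path_circlepath, simp only: pathfinish_circlepath pathstart_circlepath)
  have "deriv (deriv \<psi>) p = 0" using has_contour_integral_unique[OF c1 c2] by (simp add: numeral_2_eq_2)
  then have e1: "deriv (deriv \<phi>) p = 3 * (deriv \<phi> p)\<^sup>2" using psid2 k by simp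
  \<comment> \<open>At \<open>p\<close> the equation and its first derivative read
    \<open>3 \<phi>' = T\<close> and \<open>4 \<phi>'' = H + T \<phi>'\<close>. Together with
    \<open>\<phi>'' = 3 \<phi>'\<^sup>2\<close> this gives
    \<open>H = 9 \<phi>'\<^sup>2 = T\<^sup>2\<close>.\<close>
  have e2: "3 * deriv \<phi> p = T" using phi[OF pb] ph1 by simp
  have "((\<lambda>z. (z - p) * deriv (deriv \<phi>) z + of_nat 3 * deriv \<phi> z) has_field_derivative 4 * deriv (deriv \<phi>) p) (at p)"
    by (auto intro!: derivative_eq_intros d2[OF pb] d3[OF pb])
  moreover have "((\<lambda>z. (z - p) * deriv (deriv \<phi>) z + of_nat 3 * deriv \<phi> z) has_field_derivative H p + T * deriv \<phi> p) (at p)"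
  proof (rule has_field_derivative_transform_within_open[of "\<lambda>z. (T + (z - p) * H z) * \<phi> z" _ _ "ball p r"])
    show "((\<lambda>z. (T + (z - p) * H z) * \<phi> z) has_field_derivative H p + T * deriv \<phi> p) (at p)"
      by (auto intro!: derivative_eq_intros d1[OF pb] holomorphic_derivI[OF H open_ball pb] simp: ph1)
  qed (use pb phi in auto)
  ultimately have e3: "4 * deriv (deriv \<phi>) p = H p + T * deriv \<phi> p" by (rule DERIV_unique)
  show ?thesis using e1 e3 unfolding e2[symmetric] by (simp add: power2_eq_square)
qed

section \<open>The Darboux transform\<close>

lemma herm_sol_cong:
  assumes V: "herm_sol Q V S" and eq: "\<And>z. z \<in> S \<Longrightarrow> Q' z = Q z" "\<And>z. z \<in> S \<Longrightarrow> V' z = V z"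
  shows "herm_sol Q' V' S"
  unfolding herm_sol_def
proof
  fix z assume z: "z \<in> S"
  obtain r f g where *: "r > 0" "ball z r \<subseteq> S" "ode_sol Q (ball z r) f" "ode_sol Q (ball z r) g"
    "\<And>w. w \<in> ball z r \<Longrightarrow> wronskian f g w = 1"
    "\<And>w. w \<in> ball z r \<Longrightarrow> V w = (cmod (f w))\<^sup>2 + (cmod (g w))\<^sup>2"
    by (rule herm_solE[OF V z]) blast
  have "ode_sol Q' (ball z r) f" "ode_sol Q' (ball z r) g"
    using *(3,4) eq(1) subsetD[OF *(2)] by (auto simp: ode_sol_def)
  moreover have "\<forall>w\<in>ball z r. wronskian f g w = 1 \<and> V' w = (cmod (f w))\<^sup>2 + (cmod (g w))\<^sup>2"
    using *(5,6) eq(2) subsetD[OF *(2)] by simp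
  ultimately show "\<exists>r>0. ball z r \<subseteq> S \<and> (\<exists>f g. ode_sol Q' (ball z r) f \<and> ode_sol Q' (ball z r) g \<and>
     (\<forall>w\<in>ball z r. wronskian f g w = 1 \<and> V' w = (cmod (f w))\<^sup>2 + (cmod (g w))\<^sup>2))"
    using *(1,2) by blast
qed

lemma herm_sol_local:
  assumes "\<And>z. z \<in> S \<Longrightarrow> \<exists>T. open T \<and> z \<in> T \<and> T \<subseteq> S \<and> herm_sol Q V T"
  shows "herm_sol Q V S"
  unfolding herm_sol_def
proof
  fix z assume "z \<in> S"
  then obtain T where T: "open T" "z \<in> T" "T \<subseteq> S" "herm_sol Q V T" using assms by blast
  then show "\<exists>r>0. ball z r \<subseteq> S \<and> (\<exists>f g. ode_sol Q (ball z r) f \<and> ode_sol Q (ball z r) g \<and>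
     (\<forall>w\<in>ball z r. wronskian f g w = 1 \<and> V w = (cmod (f w))\<^sup>2 + (cmod (g w))\<^sup>2))"
    unfolding herm_sol_def by (meson order_trans)
qed

text \<open>The balls are so small that only their centre can belong to \<open>A\<close>. Each local
  extension therefore redefines \<open>V\<close> at one point only, and the values \<open>c\<close>
  fit together.\<close>

lemma herm_extend_discrete:
  assumes S: "open S" and Q: "Q holomorphic_on S" and V: "herm_sol Q V (S - A)"
    and A: "\<And>s. \<exists>r>0. \<forall>z\<in>ball s r - {s}. z \<notin> A"
  obtains V' where "herm_sol Q V' S" "\<And>z. z \<in> S - A \<Longrightarrow> V' z = V z"
proof -
  have "\<exists>r c. r > 0 \<and> ball s r \<subseteq> S \<and> (\<forall>z\<in>ball s r - {s}. z \<notin> A) \<and> (s \<notin> A \<longrightarrow> c = V s) \<and> herm_sol Q (V(s := c)) (ball s r)"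
    if s: "s \<in> S" for s
  proof -
    obtain r1 where r1: "r1 > 0" "\<And>z. z \<in> ball s r1 - {s} \<Longrightarrow> z \<notin> A" using A by meson
    obtain r2 where r2: "r2 > 0" "ball s r2 \<subseteq> S" using S s open_contains_ball by blast
    define r where "r = min r1 r2"
    have r: "r > 0" "ball s r \<subseteq> S" "\<And>z. z \<in> ball s r - {s} \<Longrightarrow> z \<notin> A" using r1 r2 by (auto simp: r_def)
    have sub: "ball s r - {s} \<subseteq> S - A" using r by blast
    have op: "open (ball s r - {s})" by blast
    show ?thesis
    proof (cases "s \<in> A")
      case True
      obtain V' where V': "herm_sol Q V' (ball s r)" "\<And>z. z \<in> ball s r - {s} \<Longrightarrow> V' z = V z"
        by (rule herm_extend[OF holomorphic_on_subset[OF Q r(2)] r(1) herm_sol_subset[OF V sub op]]) (rule that)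
      have "herm_sol Q (V(s := V' s)) (ball s r)" by (rule herm_sol_cong[OF V'(1)]) (auto simp: V'(2))
      then show ?thesis using r True by blast
    next
      case False
      then have "ball s r \<subseteq> S - A" using r by blast
      then have "herm_sol Q (V(s := V s)) (ball s r)" using herm_sol_subset[OF V _ open_ball] by simp
      then show ?thesis using r by blast
    qed
  qed
  then obtain r c where *: "\<And>s. s \<in> S \<Longrightarrow> r s > 0 \<and> ball s (r s) \<subseteq> S \<and> (\<forall>z\<in>ball s (r s) - {s}. z \<notin> A)
      \<and> (s \<notin> A \<longrightarrow> c s = V s) \<and> herm_sol Q (V(s := c s)) (ball s (r s :: real))" by metis
  show ?thesis
  proof (rule that)
    show "herm_sol Q c S"
    proof (rule herm_sol_local)
      fix s assume s: "s \<in> S"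
      have "c z = (V(s := c s)) z" if "z \<in> ball s (r s)" for z using *[OF s] *[of z] that by auto
      then have "herm_sol Q c (ball s (r s))" using *[OF s] by (blast intro: herm_sol_cong)
      then show "\<exists>T. open T \<and> s \<in> T \<and> T \<subseteq> S \<and> herm_sol Q c T" using *[OF s] by (intro exI[of _ "ball s (r s)"]) auto
    qed
    show "c z = V z" if "z \<in> S - A" for z using * that by blast
  qed
qed

text \<open>With \<open>M = k D\<close> and \<open>m = D' / (2 D) - \<kappa>\<close> this is \<open>M - m' + m\<^sup>2\<close>, the potential whose
  solutions \<open>y\<close> are mapped by \<open>y \<mapsto> (y' + m y) / sqrt M\<close> to solutions for the potential
  \<open>M + \<kappa>\<^sup>2\<close>.\<close>

definition darboux :: "complex \<Rightarrow> complex \<Rightarrow> (complex \<Rightarrow> complex) \<Rightarrow> complex \<Rightarrow> complex" where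
  "darboux k \<kappa> D z = k * D z + \<kappa>\<^sup>2 - \<kappa> * (deriv D z / D z) + 3 / 4 * (deriv D z / D z)\<^sup>2 - deriv (deriv D) z / (2 * D z)"

text \<open>With \<open>s\<^sup>2 = k D\<close> on a disc, \<open>T y = (y' + m y) / s\<close>
  satisfies \<open>(T y)' = s y - \<kappa> T y\<close>, and a second differentiation gives the new
  equation. The sign of \<open>s\<close> is ambiguous, but Lagrange's identity expresses
  \<open>|T f|\<^sup>2 + |T g|\<^sup>2\<close> by \<open>v\<close>, \<open>dz v\<close>,
  \<open>deriv D / D\<close> and \<open>|k D|\<close>, so the new form is single-valued.\<close>

lemma darboux_herm_sol:
  assumes S: "open S" and D: "D holomorphic_on S" "\<And>z. z \<in> S \<Longrightarrow> D z \<noteq> 0" and k: "k \<noteq> 0"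
    and v: "herm_sol (darboux k \<kappa> D) v S"
  shows "herm_sol (\<lambda>z. k * D z + \<kappa>\<^sup>2)
    (\<lambda>z. (1 + (cmod (dz v z + (deriv D z / (2 * D z) - \<kappa>) * of_real (v z)))\<^sup>2) / (v z * cmod (k * D z))) S"
    (is "herm_sol ?Q ?V S")
proof (rule herm_sol_local)
  fix z assume z: "z \<in> S"
  obtain r f g where r: "r > 0" "ball z r \<subseteq> S" and fg: "ode_sol (darboux k \<kappa> D) (ball z r) f" "ode_sol (darboux k \<kappa> D) (ball z r) g"
    and W: "\<And>w. w \<in> ball z r \<Longrightarrow> wronskian f g w = 1"
    and V: "\<And>w. w \<in> ball z r \<Longrightarrow> v w = (cmod (f w))\<^sup>2 + (cmod (g w))\<^sup>2"
    and P: "\<And>w. w \<in> ball z r \<Longrightarrow> dz v w = deriv f w * cnj (f w) + deriv g w * cnj (g w)"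
    by (rule herm_solE[OF v z]) (rule that)
  let ?B = "ball z r"
  have hol: "(\<lambda>w. k * D w) holomorphic_on ?B" by (intro holomorphic_intros holomorphic_on_subset[OF D(1) r(2)])
  have D0: "D w \<noteq> 0" if "w \<in> ?B" for w using D(2) r(2) that by blast
  have kD0: "k * D w \<noteq> 0" if "w \<in> ?B" for w using D0[OF that] k by simp
  obtain s where s: "s holomorphic_on ?B" "\<And>w. w \<in> ?B \<Longrightarrow> k * D w = (s w)\<^sup>2"
    by (rule contractible_imp_holomorphic_sqrt[OF hol convex_imp_contractible[OF convex_ball]], erule kD0, rule that)
  have s0: "s w \<noteq> 0" if "w \<in> ?B" for w using s(2)[OF that] kD0[OF that] by auto
  define m where "m w = deriv D w / (2 * D w) - \<kappa>" for w
  define m' where "m' w = deriv (deriv D) w / (2 * D w) - (deriv D w / D w)\<^sup>2 / 2" for w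
  have DB: "D holomorphic_on ?B" by (rule holomorphic_on_subset[OF D(1) r(2)])
  note D1 = holomorphic_derivI[OF DB open_ball]
    and D2 = holomorphic_derivI[OF holomorphic_deriv[OF DB open_ball] open_ball]
  have md: "(m has_field_derivative m' w) (at w)" if w: "w \<in> ?B" for w
    unfolding m_def[abs_def] m'_def using D1[OF w] D2[OF w] D0[OF w]
    by (auto intro!: derivative_eq_intros simp: field_simps power2_eq_square)
  have sd: "(s has_field_derivative s w * (m w + \<kappa>)) (at w)" if w: "w \<in> ?B" for w
  proof -
    note sd = holomorphic_derivI[OF s(1) open_ball w]
    have "((\<lambda>w. (s w)\<^sup>2) has_field_derivative 2 * s w * deriv s w) (at w)"
      by (auto intro!: derivative_eq_intros sd)
    moreover have "((\<lambda>w. (s w)\<^sup>2) has_field_derivative k * deriv D w) (at w)"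
      by (rule has_field_derivative_transform_within_open[OF DERIV_cmult[OF D1[OF w]] open_ball w]) (rule s(2))
    ultimately have e: "2 * s w * deriv s w = k * deriv D w" by (rule DERIV_unique)
    have "2 * s w * (s w * (m w + \<kappa>)) = (k * D w) * (deriv D w / D w)"
      unfolding s(2)[OF w] m_def by (simp add: power2_eq_square)
    also have "\<dots> = 2 * s w * deriv s w" unfolding e using D0[OF w] by simp
    finally have "deriv s w = s w * (m w + \<kappa>)" using s0[OF w] by simp
    then show ?thesis using sd by simp
  qed
  \<comment> \<open>The Darboux potential is \<open>M - m' + m\<^sup>2\<close> with
    \<open>M = k D\<close>; this is what turns the derivative of \<open>T y\<close> into
    \<open>s y - \<kappa> T y\<close>.\<close>
  have pot: "darboux k \<kappa> D w + m' w - (m w)\<^sup>2 = (s w)\<^sup>2" if w: "w \<in> ?B" for w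
  proof -
    define l where "l = deriv D w / D w"
    define R where "R = deriv (deriv D) w / (2 * D w)"
    have m: "m w = l / 2 - \<kappa>" "m' w = R - l\<^sup>2 / 2" by (auto simp: m_def m'_def l_def R_def)
    show ?thesis unfolding darboux_def l_def[symmetric] R_def[symmetric] s(2)[OF w] m
      by (simp add: power2_eq_square field_simps)
  qed
  define T where "T y w = (deriv y w + m w * y w) / s w" for y w
  have Td: "(T y has_field_derivative s w * y w - \<kappa> * T y w) (at w)"
    if y: "ode_sol (darboux k \<kappa> D) ?B y" and w: "w \<in> ?B" for y w
  proof -
    define q where "q = darboux k \<kappa> D w"
    have "(T y has_field_derivative ((q * y w + (m' w * y w + deriv y w * m w)) * s w
        - (deriv y w + m w * y w) * (s w * (m w + \<kappa>))) / (s w * s w)) (at w)"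
      unfolding T_def[abs_def] q_def
      by (intro DERIV_divide DERIV_add DERIV_mult ode_solD[OF y open_ball w] md[OF w] sd[OF w] s0[OF w])
    moreover have "((q * y w + (m' w * y w + deriv y w * m w)) * s w
        - (deriv y w + m w * y w) * (s w * (m w + \<kappa>))) / (s w * s w) = s w * y w - \<kappa> * T y w"
    proof -
      have q: "q = (s w)\<^sup>2 - m' w + (m w)\<^sup>2" using pot[OF w] by (simp add: q_def algebra_simps)
      show ?thesis unfolding q T_def using s0[OF w] by (simp add: field_simps power2_eq_square)
    qed
    ultimately show ?thesis by simp
  qed
  have Td2: "((\<lambda>w. s w * y w - \<kappa> * T y w) has_field_derivative ?Q w * T y w) (at w)"
    if y: "ode_sol (darboux k \<kappa> D) ?B y" and w: "w \<in> ?B" for y w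
  proof -
    have "((\<lambda>w. s w * y w - \<kappa> * T y w) has_field_derivative
       (s w * (m w + \<kappa>) * y w + deriv y w * s w - \<kappa> * (s w * y w - \<kappa> * T y w))) (at w)"
      by (intro DERIV_diff DERIV_mult DERIV_cmult Td[OF y w] sd[OF w] ode_solD[OF y open_ball w])
    moreover have "s w * (m w + \<kappa>) * y w + deriv y w * s w - \<kappa> * (s w * y w - \<kappa> * T y w) = ?Q w * T y w"
    proof -
      have "deriv y w = s w * T y w - m w * y w" unfolding T_def using s0[OF w] by simp
      then show ?thesis unfolding s(2)[OF w] by algebra
    qed
    ultimately show ?thesis by simp
  qed
  have Ts: "ode_sol ?Q ?B (T y)" and T': "\<And>w. w \<in> ?B \<Longrightarrow> deriv (T y) w = s w * y w - \<kappa> * T y w"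
    if y: "ode_sol (darboux k \<kappa> D) ?B y" for y
    using ode_solI[OF open_ball Td[OF y] Td2[OF y]] by blast+
  \<comment> \<open>The order of the frame is reversed because the transform changes the sign of the
    Wronskian.\<close>
  have "herm_sol ?Q ?V ?B"
  proof (rule herm_solI_scaled[OF open_ball Ts[OF fg(2)] Ts[OF fg(1)], of 1])
    fix w assume w: "w \<in> ?B"
    note Ww = W[OF w, unfolded wronskian_def]
    have "wronskian (T g) (T f) w = s w * (T g w * f w - T f w * g w)"
      unfolding wronskian_def T'[OF fg(1) w] T'[OF fg(2) w] by algebra
    also have "\<dots> = f w * deriv g w - deriv f w * g w"
      unfolding T_def using s0[OF w] by (simp add: field_simps)
    finally show "wronskian (T g) (T f) w = of_real 1" using Ww by simp
    define a b where "a = deriv f w + m w * f w" and "b = deriv g w + m w * g w"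
    have vpos: "v w > 0" by (rule herm_sol_pos[OF v]) (use w r in blast)
    have vc: "complex_of_real (v w) = f w * cnj (f w) + g w * cnj (g w)" by (simp add: V[OF w] mult_cnj_eq_norm_sq)
    have X: "dz v w + m w * of_real (v w) = a * cnj (f w) + b * cnj (g w)"
      unfolding P[OF w] vc a_def b_def by (simp add: algebra_simps)
    have ab: "f w * b - g w * a = 1" using Ww unfolding a_def b_def by (simp add: algebra_simps)
    have "complex_of_real (1 + (cmod (a * cnj (f w) + b * cnj (g w)))\<^sup>2)
       = (f w * b - g w * a) * cnj (f w * b - g w * a) + (a * cnj (f w) + b * cnj (g w)) * cnj (a * cnj (f w) + b * cnj (g w))"
      unfolding ab mult_cnj_eq_norm_sq by simp
    also have "\<dots> = (f w * cnj (f w) + g w * cnj (g w)) * (a * cnj a + b * cnj b)" by (simp add: algebra_simps)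
    also have "\<dots> = complex_of_real (v w * ((cmod a)\<^sup>2 + (cmod b)\<^sup>2))" unfolding vc[symmetric] by (simp add: mult_cnj_eq_norm_sq)
    finally have E: "1 + (cmod (a * cnj (f w) + b * cnj (g w)))\<^sup>2 = v w * ((cmod a)\<^sup>2 + (cmod b)\<^sup>2)" by (simp only: of_real_eq_iff)
    have kD: "cmod (k * D w) = (cmod (s w))\<^sup>2" unfolding s(2)[OF w] by (rule norm_power)
    have "?V w = v w * ((cmod a)\<^sup>2 + (cmod b)\<^sup>2) / (v w * (cmod (s w))\<^sup>2)"
      using X unfolding m_def kD E[symmetric] by simp
    also have "\<dots> = (cmod (T g w))\<^sup>2 + (cmod (T f w))\<^sup>2"
      using vpos unfolding T_def a_def[symmetric] b_def[symmetric]
      by (simp add: norm_divide power_divide add_divide_distrib)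
    finally show "1 * ?V w = (cmod (T g w))\<^sup>2 + (cmod (T f w))\<^sup>2" by simp
  qed simp
  then show "\<exists>T. open T \<and> z \<in> T \<and> T \<subseteq> S \<and> herm_sol ?Q ?V T" using r by (intro exI[of _ ?B]) auto
qed

text \<open>Write \<open>D = x \<mu>\<close> with \<open>x = z - s\<close> and
  \<open>l = \<mu>' / \<mu>\<close>: then \<open>D' / D = 1 / x + l\<close>,
  \<open>D'' / (2 D) = l / x + \<mu>'' / (2 \<mu>)\<close> and \<open>l s = a\<close>. The constant
  term comes out as the square of the residue, which is the relation that the absence of logarithms
  imposes on \<open>q\<close>; comparing the two fixes the additive constant.\<close>

lemma darboux_simple_zero:
  assumes D: "D holomorphic_on ball s r" and r: "r > 0" and Ds: "D s = 0" "deriv D s \<noteq> 0"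
  defines "a \<equiv> deriv (deriv D) s / (2 * deriv D s)"
  obtains \<rho> H where "0 < \<rho>" "\<rho> \<le> r" "H holomorphic_on ball s \<rho>" "H s = (a / 2 - \<kappa>)\<^sup>2"
    "\<And>z. z \<in> ball s \<rho> - {s} \<Longrightarrow> darboux k \<kappa> D z = 3 / 4 / (z - s)\<^sup>2 + (a / 2 - \<kappa>) / (z - s) + H z"
proof -
  obtain \<mu> where mu: "\<mu> holomorphic_on ball s r" and Dmu: "\<And>z. z \<in> ball s r \<Longrightarrow> D z = (z - s) * \<mu> z"
    and mus: "\<mu> s = deriv D s"
    using holo_div_point[OF D open_ball Ds(1)] by blast
  have "isCont \<mu> s" by (rule holomorphic_on_isCont[OF mu open_ball]) (use r in simp)
  then obtain e where e: "e > 0" "\<And>w. dist s w < e \<Longrightarrow> \<mu> w \<noteq> 0"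
    using continuous_at_avoid[of s \<mu> 0] mus Ds(2) by auto
  define \<rho> where "\<rho> = min r e"
  have rho: "0 < \<rho>" "\<rho> \<le> r" and nz: "\<And>w. w \<in> ball s \<rho> \<Longrightarrow> \<mu> w \<noteq> 0" using e r by (auto simp: \<rho>_def)
  let ?B = "ball s \<rho>"
  have sB: "s \<in> ?B" using rho by simp
  have muB: "\<mu> holomorphic_on ?B" by (rule holomorphic_on_subset[OF mu]) (use rho in auto)
  have mu1B: "deriv \<mu> holomorphic_on ?B" by (rule holomorphic_deriv[OF muB open_ball])
  have mu2B: "deriv (deriv \<mu>) holomorphic_on ?B" by (rule holomorphic_deriv[OF mu1B open_ball])
  note m1 = holomorphic_derivI[OF muB open_ball] and m2 = holomorphic_derivI[OF mu1B open_ball]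
  have D0: "D w = (w - s) * \<mu> w" if "w \<in> ?B" for w using Dmu that rho by auto
  have D1: "deriv D w = \<mu> w + (w - s) * deriv \<mu> w" if w: "w \<in> ?B" for w
  proof (rule DERIV_imp_deriv, rule has_field_derivative_transform_within_open[OF _ open_ball w])
    show "((\<lambda>w. (w - s) * \<mu> w) has_field_derivative \<mu> w + (w - s) * deriv \<mu> w) (at w)"
      by (auto intro!: derivative_eq_intros m1[OF w])
  qed (simp add: D0)
  have D2: "deriv (deriv D) w = 2 * deriv \<mu> w + (w - s) * deriv (deriv \<mu>) w" if w: "w \<in> ?B" for w
  proof (rule DERIV_imp_deriv, rule has_field_derivative_transform_within_open[OF _ open_ball w])
    show "((\<lambda>w. \<mu> w + (w - s) * deriv \<mu> w) has_field_derivative 2 * deriv \<mu> w + (w - s) * deriv (deriv \<mu>) w) (at w)"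
      by (auto intro!: derivative_eq_intros m1[OF w] m2[OF w])
  qed (simp add: D1)
  define l where "l w = deriv \<mu> w / \<mu> w" for w
  have lh: "l holomorphic_on ?B" unfolding l_def[abs_def] by (intro holomorphic_intros mu1B muB nz)
  have ls: "l s = a" unfolding l_def a_def D2[OF sB] D1[OF sB] by simp
  have "(\<lambda>w. l w - a) holomorphic_on ?B" by (intro holomorphic_intros lh)
  from holo_div_point[OF this open_ball, of s] ls obtain l1 where l1: "l1 holomorphic_on ?B"
    "\<And>w. w \<in> ?B \<Longrightarrow> l w - a = (w - s) * l1 w" "l1 s = deriv (\<lambda>w. l w - a) s" by auto
  have "((\<lambda>w. l w - a) has_field_derivative deriv (deriv \<mu>) s / \<mu> s - a\<^sup>2) (at s)"
    unfolding ls[symmetric] l_def[abs_def] using m1[OF sB] m2[OF sB] nz[OF sB]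
    by (auto intro!: derivative_eq_intros simp: field_simps power2_eq_square)
  then have l1s: "l1 s = deriv (deriv \<mu>) s / \<mu> s - a\<^sup>2" using l1(3) DERIV_imp_deriv by metis
  define H where "H z = k * ((z - s) * \<mu> z) + \<kappa>\<^sup>2 - \<kappa> * l z + 3 / 4 * (l z)\<^sup>2 - deriv (deriv \<mu>) z / \<mu> z / 2 + l1 z / 2" for z
  show ?thesis
  proof (rule that[OF rho])
    show "H holomorphic_on ?B"
      unfolding H_def[abs_def] by (intro holomorphic_intros muB lh mu2B l1(1) nz) auto
    show "H s = (a / 2 - \<kappa>)\<^sup>2" unfolding H_def l1s ls by (simp add: power2_eq_square field_simps)
    fix z assume z: "z \<in> ?B - {s}"
    then have zB: "z \<in> ?B" and x: "z - s \<noteq> 0" by auto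
    define x where "x = z - s"
    define i where "i = 1 / x"
    have i: "x * i = 1" using x by (simp add: i_def x_def)
    have L: "deriv D z / D z = i + l z"
      unfolding D0[OF zB] D1[OF zB] l_def i_def x_def using x nz[OF zB] by (simp add: field_simps)
    have R: "deriv (deriv D) z / (2 * D z) = i * l z + deriv (deriv \<mu>) z / \<mu> z / 2"
      unfolding D0[OF zB] D2[OF zB] l_def i_def x_def using x nz[OF zB] by (simp add: field_simps)
    have I: "y / (z - s) = y * i" "y / (z - s)\<^sup>2 = y * (i * i)" for y by (auto simp: i_def x_def power2_eq_square)
    have lz: "l z = a + x * l1 z" using l1(2)[OF zB] by (simp add: x_def algebra_simps)
    show "darboux k \<kappa> D z = 3 / 4 / (z - s)\<^sup>2 + (a / 2 - \<kappa>) / (z - s) + H z"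
      unfolding darboux_def L R unfolding H_def D0[OF zB] I unfolding x_def[symmetric]
    proof -
      have "i * l z = i * a + l1 z" unfolding lz using i by algebra
      then show "k * (x * \<mu> z) + \<kappa>\<^sup>2 - \<kappa> * (i + l z) + 3 / 4 * (i + l z)\<^sup>2 - (i * l z + deriv (deriv \<mu>) z / \<mu> z / 2) =
        3 / 4 * (i * i) + (a / 2 - \<kappa>) * i + (k * (x * \<mu> z) + \<kappa>\<^sup>2 - \<kappa> * l z + 3 / 4 * (l z)\<^sup>2 - deriv (deriv \<mu>) z / \<mu> z / 2 + l1 z / 2)"
        by (simp add: power2_eq_square field_simps)
    qed
  qed
qed

text \<open>Write \<open>D = \<mu> / z\<^sup>2\<close> and \<open>l = \<mu>' / \<mu>\<close>: then
  \<open>D' / D = l - 2 / z\<close> and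
  \<open>D'' / (2 D) = \<mu>'' / (2 \<mu>) - 2 l / z + 3 / z\<^sup>2\<close>. The terms
  \<open>3 / z\<^sup>2\<close> cancel, so the double pole is that of \<open>k D\<close>;
  \<open>l\<close> vanishes at 0, which makes \<open>l / z\<close> regular.\<close>

lemma darboux_double_pole:
  assumes w: "w holomorphic_on ball 0 r" and r: "r > 0"
    and D: "\<And>z. z \<in> ball 0 r - {0} \<Longrightarrow> D z = 1 / z\<^sup>2 + w z"
  obtains \<rho> H where "0 < \<rho>" "\<rho> \<le> r" "H holomorphic_on ball 0 \<rho>"
    "\<And>z. z \<in> ball 0 \<rho> - {0} \<Longrightarrow> darboux k \<kappa> D z = k / z\<^sup>2 + 2 * \<kappa> / z + H z"
proof -
  define \<mu> where "\<mu> z = 1 + z\<^sup>2 * w z" for z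
  have mu: "\<mu> holomorphic_on ball 0 r" unfolding \<mu>_def[abs_def] by (intro holomorphic_intros w)
  have "isCont \<mu> 0" by (rule holomorphic_on_isCont[OF mu open_ball]) (use r in simp)
  then obtain e where e: "e > 0" "\<And>w. dist 0 w < e \<Longrightarrow> \<mu> w \<noteq> 0"
    using continuous_at_avoid[of 0 \<mu> 0] by (auto simp: \<mu>_def)
  define \<rho> where "\<rho> = min r e"
  have rho: "0 < \<rho>" "\<rho> \<le> r" and nz: "\<And>w. w \<in> ball 0 \<rho> \<Longrightarrow> \<mu> w \<noteq> 0" using e r by (auto simp: \<rho>_def)
  let ?B = "ball (0 :: complex) \<rho>"
  have wB: "w holomorphic_on ?B" by (rule holomorphic_on_subset[OF w]) (use rho in auto)
  have muB: "\<mu> holomorphic_on ?B" by (rule holomorphic_on_subset[OF mu]) (use rho in auto)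
  have mu1B: "deriv \<mu> holomorphic_on ?B" by (rule holomorphic_deriv[OF muB open_ball])
  have mu2B: "deriv (deriv \<mu>) holomorphic_on ?B" by (rule holomorphic_deriv[OF mu1B open_ball])
  note m1 = holomorphic_derivI[OF muB open_ball] and m2 = holomorphic_derivI[OF mu1B open_ball]
  have op: "open (?B - {0})" by blast
  have D0: "D z = \<mu> z / z\<^sup>2" if "z \<in> ?B - {0}" for z using D[of z] that rho by (auto simp: \<mu>_def field_simps)
  have D1: "deriv D z = deriv \<mu> z / z\<^sup>2 - 2 * \<mu> z / z ^ 3" if z: "z \<in> ?B - {0}" for z
  proof (rule DERIV_imp_deriv, rule has_field_derivative_transform_within_open[OF _ op z])
    show "((\<lambda>z. \<mu> z / z\<^sup>2) has_field_derivative deriv \<mu> z / z\<^sup>2 - 2 * \<mu> z / z ^ 3) (at z)"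
      using z m1[of z] by (auto intro!: derivative_eq_intros simp: field_simps eval_nat_numeral)
  qed (simp add: D0)
  have D2: "deriv (deriv D) z = deriv (deriv \<mu>) z / z\<^sup>2 - 4 * deriv \<mu> z / z ^ 3 + 6 * \<mu> z / z ^ 4" if z: "z \<in> ?B - {0}" for z
  proof (rule DERIV_imp_deriv, rule has_field_derivative_transform_within_open[OF _ op z])
    show "((\<lambda>z. deriv \<mu> z / z\<^sup>2 - 2 * \<mu> z / z ^ 3) has_field_derivative
      deriv (deriv \<mu>) z / z\<^sup>2 - 4 * deriv \<mu> z / z ^ 3 + 6 * \<mu> z / z ^ 4) (at z)"
      using z m1[of z] m2[of z] by (auto intro!: derivative_eq_intros simp: field_simps eval_nat_numeral)
  qed (simp add: D1)
  define l where "l w = deriv \<mu> w / \<mu> w" for w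
  have lh: "l holomorphic_on ?B" unfolding l_def[abs_def] by (intro holomorphic_intros mu1B muB nz)
  have "deriv \<mu> 0 = 0"
  proof (rule DERIV_imp_deriv)
    have "(w has_field_derivative deriv w 0) (at 0)" by (rule holomorphic_derivI[OF wB open_ball]) (use rho in simp)
    then show "(\<mu> has_field_derivative 0) (at 0)" unfolding \<mu>_def[abs_def] by (auto intro!: derivative_eq_intros)
  qed
  then have "l 0 = 0" by (simp add: l_def)
  from holo_div_point[OF lh open_ball this] obtain l1 where l1: "l1 holomorphic_on ?B"
    "\<And>w. w \<in> ?B \<Longrightarrow> l w = w * l1 w" by auto
  define H where "H z = k * w z + \<kappa>\<^sup>2 - \<kappa> * l z + 3 / 4 * (l z)\<^sup>2 - deriv (deriv \<mu>) z / \<mu> z / 2 - l1 z" for z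
  show ?thesis
  proof (rule that[OF rho])
    show "H holomorphic_on ?B"
      unfolding H_def[abs_def] by (intro holomorphic_intros muB lh mu2B l1(1) nz wB) auto
    fix z assume z: "z \<in> ?B - {0}"
    then have zB: "z \<in> ?B" and x: "z \<noteq> 0" by auto
    define i where "i = 1 / z"
    have i: "z * i = 1" using x by (simp add: i_def)
    have L: "deriv D z / D z = l z - 2 * i"
      unfolding D0[OF z] D1[OF z] l_def i_def using x nz[OF zB] by (simp add: field_simps eval_nat_numeral)
    have R: "deriv (deriv D) z / (2 * D z) = deriv (deriv \<mu>) z / \<mu> z / 2 - 2 * i * l z + 3 * (i * i)"
      unfolding D0[OF z] D2[OF z] l_def i_def using x nz[OF zB] by (simp add: field_simps eval_nat_numeral)
    have I: "y / z = y * i" "y / z\<^sup>2 = y * (i * i)" for y by (auto simp: i_def power2_eq_square)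
    have D': "D z = i * i + w z" using D[of z] z rho by (auto simp: I)
    show "darboux k \<kappa> D z = k / z\<^sup>2 + 2 * \<kappa> / z + H z"
      unfolding darboux_def L R unfolding H_def D' I
    proof -
      have "i * l z = l1 z" unfolding l1(2)[OF zB] using i by algebra
      then show "k * (i * i + w z) + \<kappa>\<^sup>2 - \<kappa> * (l z - 2 * i) + 3 / 4 * (l z - 2 * i)\<^sup>2
         - (deriv (deriv \<mu>) z / \<mu> z / 2 - 2 * i * l z + 3 * (i * i)) =
        k * (i * i) + 2 * \<kappa> * i + (k * w z + \<kappa>\<^sup>2 - \<kappa> * l z + 3 / 4 * (l z)\<^sup>2 - deriv (deriv \<mu>) z / \<mu> z / 2 - l1 z)"
        by (simp add: power2_eq_square field_simps)
    qed
  qed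
qed

section \<open>The non-even component\<close>

lemma deriv_minus_const: "deriv (\<lambda>z. f z - c) = deriv f" for f :: "complex \<Rightarrow> complex"
proof
  fix z
  have "((\<lambda>z. f z - c) has_field_derivative d) (at z) \<longleftrightarrow> (f has_field_derivative d) (at z)" for d
    using DERIV_diff[OF _ DERIV_const[of c], of f d z] DERIV_add[OF _ DERIV_const[of c], of "\<lambda>z. f z - c" d z] by auto
  then show "deriv (\<lambda>z. f z - c) z = deriv f z" by (simp add: deriv_def)
qed

lemma wirtinger_shift:
  assumes "\<And>z. f (z + \<omega>) = f z"
  shows "wirtinger f (z + \<omega>) = wirtinger f z"
  unfolding wirtinger_def using partials_shift[of f \<omega> z, OF assms] by simp

text \<open>Lets the expansion at \<open>p\<close> serve also at \<open>-p\<close>, with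
  \<open>T1\<close> and \<open>T2\<close> exchanged.\<close>

lemma q_form_swap: "q_form n \<tau> (- p) T2 T1 B z = q_form n \<tau> p T1 T2 B z"
  by (simp add: q_form_def algebra_simps)

section \<open>Comparison of q with the Darboux potential\<close>

context rect_lattice
begin

lemma deriv_periodic:
  assumes "\<And>z. z \<notin> \<Lambda> \<Longrightarrow> f (z + \<omega>) = f z" "z \<notin> \<Lambda>"
  shows "deriv f (z + \<omega>) = deriv f z"
proof -
  have "\<forall>\<^sub>F w in nhds z. w \<in> - \<Lambda>"
    by (rule eventually_nhds_in_open[OF open_compl_lattice]) (use assms(2) in simp)
  then have "\<forall>\<^sub>F w in nhds z. f (w + \<omega>) = f w" by eventually_elim (simp add: assms(1))
  then have "deriv (\<lambda>w. f (w + \<omega>)) z = deriv f z" by (rule deriv_cong_ev) simp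
  then show ?thesis by (simp add: deriv_shift)
qed

lemma wp'_holo: "deriv (weierstrass_p \<tau>) holomorphic_on - \<Lambda>"
  by (rule holomorphic_deriv[OF wp_holo open_compl_lattice])

lemma wp'_odd:
  assumes z: "z \<notin> \<Lambda>"
  shows "deriv (weierstrass_p \<tau>) (- z) = - deriv (weierstrass_p \<tau>) z"
proof -
  have "((\<lambda>z. weierstrass_p \<tau> (- z)) has_field_derivative deriv (weierstrass_p \<tau>) (- z) * - 1) (at z)"
    by (rule DERIV_chain2[OF wp_deriv']) (use z in \<open>auto intro!: derivative_eq_intros\<close>)
  then have "(weierstrass_p \<tau> has_field_derivative - deriv (weierstrass_p \<tau>) (- z)) (at z)" by (simp add: wp_even)
  from DERIV_unique[OF this wp_deriv'[OF z]] show ?thesis by (metis minus_minus)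
qed

lemma wp''_even:
  assumes z: "z \<notin> \<Lambda>"
  shows "deriv (deriv (weierstrass_p \<tau>)) (- z) = deriv (deriv (weierstrass_p \<tau>)) z"
proof -
  let ?f = "deriv (weierstrass_p \<tau>)"
  note d = holomorphic_derivI[OF wp'_holo open_compl_lattice]
  have zc: "z \<in> - \<Lambda>" "- z \<in> - \<Lambda>" using z by auto
  have "((\<lambda>z. ?f (- z)) has_field_derivative deriv ?f (- z) * - 1) (at z)"
    by (rule DERIV_chain2[where f = ?f and g = uminus]) (rule d[OF zc(2)], auto intro!: derivative_eq_intros)
  from DERIV_minus[OF this] have "((\<lambda>z. - ?f (- z)) has_field_derivative deriv ?f (- z)) (at z)" by simp
  then have "(?f has_field_derivative deriv ?f (- z)) (at z)"
    by (rule has_field_derivative_transform_within_open[OF _ open_compl_lattice zc(1)]) (simp add: wp'_odd)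
  from DERIV_unique[OF this d[OF zc(1)]] show ?thesis .
qed

lemma q_form_holo: "q_form n \<tau> p T1 T2 B holomorphic_on - sing p"
proof -
  have sub: "- sing p \<subseteq> - \<Lambda>" "- sing p \<subseteq> {z. z + p \<notin> \<Lambda>}" "- sing p \<subseteq> {z. z + - p \<notin> \<Lambda>}" by (auto simp: sing_set_def)
  note h = holomorphic_on_subset[OF wp_holo sub(1)] holomorphic_on_subset[OF zeta_holo sub(1)]
    holomorphic_on_subset[OF holomorphic_shift[OF wp_holo] sub(2)] holomorphic_on_subset[OF holomorphic_shift[OF zeta_holo] sub(2)]
    holomorphic_on_subset[OF holomorphic_shift[OF wp_holo] sub(3), simplified] holomorphic_on_subset[OF holomorphic_shift[OF zeta_holo] sub(3), simplified]
  show ?thesis unfolding q_form_def[abs_def] by (intro holomorphic_intros h)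
qed

lemma q_form_at_p:
  assumes p: "2 * p \<notin> \<Lambda>"
  obtains r G where "r > 0" "ball p r \<subseteq> - \<Lambda>" "G holomorphic_on ball p r"
    "\<And>z. z \<in> ball p r - {p} \<Longrightarrow> q_form n \<tau> p T1 T2 B z = 3 / 4 / (z - p)\<^sup>2 + T2 / (z - p) + G z"
proof -
  let ?A = "- \<Lambda> \<inter> {z. z + p \<notin> \<Lambda>} \<inter> {z. z + - p \<notin> \<Lambda>0}"
  have "open ?A" by (intro open_Int open_compl_lattice open_shift_compl)
  moreover have "p \<in> ?A" using p p_notin[OF p] by simp
  ultimately obtain r where r: "r > 0" "ball p r \<subseteq> ?A" using open_contains_ball by blast
  then have sub: "ball p r \<subseteq> - \<Lambda>" "ball p r \<subseteq> {z. z + p \<notin> \<Lambda>}" "ball p r \<subseteq> {z. z + - p \<notin> \<Lambda>0}" by blast+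
  have h0: "(\<lambda>z. wp0 (z - p)) holomorphic_on ball p r" "(\<lambda>z. zeta0 (z - p)) holomorphic_on ball p r"
    using holomorphic_on_subset[OF holomorphic_shift[OF wp0_holo] sub(3)]
      holomorphic_on_subset[OF holomorphic_shift[OF zeta0_holo] sub(3)] by (simp_all only: diff_conv_add_uminus)
  note h = h0 holomorphic_on_subset[OF wp_holo sub(1)] holomorphic_on_subset[OF zeta_holo sub(1)]
    holomorphic_on_subset[OF holomorphic_shift[OF wp_holo] sub(2)] holomorphic_on_subset[OF holomorphic_shift[OF zeta_holo] sub(2)]
  define G where "G z = of_nat n * (of_nat n + 1) * weierstrass_p \<tau> z + 3 / 4 * (weierstrass_p \<tau> (z + p) + wp0 (z - p))
     + T1 * (weierstrass_zeta \<tau> (z + p) - weierstrass_zeta \<tau> z) + T2 * (zeta0 (z - p) - weierstrass_zeta \<tau> z) + B" for z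
  show ?thesis
  proof (rule that[OF r(1) sub(1)])
    show "G holomorphic_on ball p r" unfolding G_def[abs_def] by (intro holomorphic_intros h)
    show "q_form n \<tau> p T1 T2 B z = 3 / 4 / (z - p)\<^sup>2 + T2 / (z - p) + G z" if "z \<in> ball p r - {p}" for z
      unfolding q_form_def G_def weierstrass_p_eq[of "z - p"] weierstrass_zeta_eq[of "z - p"]
      by (simp add: algebra_simps)
  qed
qed

lemma q_form_at_0:
  assumes p: "2 * p \<notin> \<Lambda>"
  obtains r G where "r > 0" "G holomorphic_on ball 0 r" "wp0 holomorphic_on ball 0 r"
    "\<And>z. z \<in> ball 0 r - {0} \<Longrightarrow> q_form n \<tau> p T1 T2 B z = of_nat n * (of_nat n + 1) / z\<^sup>2 - (T1 + T2) / z + G z"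
proof -
  let ?A = "- \<Lambda>0 \<inter> {z. z + p \<notin> \<Lambda>} \<inter> {z. z + - p \<notin> \<Lambda>}"
  have "open ?A" by (intro open_Int open_compl_lattice0 open_shift_compl)
  moreover have "0 \<in> ?A" using p_notin[OF p] by simp
  ultimately obtain r where r: "r > 0" "ball 0 r \<subseteq> ?A" using open_contains_ball by blast
  then have sub: "ball 0 r \<subseteq> - \<Lambda>0" "ball 0 r \<subseteq> {z. z + p \<notin> \<Lambda>}" "ball 0 r \<subseteq> {z. z + - p \<notin> \<Lambda>}" by blast+
  have h0: "(\<lambda>z. weierstrass_p \<tau> (z - p)) holomorphic_on ball 0 r" "(\<lambda>z. weierstrass_zeta \<tau> (z - p)) holomorphic_on ball 0 r"
    using holomorphic_on_subset[OF holomorphic_shift[OF wp_holo] sub(3)]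
      holomorphic_on_subset[OF holomorphic_shift[OF zeta_holo] sub(3)] by (simp_all only: diff_conv_add_uminus)
  note h = h0 holomorphic_on_subset[OF wp0_holo sub(1)] holomorphic_on_subset[OF zeta0_holo sub(1)]
    holomorphic_on_subset[OF holomorphic_shift[OF wp_holo] sub(2)] holomorphic_on_subset[OF holomorphic_shift[OF zeta_holo] sub(2)]
  define G where "G z = of_nat n * (of_nat n + 1) * wp0 z + 3 / 4 * (weierstrass_p \<tau> (z + p) + weierstrass_p \<tau> (z - p))
     + T1 * (weierstrass_zeta \<tau> (z + p) - zeta0 z) + T2 * (weierstrass_zeta \<tau> (z - p) - zeta0 z) + B" for z
  show ?thesis
  proof (rule that[OF r(1)])
    show "G holomorphic_on ball 0 r" unfolding G_def[abs_def] by (intro holomorphic_intros h)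
    show "wp0 holomorphic_on ball 0 r" by (rule h)
    show "q_form n \<tau> p T1 T2 B z = of_nat n * (of_nat n + 1) / z\<^sup>2 - (T1 + T2) / z + G z" if "z \<in> ball 0 r - {0}" for z
      unfolding q_form_def G_def weierstrass_p_eq[of z] weierstrass_zeta_eq[of z]
      by (simp add: algebra_simps add_divide_distrib diff_divide_distrib)
  qed
qed

text \<open>The hypothesis on \<open>T2\<close> says that the residues of \<open>q_form\<close> and
  of the Darboux potential at \<open>p\<close> agree, as the double poles do. The regular parts
  \<open>G\<close> and \<open>H\<close> may differ; for the Darboux one the value at
  \<open>p\<close> is known.\<close>

lemma expansions_at_p:
  assumes p: "2 * p \<notin> \<Lambda>" and c: "weierstrass_p \<tau> p = c"
    and T2: "T2 = deriv (deriv (weierstrass_p \<tau>)) p / (2 * deriv (weierstrass_p \<tau>) p) / 2 - \<kappa>"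
  obtains r G H where "r > 0" "G holomorphic_on ball p r" "H holomorphic_on ball p r" "H p = T2\<^sup>2"
    "\<And>z. z \<in> ball p r - {p} \<Longrightarrow> q_form n \<tau> p T1 T2 B z = 3 / 4 / (z - p)\<^sup>2 + T2 / (z - p) + G z"
    "\<And>z. z \<in> ball p r - {p} \<Longrightarrow> darboux k \<kappa> (\<lambda>z. weierstrass_p \<tau> z - c) z = 3 / 4 / (z - p)\<^sup>2 + T2 / (z - p) + H z"
proof -
  let ?D = "\<lambda>z. weierstrass_p \<tau> z - c"
  obtain r G where r: "r > 0" "ball p r \<subseteq> - \<Lambda>" and G: "G holomorphic_on ball p r"
    and qf: "\<And>z. z \<in> ball p r - {p} \<Longrightarrow> q_form n \<tau> p T1 T2 B z = 3 / 4 / (z - p)\<^sup>2 + T2 / (z - p) + G z"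
    by (rule q_form_at_p[OF p]) (rule that)
  have D: "?D holomorphic_on ball p r" by (intro holomorphic_intros holomorphic_on_subset[OF wp_holo r(2)])
  have D0: "?D p = 0" "deriv ?D p \<noteq> 0" using c wp'_nonzero[OF p] by (simp_all add: deriv_minus_const)
  obtain \<rho> H where rho: "0 < \<rho>" "\<rho> \<le> r" and H: "H holomorphic_on ball p \<rho>"
    "H p = (deriv (deriv ?D) p / (2 * deriv ?D p) / 2 - \<kappa>)\<^sup>2"
    "\<And>z. z \<in> ball p \<rho> - {p} \<Longrightarrow> darboux k \<kappa> ?D z = 3 / 4 / (z - p)\<^sup>2 + (deriv (deriv ?D) p / (2 * deriv ?D p) / 2 - \<kappa>) / (z - p) + H z"
    by (rule darboux_simple_zero[OF D r(1) D0]) (rule that)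
  have sub: "ball p \<rho> \<subseteq> ball p r" using rho by auto
  show ?thesis
    by (rule that[OF rho(1) holomorphic_on_subset[OF G sub] H(1) _ qf H(3)[unfolded deriv_minus_const T2[symmetric]]])
       (use H(2) sub in \<open>auto simp: deriv_minus_const T2\<close>)
qed

lemma noneven_impossible:
  assumes p: "2 * p \<notin> \<Lambda>" and n: "n > 0" and sol: "curvature_solution n \<tau> p u"
    and T: "(T1, T2) \<in> noneven_component \<tau> p"
    and q: "\<And>z. z \<notin> sing p \<Longrightarrow> q_of u z = q_form n \<tau> p T1 T2 B z"
  shows False
proof -
  define k :: complex where "k = of_nat n * (of_nat n + 1)"
  define c where "c = weierstrass_p \<tau> p"
  define D where "D = (\<lambda>z. weierstrass_p \<tau> z - c)"
  \<comment> \<open>Matches the residue at 0, which is \<open>2 * \<kappa>\<close> for the Darboux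
    potential. The residues \<open>a / 2 - \<kappa>\<close> at \<open>p\<close> and
    \<open>- a / 2 - \<kappa>\<close> at \<open>-p\<close> then equal \<open>T2\<close> and
    \<open>T1\<close> exactly when \<open>T1 - T2 + a = 0\<close>.\<close>
  define \<kappa> where "\<kappa> = - (T1 + T2) / 2"
  define v where "v = (\<lambda>z. sqrt 8 * exp (- u z / 2))"
  define a where "a = deriv (deriv (weierstrass_p \<tau>)) p / (2 * deriv (weierstrass_p \<tau>) p)"
  let ?S = "- sing p"
  note opS = open_compl_sing[of p]
  have pL: "p \<notin> \<Lambda>" by (rule p_notin[OF p])
  have p': "2 * (- p) \<notin> \<Lambda>" using p by simp
  have k0: "k \<noteq> 0"
  proof -
    have "k = of_nat (n * (n + 1))" by (simp add: k_def algebra_simps)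
    then show ?thesis using n by (simp only: of_nat_eq_0_iff) simp
  qed
  have "T1 - T2 + a = 0" using T by (simp add: noneven_component_def a_def)
  then have T2: "T2 = a / 2 - \<kappa>" and T1: "T1 = - a / 2 - \<kappa>" by (auto simp: \<kappa>_def field_simps)
  have SL: "z \<notin> \<Lambda>" if "z \<in> ?S" for z using that sing_notin by blast
  have per_u: "u (z + \<omega>) = u z" if "\<omega> \<in> \<Lambda>" for z \<omega>
    using sol that by (auto simp: curvature_solution_def lattice_periodic_def)
  have C2: "Ck_on 2 u ?S" using sol by (simp add: curvature_solution_def)
  have herm: "herm_sol (q_form n \<tau> p T1 T2 B) v ?S"
    unfolding v_def by (rule curvature_herm_sol[OF opS C2 q_form_holo]) (use liouville_pointwise[OF sol] q in auto)
  have DS: "D holomorphic_on ?S" unfolding D_def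
    by (intro holomorphic_intros holomorphic_on_subset[OF wp_holo]) (use SL in blast)
  have D0: "D z \<noteq> 0" if "z \<in> ?S" for z
    using wp_inj[OF p SL[OF that]] that by (auto simp: D_def c_def sing_set_def)
  have perD: "D (z + \<omega>) = D z" "deriv D (z + \<omega>) = deriv D z" "deriv (deriv D) (z + \<omega>) = deriv (deriv D) z"
    if "\<omega> \<in> \<Lambda>" "z \<notin> \<Lambda>" for z \<omega>
  proof -
    have 1: "D (z + \<omega>) = D z" if "z \<notin> \<Lambda>" for z using wp_periodic[OF that \<open>\<omega> \<in> \<Lambda>\<close>] by (simp add: D_def)
    have 2: "deriv D (z + \<omega>) = deriv D z" if "z \<notin> \<Lambda>" for z by (rule deriv_periodic[where f = D, OF 1 that])
    show "D (z + \<omega>) = D z" "deriv D (z + \<omega>) = deriv D z" "deriv (deriv D) (z + \<omega>) = deriv (deriv D) z"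
      using 1[OF that(2)] 2[OF that(2)] deriv_periodic[where f = "deriv D", OF 2 that(2)] by auto
  qed
  have dar_holo: "darboux k \<kappa> D holomorphic_on ?S"
    unfolding darboux_def[abs_def] using D0
    by (intro holomorphic_intros holomorphic_deriv DS opS) auto
  \<comment> \<open>All principal parts agree, so this difference will be constant.\<close>
  define F where "F z = q_form n \<tau> p T1 T2 B z - darboux k \<kappa> D z" for z
  have Fh: "F holomorphic_on ?S" unfolding F_def[abs_def] by (intro holomorphic_intros q_form_holo dar_holo)
  \<comment> \<open>\<open>q\<close> inherits its periods from \<open>u\<close>, which avoids
    computing with quasi-periods.\<close>
  have Fper: "F (z + \<omega>) = F z" if z: "z \<notin> sing p" and w: "\<omega> \<in> \<Lambda>" for z \<omega>
  proof -
    define U where "U = (\<lambda>w. complex_of_real (u w))"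
    have 1: "wirtinger U (z + \<omega>) = wirtinger U z" for z
      by (rule wirtinger_shift) (simp add: U_def per_u[OF w])
    have 2: "wirtinger (wirtinger U) (z + \<omega>) = wirtinger (wirtinger U) z" by (rule wirtinger_shift) (rule 1)
    have "q_of u (z + \<omega>) = q_of u z" unfolding q_of_def Let_def U_def[symmetric] 1 2 ..
    moreover have "z + \<omega> \<notin> sing p" using z sing_periodic[OF w] by blast
    ultimately have "q_form n \<tau> p T1 T2 B (z + \<omega>) = q_form n \<tau> p T1 T2 B z" using q z by simp
    moreover have "z \<notin> \<Lambda>" using z sing_notin by blast
    ultimately show ?thesis unfolding F_def darboux_def by (simp add: perD w)
  qed
  have T2': "T2 = deriv (deriv (weierstrass_p \<tau>)) p / (2 * deriv (weierstrass_p \<tau>) p) / 2 - \<kappa>"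
    using T2 by (simp add: a_def)
  \<comment> \<open>At \<open>-p\<close> the quotient \<open>\<wp>'' / (2 \<wp>')\<close> is
    \<open>- a\<close>, since \<open>\<wp>'\<close> is odd and \<open>\<wp>''\<close> even.\<close>
  have T1': "T1 = deriv (deriv (weierstrass_p \<tau>)) (- p) / (2 * deriv (weierstrass_p \<tau>) (- p)) / 2 - \<kappa>"
    using T1 by (simp add: a_def wp'_odd[OF pL] wp''_even[OF pL])
  have cm: "weierstrass_p \<tau> (- p) = c" by (simp add: c_def wp_even)
  obtain r G H where rp: "r > 0" and GH: "G holomorphic_on ball p r" "H holomorphic_on ball p r" "H p = T2\<^sup>2"
    "\<And>z. z \<in> ball p r - {p} \<Longrightarrow> q_form n \<tau> p T1 T2 B z = 3 / 4 / (z - p)\<^sup>2 + T2 / (z - p) + G z"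
    "\<And>z. z \<in> ball p r - {p} \<Longrightarrow> darboux k \<kappa> D z = 3 / 4 / (z - p)\<^sup>2 + T2 / (z - p) + H z"
    by (rule expansions_at_p[where k = k, OF p c_def[symmetric] T2', folded D_def]) (rule that)
  have Fp: "\<exists>r>0. \<exists>g. g holomorphic_on ball p r \<and> (\<forall>z\<in>ball p r - {p}. g z = F z)"
    by (rule exI[of _ r], rule conjI[OF rp], rule exI[of _ "\<lambda>z. G z - H z"])
       (use GH in \<open>auto simp: F_def intro!: holomorphic_intros\<close>)
  obtain r' G' H' where rm: "r' > 0" and GH': "G' holomorphic_on ball (- p) r'" "H' holomorphic_on ball (- p) r'" "H' (- p) = T1\<^sup>2"
    "\<And>z. z \<in> ball (- p) r' - {- p} \<Longrightarrow> q_form n \<tau> (- p) T2 T1 B z = 3 / 4 / (z - - p)\<^sup>2 + T1 / (z - - p) + G' z"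
    "\<And>z. z \<in> ball (- p) r' - {- p} \<Longrightarrow> darboux k \<kappa> D z = 3 / 4 / (z - - p)\<^sup>2 + T1 / (z - - p) + H' z"
    by (rule expansions_at_p[where k = k, OF p' cm T1', folded D_def]) (rule that)
  have Fm: "\<exists>r>0. \<exists>g. g holomorphic_on ball (- p) r \<and> (\<forall>z\<in>ball (- p) r - {- p}. g z = F z)"
    by (rule exI[of _ r'], rule conjI[OF rm], rule exI[of _ "\<lambda>z. G' z - H' z"])
       (use GH' in \<open>auto simp: F_def q_form_swap intro!: holomorphic_intros\<close>)
  have F0: "\<exists>r>0. \<exists>g. g holomorphic_on ball 0 r \<and> (\<forall>z\<in>ball 0 r - {0}. g z = F z)"
  proof -
    obtain r G where r: "r > 0" "G holomorphic_on ball 0 r" "wp0 holomorphic_on ball 0 r"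
      "\<And>z. z \<in> ball 0 r - {0} \<Longrightarrow> q_form n \<tau> p T1 T2 B z = of_nat n * (of_nat n + 1) / z\<^sup>2 - (T1 + T2) / z + G z"
      by (rule q_form_at_0[OF p]) (rule that)
    have w: "(\<lambda>z. wp0 z - c) holomorphic_on ball 0 r" by (intro holomorphic_intros r)
    have De: "D z = 1 / z\<^sup>2 + (wp0 z - c)" for z by (simp add: D_def weierstrass_p_eq)
    obtain \<rho> H where rho: "0 < \<rho>" "\<rho> \<le> r" and H: "H holomorphic_on ball 0 \<rho>"
      "\<And>z. z \<in> ball 0 \<rho> - {0} \<Longrightarrow> darboux k \<kappa> D z = k / z\<^sup>2 + 2 * \<kappa> / z + H z"
      by (rule darboux_double_pole[OF w r(1) De]) (rule that)
    have sub: "ball 0 \<rho> \<subseteq> ball (0::complex) r" using rho by auto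
    have "G z - H z = F z" if z: "z \<in> ball 0 \<rho> - {0}" for z
    proof -
      have "z \<in> ball 0 r - {0}" using z sub by blast
      have "2 * \<kappa> = - (T1 + T2)" by (simp add: \<kappa>_def)
      with r(4)[OF \<open>z \<in> ball 0 r - {0}\<close>] H(2)[OF z] show ?thesis
        unfolding F_def k_def[symmetric] by (simp only: minus_divide_left[symmetric]) simp
    qed
    moreover have "(\<lambda>z. G z - H z) holomorphic_on ball 0 \<rho>" by (intro holomorphic_intros H holomorphic_on_subset[OF r(2) sub])
    ultimately show ?thesis using rho(1) by blast
  qed
  obtain \<epsilon> where eps: "\<And>z. z \<notin> sing p \<Longrightarrow> F z = \<epsilon>"
  proof (rule elliptic_const[OF Fh Fper])
    show "\<exists>r>0. \<exists>g. g holomorphic_on ball s r \<and> (\<forall>z\<in>ball s r - {s}. g z = F z)" if "s \<in> {0, p, - p}" for s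
      using that F0 Fp Fm by blast
  qed (assumption, assumption, rule that)
  \<comment> \<open>Both regular parts take the value \<open>T2\<^sup>2\<close> at \<open>p\<close>:
    the Darboux one by computation, that of \<open>q\<close> by \<open>log_free\<close>.\<close>
  have "\<epsilon> = 0"
  proof -
    obtain r1 where r1: "r1 > 0" "\<And>z. z \<in> ball p r1 - {p} \<Longrightarrow> z \<notin> sing p" using isolated_sing[of p p] by blast
    define \<rho> where "\<rho> = min r r1"
    have rho: "\<rho> > 0" "ball p \<rho> \<subseteq> ball p r" "ball p \<rho> - {p} \<subseteq> ?S" using rp r1 by (auto simp: \<rho>_def)
    have hs: "herm_sol (q_form n \<tau> p T1 T2 B) v (ball p \<rho> - {p})"
      by (rule herm_sol_subset[OF herm rho(3)]) blast
    have Hh: "(\<lambda>z. H z + \<epsilon>) holomorphic_on ball p \<rho>" by (intro holomorphic_intros holomorphic_on_subset[OF GH(2) rho(2)])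
    have "H p + \<epsilon> = T2\<^sup>2"
    proof (rule log_free[OF hs rho(1) Hh])
      fix z assume z: "z \<in> ball p \<rho> - {p}"
      have "F z = \<epsilon>" by (rule eps) (use z rho(3) in blast)
      then have "q_form n \<tau> p T1 T2 B z = darboux k \<kappa> D z + \<epsilon>" unfolding F_def by (metis diff_add_cancel add.commute)
      moreover have zr: "z \<in> ball p r - {p}" using z rho(2) by blast
      ultimately show "q_form n \<tau> p T1 T2 B z = 3 / 4 / (z - p)\<^sup>2 + T2 / (z - p) + (H z + \<epsilon>)"
        unfolding GH(5)[OF zr] by (simp only: add.assoc)
    qed
    then show ?thesis using GH(3) by simp
  qed
  then have qd: "darboux k \<kappa> D z = q_form n \<tau> p T1 T2 B z" if "z \<in> ?S" for z using eps[of z] that by (simp add: F_def)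
  have "herm_sol (darboux k \<kappa> D) v ?S" by (rule herm_sol_cong[OF herm qd]) auto
  note hd = darboux_herm_sol[OF opS DS D0 k0 this]
  define V where "V z = (1 + (cmod (dz v z + (deriv D z / (2 * D z) - \<kappa>) * of_real (v z)))\<^sup>2) / (v z * cmod (k * D z))" for z
  \<comment> \<open>\<open>k D + \<kappa>\<^sup>2 = k \<wp> + (\<kappa>\<^sup>2 - k c)\<close> is a
    Lame potential; it is regular at \<open>p\<close> and \<open>-p\<close>, so \<open>V\<close>
    extends across these points and their translates.\<close>
  define \<beta> where "\<beta> = \<kappa>\<^sup>2 - k * c"
  have "herm_sol (lame n \<beta>) V ?S"
    by (rule herm_sol_cong[OF hd]) (simp_all add: lame_def \<beta>_def k_def D_def V_def algebra_simps)
  then have hV: "herm_sol (lame n \<beta>) V (- \<Lambda> - sing p)"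
    by (rule herm_sol_subset) (use open_Diff[OF open_compl_lattice closed_sing] in auto)
  obtain V' where V': "herm_sol (lame n \<beta>) V' (- \<Lambda>)" "\<And>z. z \<in> - \<Lambda> - sing p \<Longrightarrow> V' z = V z"
    by (rule herm_extend_discrete[OF open_compl_lattice lame_holo hV isolated_sing]) (rule that)
  have perV: "V' (z + \<omega>) = V' z" if z: "z \<notin> sing p" and w: "\<omega> \<in> \<Lambda>" for z \<omega>
  proof -
    have vper: "v (z + \<omega>) = v z" for z by (simp add: v_def per_u[OF w])
    have dper: "dz v (z + \<omega>) = dz v z" by (rule wirtinger_shift) (simp add: vper)
    have zL: "z \<notin> \<Lambda>" using z sing_notin by blast
    have zw: "z + \<omega> \<notin> sing p" using z sing_periodic[OF w] by blast
    then have "z + \<omega> \<notin> \<Lambda>" using sing_notin by blast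
    then have "V' (z + \<omega>) = V (z + \<omega>)" "V' z = V z" using V'(2) z zw zL by blast+
    moreover have "V (z + \<omega>) = V z" unfolding V_def vper dper perD[OF w zL] ..
    ultimately show ?thesis by simp
  qed
  show False
  proof (rule lame_no_herm_sol[OF V'(1)])
    fix z \<omega> assume z: "z \<notin> \<Lambda>" and w: "\<omega> \<in> \<Lambda>"
    \<comment> \<open>At points of \<open>sing p\<close> off the lattice the periodicity of
      \<open>V'\<close> follows by continuity.\<close>
    define f where "f w = complex_of_real (V' w)" for w
    have cont: "isCont f x" if "x \<notin> \<Lambda>" for x
      unfolding f_def[abs_def] by (rule has_derivative_continuous[OF herm_V_deriv[OF V'(1)]]) (use that in simp)
    have "z + \<omega> \<notin> \<Lambda>" using z lattice_add_cancel[OF w] by blast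
    have "isCont (\<lambda>w. w + \<omega>) z" by (intro continuous_intros)
    from isCont_o2[OF this cont[OF \<open>z + \<omega> \<notin> \<Lambda>\<close>]]
    have 1: "(\<lambda>w. f (w + \<omega>)) \<midarrow>z\<rightarrow> f (z + \<omega>)" by (simp only: isCont_def)
    obtain r where r: "r > 0" "\<And>w. w \<in> ball z r - {z} \<Longrightarrow> w \<notin> sing p" using isolated_sing[of z p] by blast
    have "\<forall>\<^sub>F w in at z. f (w + \<omega>) = f w"
      unfolding eventually_at using r perV[OF _ w] by (intro exI[of _ r]) (auto simp: f_def dist_commute)
    from Lim_transform_eventually[OF 1 this] have "f \<midarrow>z\<rightarrow> f (z + \<omega>)" .
    moreover have "f \<midarrow>z\<rightarrow> f z" using cont[OF z] by (simp add: isCont_def)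
    ultimately have "f (z + \<omega>) = f z" by (rule LIM_unique)
    then show "V' (z + \<omega>) = V' z" by (simp add: f_def)
  qed
qed

end

theorem corollary1p13:
  fixes \<tau> p :: complex and n :: nat
  assumes "Re \<tau> = 0" and "Im \<tau> > 0"
    and "n > 0"
    and "2 * p \<notin> lattice \<tau>"
  shows "\<not> (\<exists>F. noneven_family n \<tau> p F)"
proof
  interpret rect_lattice \<tau> by unfold_locales (use assms in auto)
  assume "\<exists>F. noneven_family n \<tau> p F"
  then obtain F where fam: "solution_family n \<tau> p F" and q: "\<exists>T1 T2 B. (T1, T2) \<in> noneven_component \<tau> p \<and>
      (\<forall>u\<in>F. \<forall>z\<in>- sing_set \<tau> p. q_of u z = q_form n \<tau> p T1 T2 B z)"
    unfolding noneven_family_def by blast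
  \<comment> \<open>The family contains the solution that defines it, so there is an actual solution
    with this \<open>q\<close>.\<close>
  from fam obtain u where u: "curvature_solution n \<tau> p u" "u \<in> F" unfolding solution_family_def by blast
  from q obtain T1 T2 B where T: "(T1, T2) \<in> noneven_component \<tau> p"
    and qu: "\<forall>u\<in>F. \<forall>z\<in>- sing_set \<tau> p. q_of u z = q_form n \<tau> p T1 T2 B z" by blast
  have "q_of u z = q_form n \<tau> p T1 T2 B z" if "z \<notin> sing_set \<tau> p" for z
    using bspec[OF bspec[OF qu u(2)], of z] that by simp
  from noneven_impossible[OF assms(4,3) u(1) T this] show False .
qed

end
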